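(* The Mayer-Vietoris positive-and-negative diagram $\iota^\pm$ in $\mathsf{Cosp}^{\simeq}_{\le\infty}(\mathsf{CW}^{\mathsf{fin}}_\ast)$ satisfies the universality: for every category $\mathcal{S}$ and every MV PN diagram $F^\pm=(F^+,F^-)$ in $\mathcal{S}$ (with $\dim\le\infty$), there exists a unique functor $F:\mathsf{Cosp}^{\simeq}_{\le\infty}(\mathsf{CW}^{\mathsf{fin}}_\ast)\to\mathcal{S}$ such that $F\circ\iota^+=F^+$ and $F\circ\iota^-=F^-$ (strict equalities).
   Context: All categories are locally small. All spaces, maps and homotopies are pointed. A finite CW-space is a topological space admitting some finite CW-complex structure (none is fixed); a pointed finite CW-space is one with a basepoint. $\mathcal{H}$ is the category whose objects are all pointed finite CW-spaces and whose morphisms are pointed homotopy classes of pointed maps. For pointed maps $f:K\to L_0$, $g:K\to L_1$, the double mapping cylinder $\mathrm{Cyl}(f,g)$ is obtained from $L_0\vee (K\wedge[0,1]^+)\vee L_1$ by gluing one end of $K\wedge[0,1]^+$ to $L_0$ along $f$ and the other to $L_1$ along $g$. A square in $\mathcal{H}$ with $f_0:K\to L_0$, $g_0:K\to L_1$, $g_1:L_0\to S$, $f_1:L_1\to S$ is a homotopy pushout if, for some representatives and some homotopy $g_1f_0\simeq f_1g_0$, the induced map $\mathrm{Cyl}(f_0,g_0)\to S$ is a homotopy equivalence. A Mayer-Vietoris positive-and-negative diagram (MV PN diagram) $F^\pm$ in a category $\mathcal{S}$ (with $\dim\le\infty$) is a pair of functors $F^+:\mathcal{H}\to\mathcal{S}$,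 $F^-:\mathcal{H}^{\mathrm{op}}\to\mathcal{S}$ with $F^+(K)=F^-(K)$ for every object $K$, such that for each homotopy pushout square in $\mathcal{H}$ with maps $f_0:K\to L_0$, $g_0:K\to L_1$, $g_1:L_0\to S$, $f_1:L_1\to S$, $F^-(f_1)\circ F^+(g_1)=F^+(g_0)\circ F^-(f_0)$. Two cospans $(K_0\xrightarrow{f_0}L\xleftarrow{f_1}K_1)$ and $(K_0\xrightarrow{g_0}L'\xleftarrow{g_1}K_1)$ of pointed spaces with the same ends are homotopy equivalent if there is a homotopy equivalence $h:L\to L'$ with $g_i\simeq h\circ f_i$ for $i=0,1$. The category $\mathsf{Cosp}^{\simeq}_{\le\infty}(\mathsf{CW}^{\mathsf{fin}}_\ast)$ (also written $\mathsf{Cosp}^{\simeq}(\mathsf{CW}^{\mathsf{fin}}_\ast)$) has as objects all pointed finite CW-spaces and as morphisms $K_0\to K_1$ the homotopy equivalence classes of cospans $(K_0\to L\leftarrow K_1)$ of pointed finite CW-spaces. The composite of $[K_0\xrightarrow{f_0}L\xleftarrow{f_1}K_1]$ followed by $[K_1\xrightarrow{g_0}L'\xleftarrow{g_1}K_2]$ is the class of $(K_0\to\mathrm{Cyl}(f_1,g_0)\leftarrow K_2)$, the legs being $f_0$, $g_1$ followed by the canonical inclusions of $L$, $L'$ (the double mapping cylinder being replaced, up to homotopy equivalence of cospans, by a finite CW model using cellular approximation); the identity of $K$ is $[K\xrightarrow{\mathrm{id}}K\xleftarrow{\mathrm{id}}K]$. $\iota^+:\mathcal{H}\to\mathsf{Cosp}^{\simeq}_{\le\infty}(\mathsf{CW}^{\mathsf{fin}}_\ast)$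 and $\iota^-:\mathcal{H}^{\mathrm{op}}\to\mathsf{Cosp}^{\simeq}_{\le\infty}(\mathsf{CW}^{\mathsf{fin}}_\ast)$ are the identity on objects and send $f:K\to L$ to $[K\xrightarrow{f}L\xleftarrow{\mathrm{id}}L]$ and $[L\xrightarrow{\mathrm{id}}L\xleftarrow{f}K]$ respectively. *)

theory Defs
  imports "HOL-Analysis.Analysis"
begin

section \<open>Categories and functors\<close>

text \<open>
  Hom-sets are indexed by their ends and need not be disjoint, so composition and the
  action of a functor on morphisms take the relevant objects as arguments:
  \<open>Comp C X Y Z g f\<close> is the composite of \<open>f : X \<rightarrow> Y\<close> followed by \<open>g : Y \<rightarrow> Z\<close>.
\<close>

record ('o, 'm) cat =
  Obj :: "'o set"
  Hom :: "'o \<Rightarrow> 'o \<Rightarrow> 'm set"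
  Id :: "'o \<Rightarrow> 'm"
  Comp :: "'o \<Rightarrow> 'o \<Rightarrow> 'o \<Rightarrow> 'm \<Rightarrow> 'm \<Rightarrow> 'm"

locale category =
  fixes C :: "('o, 'm) cat"
  assumes Id_in: "X \<in> Obj C \<Longrightarrow> Id C X \<in> Hom C X X"
    and Comp_in: "\<lbrakk>X \<in> Obj C; Y \<in> Obj C; Z \<in> Obj C; f \<in> Hom C X Y; g \<in> Hom C Y Z\<rbrakk>
      \<Longrightarrow> Comp C X Y Z g f \<in> Hom C X Z"
    and Comp_Id_left: "\<lbrakk>X \<in> Obj C; Y \<in> Obj C; f \<in> Hom C X Y\<rbrakk> \<Longrightarrow> Comp C X Y Y (Id C Y) f = f"
    and Comp_Id_right: "\<lbrakk>X \<in> Obj C; Y \<in> Obj C; f \<in> Hom C X Y\<rbrakk> \<Longrightarrow> Comp C X X Y f (Id C X) = f"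
    and Comp_assoc: "\<lbrakk>X \<in> Obj C; Y \<in> Obj C; Z \<in> Obj C; W \<in> Obj C;
        f \<in> Hom C X Y; g \<in> Hom C Y Z; h \<in> Hom C Z W\<rbrakk>
      \<Longrightarrow> Comp C X Z W h (Comp C X Y Z g f) = Comp C X Y W (Comp C Y Z W h g) f"

definition op_cat :: "('o, 'm) cat \<Rightarrow> ('o, 'm) cat" where
  "op_cat C = \<lparr>Obj = Obj C, Hom = (\<lambda>X Y. Hom C Y X), Id = Id C,
     Comp = (\<lambda>X Y Z g f. Comp C Z Y X f g)\<rparr>"

record ('o, 'm, 'p, 'n) fctr =
  ob :: "'o \<Rightarrow> 'p"
  ar :: "'o \<Rightarrow> 'o \<Rightarrow> 'm \<Rightarrow> 'n"

locale is_functor = dom: category C + cod: category D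
  for C :: "('o, 'm) cat" and D :: "('p, 'n) cat" +
  fixes F :: "('o, 'm, 'p, 'n) fctr"
  assumes ob_in: "X \<in> Obj C \<Longrightarrow> ob F X \<in> Obj D"
    and ar_in: "\<lbrakk>X \<in> Obj C; Y \<in> Obj C; f \<in> Hom C X Y\<rbrakk>
      \<Longrightarrow> ar F X Y f \<in> Hom D (ob F X) (ob F Y)"
    and ar_Id: "X \<in> Obj C \<Longrightarrow> ar F X X (Id C X) = Id D (ob F X)"
    and ar_Comp: "\<lbrakk>X \<in> Obj C; Y \<in> Obj C; Z \<in> Obj C; f \<in> Hom C X Y; g \<in> Hom C Y Z\<rbrakk>
      \<Longrightarrow> ar F X Z (Comp C X Y Z g f)
        = Comp D (ob F X) (ob F Y) (ob F Z) (ar F Y Z g) (ar F X Y f)"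

definition fctr_comp ::
  "('p, 'n, 'q, 'r) fctr \<Rightarrow> ('o, 'm, 'p, 'n) fctr \<Rightarrow> ('o, 'm, 'q, 'r) fctr" where
  "fctr_comp G F = \<lparr>ob = (\<lambda>X. ob G (ob F X)),
     ar = (\<lambda>X Y f. ar G (ob F X) (ob F Y) (ar F X Y f))\<rparr>"

text \<open>
  Strict equality of functors with source \<open>C\<close>: the underlying total HOL functions are only
  compared on the objects and morphisms of \<open>C\<close>.
\<close>

definition fctr_eq ::
  "('o, 'm) cat \<Rightarrow> ('o, 'm, 'p, 'n) fctr \<Rightarrow> ('o, 'm, 'p, 'n) fctr \<Rightarrow> bool" where
  "fctr_eq C F G \<longleftrightarrow>
     (\<forall>X \<in> Obj C. ob F X = ob G X) \<and>
     (\<forall>X \<in> Obj C. \<forall>Y \<in> Obj C. \<forall>f \<in> Hom C X Y. ar F X Y f = ar G X Y f)"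


section \<open>Pointed spaces, maps and homotopies\<close>

datatype 'a pointed = Pointed (spc: "'a topology") (bpt: 'a)

definition pmap :: "'a pointed \<Rightarrow> 'b pointed \<Rightarrow> ('a \<Rightarrow> 'b) \<Rightarrow> bool" where
  "pmap X Y f \<longleftrightarrow> continuous_map (spc X) (spc Y) f \<and> f (bpt X) = bpt Y"

definition phomotopic :: "'a pointed \<Rightarrow> 'b pointed \<Rightarrow> ('a \<Rightarrow> 'b) \<Rightarrow> ('a \<Rightarrow> 'b) \<Rightarrow> bool" where
  "phomotopic X Y = homotopic_with (\<lambda>h. h (bpt X) = bpt Y) (spc X) (spc Y)"

definition phomotopy_equivalence :: "'a pointed \<Rightarrow> 'b pointed \<Rightarrow> ('a \<Rightarrow> 'b) \<Rightarrow> bool" where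
  "phomotopy_equivalence X Y h \<longleftrightarrow> pmap X Y h \<and>
     (\<exists>k. pmap Y X k \<and> phomotopic X X (k \<circ> h) (\<lambda>x. x) \<and> phomotopic Y Y (h \<circ> k) (\<lambda>y. y))"

definition hclass :: "'a pointed \<Rightarrow> 'b pointed \<Rightarrow> ('a \<Rightarrow> 'b) \<Rightarrow> ('a \<Rightarrow> 'b) set" where
  "hclass X Y f = {g. phomotopic X Y f g}"


section \<open>Finite CW-spaces\<close>

definition cell_disk :: "nat \<Rightarrow> (nat \<Rightarrow> real) set" where
  "cell_disk n = {x \<in> topspace (Euclidean_space n). (\<Sum>i<n. x i ^ 2) \<le> 1}"

definition cell_interior :: "nat \<Rightarrow> (nat \<Rightarrow> real) set" where
  "cell_interior n = {x \<in> topspace (Euclidean_space n). (\<Sum>i<n. x i ^ 2) < 1}"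

definition cell_boundary :: "nat \<Rightarrow> (nat \<Rightarrow> real) set" where
  "cell_boundary n = {x \<in> topspace (Euclidean_space n). (\<Sum>i<n. x i ^ 2) = 1}"

text \<open>
  A CW-complex structure with finitely many cells, indexed by \<open>i < N\<close>, of dimension \<open>d i\<close> and
  with characteristic map \<open>\<Phi> i\<close>. Closure-finiteness and the weak topology are automatic for
  finitely many cells.
\<close>

definition finite_CW_structure ::
  "'a topology \<Rightarrow> nat \<Rightarrow> (nat \<Rightarrow> nat) \<Rightarrow> (nat \<Rightarrow> (nat \<Rightarrow> real) \<Rightarrow> 'a) \<Rightarrow> bool" where
  "finite_CW_structure X N d \<Phi> \<longleftrightarrow>
     Hausdorff_space X \<and>
     (\<forall>i<N. continuous_map (subtopology (Euclidean_space (d i)) (cell_disk (d i))) X (\<Phi> i)) \<and>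
     (\<forall>i<N. homeomorphic_map (subtopology (Euclidean_space (d i)) (cell_interior (d i)))
              (subtopology X (\<Phi> i ` cell_interior (d i))) (\<Phi> i)) \<and>
     disjoint_family_on (\<lambda>i. \<Phi> i ` cell_interior (d i)) {..<N} \<and>
     (\<Union>i<N. \<Phi> i ` cell_interior (d i)) = topspace X \<and>
     (\<forall>i<N. \<Phi> i ` cell_boundary (d i) \<subseteq> (\<Union>j\<in>{j. j < N \<and> d j < d i}. \<Phi> j ` cell_interior (d j)))"

definition finite_CW_space :: "'a topology \<Rightarrow> bool" where
  "finite_CW_space X \<longleftrightarrow> (\<exists>N d \<Phi>. finite_CW_structure X N d \<Phi>)"

definition pointed_finite_CW :: "'a pointed \<Rightarrow> bool" where
  "pointed_finite_CW X \<longleftrightarrow> finite_CW_space (spc X) \<and> bpt X \<in> topspace (spc X)"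


section \<open>The homotopy category of pointed finite CW-spaces\<close>

text \<open>
  The type \<open>'u\<close> plays the role of the universe: objects are the pointed finite CW-spaces whose
  underlying set is a subset of \<open>'u\<close>. A finite CW-space has at most continuum many points, so
  every finite CW-space is homeomorphic to one of these as soon as \<open>real\<close> injects into \<open>'u\<close>.
\<close>

definition HCW :: "('u pointed, ('u \<Rightarrow> 'u) set) cat" where
  "HCW = \<lparr>Obj = {K. pointed_finite_CW K},
     Hom = (\<lambda>K L. {hclass K L f |f. pmap K L f}),
     Id = (\<lambda>K. hclass K K (\<lambda>x. x)),
     Comp = (\<lambda>K L M G F. {h. \<exists>g\<in>G. \<exists>f\<in>F. phomotopic K M (g \<circ> f) h})\<rparr>"


section \<open>Double mapping cylinders\<close>

definition quotient_space :: "'a topology \<Rightarrow> ('a \<times> 'a) set \<Rightarrow> 'a set topology" where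
  "quotient_space X R = topology (\<lambda>U. U \<subseteq> topspace X // R \<and> openin X (\<Union>U))"

lemma istopology_quotient_space:
  assumes "equiv (topspace X) R"
  shows "istopology (\<lambda>U. U \<subseteq> topspace X // R \<and> openin X (\<Union>U))"
proof -
  have inter: "\<Union>(U \<inter> V) = \<Union>U \<inter> \<Union>V" if "U \<subseteq> topspace X // R" "V \<subseteq> topspace X // R" for U V
  proof
    show "\<Union>U \<inter> \<Union>V \<subseteq> \<Union>(U \<inter> V)"
    proof
      fix x assume "x \<in> \<Union>U \<inter> \<Union>V"
      then obtain A B where AB: "A \<in> U" "B \<in> V" "x \<in> A" "x \<in> B" by blast
      with that have "A = B"
        using quotient_disj[OF assms, of A B] by (meson disjoint_iff subsetD)
      with AB show "x \<in> \<Union>(U \<inter> V)" by blast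
    qed
  qed blast
  have un: "openin X (\<Union>(\<Union>K))" if "\<forall>U\<in>K. openin X (\<Union>U)" for K
  proof -
    have "\<Union>(\<Union>K) = \<Union>(Union ` K)" by blast
    with that show ?thesis by (metis (mono_tags, lifting) imageE openin_Union)
  qed
  show ?thesis
    unfolding istopology_def
  proof (intro conjI allI impI)
    fix U V
    assume U: "U \<subseteq> topspace X // R \<and> openin X (\<Union>U)"
      and V: "V \<subseteq> topspace X // R \<and> openin X (\<Union>V)"
    then show "U \<inter> V \<subseteq> topspace X // R" by blast
    show "openin X (\<Union>(U \<inter> V))"
      using U V by (simp add: inter openin_Int)
  next
    fix K
    assume K: "\<forall>U\<in>K. U \<subseteq> topspace X // R \<and> openin X (\<Union>U)"
    then show "\<Union>K \<subseteq> topspace X // R" by blast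
    show "openin X (\<Union>(\<Union>K))" using K un by blast
  qed
qed

lemma openin_quotient_space:
  assumes "equiv (topspace X) R"
  shows "openin (quotient_space X R) U \<longleftrightarrow> U \<subseteq> topspace X // R \<and> openin X (\<Union>U)"
  unfolding quotient_space_def
  by (simp add: topology_inverse'[OF istopology_quotient_space[OF assms]])

datatype ('a, 'k, 'b) cyl_pt = CLeft 'a | CMid real 'k | CRight 'b

text \<open>The disjoint union of \<open>L\<^sub>0\<close>, \<open>[0,1] \<times> K\<close> and \<open>L\<^sub>1\<close>.\<close>

definition cyl_sum :: "'k pointed \<Rightarrow> 'a pointed \<Rightarrow> 'b pointed \<Rightarrow> ('a, 'k, 'b) cyl_pt topology" where
  "cyl_sum K L0 L1 = topology (\<lambda>U.
     openin (spc L0) {x. CLeft x \<in> U} \<and>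
     openin (prod_topology (top_of_set {0..1}) (spc K)) {(t, k). CMid t k \<in> U} \<and>
     openin (spc L1) {y. CRight y \<in> U})"

lemma openin_cyl_sum:
  fixes K :: "'k pointed" and L0 :: "'a pointed" and L1 :: "'b pointed"
  shows "openin (cyl_sum K L0 L1) U \<longleftrightarrow>
     openin (spc L0) {x. CLeft x \<in> U} \<and>
     openin (prod_topology (top_of_set {0..1}) (spc K)) {(t, k). CMid t k \<in> U} \<and>
     openin (spc L1) {y. CRight y \<in> U}"
proof -
  have "istopology (\<lambda>U :: ('a, 'k, 'b) cyl_pt set.
     openin (spc L0) {x. CLeft x \<in> U} \<and>
     openin (prod_topology (top_of_set {0..1}) (spc K)) {(t, k). CMid t k \<in> U} \<and>
     openin (spc L1) {y. CRight y \<in> U})"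
    unfolding istopology_def
  proof (intro conjI allI impI)
    fix U V :: "('a, 'k, 'b) cyl_pt set"
    have *: "{x. CLeft x \<in> U \<inter> V} = {x. CLeft x \<in> U} \<inter> {x. CLeft x \<in> V}"
      "{(t, k). CMid t k \<in> U \<inter> V} = {(t, k). CMid t k \<in> U} \<inter> {(t, k). CMid t k \<in> V}"
      "{x. CRight x \<in> U \<inter> V} = {x. CRight x \<in> U} \<inter> {x. CRight x \<in> V}"
      by auto
    assume U: "openin (spc L0) {x. CLeft x \<in> U} \<and>
       openin (prod_topology (top_of_set {0..1}) (spc K)) {(t, k). CMid t k \<in> U} \<and>
       openin (spc L1) {y. CRight y \<in> U}"
      and V: "openin (spc L0) {x. CLeft x \<in> V} \<and>
       openin (prod_topology (top_of_set {0..1}) (spc K)) {(t, k). CMid t k \<in> V} \<and>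
       openin (spc L1) {y. CRight y \<in> V}"
    show "openin (spc L0) {x. CLeft x \<in> U \<inter> V}"
      "openin (prod_topology (top_of_set {0..1}) (spc K)) {(t, k). CMid t k \<in> U \<inter> V}"
      "openin (spc L1) {y. CRight y \<in> U \<inter> V}"
      unfolding * using U V by (auto intro: openin_Int)
  next
    fix \<K> :: "('a, 'k, 'b) cyl_pt set set"
    have *: "{x. CLeft x \<in> \<Union>\<K>} = (\<Union>U\<in>\<K>. {x. CLeft x \<in> U})"
      "{(t, k). CMid t k \<in> \<Union>\<K>} = (\<Union>U\<in>\<K>. {(t, k). CMid t k \<in> U})"
      "{x. CRight x \<in> \<Union>\<K>} = (\<Union>U\<in>\<K>. {x. CRight x \<in> U})"
      by auto
    assume K: "\<forall>U\<in>\<K>. openin (spc L0) {x. CLeft x \<in> U} \<and>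
       openin (prod_topology (top_of_set {0..1}) (spc K)) {(t, k). CMid t k \<in> U} \<and>
       openin (spc L1) {y. CRight y \<in> U}"
    show "openin (spc L0) {x. CLeft x \<in> \<Union>\<K>}"
      "openin (prod_topology (top_of_set {0..1}) (spc K)) {(t, k). CMid t k \<in> \<Union>\<K>}"
      "openin (spc L1) {y. CRight y \<in> \<Union>\<K>}"
      unfolding * using K by (auto intro!: openin_Union)
  qed
  then show ?thesis
    unfolding cyl_sum_def by (simp add: topology_inverse')
qed

text \<open>
  The identifications producing the double mapping cylinder from the disjoint union: the wedge
  of \<open>L\<^sub>0\<close> and \<open>L\<^sub>1\<close> with the reduced cylinder, which is \<open>[0,1] \<times> K\<close> with
  \<open>[0,1] \<times> {bpt K}\<close> collapsed to the base point, and then the gluing of its two ends.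
\<close>

inductive cyl_glue ::
  "'k pointed \<Rightarrow> 'a pointed \<Rightarrow> 'b pointed \<Rightarrow> ('k \<Rightarrow> 'a) \<Rightarrow> ('k \<Rightarrow> 'b) \<Rightarrow>
    ('a, 'k, 'b) cyl_pt \<Rightarrow> ('a, 'k, 'b) cyl_pt \<Rightarrow> bool"
  for K L0 L1 f g where
  wedge: "cyl_glue K L0 L1 f g (CLeft (bpt L0)) (CRight (bpt L1))"
| collapse: "t \<in> {0..1} \<Longrightarrow> cyl_glue K L0 L1 f g (CMid t (bpt K)) (CLeft (bpt L0))"
| left_end: "k \<in> topspace (spc K) \<Longrightarrow> cyl_glue K L0 L1 f g (CMid 0 k) (CLeft (f k))"
| right_end: "k \<in> topspace (spc K) \<Longrightarrow> cyl_glue K L0 L1 f g (CMid 1 k) (CRight (g k))"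

definition cyl_rel ::
  "'k pointed \<Rightarrow> 'a pointed \<Rightarrow> 'b pointed \<Rightarrow> ('k \<Rightarrow> 'a) \<Rightarrow> ('k \<Rightarrow> 'b) \<Rightarrow>
    (('a, 'k, 'b) cyl_pt \<times> ('a, 'k, 'b) cyl_pt) set" where
  "cyl_rel K L0 L1 f g =
     {(p, q). p \<in> topspace (cyl_sum K L0 L1) \<and> q \<in> topspace (cyl_sum K L0 L1) \<and>
              equivclp (cyl_glue K L0 L1 f g) p q}"

lemma equiv_cyl_rel: "equiv (topspace (cyl_sum K L0 L1)) (cyl_rel K L0 L1 f g)"
  by (rule equivI)
    (auto simp: cyl_rel_def refl_on_def sym_def trans_def intro: equivclp_sym equivclp_trans)

definition cyl_class ::
  "'k pointed \<Rightarrow> 'a pointed \<Rightarrow> 'b pointed \<Rightarrow> ('k \<Rightarrow> 'a) \<Rightarrow> ('k \<Rightarrow> 'b) \<Rightarrow>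
    ('a, 'k, 'b) cyl_pt \<Rightarrow> ('a, 'k, 'b) cyl_pt set" where
  "cyl_class K L0 L1 f g p = cyl_rel K L0 L1 f g `` {p}"

definition Cyl ::
  "'k pointed \<Rightarrow> 'a pointed \<Rightarrow> 'b pointed \<Rightarrow> ('k \<Rightarrow> 'a) \<Rightarrow> ('k \<Rightarrow> 'b) \<Rightarrow>
    ('a, 'k, 'b) cyl_pt set pointed" where
  "Cyl K L0 L1 f g =
     Pointed (quotient_space (cyl_sum K L0 L1) (cyl_rel K L0 L1 f g))
             (cyl_class K L0 L1 f g (CLeft (bpt L0)))"


section \<open>Homotopy pushouts and Mayer-Vietoris diagrams\<close>

text \<open>
  In a homotopy pushout square, \<open>\<eta>\<close> is the pointed homotopy from \<open>g\<^sub>1 \<circ> f\<^sub>0\<close> to \<open>f\<^sub>1 \<circ> g\<^sub>0\<close> (for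
  representatives \<open>a\<^sub>0, b\<^sub>0, b\<^sub>1, a\<^sub>1\<close> of the homotopy classes \<open>f\<^sub>0, g\<^sub>0, g\<^sub>1, f\<^sub>1\<close>) and \<open>\<phi>\<close> the map
  induced on the double mapping cylinder.
\<close>

definition homotopy_pushout ::
  "'u pointed \<Rightarrow> 'u pointed \<Rightarrow> 'u pointed \<Rightarrow> 'u pointed \<Rightarrow>
    ('u \<Rightarrow> 'u) set \<Rightarrow> ('u \<Rightarrow> 'u) set \<Rightarrow> ('u \<Rightarrow> 'u) set \<Rightarrow> ('u \<Rightarrow> 'u) set \<Rightarrow> bool" where
  "homotopy_pushout K L0 L1 S f0 g0 g1 f1 \<longleftrightarrow>
     K \<in> Obj HCW \<and> L0 \<in> Obj HCW \<and> L1 \<in> Obj HCW \<and> S \<in> Obj HCW \<and>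
     f0 \<in> Hom HCW K L0 \<and> g0 \<in> Hom HCW K L1 \<and> g1 \<in> Hom HCW L0 S \<and> f1 \<in> Hom HCW L1 S \<and>
     (\<exists>a0\<in>f0. \<exists>b0\<in>g0. \<exists>b1\<in>g1. \<exists>a1\<in>f1. \<exists>\<eta> \<phi>.
        continuous_map (prod_topology (top_of_set {0..1}) (spc K)) (spc S) \<eta> \<and>
        (\<forall>k \<in> topspace (spc K). \<eta> (0, k) = b1 (a0 k) \<and> \<eta> (1, k) = a1 (b0 k)) \<and>
        (\<forall>t \<in> {0..1}. \<eta> (t, bpt K) = bpt S) \<and>
        (\<forall>x \<in> topspace (spc L0). \<phi> (cyl_class K L0 L1 a0 b0 (CLeft x)) = b1 x) \<and>
        (\<forall>t \<in> {0..1}. \<forall>k \<in> topspace (spc K).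
           \<phi> (cyl_class K L0 L1 a0 b0 (CMid t k)) = \<eta> (t, k)) \<and>
        (\<forall>y \<in> topspace (spc L1). \<phi> (cyl_class K L0 L1 a0 b0 (CRight y)) = a1 y) \<and>
        phomotopy_equivalence (Cyl K L0 L1 a0 b0) S \<phi>)"

locale MV_PN_diagram =
  Fp: is_functor HCW S Fp + Fm: is_functor "op_cat HCW" S Fm
  for S :: "('o, 'm) cat"
    and Fp Fm :: "('u pointed, ('u \<Rightarrow> 'u) set, 'o, 'm) fctr" +
  assumes same_ob: "K \<in> Obj HCW \<Longrightarrow> ob Fp K = ob Fm K"
    and Mayer_Vietoris: "homotopy_pushout K L0 L1 T f0 g0 g1 f1 \<Longrightarrow>
      Comp S (ob Fp L0) (ob Fp T) (ob Fp L1) (ar Fm T L1 f1) (ar Fp L0 T g1) =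
      Comp S (ob Fp L0) (ob Fp K) (ob Fp L1) (ar Fp K L1 g0) (ar Fm L0 K f0)"


section \<open>The category of cospans up to homotopy equivalence\<close>

datatype ('k, 'a) cospan = Cospan (apex: "'a pointed") (lleg: "'k \<Rightarrow> 'a") (rleg: "'k \<Rightarrow> 'a")

definition finite_CW_cospan :: "'k pointed \<Rightarrow> 'k pointed \<Rightarrow> ('k, 'a) cospan \<Rightarrow> bool" where
  "finite_CW_cospan K0 K1 c \<longleftrightarrow>
     pointed_finite_CW (apex c) \<and> pmap K0 (apex c) (lleg c) \<and> pmap K1 (apex c) (rleg c)"

definition cospan_equiv ::
  "'k pointed \<Rightarrow> 'k pointed \<Rightarrow> ('k, 'a) cospan \<Rightarrow> ('k, 'b) cospan \<Rightarrow> bool" where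
  "cospan_equiv K0 K1 c c' \<longleftrightarrow>
     (\<exists>h. phomotopy_equivalence (apex c) (apex c') h \<and>
          phomotopic K0 (apex c') (lleg c') (h \<circ> lleg c) \<and>
          phomotopic K1 (apex c') (rleg c') (h \<circ> rleg c))"

text \<open>
  The class of a cospan \<open>c\<close> consists of cospans of finite CW-spaces in the universe \<open>'u\<close>, but the
  apex of \<open>c\<close> itself may live in another type and need not be literally a CW-space. This is how
  the double mapping cylinder is replaced by a finite CW model.
\<close>

definition cospan_class ::
  "'u pointed \<Rightarrow> 'u pointed \<Rightarrow> ('u, 'a) cospan \<Rightarrow> ('u, 'u) cospan set" where
  "cospan_class K0 K1 c = {c'. finite_CW_cospan K0 K1 c' \<and> cospan_equiv K0 K1 c c'}"

definition cyl_cospan ::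
  "'k pointed \<Rightarrow> ('k, 'a) cospan \<Rightarrow> ('k, 'b) cospan \<Rightarrow> ('k, ('a, 'k, 'b) cyl_pt set) cospan" where
  "cyl_cospan K1 c d =
     (let cls = cyl_class K1 (apex c) (apex d) (rleg c) (lleg d) in
      Cospan (Cyl K1 (apex c) (apex d) (rleg c) (lleg d))
        (\<lambda>x. cls (CLeft (lleg c x))) (\<lambda>y. cls (CRight (rleg d y))))"

definition CospCW :: "('u pointed, ('u, 'u) cospan set) cat" where
  "CospCW = \<lparr>Obj = {K. pointed_finite_CW K},
     Hom = (\<lambda>K0 K1. {cospan_class K0 K1 c |c :: ('u, 'u) cospan. finite_CW_cospan K0 K1 c}),
     Id = (\<lambda>K. cospan_class K K (Cospan K (\<lambda>x. x) (\<lambda>x. x))),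
     Comp = (\<lambda>K0 K1 K2 D C. \<Union>c\<in>C. \<Union>d\<in>D. cospan_class K0 K2 (cyl_cospan K1 c d))\<rparr>"

definition iota_plus :: "('u pointed, ('u \<Rightarrow> 'u) set, 'u pointed, ('u, 'u) cospan set) fctr" where
  "iota_plus = \<lparr>ob = (\<lambda>K. K),
     ar = (\<lambda>K L F. \<Union>f\<in>F. cospan_class K L (Cospan L f (\<lambda>x. x)))\<rparr>"

text \<open>A morphism \<open>L \<rightarrow> K\<close> of \<open>op_cat HCW\<close> is the homotopy class of a map from \<open>K\<close> to \<open>L\<close>.\<close>

definition iota_minus :: "('u pointed, ('u \<Rightarrow> 'u) set, 'u pointed, ('u, 'u) cospan set) fctr" where
  "iota_minus = \<lparr>ob = (\<lambda>L. L),
     ar = (\<lambda>L K F. \<Union>f\<in>F. cospan_class L K (Cospan L (\<lambda>x. x) f))\<rparr>"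

end

theory Submission
  imports Defs
begin

text \<open>Every class \<open>[f, g]\<close> of a cospan \<open>K\<^sub>0 \<rightarrow> L \<leftarrow> K\<^sub>1\<close> is \<open>\<iota>\<^sup>-(g) \<circ> \<iota>\<^sup>+(f)\<close>, so \<open>F\<close> must be
  \<open>F[f, g] = F\<^sup>-(g) \<circ> F\<^sup>+(f)\<close>. This depends only on the class because \<open>F\<^sup>-(h) \<circ> F\<^sup>+(h) = id\<close> for a
  homotopy equivalence \<open>h\<close>: the square with maps \<open>id, id, h, h\<close> is a homotopy pushout. It respects
  composition by the Mayer-Vietoris relation for the square of a double mapping cylinder.

  That cospans form a category rests on two facts. First, the double mapping cylinder is
  homotopy invariant: replacing one end along a homotopy equivalence gives a map of cylinders which
  has a left homotopy inverse of the same form, hence is itself a homotopy equivalence. Second, the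
  cylinder of finite CW-spaces has the homotopy type of a finite CW-space: it arises from a point by
  attaching cells in some order, and each attaching map of an \<open>n\<close>-cell can be deformed
  into the skeleton of dimension less than \<open>n\<close>, because a Lipschitz approximation misses a point in
  every cell of dimension at least \<open>n\<close> and can be pushed off it.\<close>

section \<open>Pointed homotopies\<close>

text \<open>The legs of a cospan are arbitrary maps, so a cylinder carries no evident CW structure:
  its new cells are products of cells with the interval, and their boundaries may meet cells of the
  same or of higher dimension. \<open>cell_built\<close> therefore records attachments without a
  condition on dimensions, and the CW structure is created afterwards, one cell at a time, on a
  homotopy equivalent model. Base points cause two further difficulties. A base point may lie inside
  an open cell, and this cell must then be subdivided. Moreover attaching maps are unpointed while
  all homotopies here are pointed; a disjoint base point is added to the sphere, which makes the
  mapping cone of an unpointed map a double mapping cylinder with a two-point right end. One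
  invariance theorem for cylinders then serves both the composition of cospans and the attachment of
  cells. Models are moved into the universe \<open>'u\<close>, which contains a copy of the reals.
  In the universality proof the Mayer-Vietoris relation is applied to such models, since a cylinder
  is not itself an object.\<close>

lemma homotopic_with_pointed_iff:
  "x0 \<in> topspace X \<Longrightarrow> homotopic_with (\<lambda>h. h x0 = y0) X Y p q \<longleftrightarrow>
     (\<exists>h. continuous_map (prod_topology (top_of_set {0..1::real}) X) Y h \<and>
        (\<forall>x \<in> topspace X. h (0, x) = p x) \<and> (\<forall>x \<in> topspace X. h (1, x) = q x) \<and>
        (\<forall>t \<in> {0..1}. h (t, x0) = y0))"
  using homotopic_with[of X "\<lambda>h. h x0 = y0" Y p q] by simp

text \<open>Homotopies are kept curried, with the time first, so that \<open>H t\<close> is a map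
  and time and point can be substituted independently.\<close>

definition jcont :: "'a topology \<Rightarrow> 'b topology \<Rightarrow> (real \<Rightarrow> 'a \<Rightarrow> 'b) \<Rightarrow> bool" where
  "jcont X Y H \<longleftrightarrow> continuous_map (prod_topology (top_of_set {0..1}) X) Y (\<lambda>z. H (fst z) (snd z))"

text \<open>Most continuity goals below have this form: time and point both depend continuously on a
  third variable, and the time has to be shown to stay in the unit interval.\<close>

lemma jcont_comp:
  assumes "jcont X Y H" "continuous_map Z euclideanreal a" "continuous_map Z X b"
    and "\<And>z. z \<in> topspace Z \<Longrightarrow> 0 \<le> a z \<and> a z \<le> 1"
  shows "continuous_map Z Y (\<lambda>z. H (a z) (b z))"
proof -
  have "continuous_map Z (prod_topology (top_of_set {0..1}) X) (\<lambda>z. (a z, b z))"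
    using assms by (auto simp: continuous_map_paired continuous_map_in_subtopology)
  from continuous_map_compose[OF this assms(1)[unfolded jcont_def]] show ?thesis
    by (simp add: o_def)
qed

lemma jcont_at: "jcont X Y H \<Longrightarrow> t \<in> {0..1} \<Longrightarrow> continuous_map X Y (H t)"
  by (rule jcont_comp[where a="\<lambda>_. t" and b="\<lambda>x. x", simplified]) auto

lemma jcont_in: "jcont X Y H \<Longrightarrow> t \<in> {0..1} \<Longrightarrow> x \<in> topspace X \<Longrightarrow> H t x \<in> topspace Y"
  by (meson continuous_map_image_subset_topspace image_subset_iff jcont_at)

lemma jcont_const: "continuous_map X Y f \<Longrightarrow> jcont X Y (\<lambda>_. f)"
  unfolding jcont_def by (rule continuous_map_compose[OF continuous_map_snd, unfolded o_def])

lemma jcont_rev: "jcont X Y H \<Longrightarrow> jcont X Y (\<lambda>t. H (1 - t))"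
  unfolding jcont_def[of X Y "\<lambda>t. H (1 - t)"]
  by (rule jcont_comp[where H = H])
     (auto intro!: continuous_map_diff continuous_map_into_fulltopology[OF continuous_map_fst]
        continuous_map_snd)

text \<open>The coordinates of nested products are given as explicit functions of \<open>z\<close>,
  so that the collection \<open>cm_real\<close> can take arithmetic expressions in them apart by
  resolution.\<close>

lemma cm_proj:
  "continuous_map (prod_topology (top_of_set S) X) euclideanreal (\<lambda>z. fst z)"
  "continuous_map (prod_topology X Y) Y (\<lambda>z. snd z)"
  "continuous_map (prod_topology X (prod_topology (top_of_set S) Y)) euclideanreal (\<lambda>z. fst (snd z))"
  "continuous_map (prod_topology X (prod_topology Y Y')) Y' (\<lambda>z. snd (snd z))"
proof -
  show 1: "continuous_map (prod_topology (top_of_set S) X) euclideanreal (\<lambda>z. fst z)"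
    for S and X :: "'x topology"
    by (rule continuous_map_into_fulltopology[OF continuous_map_fst])
  show 2: "continuous_map (prod_topology X Y) Y (\<lambda>z. snd z)"
    for X :: "'x topology" and Y :: "'y topology"
    by (rule continuous_map_snd)
  show "continuous_map (prod_topology X (prod_topology (top_of_set S) Y)) euclideanreal (\<lambda>z. fst (snd z))"
    using continuous_map_compose[OF 2 1] by (simp add: o_def)
  show "continuous_map (prod_topology X (prod_topology Y Y')) Y' (\<lambda>z. snd (snd z))"
    using continuous_map_compose[OF 2 2] by (simp add: o_def)
qed

lemma cm_comp: "continuous_map X Y f \<Longrightarrow> continuous_map Z X b \<Longrightarrow> continuous_map Z Y (\<lambda>z. f (b z))"
  using continuous_map_compose[of Z X b Y f] by (simp add: o_def)

lemmas cm_sub = cm_proj[THEN continuous_map_from_subtopology]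

lemma cm_const_real: "continuous_map Z euclideanreal (\<lambda>_. c)"
  by simp

lemmas cm_real = cm_proj cm_sub cm_const_real continuous_map_add continuous_map_diff
  continuous_map_real_mult continuous_map_real_min continuous_map_real_max

text \<open>The base point is required to lie in the space because a condition on functions inside
  \<open>homotopic_with\<close> is meaningful only if it depends on their values on the
  carrier.\<close>

lemma phomotopic_iff:
  "bpt X \<in> topspace (spc X) \<Longrightarrow> phomotopic X Y p q \<longleftrightarrow>
     (\<exists>H. jcont (spc X) (spc Y) H \<and> (\<forall>x \<in> topspace (spc X). H 0 x = p x \<and> H 1 x = q x) \<and>
        (\<forall>t \<in> {0..1}. H t (bpt X) = bpt Y))"
  (is "_ \<Longrightarrow> _ \<longleftrightarrow> ?R")
  unfolding phomotopic_def homotopic_with_pointed_iff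
proof
  assume "\<exists>h. continuous_map (prod_topology (top_of_set {0..1::real}) (spc X)) (spc Y) h \<and>
        (\<forall>x \<in> topspace (spc X). h (0, x) = p x) \<and> (\<forall>x \<in> topspace (spc X). h (1, x) = q x) \<and>
        (\<forall>t \<in> {0..1}. h (t, bpt X) = bpt Y)" (is ?L)
  then obtain h where "continuous_map (prod_topology (top_of_set {0..1::real}) (spc X)) (spc Y) h"
    "\<forall>x \<in> topspace (spc X). h (0, x) = p x" "\<forall>x \<in> topspace (spc X). h (1, x) = q x"
    "\<forall>t \<in> {0..1}. h (t, bpt X) = bpt Y"
    by (elim exE conjE)
  then show ?R by (intro exI[of _ "\<lambda>t x. h (t, x)"]) (simp add: jcont_def)
next
  assume ?R
  then obtain H where "jcont (spc X) (spc Y) H"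
    "\<forall>x \<in> topspace (spc X). H 0 x = p x \<and> H 1 x = q x" "\<forall>t \<in> {0..1}. H t (bpt X) = bpt Y"
    by (elim exE conjE)
  then show "\<exists>h. continuous_map (prod_topology (top_of_set {0..1::real}) (spc X)) (spc Y) h \<and>
        (\<forall>x \<in> topspace (spc X). h (0, x) = p x) \<and> (\<forall>x \<in> topspace (spc X). h (1, x) = q x) \<and>
        (\<forall>t \<in> {0..1}. h (t, bpt X) = bpt Y)"
    by (intro exI[of _ "\<lambda>z. H (fst z) (snd z)"]) (simp add: jcont_def)
qed

lemma phomotopicI:
  "bpt X \<in> topspace (spc X) \<Longrightarrow> jcont (spc X) (spc Y) H \<Longrightarrow>
   (\<And>x. x \<in> topspace (spc X) \<Longrightarrow> H 0 x = p x) \<Longrightarrow> (\<And>x. x \<in> topspace (spc X) \<Longrightarrow> H 1 x = q x) \<Longrightarrow>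
   (\<And>t. 0 \<le> t \<Longrightarrow> t \<le> 1 \<Longrightarrow> H t (bpt X) = bpt Y) \<Longrightarrow> phomotopic X Y p q"
  by (subst phomotopic_iff) auto

lemma phomotopicE:
  assumes "phomotopic X Y p q" "bpt X \<in> topspace (spc X)"
  obtains H where "jcont (spc X) (spc Y) H" "\<And>x. x \<in> topspace (spc X) \<Longrightarrow> H 0 x = p x"
    "\<And>x. x \<in> topspace (spc X) \<Longrightarrow> H 1 x = q x" "\<And>t. t \<in> {0..1} \<Longrightarrow> H t (bpt X) = bpt Y"
  using assms by (auto simp: phomotopic_iff)

lemma phomotopic_refl: "pmap X Y f \<Longrightarrow> phomotopic X Y f f"
  by (simp add: phomotopic_def pmap_def)

lemma phomotopic_sym: "phomotopic X Y f g \<Longrightarrow> phomotopic X Y g f"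
  by (simp add: phomotopic_def homotopic_with_sym)

lemma phomotopic_trans: "phomotopic X Y f g \<Longrightarrow> phomotopic X Y g h \<Longrightarrow> phomotopic X Y f h"
  unfolding phomotopic_def by (rule homotopic_with_trans)

lemma phomotopic_imp_pmap:
  "phomotopic X Y f g \<Longrightarrow> pmap X Y f" "phomotopic X Y f g \<Longrightarrow> pmap X Y g"
  using homotopic_with_imp_continuous_maps homotopic_with_imp_property
  unfolding phomotopic_def pmap_def by blast+

lemma phomotopic_eq:
  "bpt X \<in> topspace (spc X) \<Longrightarrow> pmap X Y f \<Longrightarrow> (\<And>x. x \<in> topspace (spc X) \<Longrightarrow> f x = g x)
    \<Longrightarrow> phomotopic X Y f g"
  unfolding phomotopic_def by (rule homotopic_with_equal) (auto simp: pmap_def)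

lemma pmap_compose: "pmap X Y f \<Longrightarrow> pmap Y Z g \<Longrightarrow> pmap X Z (g \<circ> f)"
  by (auto simp: pmap_def intro: continuous_map_compose)

lemma pmap_id: "pmap X X (\<lambda>x. x)"
  by (simp add: pmap_def)

lemma pmap_in: "pmap X Y f \<Longrightarrow> x \<in> topspace (spc X) \<Longrightarrow> f x \<in> topspace (spc Y)"
  by (auto simp: pmap_def continuous_map_def)

lemma pmap_bpt: "pmap X Y f \<Longrightarrow> f (bpt X) = bpt Y"
  by (simp add: pmap_def)

lemma pmap_cm: "pmap X Y f \<Longrightarrow> continuous_map (spc X) (spc Y) f"
  by (simp add: pmap_def)

lemma phomotopic_compose:
  assumes "phomotopic X Y f f'" "phomotopic Y Z g g'"
  shows "phomotopic X Z (g \<circ> f) (g' \<circ> f')"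
proof -
  have "phomotopic X Z (g \<circ> f) (g \<circ> f')"
    using assms(1) phomotopic_imp_pmap(1)[OF assms(2)] unfolding phomotopic_def pmap_def
    by (intro homotopic_with_compose_continuous_map_left[where p="\<lambda>h. h (bpt X) = bpt Y"]) auto
  moreover have "phomotopic X Z (g \<circ> f') (g' \<circ> f')"
    using assms(2) phomotopic_imp_pmap(2)[OF assms(1)] unfolding phomotopic_def pmap_def
    by (intro homotopic_with_compose_continuous_map_right[where p="\<lambda>h. h (bpt Y) = bpt Z"]) auto
  ultimately show ?thesis by (rule phomotopic_trans)
qed

lemma phomotopic_post: "phomotopic X Y f f' \<Longrightarrow> pmap Y Z g \<Longrightarrow> phomotopic X Z (g \<circ> f) (g \<circ> f')"
  by (rule phomotopic_compose[OF _ phomotopic_refl])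

lemma phomotopic_pre: "phomotopic Y Z g g' \<Longrightarrow> pmap X Y f \<Longrightarrow> phomotopic X Z (g \<circ> f) (g' \<circ> f)"
  by (rule phomotopic_compose[OF phomotopic_refl])

text \<open>A left inverse \<open>k\<close> and a right inverse \<open>l\<close> agree up to
  homotopy, since k ~ k h l ~ l. One-sided inverses can thus be found separately, which is how
  cylinder maps are inverted below.\<close>

lemma phomotopy_equivalenceI:
  assumes "pmap X Y h" "phomotopic X X (k \<circ> h) (\<lambda>x. x)" "phomotopic Y Y (h \<circ> l) (\<lambda>y. y)"
    "pmap Y X k" "pmap Y X l"
  shows "phomotopy_equivalence X Y h"
proof -
  have "phomotopic Y X (k \<circ> (h \<circ> l)) (k \<circ> (\<lambda>y. y))"
    using assms by (intro phomotopic_post)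
  moreover have "phomotopic Y X ((k \<circ> h) \<circ> l) ((\<lambda>x. x) \<circ> l)"
    using assms by (intro phomotopic_pre)
  ultimately have "phomotopic Y X k l"
    by (simp add: o_assoc o_def) (metis phomotopic_sym phomotopic_trans)
  then have "phomotopic Y Y (h \<circ> k) (h \<circ> l)"
    using assms by (intro phomotopic_post)
  then have "phomotopic Y Y (h \<circ> k) (\<lambda>y. y)"
    using assms phomotopic_trans by blast
  then show ?thesis using assms unfolding phomotopy_equivalence_def by blast
qed

lemma phomotopy_equivalence_id: "phomotopy_equivalence X X (\<lambda>x. x)"
  by (rule phomotopy_equivalenceI[where k="\<lambda>x. x" and l="\<lambda>x. x"])
     (simp_all add: o_def phomotopic_refl pmap_id)

lemma phomotopy_equivalence_pmap: "phomotopy_equivalence X Y h \<Longrightarrow> pmap X Y h"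
  by (simp add: phomotopy_equivalence_def)

lemma phomotopy_equivalence_inverse:
  assumes "phomotopy_equivalence X Y h"
  obtains k where "phomotopy_equivalence Y X k" "phomotopic X X (k \<circ> h) (\<lambda>x. x)"
    "phomotopic Y Y (h \<circ> k) (\<lambda>y. y)"
  using assms unfolding phomotopy_equivalence_def by blast

lemma phomotopy_equivalence_compose:
  assumes "phomotopy_equivalence X Y f" "phomotopy_equivalence Y Z g"
  shows "phomotopy_equivalence X Z (g \<circ> f)"
proof -
  obtain f' where f': "phomotopy_equivalence Y X f'" "phomotopic X X (f' \<circ> f) (\<lambda>x. x)"
    "phomotopic Y Y (f \<circ> f') (\<lambda>y. y)"
    using assms phomotopy_equivalence_inverse by blast
  obtain g' where g': "phomotopy_equivalence Z Y g'" "phomotopic Y Y (g' \<circ> g) (\<lambda>x. x)"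
    "phomotopic Z Z (g \<circ> g') (\<lambda>y. y)"
    using assms phomotopy_equivalence_inverse by blast
  note pm = assms[THEN phomotopy_equivalence_pmap] f'(1)[THEN phomotopy_equivalence_pmap]
    g'(1)[THEN phomotopy_equivalence_pmap]
  have "phomotopic X X (f' \<circ> ((g' \<circ> g) \<circ> f)) (f' \<circ> ((\<lambda>x. x) \<circ> f))"
    using g' pm by (blast intro: phomotopic_post phomotopic_pre)
  moreover have "phomotopic Z Z (g \<circ> ((f \<circ> f') \<circ> g')) (g \<circ> ((\<lambda>x. x) \<circ> g'))"
    using f' pm by (blast intro: phomotopic_post phomotopic_pre)
  ultimately show ?thesis
    using f' g' pm
    by (intro phomotopy_equivalenceI[where k="f' \<circ> g'" and l="f' \<circ> g'"] pmap_compose)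
       (auto simp: o_def intro: phomotopic_trans)
qed

lemma phomotopy_equivalence_mutual_inverse:
  assumes "bpt X \<in> topspace (spc X)" "bpt Y \<in> topspace (spc Y)" "pmap X Y h" "pmap Y X k"
    "\<And>x. x \<in> topspace (spc X) \<Longrightarrow> k (h x) = x" "\<And>y. y \<in> topspace (spc Y) \<Longrightarrow> h (k y) = y"
  shows "phomotopy_equivalence X Y h"
  using assms
  by (intro phomotopy_equivalenceI[where k=k and l=k] phomotopic_eq pmap_compose)
     (auto intro: pmap_compose)

section \<open>Maps out of the double mapping cylinder\<close>

lemma topspace_cyl_sum:
  "topspace (cyl_sum K L0 L1) = CLeft ` topspace (spc L0) \<union>
     (\<lambda>(t, k). CMid t k) ` ({0..1} \<times> topspace (spc K)) \<union> CRight ` topspace (spc L1)"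
  (is "?A = ?B")
proof
  let ?U = "topspace (cyl_sum K L0 L1)"
  have "openin (cyl_sum K L0 L1) ?U" by simp
  then have "{x. CLeft x \<in> ?U} \<subseteq> topspace (spc L0)" "{(t, k). CMid t k \<in> ?U} \<subseteq> {0..1} \<times> topspace (spc K)"
    "{x. CRight x \<in> ?U} \<subseteq> topspace (spc L1)"
    unfolding openin_cyl_sum by (auto dest!: openin_subset)
  note sub = this
  show "?A \<subseteq> ?B"
  proof
    fix p assume "p \<in> ?A"
    then show "p \<in> ?B"
      using subsetD[OF sub(1)] subsetD[OF sub(2), of "(t, k)" for t k] subsetD[OF sub(3)]
      by (cases p) auto
  qed
  have "openin (cyl_sum K L0 L1) ?B"
    unfolding openin_cyl_sum
    apply (intro conjI)
    subgoal by (rule back_subst[of "openin _", OF openin_topspace]) auto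
    subgoal by (rule back_subst[of "openin _", OF openin_topspace]) auto
    subgoal by (rule back_subst[of "openin _", OF openin_topspace]) auto
    done
  then show "?B \<subseteq> ?A" by (rule openin_subset)
qed

lemma sum_iff:
  "CLeft x \<in> topspace (cyl_sum K L0 L1) \<longleftrightarrow> x \<in> topspace (spc L0)"
  "CRight y \<in> topspace (cyl_sum K L0 L1) \<longleftrightarrow> y \<in> topspace (spc L1)"
  "CMid t k \<in> topspace (cyl_sum K L0 L1) \<longleftrightarrow> t \<in> {0..1} \<and> k \<in> topspace (spc K)"
  unfolding topspace_cyl_sum by auto

lemma cyl_sum_pre:
  assumes "openin (cyl_sum K L0 L1) U"
  shows "openin (spc L0) {x \<in> topspace (spc L0). CLeft x \<in> U}"
    "openin (spc L1) {x \<in> topspace (spc L1). CRight x \<in> U}"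
    "openin (prod_topology (top_of_set {0..1}) (spc K))
       {z \<in> topspace (prod_topology (top_of_set {0..1}) (spc K)). CMid (fst z) (snd z) \<in> U}"
proof -
  note o = assms[unfolded openin_cyl_sum]
  show "openin (spc L0) {x \<in> topspace (spc L0). CLeft x \<in> U}"
    using openin_Int[OF openin_topspace conjunct1[OF o]] by (simp add: Collect_conj_eq)
  show "openin (spc L1) {x \<in> topspace (spc L1). CRight x \<in> U}"
    using openin_Int[OF openin_topspace conjunct2[OF conjunct2[OF o]]] by (simp add: Collect_conj_eq)
  show "openin (prod_topology (top_of_set {0..1}) (spc K))
       {z \<in> topspace (prod_topology (top_of_set {0..1}) (spc K)). CMid (fst z) (snd z) \<in> U}"
    using openin_Int[OF openin_topspace conjunct1[OF conjunct2[OF o]]]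
    by (simp add: Collect_conj_eq split_def)
qed

lemma sum_cases:
  assumes "p \<in> topspace (cyl_sum K L0 L1)"
  obtains (L) x where "x \<in> topspace (spc L0)" "p = CLeft x"
  | (M) t k where "0 \<le> t" "t \<le> 1" "k \<in> topspace (spc K)" "p = CMid t k"
  | (R) y where "y \<in> topspace (spc L1)" "p = CRight y"
proof (cases p)
  case (CLeft x)
  then show ?thesis using assms L[of x] by (simp add: sum_iff)
next
  case (CMid t k)
  then show ?thesis using assms M[of t k] by (simp add: sum_iff)
next
  case (CRight y)
  then show ?thesis using assms R[of y] by (simp add: sum_iff)
qed

locale dmc =
  fixes K :: "'k pointed" and L0 :: "'a pointed" and L1 :: "'b pointed" and f g
  assumes bK: "bpt K \<in> topspace (spc K)" and pf: "pmap K L0 f" and pg: "pmap K L1 g"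
begin

abbreviation "C \<equiv> Cyl K L0 L1 f g"
abbreviation "S \<equiv> cyl_sum K L0 L1"
abbreviation "cls \<equiv> cyl_class K L0 L1 f g"
text \<open>Coordinates on the cylinder: every point of \<open>C\<close> is a value of
  \<open>iL\<close>, \<open>iM\<close> or \<open>iR\<close>, and maps out of \<open>C\<close> are
  described by their composites with these three.\<close>

definition "iL x = cls (CLeft x)"
definition "iM t k = cls (CMid t k)"
definition "iR y = cls (CRight y)"

lemma bL0: "bpt L0 \<in> topspace (spc L0)" and bL1: "bpt L1 \<in> topspace (spc L1)"
  using pmap_in[OF pf bK] pmap_in[OF pg bK] pf pg by (auto simp: pmap_def)

lemma spc_C: "spc C = quotient_space S (cyl_rel K L0 L1 f g)"
  and bpt_C: "bpt C = iL (bpt L0)"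
  by (simp_all add: Cyl_def iL_def)

lemma topspace_C_quotient: "topspace (spc C) = topspace S // cyl_rel K L0 L1 f g"
proof
  show "topspace (spc C) \<subseteq> topspace S // cyl_rel K L0 L1 f g"
    using openin_topspace[of "spc C"] unfolding spc_C openin_quotient_space[OF equiv_cyl_rel] by blast
  have "openin (spc C) (topspace S // cyl_rel K L0 L1 f g)"
    unfolding spc_C openin_quotient_space[OF equiv_cyl_rel]
    by (simp add: Union_quotient[OF equiv_cyl_rel])
  then show "topspace S // cyl_rel K L0 L1 f g \<subseteq> topspace (spc C)"
    by (rule openin_subset)
qed

lemma quotient_map_cls: "quotient_map S (spc C) cls"
  unfolding quotient_map_def
proof (intro conjI allI impI)
  show im: "cls ` topspace S = topspace (spc C)"
    unfolding topspace_C_quotient by (auto simp: quotient_def cyl_class_def)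
  fix U assume U: "U \<subseteq> topspace (spc C)"
  have "\<Union>U = {x \<in> topspace S. cls x \<in> U}"
  proof safe
    fix x A assume "A \<in> U" "x \<in> A"
    then have A: "A \<in> topspace S // cyl_rel K L0 L1 f g" using U topspace_C_quotient by auto
    then show x: "x \<in> topspace S" using \<open>x \<in> A\<close> in_quotient_imp_subset[OF equiv_cyl_rel] by (meson subsetD)
    have "cls x = A"
      unfolding cyl_class_def
      by (metis A \<open>x \<in> A\<close> Image_singleton_iff equiv_class_eq[OF equiv_cyl_rel] quotientE)
    then show "cls x \<in> U" using \<open>A \<in> U\<close> by simp
  next
    fix x assume "x \<in> topspace S" "cls x \<in> U"
    moreover have "x \<in> cls x"
      using \<open>x \<in> topspace S\<close> equiv_class_self[OF equiv_cyl_rel] by (simp add: cyl_class_def)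
    ultimately show "x \<in> \<Union>U" by blast
  qed
  then show "openin S {x \<in> topspace S. cls x \<in> U} = openin (spc C) U"
    using U topspace_C_quotient by (simp add: spc_C openin_quotient_space[OF equiv_cyl_rel])
qed

lemma cls_eq: "p \<in> topspace S \<Longrightarrow> q \<in> topspace S \<Longrightarrow> cls p = cls q \<longleftrightarrow> equivclp (cyl_glue K L0 L1 f g) p q"
  using eq_equiv_class_iff[OF equiv_cyl_rel, of p K L0 L1 q f g] by (simp add: cyl_class_def cyl_rel_def)

lemma iL_in: "x \<in> topspace (spc L0) \<Longrightarrow> iL x \<in> topspace (spc C)"
  and iR_in: "y \<in> topspace (spc L1) \<Longrightarrow> iR y \<in> topspace (spc C)"
  and iM_in: "t \<in> {0..1} \<Longrightarrow> k \<in> topspace (spc K) \<Longrightarrow> iM t k \<in> topspace (spc C)"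
  unfolding iL_def iR_def iM_def
  by (simp_all add: quotient_imp_surjective_map[OF quotient_map_cls, symmetric] sum_iff)

lemma C_cases:
  assumes "z \<in> topspace (spc C)"
  obtains (L) x where "x \<in> topspace (spc L0)" "z = iL x"
  | (M) t k where "0 \<le> t" "t \<le> 1" "k \<in> topspace (spc K)" "z = iM t k"
  | (R) y where "y \<in> topspace (spc L1)" "z = iR y"
proof -
  obtain p where "p \<in> topspace S" "z = cls p"
    using assms[folded quotient_imp_surjective_map[OF quotient_map_cls]] by (rule imageE)
  then show thesis
  proof (cases p rule: sum_cases)
    case (L x)
    then show ?thesis using that(1)[of x] \<open>z = cls p\<close> by (simp add: iL_def)
  next
    case (M t k)
    then show ?thesis using that(2)[of t k] \<open>z = cls p\<close> by (simp add: iM_def)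
  next
    case (R y)
    then show ?thesis using that(3)[of y] \<open>z = cls p\<close> by (simp add: iR_def)
  qed
qed

lemma iL_bpt: "iL (bpt L0) = bpt C"
  and iR_bpt: "iR (bpt L1) = bpt C"
  and iM_bpt: "t \<in> {0..1} \<Longrightarrow> iM t (bpt K) = bpt C"
  and iM_0: "k \<in> topspace (spc K) \<Longrightarrow> iM 0 k = iL (f k)"
  and iM_1: "k \<in> topspace (spc K) \<Longrightarrow> iM 1 k = iR (g k)"
  unfolding bpt_C iL_def iR_def iM_def
proof -
  have glue: "cls p = cls q" if "cyl_glue K L0 L1 f g p q" "p \<in> topspace S" "q \<in> topspace S" for p q
    using that(1) cls_eq[OF that(2,3)] by (simp add: r_into_equivclp)
  note S = sum_iff
  show "cls (CLeft (bpt L0)) = cls (CLeft (bpt L0))" ..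
  show "cls (CRight (bpt L1)) = cls (CLeft (bpt L0))"
    by (rule glue[OF cyl_glue.wedge, symmetric]) (simp_all add: S bL0 bL1)
  show "t \<in> {0..1} \<Longrightarrow> cls (CMid t (bpt K)) = cls (CLeft (bpt L0))"
    by (rule glue[OF cyl_glue.collapse]) (auto simp: S bL0 bK)
  show "k \<in> topspace (spc K) \<Longrightarrow> cls (CMid 0 k) = cls (CLeft (f k))"
    by (rule glue[OF cyl_glue.left_end]) (auto simp: S intro!: pmap_in[OF pf])
  show "k \<in> topspace (spc K) \<Longrightarrow> cls (CMid 1 k) = cls (CRight (g k))"
    by (rule glue[OF cyl_glue.right_end]) (auto simp: S intro!: pmap_in[OF pg])
qed

lemma bC: "bpt C \<in> topspace (spc C)"
  using iL_in[OF bL0] iL_bpt by simp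

lemma cm_C:
  assumes "continuous_map (spc L0) Y (\<lambda>x. \<phi> (iL x))" "jcont (spc K) Y (\<lambda>t k. \<phi> (iM t k))"
    "continuous_map (spc L1) Y (\<lambda>y. \<phi> (iR y))"
  shows "continuous_map (spc C) Y \<phi>"
proof (rule continuous_compose_quotient_map[OF quotient_map_cls])
  show "continuous_map S Y (\<phi> \<circ> cls)"
    unfolding continuous_map_def
  proof (intro conjI allI impI)
    show "\<phi> \<circ> cls \<in> topspace S \<rightarrow> topspace Y"
    proof
      fix p assume "p \<in> topspace S"
      then show "(\<phi> \<circ> cls) p \<in> topspace Y"
        using continuous_map_image_subset_topspace[OF assms(1)] jcont_in[OF assms(2)]
          continuous_map_image_subset_topspace[OF assms(3)]
        by (cases rule: sum_cases) (auto simp: image_subset_iff iL_def iR_def iM_def)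
    qed
    fix U assume U: "openin Y U"
    let ?W = "{x \<in> topspace S. (\<phi> \<circ> cls) x \<in> U}"
    have 1: "{x. CLeft x \<in> ?W} = {x \<in> topspace (spc L0). \<phi> (iL x) \<in> U}"
      "{x. CRight x \<in> ?W} = {x \<in> topspace (spc L1). \<phi> (iR x) \<in> U}"
      "{(t, k). CMid t k \<in> ?W} = {z \<in> topspace (prod_topology (top_of_set {0..1}) (spc K)). \<phi> (iM (fst z) (snd z)) \<in> U}"
      by (auto simp: iL_def iR_def iM_def sum_iff)
    show "openin S ?W"
      unfolding openin_cyl_sum 1
      by (intro conjI openin_continuous_map_preimage[OF assms(1) U] openin_continuous_map_preimage[OF assms(3) U]
          openin_continuous_map_preimage[OF assms(2)[unfolded jcont_def] U])
  qed
qed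

text \<open>The interval is locally compact and Hausdorff, so the product of \<open>cls\<close> with
  it is still a quotient map. Joint continuity of a homotopy on \<open>C\<close> can therefore be
  tested on the three pieces.\<close>

lemma jcont_C:
  assumes L: "jcont (spc L0) Y (\<lambda>s x. H s (iL x))"
    and M: "continuous_map (prod_topology (top_of_set {0..1}) (prod_topology (top_of_set {0..1}) (spc K))) Y
            (\<lambda>z. H (fst z) (iM (fst (snd z)) (snd (snd z))))"
    and R: "jcont (spc L1) Y (\<lambda>s y. H s (iR y))"
  shows "jcont (spc C) Y H"
proof -
  let ?I = "top_of_set {0..1::real}"
  let ?F = "\<lambda>z. H (fst z) (cls (snd z))"
  have q: "quotient_map (prod_topology ?I S) (prod_topology ?I (spc C)) (\<lambda>(x,y). (x, cls y))"
    by (rule quotient_map_prod_right[OF _ _ quotient_map_cls])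
       (simp_all add: Hausdorff_space_subtopology compact_imp_locally_compact_space compact_space_subtopology)
  have "continuous_map (prod_topology ?I S) Y ?F"
    unfolding continuous_map_def
  proof (intro conjI allI impI)
    show "?F \<in> topspace (prod_topology ?I S) \<rightarrow> topspace Y"
    proof
      fix z assume "z \<in> topspace (prod_topology ?I S)"
      then have z: "fst z \<in> {0..1}" "snd z \<in> topspace S" by auto
      have M': "H s (iM t k) \<in> topspace Y" if "s \<in> {0..1}" "t \<in> {0..1}" "k \<in> topspace (spc K)" for s t k
        using continuous_map_image_subset_topspace[OF M, unfolded image_subset_iff, rule_format, of "(s, t, k)"] that
        by simp
      from z(2) show "?F z \<in> topspace Y"
        using z(1) M' jcont_in[OF L] jcont_in[OF R]
        by (cases rule: sum_cases) (auto simp: iL_def iR_def iM_def)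
    qed
    fix U assume U: "openin Y U"
    let ?W = "{z \<in> topspace (prod_topology ?I S). ?F z \<in> U}"
    have oL: "openin (prod_topology ?I (spc L0)) {z \<in> topspace (prod_topology ?I (spc L0)). H (fst z) (iL (snd z)) \<in> U}"
      using L U unfolding jcont_def by (rule openin_continuous_map_preimage)
    have oR: "openin (prod_topology ?I (spc L1)) {z \<in> topspace (prod_topology ?I (spc L1)). H (fst z) (iR (snd z)) \<in> U}"
      using R U unfolding jcont_def by (rule openin_continuous_map_preimage)
    have oM: "openin (prod_topology ?I (prod_topology ?I (spc K)))
       {z \<in> topspace (prod_topology ?I (prod_topology ?I (spc K))). H (fst z) (iM (fst (snd z)) (snd (snd z))) \<in> U}"
      using M U by (rule openin_continuous_map_preimage)
    \<comment> \<open>Openness is tested with boxes: around each point there is a box lying over a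
      single summand of the disjoint union, where one of the three hypotheses applies.\<close>
    show "openin (prod_topology ?I S) ?W"
      unfolding openin_prod_topology_alt
    proof (intro allI impI)
      fix s p assume sp: "(s, p) \<in> ?W"
      then have "s \<in> {0..1}" "p \<in> topspace S" by auto
      show "\<exists>V V'. openin ?I V \<and> openin S V' \<and> s \<in> V \<and> p \<in> V' \<and> V \<times> V' \<subseteq> ?W"
      proof (cases p)
        case (CLeft x)
        then have "(s, x) \<in> {z \<in> topspace (prod_topology ?I (spc L0)). H (fst z) (iL (snd z)) \<in> U}"
          using sp by (auto simp: iL_def sum_iff)
        then obtain V V' where V: "openin ?I V" "openin (spc L0) V'" "s \<in> V" "x \<in> V'"
          "V \<times> V' \<subseteq> {z \<in> topspace (prod_topology ?I (spc L0)). H (fst z) (iL (snd z)) \<in> U}"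
          using oL[unfolded openin_prod_topology_alt] by meson
        have "openin S (CLeft ` V')"
          unfolding openin_cyl_sum using V(2) by (auto simp: image_iff)
        moreover have "V \<times> CLeft ` V' \<subseteq> ?W"
          using V(5) by (auto simp: iL_def subset_iff sum_iff)
        ultimately show ?thesis using V CLeft by blast
      next
        case (CRight x)
        then have "(s, x) \<in> {z \<in> topspace (prod_topology ?I (spc L1)). H (fst z) (iR (snd z)) \<in> U}"
          using sp by (auto simp: iR_def sum_iff)
        then obtain V V' where V: "openin ?I V" "openin (spc L1) V'" "s \<in> V" "x \<in> V'"
          "V \<times> V' \<subseteq> {z \<in> topspace (prod_topology ?I (spc L1)). H (fst z) (iR (snd z)) \<in> U}"
          using oR[unfolded openin_prod_topology_alt] by meson
        have "openin S (CRight ` V')"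
          unfolding openin_cyl_sum using V(2) by (auto simp: image_iff)
        moreover have "V \<times> CRight ` V' \<subseteq> ?W"
          using V(5) by (auto simp: iR_def subset_iff sum_iff)
        ultimately show ?thesis using V CRight by blast
      next
        case (CMid t k)
        let ?Z = "{z \<in> topspace (prod_topology ?I (prod_topology ?I (spc K))). H (fst z) (iM (fst (snd z)) (snd (snd z))) \<in> U}"
        have "(s, (t, k)) \<in> ?Z"
          using sp CMid by (auto simp: iM_def sum_iff)
        then obtain V V' where V: "openin ?I V" "openin (prod_topology ?I (spc K)) V'" "s \<in> V" "(t, k) \<in> V'"
          "V \<times> V' \<subseteq> ?Z"
          using oM[unfolded openin_prod_topology_alt[of ?I "prod_topology ?I (spc K)"]] by meson
        have "openin S ((\<lambda>(t, k). CMid t k) ` V')"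
        proof -
          have "{(t, k). CMid t k \<in> (\<lambda>(t, k). CMid t k) ` V'} = V'"
            "{x. CLeft x \<in> (\<lambda>(t, k). CMid t k) ` V'} = {}" "{x. CRight x \<in> (\<lambda>(t, k). CMid t k) ` V'} = {}"
            by auto
          then show ?thesis unfolding openin_cyl_sum using V(2) by (metis openin_empty)
        qed
        moreover have "V \<times> (\<lambda>(t, k). CMid t k) ` V' \<subseteq> ?W"
        proof
          fix z :: "real \<times> ('a, 'k, 'b) cyl_pt" assume "z \<in> V \<times> (\<lambda>(t, k). CMid t k) ` V'"
          then obtain s t k where z: "z = (s, CMid t k :: ('a, 'k, 'b) cyl_pt)" "s \<in> V" "(t, k) \<in> V'" by auto
          then have "(s, t, k) \<in> ?Z" using V(5) by blast
          then show "z \<in> ?W" by (auto simp: z(1) iM_def sum_iff)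
        qed
        moreover have "p \<in> (\<lambda>(t, k). CMid t k) ` V'" using V(4) CMid by force
        ultimately show ?thesis using V by blast
      qed
    qed
  qed
  then have "continuous_map (prod_topology ?I S) Y ((\<lambda>z. H (fst z) (snd z)) \<circ> (\<lambda>(x,y). (x, cls y)))"
    by (simp add: o_def split_beta)
  then show ?thesis
    unfolding jcont_def by (rule continuous_compose_quotient_map[OF q])
qed

lemma cm_iL: "continuous_map (spc L0) (spc C) iL"
  and cm_iR: "continuous_map (spc L1) (spc C) iR"
  and jcont_iM: "jcont (spc K) (spc C) iM"
proof -
  have "continuous_map (spc L0) S CLeft" "continuous_map (spc L1) S CRight"
    "continuous_map (prod_topology (top_of_set {0..1}) (spc K)) S (\<lambda>z. CMid (fst z) (snd z))"
    unfolding continuous_map_def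
    by (auto simp: sum_iff intro: cyl_sum_pre cyl_sum_pre(3)[simplified])
  note this[THEN continuous_map_compose, OF quotient_imp_continuous_map[OF quotient_map_cls]]
  then show "continuous_map (spc L0) (spc C) iL" "continuous_map (spc L1) (spc C) iR"
    "jcont (spc K) (spc C) iM"
    by (simp_all add: o_def iL_def[abs_def] iR_def[abs_def] iM_def[abs_def] jcont_def)
qed

lemma pmap_iL: "pmap L0 C iL" and pmap_iR: "pmap L1 C iR"
  by (simp_all add: pmap_def cm_iL cm_iR iL_bpt iR_bpt)

text \<open>The three prescribed maps are evaluated on a chosen representative; the gluing
  conditions of \<open>cmap_eq\<close> make the choice immaterial. The values lie in a bare type
  without topology, so the same construction also yields the normal form \<open>nf\<close>.\<close>

definition cmap :: "('a \<Rightarrow> 'y) \<Rightarrow> (real \<Rightarrow> 'k \<Rightarrow> 'y) \<Rightarrow> ('b \<Rightarrow> 'y) \<Rightarrow> ('a, 'k, 'b) cyl_pt set \<Rightarrow> 'y" where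
  "cmap b e a P = (case SOME p. p \<in> P of CLeft x \<Rightarrow> b x | CMid t k \<Rightarrow> e t k | CRight y \<Rightarrow> a y)"

lemma cmap_eq:
  assumes 0: "\<And>k. k \<in> topspace (spc K) \<Longrightarrow> e 0 k = b (f k)"
    and 1: "\<And>k. k \<in> topspace (spc K) \<Longrightarrow> e 1 k = a (g k)"
    and "b (bpt L0) = y0" "a (bpt L1) = y0" "\<And>t. t \<in> {0..1} \<Longrightarrow> e t (bpt K) = y0"
  shows "x \<in> topspace (spc L0) \<Longrightarrow> cmap b e a (iL x) = b x"
    "t \<in> {0..1} \<Longrightarrow> k \<in> topspace (spc K) \<Longrightarrow> cmap b e a (iM t k) = e t k"
    "y \<in> topspace (spc L1) \<Longrightarrow> cmap b e a (iR y) = a y"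
proof -
  define F where "F p = (case p of CLeft x \<Rightarrow> b x | CMid t k \<Rightarrow> e t k | CRight y \<Rightarrow> a y)" for p
  have g: "F p = F q" if "cyl_glue K L0 L1 f g p q" for p q
    using that assms by cases (auto simp: F_def)
  have "F p = F q" if "equivclp (cyl_glue K L0 L1 f g) p q" for p q
    using that by (induction rule: equivclp_induct) (auto dest: g)
  then have "cmap b e a (cls p) = F p" if "p \<in> topspace S" for p
  proof -
    have "p \<in> cls p"
      using that equiv_class_self[OF equiv_cyl_rel] by (simp add: cyl_class_def)
    then have "(SOME q. q \<in> cls p) \<in> cls p" by (rule someI)
    then have "equivclp (cyl_glue K L0 L1 f g) p (SOME q. q \<in> cls p)"
      by (auto simp: cyl_class_def cyl_rel_def)
    then show ?thesis
      using \<open>\<And>p q. equivclp (cyl_glue K L0 L1 f g) p q \<Longrightarrow> F p = F q\<close>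
      by (metis F_def cmap_def)
  qed
  then show "x \<in> topspace (spc L0) \<Longrightarrow> cmap b e a (iL x) = b x"
    "t \<in> {0..1} \<Longrightarrow> k \<in> topspace (spc K) \<Longrightarrow> cmap b e a (iM t k) = e t k"
    "y \<in> topspace (spc L1) \<Longrightarrow> cmap b e a (iR y) = a y"
    by (auto simp: F_def iL_def iM_def iR_def sum_iff)
qed

lemma cmap_pmap:
  assumes "pmap L0 Y b" "pmap L1 Y a" "jcont (spc K) (spc Y) e"
    and "\<And>k. k \<in> topspace (spc K) \<Longrightarrow> e 0 k = b (f k)"
    and "\<And>k. k \<in> topspace (spc K) \<Longrightarrow> e 1 k = a (g k)"
    and "\<And>t. t \<in> {0..1} \<Longrightarrow> e t (bpt K) = bpt Y"
  shows "pmap C Y (cmap b e a)"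
proof -
  have ce: "x \<in> topspace (spc L0) \<Longrightarrow> cmap b e a (iL x) = b x"
    "t \<in> {0..1} \<Longrightarrow> k \<in> topspace (spc K) \<Longrightarrow> cmap b e a (iM t k) = e t k"
    "y \<in> topspace (spc L1) \<Longrightarrow> cmap b e a (iR y) = a y" for x t k y
    using cmap_eq[of e b a "bpt Y"] assms pmap_bpt[OF assms(1)] pmap_bpt[OF assms(2)] by auto
  have "continuous_map (spc C) (spc Y) (cmap b e a)"
  proof (rule cm_C)
    show "continuous_map (spc L0) (spc Y) (\<lambda>x. cmap b e a (iL x))"
      using assms(1) ce by (auto simp: pmap_def intro: continuous_map_eq)
    show "continuous_map (spc L1) (spc Y) (\<lambda>x. cmap b e a (iR x))"
      using assms(2) ce by (auto simp: pmap_def intro: continuous_map_eq)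
    show "jcont (spc K) (spc Y) (\<lambda>t k. cmap b e a (iM t k))"
      using assms(3) unfolding jcont_def
      by (rule continuous_map_eq) (rule ce(2)[symmetric]; auto)
  qed
  then show ?thesis
    using ce(1)[OF bL0] assms(1) by (simp add: pmap_def iL_bpt)
qed

text \<open>A homotopy on the cylinder is a family of compatible triples: for each time
  \<open>s\<close> the maps \<open>B s\<close>, \<open>E s\<close> and \<open>A s\<close> satisfy
  the gluing conditions and define a map by \<open>cmap\<close>.\<close>

lemma phomotopic_C:
  assumes B: "jcont (spc L0) (spc Y) B" and A: "jcont (spc L1) (spc Y) A"
    and E: "continuous_map (prod_topology (top_of_set {0..1}) (prod_topology (top_of_set {0..1}) (spc K))) (spc Y)
            (\<lambda>z. E (fst z) (fst (snd z)) (snd (snd z)))"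
    and E0: "\<And>s k. s \<in> {0..1} \<Longrightarrow> k \<in> topspace (spc K) \<Longrightarrow> E s 0 k = B s (f k)"
    and E1: "\<And>s k. s \<in> {0..1} \<Longrightarrow> k \<in> topspace (spc K) \<Longrightarrow> E s 1 k = A s (g k)"
    and bp: "\<And>s. s \<in> {0..1} \<Longrightarrow> B s (bpt L0) = bpt Y" "\<And>s. s \<in> {0..1} \<Longrightarrow> A s (bpt L1) = bpt Y"
      "\<And>s t. s \<in> {0..1} \<Longrightarrow> t \<in> {0..1} \<Longrightarrow> E s t (bpt K) = bpt Y"
    and \<phi>: "\<And>x. x \<in> topspace (spc L0) \<Longrightarrow> B 0 x = \<phi> (iL x)"
      "\<And>x. x \<in> topspace (spc L1) \<Longrightarrow> A 0 x = \<phi> (iR x)"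
      "\<And>t k. t \<in> {0..1} \<Longrightarrow> k \<in> topspace (spc K) \<Longrightarrow> E 0 t k = \<phi> (iM t k)"
    and \<psi>: "\<And>x. x \<in> topspace (spc L0) \<Longrightarrow> B 1 x = \<psi> (iL x)"
      "\<And>x. x \<in> topspace (spc L1) \<Longrightarrow> A 1 x = \<psi> (iR x)"
      "\<And>t k. t \<in> {0..1} \<Longrightarrow> k \<in> topspace (spc K) \<Longrightarrow> E 1 t k = \<psi> (iM t k)"
  shows "phomotopic C Y \<phi> \<psi>"
proof (rule phomotopicI[OF bC])
  let ?H = "\<lambda>s. cmap (B s) (E s) (A s)"
  have ce: "x \<in> topspace (spc L0) \<Longrightarrow> ?H s (iL x) = B s x"
    "t \<in> {0..1} \<Longrightarrow> k \<in> topspace (spc K) \<Longrightarrow> ?H s (iM t k) = E s t k"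
    "y \<in> topspace (spc L1) \<Longrightarrow> ?H s (iR y) = A s y" if "s \<in> {0..1}" for s x y k t
    using cmap_eq[of "E s" "B s" "A s" "bpt Y"] that E0 E1 bp by auto
  show "jcont (spc C) (spc Y) ?H"
  proof (rule jcont_C)
    show "jcont (spc L0) (spc Y) (\<lambda>s x. ?H s (iL x))"
      using B unfolding jcont_def by (rule continuous_map_eq) (auto simp: ce)
    show "jcont (spc L1) (spc Y) (\<lambda>s x. ?H s (iR x))"
      using A unfolding jcont_def by (rule continuous_map_eq) (auto simp: ce)
    show "continuous_map (prod_topology (top_of_set {0..1}) (prod_topology (top_of_set {0..1}) (spc K))) (spc Y)
       (\<lambda>z. ?H (fst z) (iM (fst (snd z)) (snd (snd z))))"
      using E by (rule continuous_map_eq) (auto simp: ce)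
  qed
  show "?H 0 z = \<phi> z" if "z \<in> topspace (spc C)" for z
    using that by (cases rule: C_cases) (auto simp: ce \<phi>)
  show "?H 1 z = \<psi> z" if "z \<in> topspace (spc C)" for z
    using that by (cases rule: C_cases) (auto simp: ce \<psi>)
  show "?H t (bpt C) = bpt Y" if "0 \<le> t" "t \<le> 1" for t
    using ce(1)[OF _ bL0, of t] bp that by (simp add: iL_bpt)
qed

end

section \<open>Homotopy invariance of the double mapping cylinder\<close>

definition concat_homotopy :: "(real \<Rightarrow> 'a \<Rightarrow> 'b) \<Rightarrow> (real \<Rightarrow> 'a \<Rightarrow> 'b) \<Rightarrow> real \<Rightarrow> 'a \<Rightarrow> 'b" where
  "concat_homotopy F G t x = (if t \<le> 1/2 then F (2 * t) x else G (2 * t - 1) x)"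

lemma jcont_concat:
  assumes "jcont X Y F" "jcont X Y G" "\<And>x. x \<in> topspace X \<Longrightarrow> F 1 x = G 0 x"
  shows "jcont X Y (concat_homotopy F G)"
  unfolding jcont_def concat_homotopy_def
proof (rule continuous_map_cases_le)
  fix z assume "z \<in> topspace (prod_topology (top_of_set {0..1}) X)" "fst z = (1 / 2 :: real)"
  then have "2 * fst z = 1" "2 * fst z - 1 = 0" "snd z \<in> topspace X" by auto
  then show "F (2 * fst z) (snd z) = G (2 * fst z - 1) (snd z)" by (simp only: assms(3))
qed (auto intro!: jcont_comp[OF assms(1)] jcont_comp[OF assms(2)] cm_real)

lemma jcont_post: "jcont X Y H \<Longrightarrow> continuous_map Y Z h \<Longrightarrow> jcont X Z (\<lambda>t x. h (H t x))"
  unfolding jcont_def by (drule (1) continuous_map_compose) (simp add: o_def)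

lemma jcont_pre: "jcont Y Z H \<Longrightarrow> continuous_map X Y f \<Longrightarrow> jcont X Z (\<lambda>t x. H t (f x))"
  unfolding jcont_def[of X]
  by (erule jcont_comp[where a = fst and b = "\<lambda>z. f (snd z)"])
     (auto intro: cm_real continuous_map_compose[OF cm_proj(2), unfolded o_def])

text \<open>The homotopy itself is named, because the map of cylinders built from it depends on the
  homotopy and not merely on its existence.\<close>

definition is_phomotopy ::
  "'a pointed \<Rightarrow> 'b pointed \<Rightarrow> (real \<Rightarrow> 'a \<Rightarrow> 'b) \<Rightarrow> ('a \<Rightarrow> 'b) \<Rightarrow> ('a \<Rightarrow> 'b) \<Rightarrow> bool" where
  "is_phomotopy X Y H f g \<longleftrightarrow> jcont (spc X) (spc Y) H \<and>
     (\<forall>x \<in> topspace (spc X). H 0 x = f x \<and> H 1 x = g x) \<and> (\<forall>t \<in> {0..1}. H t (bpt X) = bpt Y)"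

lemma phomotopic_iff_is_phomotopy:
  "bpt X \<in> topspace (spc X) \<Longrightarrow> phomotopic X Y f g \<longleftrightarrow> (\<exists>H. is_phomotopy X Y H f g)"
  by (simp add: phomotopic_iff is_phomotopy_def)

context dmc
begin

text \<open>The map of cylinders induced by a map \<open>h\<close> of left ends together with a
  homotopy \<open>H\<close> from \<open>h \<circ> f\<close> to \<open>f'\<close>: the first half of
  a cylinder line traces \<open>H\<close> inside the new left end, the second half runs through the
  new line at double speed.\<close>

definition "cyl_shift L0' f' h H = cmap (\<lambda>x. dmc.iL K L0' L1 f' g (h x))
     (concat_homotopy (\<lambda>t k. dmc.iL K L0' L1 f' g (H t k)) (dmc.iM K L0' L1 f' g))
     (dmc.iR K L0' L1 f' g)"

lemma cyl_shift:
  assumes h: "pmap L0 L0' h" and hH: "is_phomotopy K L0' H (h \<circ> f) f'"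
    and f': "pmap K L0' f'"
  shows "pmap C (Cyl K L0' L1 f' g) (cyl_shift L0' f' h H)"
    "x \<in> topspace (spc L0) \<Longrightarrow> cyl_shift L0' f' h H (iL x) = dmc.iL K L0' L1 f' g (h x)"
    "t \<in> {0..1} \<Longrightarrow> k \<in> topspace (spc K) \<Longrightarrow> cyl_shift L0' f' h H (iM t k) =
      (if t \<le> 1/2 then dmc.iL K L0' L1 f' g (H (2 * t) k) else dmc.iM K L0' L1 f' g (2 * t - 1) k)"
    "y \<in> topspace (spc L1) \<Longrightarrow> cyl_shift L0' f' h H (iR y) = dmc.iR K L0' L1 f' g y"
proof -
  have H: "jcont (spc K) (spc L0') H"
    and H0: "\<And>k. k \<in> topspace (spc K) \<Longrightarrow> H 0 k = h (f k)"
    and H1: "\<And>k. k \<in> topspace (spc K) \<Longrightarrow> H 1 k = f' k"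
    and Hb: "\<And>t. t \<in> {0..1} \<Longrightarrow> H t (bpt K) = bpt L0'"
    using hH by (auto simp: is_phomotopy_def)
  interpret D: dmc K L0' L1 f' g using bK f' pg by unfold_locales
  let ?e = "concat_homotopy (\<lambda>t k. D.iL (H t k)) D.iM"
  have e: "jcont (spc K) (spc D.C) ?e"
    by (intro jcont_concat jcont_post[OF H D.cm_iL] D.jcont_iM) (simp add: H1 D.iM_0)
  have e0: "\<And>k. k \<in> topspace (spc K) \<Longrightarrow> ?e 0 k = D.iL (h (f k))"
    and e1: "\<And>k. k \<in> topspace (spc K) \<Longrightarrow> ?e 1 k = D.iR (g k)"
    and eb: "\<And>t. t \<in> {0..1} \<Longrightarrow> ?e t (bpt K) = bpt D.C"
    by (auto simp: concat_homotopy_def H0 D.iM_1 Hb D.iL_bpt D.iM_bpt)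
  have hb: "D.iL (h (bpt L0)) = bpt D.C" by (simp add: pmap_bpt[OF h] D.iL_bpt)
  show "pmap C D.C (cyl_shift L0' f' h H)"
    unfolding cyl_shift_def using pmap_compose[OF h D.pmap_iL] D.pmap_iR e e0 e1 eb
    by (intro cmap_pmap) (auto simp: o_def)
  have ce: "x \<in> topspace (spc L0) \<Longrightarrow> cyl_shift L0' f' h H (iL x) = D.iL (h x)"
    "t \<in> {0..1} \<Longrightarrow> k \<in> topspace (spc K) \<Longrightarrow> cyl_shift L0' f' h H (iM t k) = ?e t k"
    "y \<in> topspace (spc L1) \<Longrightarrow> cyl_shift L0' f' h H (iR y) = D.iR y" for x t k y
    unfolding cyl_shift_def
    using cmap_eq[of ?e "\<lambda>x. D.iL (h x)" D.iR "bpt D.C"] e0 e1 hb D.iR_bpt eb by auto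
  show "x \<in> topspace (spc L0) \<Longrightarrow> cyl_shift L0' f' h H (iL x) = D.iL (h x)"
    "t \<in> {0..1} \<Longrightarrow> k \<in> topspace (spc K) \<Longrightarrow> cyl_shift L0' f' h H (iM t k) =
      (if t \<le> 1/2 then D.iL (H (2 * t) k) else D.iM (2 * t - 1) k)"
    "y \<in> topspace (spc L1) \<Longrightarrow> cyl_shift L0' f' h H (iR y) = D.iR y"
    by (simp_all add: ce) (simp add: concat_homotopy_def)
qed

end

text \<open>The return homotopy \<open>H'\<close> is chosen to undo the outward one: it runs h' H
  backwards, from h' f' to h' h f, and then follows the homotopy from h' h to the identity, from h'
  h f to f. Along a line the composite then traces a path, the same path reversed, the second
  homotopy, and finally the line itself. The back-and-forth part contracts, and the second homotopy
  is absorbed while the left end moves along \<open>Q\<close>.\<close>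

lemma cyl_shift_left_inverse:
  fixes K :: "'k pointed" and L0 :: "'a pointed" and L0' :: "'c pointed" and L1 :: "'b pointed"
  assumes "dmc K L0 L1 f g"
    and h: "pmap L0 L0' h" and hH: "is_phomotopy K L0' H (h \<circ> f) f'"
    and f': "pmap K L0' f'" and h': "pmap L0' L0 h'" and Q: "phomotopic L0 L0 (h' \<circ> h) (\<lambda>x. x)"
  obtains H' where "is_phomotopy K L0 H' (h' \<circ> f') f"
    "phomotopic (Cyl K L0 L1 f g) (Cyl K L0 L1 f g)
       (dmc.cyl_shift K L1 g L0 f h' H' \<circ> dmc.cyl_shift K L1 g L0' f' h H) (\<lambda>x. x)"
proof -
  have H: "jcont (spc K) (spc L0') H"
    and H0: "\<And>k. k \<in> topspace (spc K) \<Longrightarrow> H 0 k = h (f k)"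
    and H1: "\<And>k. k \<in> topspace (spc K) \<Longrightarrow> H 1 k = f' k"
    and Hb: "\<And>t. t \<in> {0..1} \<Longrightarrow> H t (bpt K) = bpt L0'"
    using hH by (auto simp: is_phomotopy_def)
  interpret A: dmc K L0 L1 f g by fact
  interpret B: dmc K L0' L1 f' g using A.bK f' A.pg by unfold_locales
  obtain Q where Q: "jcont (spc L0) (spc L0) Q" "\<And>x. x \<in> topspace (spc L0) \<Longrightarrow> Q 0 x = h' (h x)"
    "\<And>x. x \<in> topspace (spc L0) \<Longrightarrow> Q 1 x = x" "\<And>t. t \<in> {0..1} \<Longrightarrow> Q t (bpt L0) = bpt L0"
    using phomotopicE[OF Q A.bL0] by auto
  define P where "P t k = h' (H t k)" for t k
  define R where "R t k = Q t (f k)" for t k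
  have P: "jcont (spc K) (spc L0) P" "\<And>k. k \<in> topspace (spc K) \<Longrightarrow> P 0 k = h' (h (f k))"
    "\<And>k. k \<in> topspace (spc K) \<Longrightarrow> P 1 k = h' (f' k)" "\<And>t. t \<in> {0..1} \<Longrightarrow> P t (bpt K) = bpt L0"
    unfolding P_def[abs_def] using H0 H1 Hb by (auto intro: jcont_post[OF H pmap_cm[OF h']] simp: pmap_bpt[OF h'])
  have R: "jcont (spc K) (spc L0) R" "\<And>k. k \<in> topspace (spc K) \<Longrightarrow> R 0 k = h' (h (f k))"
    "\<And>k. k \<in> topspace (spc K) \<Longrightarrow> R 1 k = f k" "\<And>t. t \<in> {0..1} \<Longrightarrow> R t (bpt K) = bpt L0"
    unfolding R_def[abs_def] using Q(2-4) pmap_in[OF A.pf]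
    by (auto intro: jcont_pre[OF Q(1) pmap_cm[OF A.pf]] simp: pmap_bpt[OF A.pf])
  define H' where "H' = concat_homotopy (\<lambda>t. P (1 - t)) R"
  have H': "jcont (spc K) (spc L0) H'" "\<And>k. k \<in> topspace (spc K) \<Longrightarrow> H' 0 k = h' (f' k)"
    "\<And>k. k \<in> topspace (spc K) \<Longrightarrow> H' 1 k = f k" "\<And>t. t \<in> {0..1} \<Longrightarrow> H' t (bpt K) = bpt L0"
    unfolding H'_def by (auto intro!: jcont_concat jcont_rev P(1) R(1) simp: P R) (auto simp: concat_homotopy_def P R)
  have hH': "is_phomotopy K L0 H' (h' \<circ> f') f" using H' by (simp add: is_phomotopy_def)
  note \<phi> = A.cyl_shift[OF h hH f']
  note \<psi> = B.cyl_shift[OF h' hH' A.pf]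
  \<comment> \<open>The slopes -2, 8 and 4 come from the two concatenations: \<open>P\<close> fills
    the times [0, 1/2], the two halves of \<open>H'\<close> fill [1/2, 5/8] and [5/8, 3/4], and the
    line itself fills [3/4, 1]. Writing \<open>u\<close> with \<open>max\<close> and
    \<open>min\<close> makes its continuity immediate. The function \<open>r\<close> interpolates
    linearly between \<open>u\<close> and the undisturbed parameter 2 + t.\<close>
  define u :: "real \<Rightarrow> real" where "u t = max (1 - 2 * t) (min (8 * t - 4) (4 * t - 1))" for t
  define r :: "real \<Rightarrow> real \<Rightarrow> real" where "r s t = (1 - s) * u t + s * (2 + t)" for s t
  text \<open>The path is traced along \<open>W\<close> on \<open>[0, 3]\<close>: a detour \<open>1, 0, 1, 2, 3\<close> is straightened
    while its starting point slides from \<open>1\<close> to \<open>2\<close>.\<close>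
  define W where "W r k = (if r \<le> 2 then (if r \<le> 1 then A.iL (P (1 - r) k) else A.iL (R (r - 1) k)) else A.iM (r - 2) k)" for r k
  have "phomotopic A.C A.C (B.cyl_shift L0 f h' H' \<circ> A.cyl_shift L0' f' h H) (\<lambda>x. x)"
  proof (rule A.phomotopic_C[where B="\<lambda>s x. A.iL (Q s x)" and E="\<lambda>s t k. W (r s t) k" and A="\<lambda>s. A.iR"])
    show "jcont (spc L0) (spc A.C) (\<lambda>s x. A.iL (Q s x))" by (rule jcont_post[OF Q(1) A.cm_iL])
    show "jcont (spc L1) (spc A.C) (\<lambda>s. A.iR)" by (rule jcont_const[OF A.cm_iR])
    have r: "0 \<le> r s t" "r s t \<le> 3" if "s \<in> {0..1}" "t \<in> {0..1}" for s t
    proof -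
      have u: "0 \<le> u t" "u t \<le> 3" using that by (auto simp: u_def max_def min_def)
      show "0 \<le> r s t" using that u by (simp add: r_def)
      have "r s t \<le> (1 - s) * 3 + s * 3" unfolding r_def using that u
        by (intro add_mono mult_left_mono) auto
      then show "r s t \<le> 3" by simp
    qed
    let ?Z = "prod_topology (top_of_set {0..1}) (prod_topology (top_of_set {0..1}) (spc K))"
    have cr: "continuous_map ?Z euclideanreal (\<lambda>z. r (fst z) (fst (snd z)))"
      unfolding r_def u_def by (intro cm_real)
    have iLP: "jcont (spc K) (spc A.C) (\<lambda>t k. A.iL (P t k))" "jcont (spc K) (spc A.C) (\<lambda>t k. A.iL (R t k))"
      by (rule jcont_post[OF _ A.cm_iL]; fact)+
    note cr' = cr[THEN continuous_map_from_subtopology]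
    \<comment> \<open>The three pieces of \<open>W\<close> agree at their joints: at 1 because
      \<open>P\<close> and \<open>R\<close> both start at h' h f, and at 2 because \<open>R\<close>
      ends at f, whose image in the left end is the start of the line.\<close>
    show "continuous_map ?Z (spc A.C) (\<lambda>z. W (r (fst z) (fst (snd z))) (snd (snd z)))"
      unfolding W_def
      apply (rule continuous_map_cases_le[OF cr])
          apply simp
         apply (rule continuous_map_cases_le[OF cr'])
            apply simp
           apply (rule jcont_comp[OF iLP(1)])
             apply (unfold subtopology_subtopology)
             apply (intro cm_real cr')
            apply (intro cm_real)
           apply (auto simp: r)[1]
          apply (rule jcont_comp[OF iLP(2)])
            apply (intro cm_real cr')
           apply (intro cm_real)
          apply (auto simp: r)[1]
         apply (auto simp: P R)[1]
        apply (rule jcont_comp[OF A.jcont_iM])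
          apply (intro cm_real cr')
         apply (intro cm_real)
        apply (use r in force)
       apply (auto simp: R A.iM_0)
      done
    fix s t k assume s: "s \<in> {0..1::real}"
    show "A.iL (Q s (bpt L0)) = bpt A.C" "A.iR (bpt L1) = bpt A.C"
      using s Q by (auto simp: A.iL_bpt A.iR_bpt)
    show "W (r s t) (bpt K) = bpt A.C" if t: "t \<in> {0..1}"
      using r[OF s t] by (auto simp: W_def P R A.iL_bpt A.iM_bpt)
    assume k: "k \<in> topspace (spc K)"
    show "W (r s 0) k = A.iL (Q s (f k))"
      using s by (auto simp: W_def r_def u_def R_def P k Q A.iM_0 pmap_in[OF A.pf])
    show "W (r s 1) k = A.iR (g k)"
      using s by (auto simp: W_def r_def u_def k A.iM_1)
  next
    fix x assume x: "x \<in> topspace (spc L0)"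
    then show "A.iL (Q 0 x) = (B.cyl_shift L0 f h' H' \<circ> A.cyl_shift L0' f' h H) (A.iL x)"
      by (simp add: \<phi> \<psi> Q pmap_in[OF h])
    show "A.iL (Q 1 x) = A.iL x" using x by (simp add: Q)
  next
    fix y assume "y \<in> topspace (spc L1)"
    then show "A.iR y = (B.cyl_shift L0 f h' H' \<circ> A.cyl_shift L0' f' h H) (A.iR y)"
      by (simp add: \<phi> \<psi>)
  next
    fix t k assume t: "t \<in> {0..1::real}" and k: "k \<in> topspace (spc K)"
    show "W (r 1 t) k = A.iM t k"
      using t k by (auto simp: W_def r_def A.iM_0 R)
    consider "t \<le> 1/2" | "1/2 < t" "t \<le> 5/8" | "5/8 < t" "t \<le> 3/4" | "3/4 < t" by linarith
    then show "W (r 0 t) k = (B.cyl_shift L0 f h' H' \<circ> A.cyl_shift L0' f' h H) (A.iM t k)"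
    proof cases
      case 1
      then have "u t = 1 - 2 * t" by (auto simp: u_def)
      then show ?thesis using 1 t k jcont_in[OF H, of "2 * t" k]
        by (simp add: \<phi> \<psi> W_def r_def P_def)
    next
      case 2
      then have "u t = 8 * t - 4" by (auto simp: u_def)
      then show ?thesis using 2 t k
        by (simp add: \<phi> \<psi> W_def r_def) (simp add: H'_def concat_homotopy_def)
    next
      case 3
      then have "u t = 8 * t - 4" by (auto simp: u_def)
      then show ?thesis using 3 t k
        by (simp add: \<phi> \<psi> W_def r_def) (simp add: H'_def concat_homotopy_def)
    next
      case 4
      then have "u t = 4 * t - 1" by (auto simp: u_def)
      then show ?thesis using 4 t k
        by (simp add: \<phi> \<psi> W_def r_def)
    qed
  qed simp
  with hH' show thesis by (rule that)
qed

text \<open>The left inverse of a shift is again a shift, hence it has a left inverse of its own,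
  though along a possibly different homotopy \<open>H''\<close>. The return map thus has inverses on
  both sides and is an equivalence; the original shift, being a right inverse of it, is then an
  equivalence too.\<close>

lemma cyl_shift_equivalence:
  fixes K :: "'k pointed" and L0 :: "'a pointed" and L0' :: "'c pointed" and L1 :: "'b pointed"
  assumes "dmc K L0 L1 f g" and he: "phomotopy_equivalence L0 L0' h" and H: "phomotopic K L0' (h \<circ> f) f'"
  obtains \<phi> where "phomotopy_equivalence (Cyl K L0 L1 f g) (Cyl K L0' L1 f' g) \<phi>"
    "\<And>x. x \<in> topspace (spc L0) \<Longrightarrow> \<phi> (dmc.iL K L0 L1 f g x) = dmc.iL K L0' L1 f' g (h x)"
    "\<And>y. y \<in> topspace (spc L1) \<Longrightarrow> \<phi> (dmc.iR K L0 L1 f g y) = dmc.iR K L0' L1 f' g y"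
proof -
  interpret A: dmc K L0 L1 f g by fact
  have f': "pmap K L0' f'" using phomotopic_imp_pmap(2)[OF H] .
  interpret B: dmc K L0' L1 f' g using A.bK f' A.pg by unfold_locales
  note h = phomotopy_equivalence_pmap[OF he]
  obtain k where k: "phomotopy_equivalence L0' L0 k" "phomotopic L0 L0 (k \<circ> h) (\<lambda>x. x)"
    "phomotopic L0' L0' (h \<circ> k) (\<lambda>y. y)"
    using he by (rule phomotopy_equivalence_inverse)
  note kp = phomotopy_equivalence_pmap[OF k(1)]
  obtain H where H: "is_phomotopy K L0' H (h \<circ> f) f'"
    using phomotopic_iff_is_phomotopy[OF A.bK] H by blast
  obtain H' where H': "is_phomotopy K L0 H' (k \<circ> f') f"
    and inv: "phomotopic A.C A.C (B.cyl_shift L0 f k H' \<circ> A.cyl_shift L0' f' h H) (\<lambda>x. x)"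
    by (rule cyl_shift_left_inverse[OF assms(1) h H f' kp k(2)])
  obtain H'' where H'': "is_phomotopy K L0' H'' (h \<circ> f) f'"
    and inv': "phomotopic B.C B.C (A.cyl_shift L0' f' h H'' \<circ> B.cyl_shift L0 f k H') (\<lambda>x. x)"
    by (rule cyl_shift_left_inverse[OF B.dmc_axioms kp H' A.pf h k(3)])
  note \<phi> = A.cyl_shift[OF h H f']
  note \<psi> = B.cyl_shift(1)[OF kp H' A.pf]
  note \<chi> = A.cyl_shift(1)[OF h H'' f']
  have "phomotopy_equivalence B.C A.C (B.cyl_shift L0 f k H')"
    by (rule phomotopy_equivalenceI[OF \<psi> inv' inv \<chi> \<phi>(1)])
  then obtain \<theta> where \<theta>: "phomotopy_equivalence A.C B.C \<theta>"
    "phomotopic B.C B.C (\<theta> \<circ> B.cyl_shift L0 f k H') (\<lambda>x. x)"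
    "phomotopic A.C A.C (B.cyl_shift L0 f k H' \<circ> \<theta>) (\<lambda>x. x)"
    by (rule phomotopy_equivalence_inverse)
  note \<theta>p = phomotopy_equivalence_pmap[OF \<theta>(1)]
  \<comment> \<open>The return map is cancelled on the left by its inverse \<theta>, which shows
    that the shift along the given \<open>H\<close> is homotopic to \<theta>. This identifies the
    equivalence with a map whose values on both ends are known.\<close>
  have "phomotopic A.C B.C ((\<theta> \<circ> B.cyl_shift L0 f k H') \<circ> A.cyl_shift L0' f' h H) ((\<lambda>x. x) \<circ> A.cyl_shift L0' f' h H)"
    by (rule phomotopic_pre[OF \<theta>(2) \<phi>(1)])
  moreover have "phomotopic A.C B.C (\<theta> \<circ> (B.cyl_shift L0 f k H' \<circ> A.cyl_shift L0' f' h H)) (\<theta> \<circ> (\<lambda>x. x))"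
    by (rule phomotopic_post[OF inv \<theta>p])
  ultimately have "phomotopic A.C B.C \<theta> (A.cyl_shift L0' f' h H)"
    unfolding o_def by (blast intro: phomotopic_sym phomotopic_trans)
  then have "phomotopic B.C B.C (\<theta> \<circ> B.cyl_shift L0 f k H') (A.cyl_shift L0' f' h H \<circ> B.cyl_shift L0 f k H')"
    using \<psi> by (rule phomotopic_pre)
  with \<theta>(2) have "phomotopic B.C B.C (A.cyl_shift L0' f' h H \<circ> B.cyl_shift L0 f k H') (\<lambda>x. x)"
    by (blast intro: phomotopic_sym phomotopic_trans)
  then have "phomotopy_equivalence A.C B.C (A.cyl_shift L0' f' h H)"
    by (rule phomotopy_equivalenceI[OF \<phi>(1) inv _ \<psi> \<psi>])
  then show thesis using \<phi>(2,4) by (rule that)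
qed

section \<open>Symmetry, unit and associativity of double mapping cylinders\<close>

lemma cyl_swap:
  fixes K :: "'k pointed" and L0 :: "'a pointed" and L1 :: "'b pointed"
  assumes "dmc K L0 L1 f g"
  obtains \<phi> where "phomotopy_equivalence (Cyl K L0 L1 f g) (Cyl K L1 L0 g f) \<phi>"
    "\<And>x. x \<in> topspace (spc L0) \<Longrightarrow> \<phi> (dmc.iL K L0 L1 f g x) = dmc.iR K L1 L0 g f x"
    "\<And>y. y \<in> topspace (spc L1) \<Longrightarrow> \<phi> (dmc.iR K L0 L1 f g y) = dmc.iL K L1 L0 g f y"
proof -
  \<comment> \<open>The interval coordinate is reversed. The end types are generalized because the
    same construction is used for the map and, with the ends exchanged, for its inverse.\<close>
  have *: "\<exists>\<phi>. pmap (Cyl K L0 L1 f g) (Cyl K L1 L0 g f) \<phi> \<and>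
      (\<forall>x \<in> topspace (spc L0). \<phi> (dmc.iL K L0 L1 f g x) = dmc.iR K L1 L0 g f x) \<and>
      (\<forall>y \<in> topspace (spc L1). \<phi> (dmc.iR K L0 L1 f g y) = dmc.iL K L1 L0 g f y) \<and>
      (\<forall>t \<in> {0..1}. \<forall>k \<in> topspace (spc K). \<phi> (dmc.iM K L0 L1 f g t k) = dmc.iM K L1 L0 g f (1 - t) k)"
    if "dmc K L0 L1 f g" for L0 :: "'x pointed" and L1 :: "'y pointed" and f g
  proof -
    interpret A: dmc K L0 L1 f g by fact
    interpret B: dmc K L1 L0 g f using A.bK A.pf A.pg by unfold_locales
    let ?e = "\<lambda>t. B.iM (1 - t)"
    let ?\<phi> = "A.cmap B.iR ?e B.iL"
    have "jcont (spc K) (spc B.C) ?e" by (rule jcont_rev[OF B.jcont_iM])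
    then show ?thesis
      using A.cmap_eq[of ?e B.iR B.iL "bpt B.C"] A.cmap_pmap[of B.C B.iR B.iL ?e] B.pmap_iL B.pmap_iR
      by (intro exI[of _ ?\<phi>]) (auto simp: B.iM_0 B.iM_1 B.iM_bpt B.iL_bpt B.iR_bpt)
  qed
  interpret A: dmc K L0 L1 f g by fact
  interpret B: dmc K L1 L0 g f using A.bK A.pf A.pg by unfold_locales
  obtain \<phi> where \<phi>: "pmap A.C B.C \<phi>" "\<And>x. x \<in> topspace (spc L0) \<Longrightarrow> \<phi> (A.iL x) = B.iR x"
    "\<And>y. y \<in> topspace (spc L1) \<Longrightarrow> \<phi> (A.iR y) = B.iL y"
    "\<And>t k. t \<in> {0..1} \<Longrightarrow> k \<in> topspace (spc K) \<Longrightarrow> \<phi> (A.iM t k) = B.iM (1 - t) k"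
    using *[OF A.dmc_axioms] by blast
  obtain \<psi> where \<psi>: "pmap B.C A.C \<psi>" "\<And>x. x \<in> topspace (spc L1) \<Longrightarrow> \<psi> (B.iL x) = A.iR x"
    "\<And>y. y \<in> topspace (spc L0) \<Longrightarrow> \<psi> (B.iR y) = A.iL y"
    "\<And>t k. t \<in> {0..1} \<Longrightarrow> k \<in> topspace (spc K) \<Longrightarrow> \<psi> (B.iM t k) = A.iM (1 - t) k"
    using *[OF B.dmc_axioms] by blast
  have "phomotopy_equivalence A.C B.C \<phi>"
  proof (rule phomotopy_equivalence_mutual_inverse[OF A.bC B.bC \<phi>(1) \<psi>(1)])
    show "\<psi> (\<phi> z) = z" if "z \<in> topspace (spc A.C)" for z
      using that by (cases rule: A.C_cases) (simp_all add: \<phi> \<psi>)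
    show "\<phi> (\<psi> z) = z" if "z \<in> topspace (spc B.C)" for z
      using that by (cases rule: B.C_cases) (simp_all add: \<phi> \<psi>)
  qed
  then show thesis using \<phi>(2,3) by (rule that)
qed

text \<open>When the left map is the identity, the cylinder is the mapping cylinder of
  \<open>g\<close>, and it retracts onto its right end by sliding along the lines.\<close>

lemma cyl_id_left:
  fixes K :: "'k pointed" and L1 :: "'b pointed"
  assumes "dmc K K L1 (\<lambda>x. x) g"
  obtains \<phi> where "phomotopy_equivalence (Cyl K K L1 (\<lambda>x. x) g) L1 \<phi>"
    "\<And>x. x \<in> topspace (spc K) \<Longrightarrow> \<phi> (dmc.iL K K L1 (\<lambda>x. x) g x) = g x"
    "\<And>t x. t \<in> {0..1} \<Longrightarrow> x \<in> topspace (spc K) \<Longrightarrow> \<phi> (dmc.iM K K L1 (\<lambda>x. x) g t x) = g x"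
    "\<And>y. y \<in> topspace (spc L1) \<Longrightarrow> \<phi> (dmc.iR K K L1 (\<lambda>x. x) g y) = y"
proof -
  interpret A: dmc K K L1 "\<lambda>x. x" g by fact
  let ?\<phi> = "A.cmap g (\<lambda>t. g) (\<lambda>y. y)"
  have \<phi>: "x \<in> topspace (spc K) \<Longrightarrow> ?\<phi> (A.iL x) = g x"
    "t \<in> {0..1} \<Longrightarrow> k \<in> topspace (spc K) \<Longrightarrow> ?\<phi> (A.iM t k) = g k"
    "y \<in> topspace (spc L1) \<Longrightarrow> ?\<phi> (A.iR y) = y" for x t k y
    using A.cmap_eq[of "\<lambda>t. g" g "\<lambda>y. y" "bpt L1"] pmap_bpt[OF A.pg] by auto
  have \<phi>p: "pmap A.C L1 ?\<phi>"
    by (intro A.cmap_pmap A.pg pmap_id jcont_const pmap_cm pmap_bpt) auto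
  have 1: "phomotopic L1 L1 (?\<phi> \<circ> A.iR) (\<lambda>y. y)"
    by (rule phomotopic_eq[OF A.bL1 pmap_compose[OF A.pmap_iR \<phi>p]]) (simp add: \<phi>)
  have "phomotopic A.C A.C (A.iR \<circ> ?\<phi>) (\<lambda>y. y)"
  \<comment> \<open>At time \<open>s\<close> the parameter \<open>t\<close> is moved to 1 - s (1 -
    t). For s = 0 everything sits at the right end, for s = 1 nothing has moved, and the left end,
    where t = 0, travels along 1 - s.\<close>
  proof (rule A.phomotopic_C[where B="\<lambda>s x. A.iM (1 - s) x" and A="\<lambda>s. A.iR" and E="\<lambda>s t x. A.iM (1 - s * (1 - t)) x"])
    show "jcont (spc K) (spc A.C) (\<lambda>s. A.iM (1 - s))" by (rule jcont_rev[OF A.jcont_iM])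
    show "jcont (spc L1) (spc A.C) (\<lambda>s. A.iR)" by (rule jcont_const[OF A.cm_iR])
    show "continuous_map (prod_topology (top_of_set {0..1}) (prod_topology (top_of_set {0..1}) (spc K))) (spc A.C)
            (\<lambda>z. A.iM (1 - fst z * (1 - fst (snd z))) (snd (snd z)))"
      by (intro jcont_comp[OF A.jcont_iM] cm_real) (auto intro: mult_le_one)
  next
    fix s t :: real assume "s \<in> {0..1}" "t \<in> {0..1}"
    then show "A.iM (1 - s * (1 - t)) (bpt K) = bpt A.C"
      by (intro A.iM_bpt) (auto intro: mult_le_one)
  qed (auto simp: \<phi> A.iM_bpt A.iR_bpt A.iM_0 A.iM_1)
  then have "phomotopy_equivalence A.C L1 ?\<phi>"
    using 1 by (rule phomotopy_equivalenceI[OF \<phi>p _ _ A.pmap_iR A.pmap_iR])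
  then show thesis using \<phi> by (rule that)
qed

text \<open>Both iterated cylinders are the same quotient of \<open>L\<^sub>0\<close>, \<open>I \<times> K\<close>, \<open>L\<^sub>1\<close>, \<open>I \<times> K'\<close> and \<open>L\<^sub>2\<close>.\<close>

lemma cyl_assoc:
  fixes K :: "'k pointed" and K' :: "'l pointed"
    and L0 :: "'a pointed" and L1 :: "'b pointed" and L2 :: "'c pointed"
  assumes "dmc K L0 L1 f g" "dmc K' L1 L2 f' g'"
  defines "Z \<equiv> Cyl K' (Cyl K L0 L1 f g) L2 (dmc.iR K L0 L1 f g \<circ> f') g'"
    and "Z' \<equiv> Cyl K L0 (Cyl K' L1 L2 f' g') f (dmc.iL K' L1 L2 f' g' \<circ> g)"
  obtains \<phi> where "phomotopy_equivalence Z Z' \<phi>"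
    "\<And>x. x \<in> topspace (spc L0) \<Longrightarrow>
      \<phi> (dmc.iL K' (Cyl K L0 L1 f g) L2 (dmc.iR K L0 L1 f g \<circ> f') g' (dmc.iL K L0 L1 f g x))
      = dmc.iL K L0 (Cyl K' L1 L2 f' g') f (dmc.iL K' L1 L2 f' g' \<circ> g) x"
    "\<And>y. y \<in> topspace (spc L2) \<Longrightarrow>
      \<phi> (dmc.iR K' (Cyl K L0 L1 f g) L2 (dmc.iR K L0 L1 f g \<circ> f') g' y)
      = dmc.iR K L0 (Cyl K' L1 L2 f' g') f (dmc.iL K' L1 L2 f' g' \<circ> g) (dmc.iR K' L1 L2 f' g' y)"
proof -
  interpret A: dmc K L0 L1 f g by fact
  interpret B: dmc K' L1 L2 f' g' by fact
  interpret AC: dmc K' A.C L2 "A.iR \<circ> f'" g'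
    using B.bK B.pg pmap_compose[OF B.pf A.pmap_iR] by unfold_locales
  interpret BC: dmc K L0 B.C f "B.iL \<circ> g"
    using A.bK A.pf pmap_compose[OF A.pg B.pmap_iL] by unfold_locales
  let ?a = "\<lambda>y. BC.iR (B.iL y)"
  have a: "pmap L1 BC.C ?a" using pmap_compose[OF B.pmap_iL BC.pmap_iR] by (simp add: o_def)
  \<comment> \<open>In the target the space \<open>L1\<close> sits inside \<open>B.C\<close>, which
    is the right end of \<open>BC.C\<close>. So \<alpha> maps the inner cylinder \<open>A.C\<close>
    with its right end going through \<open>B.iL\<close>; \<beta> plays the mirrored part for the
    inverse.\<close>
  define \<alpha> where "\<alpha> = A.cmap BC.iL BC.iM ?a"
  have \<alpha>p: "pmap A.C BC.C \<alpha>"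
    unfolding \<alpha>_def by (rule A.cmap_pmap[OF BC.pmap_iL a BC.jcont_iM]) (auto simp: BC.iM_0 BC.iM_1 BC.iM_bpt)
  have \<alpha>: "x \<in> topspace (spc L0) \<Longrightarrow> \<alpha> (A.iL x) = BC.iL x"
    "t \<in> {0..1} \<Longrightarrow> k \<in> topspace (spc K) \<Longrightarrow> \<alpha> (A.iM t k) = BC.iM t k"
    "y \<in> topspace (spc L1) \<Longrightarrow> \<alpha> (A.iR y) = BC.iR (B.iL y)" for x t k y
    unfolding \<alpha>_def using A.cmap_eq[of BC.iM BC.iL ?a "bpt BC.C"]
    by (auto simp: BC.iM_0 BC.iM_1 BC.iM_bpt BC.iL_bpt BC.iR_bpt B.iL_bpt)
  let ?e = "\<lambda>t k. BC.iR (B.iM t k)"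
  have e: "jcont (spc K') (spc BC.C) ?e" by (rule jcont_post[OF B.jcont_iM BC.cm_iR])
  let ?b = "\<lambda>y. BC.iR (B.iR y)"
  have b: "pmap L2 BC.C ?b" using pmap_compose[OF B.pmap_iR BC.pmap_iR] by (simp add: o_def)
  define \<phi> where "\<phi> = AC.cmap \<alpha> ?e ?b"
  have \<phi>p: "pmap AC.C BC.C \<phi>"
    unfolding \<phi>_def by (rule AC.cmap_pmap[OF \<alpha>p b e]) 
      (auto simp: \<alpha> B.iM_0 B.iM_1 B.iM_bpt BC.iR_bpt pmap_in[OF B.pf])
  have \<phi>: "x \<in> topspace (spc A.C) \<Longrightarrow> \<phi> (AC.iL x) = \<alpha> x"
    "t \<in> {0..1} \<Longrightarrow> k \<in> topspace (spc K') \<Longrightarrow> \<phi> (AC.iM t k) = BC.iR (B.iM t k)"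
    "y \<in> topspace (spc L2) \<Longrightarrow> \<phi> (AC.iR y) = BC.iR (B.iR y)" for x t k y
    unfolding \<phi>_def using AC.cmap_eq[of ?e \<alpha> ?b "bpt BC.C"]
    by (auto simp: \<alpha> B.iM_0 B.iM_1 B.iM_bpt BC.iR_bpt B.iR_bpt pmap_in[OF B.pf] pmap_bpt[OF \<alpha>p])
  let ?c = "\<lambda>y. AC.iL (A.iR y)"
  have c: "pmap L1 AC.C ?c" using pmap_compose[OF A.pmap_iR AC.pmap_iL] by (simp add: o_def)
  define \<beta> where "\<beta> = B.cmap ?c AC.iM AC.iR"
  have \<beta>p: "pmap B.C AC.C \<beta>"
    unfolding \<beta>_def by (rule B.cmap_pmap[OF c AC.pmap_iR AC.jcont_iM]) (auto simp: AC.iM_0 AC.iM_1 AC.iM_bpt)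
  have \<beta>: "x \<in> topspace (spc L1) \<Longrightarrow> \<beta> (B.iL x) = AC.iL (A.iR x)"
    "t \<in> {0..1} \<Longrightarrow> k \<in> topspace (spc K') \<Longrightarrow> \<beta> (B.iM t k) = AC.iM t k"
    "y \<in> topspace (spc L2) \<Longrightarrow> \<beta> (B.iR y) = AC.iR y" for x t k y
    unfolding \<beta>_def using B.cmap_eq[of AC.iM ?c AC.iR "bpt AC.C"]
    by (auto simp: AC.iM_0 AC.iM_1 AC.iM_bpt AC.iL_bpt AC.iR_bpt A.iR_bpt)
  let ?e' = "\<lambda>t k. AC.iL (A.iM t k)"
  have e': "jcont (spc K) (spc AC.C) ?e'" by (rule jcont_post[OF A.jcont_iM AC.cm_iL])
  let ?d = "\<lambda>y. AC.iL (A.iL y)"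
  have d: "pmap L0 AC.C ?d" using pmap_compose[OF A.pmap_iL AC.pmap_iL] by (simp add: o_def)
  define \<psi> where "\<psi> = BC.cmap ?d ?e' \<beta>"
  have \<psi>p: "pmap BC.C AC.C \<psi>"
    unfolding \<psi>_def by (rule BC.cmap_pmap[OF d \<beta>p e']) 
      (auto simp: \<beta> A.iM_0 A.iM_1 A.iM_bpt AC.iL_bpt pmap_in[OF A.pg])
  have \<psi>: "x \<in> topspace (spc L0) \<Longrightarrow> \<psi> (BC.iL x) = AC.iL (A.iL x)"
    "t \<in> {0..1} \<Longrightarrow> k \<in> topspace (spc K) \<Longrightarrow> \<psi> (BC.iM t k) = AC.iL (A.iM t k)"
    "y \<in> topspace (spc B.C) \<Longrightarrow> \<psi> (BC.iR y) = \<beta> y" for x t k y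
    unfolding \<psi>_def using BC.cmap_eq[of ?e' ?d \<beta> "bpt AC.C"]
    by (auto simp: \<beta> A.iM_0 A.iM_1 A.iM_bpt AC.iL_bpt A.iL_bpt pmap_in[OF A.pg] pmap_bpt[OF \<beta>p])
  have "phomotopy_equivalence AC.C BC.C \<phi>"
  proof (rule phomotopy_equivalence_mutual_inverse[OF AC.bC BC.bC \<phi>p \<psi>p])
    have 1: "\<psi> (\<alpha> w) = AC.iL w" if "w \<in> topspace (spc A.C)" for w
      using that by (cases rule: A.C_cases) (simp_all add: \<alpha> \<beta> \<psi> B.iL_in)
    show "\<psi> (\<phi> z) = z" if "z \<in> topspace (spc AC.C)" for z
      using that by (cases rule: AC.C_cases) (simp_all add: 1 \<phi> \<psi> \<beta> B.iM_in B.iR_in)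
    have 2: "\<phi> (\<beta> w) = BC.iR w" if "w \<in> topspace (spc B.C)" for w
      using that by (cases rule: B.C_cases) (simp_all add: \<alpha> \<beta> \<phi> A.iR_in)
    show "\<phi> (\<psi> z) = z" if "z \<in> topspace (spc BC.C)" for z
      using that by (cases rule: BC.C_cases) (simp_all add: 2 \<phi> \<psi> \<alpha> A.iM_in A.iL_in)
  qed
  then show thesis
    using that[of \<phi>] \<alpha> \<phi> A.iL_in unfolding Z_def Z'_def by simp
qed

section \<open>Points, compactness and separation of the double mapping cylinder\<close>

lemma openin_cyl_sum_pieces:
  "openin (spc L0) U \<Longrightarrow> openin (cyl_sum K L0 L1) (CLeft ` U)"
  "openin (spc L1) V \<Longrightarrow> openin (cyl_sum K L0 L1) (CRight ` V)"
  "openin (prod_topology (top_of_set {0..1}) (spc K)) W \<Longrightarrow>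
    openin (cyl_sum K L0 L1) ((\<lambda>z. CMid (fst z) (snd z)) ` W)"
proof -
  have 1: "{x. CLeft x \<in> CLeft ` U} = U" "{(t, k). CMid t k \<in> CLeft ` U} = {}" "{x. CRight x \<in> CLeft ` U} = {}"
    for U by auto
  have 2: "{x. CRight x \<in> CRight ` U} = U" "{(t, k). CMid t k \<in> CRight ` U} = {}" "{x. CLeft x \<in> CRight ` U} = {}"
    for U by auto
  have 3: "{(t, k). CMid t k \<in> (\<lambda>z. CMid (fst z) (snd z)) ` W} = W"
    "{x. CLeft x \<in> (\<lambda>z. CMid (fst z) (snd z)) ` W} = {}" "{x. CRight x \<in> (\<lambda>z. CMid (fst z) (snd z)) ` W} = {}"
    for W by force+
  show "openin (spc L0) U \<Longrightarrow> openin (cyl_sum K L0 L1) (CLeft ` U)"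
    "openin (spc L1) V \<Longrightarrow> openin (cyl_sum K L0 L1) (CRight ` V)"
    "openin (prod_topology (top_of_set {0..1}) (spc K)) W \<Longrightarrow>
      openin (cyl_sum K L0 L1) ((\<lambda>z. CMid (fst z) (snd z)) ` W)"
    unfolding openin_cyl_sum 1 2 3 by (intro conjI openin_empty; assumption)+
qed

lemma continuous_cyl_sum_pieces:
  "continuous_map (spc L0) (cyl_sum K L0 L1) CLeft"
  "continuous_map (spc L1) (cyl_sum K L0 L1) CRight"
  "continuous_map (prod_topology (top_of_set {0..1}) (spc K)) (cyl_sum K L0 L1) (\<lambda>z. CMid (fst z) (snd z))"
  unfolding continuous_map_def
  by (auto simp: sum_iff intro: cyl_sum_pre cyl_sum_pre(3)[simplified])

lemma closedin_cyl_sumI: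
  assumes W: "W \<subseteq> topspace (cyl_sum K L0 L1)"
    and "closedin (spc L0) {x \<in> topspace (spc L0). CLeft x \<in> W}"
    and "closedin (spc L1) {x \<in> topspace (spc L1). CRight x \<in> W}"
    and "closedin (prod_topology (top_of_set {0..1}) (spc K))
       {z \<in> topspace (prod_topology (top_of_set {0..1}) (spc K)). CMid (fst z) (snd z) \<in> W}"
  shows "closedin (cyl_sum K L0 L1) W"
proof -
  let ?T = "topspace (cyl_sum K L0 L1)"
  have "{x. CLeft x \<in> ?T - W} = topspace (spc L0) - {x \<in> topspace (spc L0). CLeft x \<in> W}"
    "{x. CRight x \<in> ?T - W} = topspace (spc L1) - {x \<in> topspace (spc L1). CRight x \<in> W}"
    "{(t, k). CMid t k \<in> ?T - W} = topspace (prod_topology (top_of_set {0..1}) (spc K)) -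
       {z \<in> topspace (prod_topology (top_of_set {0..1}) (spc K)). CMid (fst z) (snd z) \<in> W}"
    by (auto simp: sum_iff)
  then have "openin (cyl_sum K L0 L1) (?T - W)"
    unfolding openin_cyl_sum using assms by (simp only:) (intro conjI openin_diff openin_topspace)
  then show ?thesis using W by (simp add: closedin_def)
qed

lemma Hausdorff_cyl_sum:
  assumes "Hausdorff_space (spc K)" "Hausdorff_space (spc L0)" "Hausdorff_space (spc L1)"
  shows "Hausdorff_space (cyl_sum K L0 L1)"
  unfolding Hausdorff_space_def
proof (intro allI impI, elim conjE)
  let ?S = "cyl_sum K L0 L1"
  let ?IK = "prod_topology (top_of_set {0..1::real}) (spc K)"
  have IK: "Hausdorff_space ?IK"
    using assms(1) by (simp add: Hausdorff_space_prod_topology Hausdorff_space_subtopology)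
  have sep: "\<exists>U V. openin ?S U \<and> openin ?S V \<and> p \<in> U \<and> q \<in> V \<and> disjnt U V"
    if "Hausdorff_space X" "\<And>U. openin X U \<Longrightarrow> openin ?S (j ` U)" "inj j" "p = j a" "q = j b" "p \<noteq> q"
      "a \<in> topspace X" "b \<in> topspace X" for X :: "'x topology" and j p q a b
  proof -
    from that obtain U V where UV: "openin X U" "openin X V" "a \<in> U" "b \<in> V" "disjnt U V"
      unfolding Hausdorff_space_def by metis
    have "disjnt (j ` U) (j ` V)" using UV(5) \<open>inj j\<close> by (auto simp: disjnt_iff inj_eq)
    then show ?thesis using UV that by blast
  qed
  let ?L = "CLeft ` topspace (spc L0)" and ?R = "CRight ` topspace (spc L1)"
    and ?M = "(\<lambda>z. CMid (fst z) (snd z)) ` topspace ?IK"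
  have o: "openin ?S ?L" "openin ?S ?R" "openin ?S ?M"
    by (intro openin_cyl_sum_pieces openin_topspace)+
  have d: "disjnt ?L ?M" "disjnt ?L ?R" "disjnt ?M ?R" "disjnt ?M ?L" "disjnt ?R ?L" "disjnt ?R ?M"
    by (auto simp: disjnt_iff)
  have inj: "inj CLeft" "inj CRight" "inj (\<lambda>z. CMid (fst z) (snd z))"
    by (auto simp: inj_def prod_eq_iff)
  have M: "CMid t k \<in> ?M" if "(t, k) \<in> topspace ?IK" for t k
    using imageI[OF that, of "\<lambda>z. CMid (fst z) (snd z)"] by simp
  fix p q assume p: "p \<in> topspace ?S" and q: "q \<in> topspace ?S" and "p \<noteq> q"
  show "\<exists>U V. openin ?S U \<and> openin ?S V \<and> p \<in> U \<and> q \<in> V \<and> disjnt U V"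
  proof (cases p)
    case p': (CLeft x)
    show ?thesis
    proof (cases q)
      case (CLeft y)
      then show ?thesis using p q p' \<open>p \<noteq> q\<close>
        by (intro sep[OF assms(2) openin_cyl_sum_pieces(1) inj(1), where a = x and b = y]) (auto simp: sum_iff)
    next
      case (CMid t k)
      then have "p \<in> ?L" "q \<in> ?M" using p q p' M by (auto simp: sum_iff)
      then show ?thesis using o d by blast
    next
      case (CRight y)
      then have "p \<in> ?L" "q \<in> ?R" using p q p' by (auto simp: sum_iff)
      then show ?thesis using o d by blast
    qed
  next
    case p': (CRight x)
    show ?thesis
    proof (cases q)
      case (CRight y)
      then show ?thesis using p q p' \<open>p \<noteq> q\<close>
        by (intro sep[OF assms(3) openin_cyl_sum_pieces(2) inj(2), where a = x and b = y]) (auto simp: sum_iff)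
    next
      case (CMid t k)
      then have "p \<in> ?R" "q \<in> ?M" using p q p' M by (auto simp: sum_iff)
      then show ?thesis using o d by blast
    next
      case (CLeft y)
      then have "p \<in> ?R" "q \<in> ?L" using p q p' by (auto simp: sum_iff)
      then show ?thesis using o d by blast
    qed
  next
    case p': (CMid s k)
    then have pM: "p \<in> ?M" using p M by (auto simp: sum_iff)
    show ?thesis
    proof (cases q)
      case (CMid t l)
      then show ?thesis using p q p' \<open>p \<noteq> q\<close>
        by (intro sep[OF IK openin_cyl_sum_pieces(3) inj(3), where a = "(s, k)" and b = "(t, l)"]) (auto simp: sum_iff)
    next
      case (CRight y)
      then have "q \<in> ?R" using q by (auto simp: sum_iff)
      then show ?thesis using o d pM by blast
    next
      case (CLeft y)
      then have "q \<in> ?L" using q by (auto simp: sum_iff)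
      then show ?thesis using o d pM by blast
    qed
  qed
qed

lemma compact_cyl_sum:
  assumes "compact_space (spc K)" "compact_space (spc L0)" "compact_space (spc L1)"
  shows "compact_space (cyl_sum K L0 L1)"
proof -
  let ?IK = "prod_topology (top_of_set {0..1::real}) (spc K)"
  have "compact_space ?IK"
    using assms(1) by (simp add: compact_space_prod_topology compact_space_subtopology)
  then have "compactin (cyl_sum K L0 L1) (CLeft ` topspace (spc L0) \<union>
      (\<lambda>z. CMid (fst z) (snd z)) ` topspace ?IK \<union> CRight ` topspace (spc L1))"
    using assms unfolding compact_space_def
    by (intro compactin_Un image_compactin[OF _ continuous_cyl_sum_pieces(1)]
        image_compactin[OF _ continuous_cyl_sum_pieces(2)] image_compactin[OF _ continuous_cyl_sum_pieces(3)])
  moreover have "topspace (cyl_sum K L0 L1) = CLeft ` topspace (spc L0) \<union>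
      (\<lambda>z. CMid (fst z) (snd z)) ` topspace ?IK \<union> CRight ` topspace (spc L1)"
    unfolding topspace_cyl_sum by (simp add: case_prod_unfold)
  ultimately show ?thesis by (simp add: compact_space_def)
qed

context dmc
begin

text \<open>A normal form for the points of \<open>C\<close>: a representative in the left end is
  preferred, then one in the right end, and only interior points off the base line remain in the
  middle. It is built by \<open>cmap\<close>, hence constant on classes, so that points of the
  quotient can be told apart by their normal forms.\<close>

definition nf :: "('a, 'k, 'b) cyl_pt set \<Rightarrow> ('a, 'k, 'b) cyl_pt" where
  "nf = (let R = \<lambda>y. if y = bpt L1 then CLeft (bpt L0) else CRight y in
     cmap CLeft (\<lambda>t k. if k = bpt K then CLeft (bpt L0) else if t = 0 then CLeft (f k)
       else if t = 1 then R (g k) else CMid t k) R)"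

lemma nf:
  "x \<in> topspace (spc L0) \<Longrightarrow> nf (iL x) = CLeft x"
  "y \<in> topspace (spc L1) \<Longrightarrow> nf (iR y) = (if y = bpt L1 then CLeft (bpt L0) else CRight y)"
  "k \<in> topspace (spc K) \<Longrightarrow> 0 < t \<Longrightarrow> t < 1 \<Longrightarrow> k \<noteq> bpt K \<Longrightarrow> nf (iM t k) = CMid t k"
proof -
  let ?R = "\<lambda>y. if y = bpt L1 then CLeft (bpt L0) else CRight y"
  let ?e = "\<lambda>t k. if k = bpt K then CLeft (bpt L0) else if t = 0 then CLeft (f k)
       else if t = 1 then ?R (g k) else CMid t k"
  have ce: "x \<in> topspace (spc L0) \<Longrightarrow> nf (iL x) = CLeft x"
    "t \<in> {0..1} \<Longrightarrow> k \<in> topspace (spc K) \<Longrightarrow> nf (iM t k) = ?e t k"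
    "y \<in> topspace (spc L1) \<Longrightarrow> nf (iR y) = ?R y" for x t k y
    unfolding nf_def Let_def
    using cmap_eq[of ?e CLeft ?R "CLeft (bpt L0)"] pmap_bpt[OF pf] pmap_bpt[OF pg] by auto
  show "x \<in> topspace (spc L0) \<Longrightarrow> nf (iL x) = CLeft x"
    "y \<in> topspace (spc L1) \<Longrightarrow> nf (iR y) = ?R y" by (fact ce)+
  show "k \<in> topspace (spc K) \<Longrightarrow> 0 < t \<Longrightarrow> t < 1 \<Longrightarrow> k \<noteq> bpt K \<Longrightarrow> nf (iM t k) = CMid t k"
    by (simp add: ce)
qed

lemma iL_eq: "x \<in> topspace (spc L0) \<Longrightarrow> x' \<in> topspace (spc L0) \<Longrightarrow> iL x = iL x' \<longleftrightarrow> x = x'"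
  by (metis nf(1) cyl_pt.inject(1))

lemma iL_iR_eq:
  "x \<in> topspace (spc L0) \<Longrightarrow> y \<in> topspace (spc L1) \<Longrightarrow> iL x = iR y \<longleftrightarrow> x = bpt L0 \<and> y = bpt L1"
  by (metis nf(1,2) cyl_pt.inject(1) cyl_pt.distinct(3) iL_bpt iR_bpt)

lemma iR_eq: "y \<in> topspace (spc L1) \<Longrightarrow> y' \<in> topspace (spc L1) \<Longrightarrow> iR y = iR y' \<longleftrightarrow> y = y'"
  by (metis nf(2) cyl_pt.inject(3) cyl_pt.distinct(3))

lemma iM_interior:
  assumes "k \<in> topspace (spc K)" "0 < t" "t < 1" "k \<noteq> bpt K"
  shows "x \<in> topspace (spc L0) \<Longrightarrow> iM t k \<noteq> iL x"
    "y \<in> topspace (spc L1) \<Longrightarrow> iM t k \<noteq> iR y"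
    "k' \<in> topspace (spc K) \<Longrightarrow> 0 \<le> t' \<Longrightarrow> t' \<le> 1 \<Longrightarrow> iM t k = iM t' k' \<longleftrightarrow> t = t' \<and> k = k'"
proof -
  show L: "iM t k \<noteq> iL x" if "x \<in> topspace (spc L0)" for x
    using nf(3)[OF assms] nf(1)[OF that] by (metis cyl_pt.distinct(1))
  show R: "iM t k \<noteq> iR y" if "y \<in> topspace (spc L1)" for y
    using nf(3)[OF assms] nf(2)[OF that] by (metis cyl_pt.distinct(1,5))
  show "iM t k = iM t' k' \<longleftrightarrow> t = t' \<and> k = k'" if "k' \<in> topspace (spc K)" "0 \<le> t'" "t' \<le> 1"
  proof
    assume eq: "iM t k = iM t' k'"
    have "k' \<noteq> bpt K"
    proof
      assume "k' = bpt K"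
      then have "iM t k = iL (bpt L0)" using eq iM_bpt[of t'] that by (simp add: iL_bpt)
      then show False using L[OF bL0] by simp
    qed
    moreover have "t' \<noteq> 0"
    proof
      assume "t' = 0"
      then have "iM t k = iL (f k')" using eq iM_0[OF that(1)] by simp
      then show False using L[OF pmap_in[OF pf that(1)]] by simp
    qed
    moreover have "t' \<noteq> 1"
    proof
      assume "t' = 1"
      then have "iM t k = iR (g k')" using eq iM_1[OF that(1)] by simp
      then show False using R[OF pmap_in[OF pg that(1)]] by simp
    qed
    ultimately have "0 < t'" "t' < 1" "k' \<noteq> bpt K" using that(2,3) by simp_all
    then have "nf (iM t' k') = CMid t' k'" by (intro nf(3) that(1))
    then have "CMid t k = (CMid t' k' :: ('a, 'k, 'b) cyl_pt)"
      using nf(3)[OF assms] by (simp only: eq)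
    then show "t = t' \<and> k = k'" by simp
  qed auto
qed

text \<open>The preimage under \<open>cls\<close> of the image of a closed set is computed on each
  of the three pieces. The end slices of its middle part have closed images under \<open>f\<close>
  and \<open>g\<close>, because \<open>K\<close> is compact and the two ends are Hausdorff; every
  piece is then a finite union of closed sets.\<close>

lemma closed_map_cls:
  assumes "compact_space (spc K)" "Hausdorff_space (spc K)" "Hausdorff_space (spc L0)" "Hausdorff_space (spc L1)"
  shows "closed_map S (spc C) cls"
  unfolding closed_map_def
proof (intro allI impI)
  let ?IK = "prod_topology (top_of_set {0..1::real}) (spc K)"
  fix D assume D: "closedin S D"
  define A where "A = {x \<in> topspace (spc L0). CLeft x \<in> D}"
  define M where "M = {z \<in> topspace ?IK. CMid (fst z) (snd z) \<in> D}"
  define B where "B = {x \<in> topspace (spc L1). CRight x \<in> D}"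
  have cl: "closedin (spc L0) A" "closedin ?IK M" "closedin (spc L1) B"
    unfolding A_def M_def B_def
    by (rule closedin_continuous_map_preimage[OF _ D] continuous_cyl_sum_pieces)+
  \<comment> \<open>\<open>z\<close> says that the class of the base point is met. In that case the
    preimage gains the base points of both ends and the entire line over \<open>bpt K\<close>, so
    this class is treated apart from the others.\<close>
  define z where "z \<longleftrightarrow> bpt C \<in> cls ` D"
  define SL where "SL = {x \<in> topspace (spc L0). iL x \<in> cls ` D}"
  define SR where "SR = {x \<in> topspace (spc L1). iR x \<in> cls ` D}"
  define SM where "SM = {w \<in> topspace ?IK. iM (fst w) (snd w) \<in> cls ` D}"
  have clsD: "w \<in> cls ` D \<longleftrightarrow> (\<exists>x \<in> A. w = iL x) \<or> (\<exists>v \<in> M. w = iM (fst v) (snd v)) \<or> (\<exists>y \<in> B. w = iR y)" for w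
  proof
    assume "w \<in> cls ` D"
    then obtain p where p: "p \<in> D" "w = cls p" by blast
    then have "p \<in> topspace S" using closedin_subset[OF D] by blast
    then show "(\<exists>x \<in> A. w = iL x) \<or> (\<exists>v \<in> M. w = iM (fst v) (snd v)) \<or> (\<exists>y \<in> B. w = iR y)"
    proof (cases rule: sum_cases)
      case (M t k)
      then have "(t, k) \<in> M" using p by (simp add: M_def)
      then show ?thesis using M p by (force simp: iM_def)
    qed (use p in \<open>auto simp: A_def B_def iL_def iR_def\<close>)
  qed (auto simp: A_def B_def M_def iL_def iR_def iM_def)
  have cc: "closedin (spc L0) {bpt L0}" "closedin (spc L1) {bpt L1}"
    using assms bL0 bL1 by (auto intro: closedin_Hausdorff_singleton)
  define M0 where "M0 = {k \<in> topspace (spc K). (0, k) \<in> M}"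
  define M1 where "M1 = {k \<in> topspace (spc K). (1, k) \<in> M}"
  have "closedin (spc K) M0" "closedin (spc K) M1"
    unfolding M0_def M1_def
    by (rule closedin_continuous_map_preimage[OF _ cl(2)]; auto simp: continuous_map_paired)+
  then have im: "closedin (spc L0) (f ` M0)" "closedin (spc L1) (g ` M1)"
    using continuous_imp_closed_map[OF pmap_cm[OF pf]] continuous_imp_closed_map[OF pmap_cm[OF pg]]
      assms unfolding closed_map_def by blast+
  have SL_eq: "SL = A \<union> f ` M0 \<union> (if z then {bpt L0} else {})"
  proof
    show "A \<union> f ` M0 \<union> (if z then {bpt L0} else {}) \<subseteq> SL"
    proof -
      have "f k \<in> SL" if "k \<in> M0" for k
        using that clsD[of "iL (f k)"] iM_0[of k] pmap_in[OF pf, of k] unfolding SL_def M0_def by force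
      then show ?thesis
        using clsD bL0 by (auto simp: SL_def A_def z_def iL_bpt)
    qed
    show "SL \<subseteq> A \<union> f ` M0 \<union> (if z then {bpt L0} else {})"
    proof
      fix x assume "x \<in> SL"
      then have x: "x \<in> topspace (spc L0)" "iL x \<in> cls ` D" by (auto simp: SL_def)
      show "x \<in> A \<union> f ` M0 \<union> (if z then {bpt L0} else {})"
      proof (cases "x = bpt L0")
        case True
        then have z using x by (simp add: z_def iL_bpt)
        then show ?thesis using True by simp
      next
        case False
        from x(2)[unfolded clsD] consider (1) x' where "x' \<in> A" "iL x = iL x'"
          | (2) v where "v \<in> M" "iL x = iM (fst v) (snd v)" | (3) y where "y \<in> B" "iL x = iR y" by blast
        then show ?thesis
        proof cases
          case 1
          then show ?thesis using iL_eq[OF x(1), of x'] by (auto simp: A_def)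
        next
          case 2
          obtain t k where v: "v = (t, k)" by (cases v)
          then have tk: "t \<in> {0..1}" "k \<in> topspace (spc K)" "iL x = iM t k" using 2 by (auto simp: M_def)
          have "k \<noteq> bpt K" using tk iM_bpt[of t] iL_eq[OF x(1) bL0] False by (auto simp: iL_bpt)
          moreover have "t \<noteq> 1"
            using tk iM_1[of k] iL_iR_eq[OF x(1) pmap_in[OF pg tk(2)]] False by auto
          ultimately have "t = 0" using tk iM_interior(1)[of k t x] x(1) by force
          then have "x = f k" "k \<in> M0"
            using tk 2 v iM_0[of k] iL_eq[OF x(1) pmap_in[OF pf tk(2)]] by (auto simp: M0_def)
          then show ?thesis by blast
        next
          case 3
          then show ?thesis using iL_iR_eq[OF x(1), of y] False by (auto simp: B_def)
        qed
      qed
    qed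
  qed
  have cSL: "closedin (spc L0) SL"
    unfolding SL_eq by (cases z; simp only: if_True if_False; intro closedin_Un closedin_empty cl im cc)
  have SR_eq: "SR = B \<union> g ` M1 \<union> (if z then {bpt L1} else {})"
  proof
    show "B \<union> g ` M1 \<union> (if z then {bpt L1} else {}) \<subseteq> SR"
    proof -
      have "g k \<in> SR" if "k \<in> M1" for k
        using that clsD[of "iR (g k)"] iM_1[of k] pmap_in[OF pg, of k] unfolding SR_def M1_def by force
      then show ?thesis
        using clsD bL1 by (auto simp: SR_def B_def z_def iR_bpt)
    qed
    show "SR \<subseteq> B \<union> g ` M1 \<union> (if z then {bpt L1} else {})"
    proof
      fix x assume "x \<in> SR"
      then have x: "x \<in> topspace (spc L1)" "iR x \<in> cls ` D" by (auto simp: SR_def)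
      show "x \<in> B \<union> g ` M1 \<union> (if z then {bpt L1} else {})"
      proof (cases "x = bpt L1")
        case True
        then have z using x by (simp add: z_def iR_bpt)
        then show ?thesis using True by simp
      next
        case False
        from x(2)[unfolded clsD] consider (1) x' where "x' \<in> A" "iR x = iL x'"
          | (2) v where "v \<in> M" "iR x = iM (fst v) (snd v)" | (3) y where "y \<in> B" "iR x = iR y" by blast
        then show ?thesis
        proof cases
          case 1
          then show ?thesis using iL_iR_eq[of x', OF _ x(1)] False by (auto simp: A_def)
        next
          case 2
          obtain t k where v: "v = (t, k)" by (cases v)
          then have tk: "t \<in> {0..1}" "k \<in> topspace (spc K)" "iR x = iM t k" using 2 by (auto simp: M_def)
          have "k \<noteq> bpt K" using tk iM_bpt[of t] iR_eq[OF x(1) bL1] False by (auto simp: iR_bpt)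
          moreover have "t \<noteq> 0"
            using tk iM_0[of k] iL_iR_eq[OF pmap_in[OF pf tk(2)] x(1)] False by auto
          ultimately have "t = 1" using tk iM_interior(2)[of k t x] x(1) by force
          then have "x = g k" "k \<in> M1"
            using tk 2 v iM_1[of k] iR_eq[OF x(1) pmap_in[OF pg tk(2)]] by (auto simp: M1_def)
          then show ?thesis by blast
        next
          case 3
          then show ?thesis using iR_eq[OF x(1), of y] by (auto simp: B_def)
        qed
      qed
    qed
  qed
  have cSR: "closedin (spc L1) SR"
    unfolding SR_eq by (cases z; simp only: if_True if_False; intro closedin_Un closedin_empty cl im cc)
  \<comment> \<open>A point of an end slice belongs to the preimage exactly when its image in the
    corresponding end does, which brings in \<open>SL\<close> and \<open>SR\<close>. A point
    strictly between the ends and off the base line is identified with no other point, so it must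
    come from \<open>M\<close>.\<close>
  have "SM = M \<union> {0} \<times> {k \<in> topspace (spc K). f k \<in> SL} \<union> {1} \<times> {k \<in> topspace (spc K). g k \<in> SR}
      \<union> (if z then {0..1} \<times> {bpt K} else {})" (is "_ = ?R")
  proof
    show "?R \<subseteq> SM"
    proof -
      have "M \<subseteq> SM" unfolding SM_def using clsD closedin_subset[OF cl(2)] by blast
      moreover have "{0} \<times> {k \<in> topspace (spc K). f k \<in> SL} \<subseteq> SM" by (auto simp: SM_def SL_def iM_0)
      moreover have "{1} \<times> {k \<in> topspace (spc K). g k \<in> SR} \<subseteq> SM" by (auto simp: SM_def SR_def iM_1)
      moreover have "(if z then {0..1} \<times> {bpt K} else {}) \<subseteq> SM"
        using bK by (auto simp: SM_def z_def iM_bpt)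
      ultimately show ?thesis by (intro Un_least)
    qed
    show "SM \<subseteq> ?R"
    proof
      fix w assume "w \<in> SM"
      then obtain t k where w: "w = (t, k)" "t \<in> {0..1}" "k \<in> topspace (spc K)" "iM t k \<in> cls ` D"
        by (cases w) (auto simp: SM_def)
      consider "k = bpt K" | "t = 0" | "t = 1" | "k \<noteq> bpt K" "0 < t" "t < 1" using w(2) by fastforce
      then show "w \<in> ?R"
      proof cases
        case 1
        then have z using w by (simp add: z_def iM_bpt)
        then show ?thesis using 1 w by auto
      next
        case 2
        then have "f k \<in> SL" using w(3,4) pmap_in[OF pf] by (simp add: SL_def iM_0)
        then show ?thesis using 2 w by simp
      next
        case 3
        then have "g k \<in> SR" using w(3,4) pmap_in[OF pg] by (simp add: SR_def iM_1)
        then show ?thesis using 3 w by simp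
      next
        case 4
        note int = iM_interior[OF w(3) 4(2,3,1)]
        from w(4)[unfolded clsD] consider (L) x where "x \<in> A" "iM t k = iL x"
          | (M) v where "v \<in> M" "iM t k = iM (fst v) (snd v)" | (R) y where "y \<in> B" "iM t k = iR y" by blast
        then have "(t, k) \<in> M"
        proof cases
          case L
          then show ?thesis using int(1)[of x] by (simp add: A_def)
        next
          case M
          then have "t = fst v \<and> k = snd v"
            using int(3)[of "snd v" "fst v"] closedin_subset[OF cl(2)] by auto
          then show ?thesis using M(1) by simp
        next
          case R
          then show ?thesis using int(2)[of y] by (simp add: B_def)
        qed
        then show ?thesis using w by simp
      qed
    qed
  qed
  moreover have "closedin ?IK ?R"
  proof -
    have "closedin (top_of_set {0..1::real}) {0}" "closedin (top_of_set {0..1::real}) {1}"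
      by (auto intro!: closedin_Hausdorff_singleton Hausdorff_space_subtopology)
    moreover have "closedin (spc K) {k \<in> topspace (spc K). f k \<in> SL}" "closedin (spc K) {k \<in> topspace (spc K). g k \<in> SR}"
      using closedin_continuous_map_preimage[OF pmap_cm[OF pf] cSL] closedin_continuous_map_preimage[OF pmap_cm[OF pg] cSR] .
    moreover have "closedin (spc K) {bpt K}" using bK assms(2) by (rule closedin_Hausdorff_singleton[rotated])
    moreover have "closedin (top_of_set {0..1::real}) {0..1}" by (metis closedin_topspace topspace_euclidean_subtopology)
    ultimately show ?thesis
      using cl(2) by (auto intro!: closedin_Un simp: closedin_prod_Times_iff)
  qed
  ultimately have cSM: "closedin ?IK SM" by simp
  let ?W = "{p \<in> topspace S. cls p \<in> cls ` D}"
  have "closedin S ?W"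
  proof (rule closedin_cyl_sumI)
    show "closedin (spc L0) {x \<in> topspace (spc L0). CLeft x \<in> ?W}"
      using cSL by (simp add: SL_def sum_iff iL_def cong: conj_cong)
    show "closedin (spc L1) {x \<in> topspace (spc L1). CRight x \<in> ?W}"
      using cSR by (simp add: SR_def sum_iff iR_def cong: conj_cong)
    have "{w \<in> topspace ?IK. CMid (fst w) (snd w) \<in> ?W} = SM"
      unfolding SM_def iM_def using sum_iff(3)[of _ _ K L0 L1] by auto
    then show "closedin ?IK {w \<in> topspace ?IK. CMid (fst w) (snd w) \<in> ?W}"
      using cSM by simp
  qed blast
  moreover have "cls ` D \<subseteq> topspace (spc C)"
    using closedin_subset[OF D] quotient_imp_surjective_map[OF quotient_map_cls] by blast
  ultimately show "closedin (spc C) (cls ` D)"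
    using quotient_map_cls unfolding quotient_map_closedin by blast
qed

text \<open>Quotients of compact Hausdorff spaces can fail to be Hausdorff. Here the quotient map is
  closed, and a closed continuous surjection carries over normality and the closedness of
  points.\<close>

lemma Hausdorff_C:
  assumes "compact_space (spc K)" "compact_space (spc L0)" "compact_space (spc L1)"
    "Hausdorff_space (spc K)" "Hausdorff_space (spc L0)" "Hausdorff_space (spc L1)"
  shows "Hausdorff_space (spc C)"
proof -
  note S = Hausdorff_cyl_sum[OF assms(4-6)] compact_cyl_sum[OF assms(1-3)]
  note cl = closed_map_cls[OF assms(1,4-6)]
  note sur = quotient_imp_surjective_map[OF quotient_map_cls]
  have "normal_space (spc C)"
    by (rule normal_space_continuous_closed_map_image[OF _ quotient_imp_continuous_map[OF quotient_map_cls] cl sur])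
       (intro compact_Hausdorff_or_regular_imp_normal_space S disjI1)
  moreover have "t1_space (spc C)"
    unfolding t1_space_closedin_singleton
  proof
    fix w assume "w \<in> topspace (spc C)"
    then obtain p where "p \<in> topspace S" "w = cls p" using sur by blast
    then show "closedin (spc C) {w}"
      using cl closedin_Hausdorff_singleton[OF S(1)] unfolding closed_map_def by fastforce
  qed
  ultimately show ?thesis by (simp add: normal_t1_imp_Hausdorff_space)
qed

lemma compact_C:
  assumes "compact_space (spc K)" "compact_space (spc L0)" "compact_space (spc L1)"
  shows "compact_space (spc C)"
  using image_compactin[OF _ quotient_imp_continuous_map[OF quotient_map_cls], of "topspace S"]
    compact_cyl_sum[OF assms] quotient_imp_surjective_map[OF quotient_map_cls]
  by (simp add: compact_space_def)

end

section \<open>The maximum norm and cubes\<close>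

primrec nrm :: "nat \<Rightarrow> (nat \<Rightarrow> real) \<Rightarrow> real" where
  "nrm 0 x = 0"
| "nrm (Suc n) x = max (nrm n x) \<bar>x n\<bar>"

definition espace :: "nat \<Rightarrow> (nat \<Rightarrow> real) set" where
  "espace n = {x. \<forall>i\<ge>n. x i = 0}"

text \<open>Cubes replace round disks as models of cells because the product of a cube with an
  interval is again a cube, and such products are the cells of a cylinder. Cubes of all dimensions
  live in one type of sequences, padded with zeros.\<close>

definition cube :: "nat \<Rightarrow> (nat \<Rightarrow> real) set" where
  "cube n = {x \<in> espace n. nrm n x \<le> 1}"

definition cube_int :: "nat \<Rightarrow> (nat \<Rightarrow> real) set" where
  "cube_int n = {x \<in> espace n. nrm n x < 1}"

definition cube_bd :: "nat \<Rightarrow> (nat \<Rightarrow> real) set" where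
  "cube_bd n = {x \<in> espace n. nrm n x = 1}"

lemma cube_split: "cube n = cube_int n \<union> cube_bd n" "cube_int n \<inter> cube_bd n = {}"
  by (auto simp: cube_def cube_int_def cube_bd_def)

lemma nrm_nonneg: "0 \<le> nrm n x"
  by (induction n) auto

lemma nrm_ge: "i < n \<Longrightarrow> \<bar>x i\<bar> \<le> nrm n x"
  by (induction n) (auto simp: less_Suc_eq)

lemma nrm_le_iff: "0 \<le> c \<Longrightarrow> nrm n x \<le> c \<longleftrightarrow> (\<forall>i<n. \<bar>x i\<bar> \<le> c)"
  by (induction n) (auto simp: less_Suc_eq)

lemma nrm_less_iff: "0 < c \<Longrightarrow> nrm n x < c \<longleftrightarrow> (\<forall>i<n. \<bar>x i\<bar> < c)"
  by (induction n) (auto simp: less_Suc_eq)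

lemma nrm_attain: "0 < n \<Longrightarrow> \<exists>i<n. \<bar>x i\<bar> = nrm n x"
proof (induction n)
  case (Suc n)
  show ?case
  proof (cases "n = 0 \<or> nrm n x \<le> \<bar>x n\<bar>")
    case True
    then show ?thesis by (intro exI[of _ n]) auto
  next
    case False
    then obtain i where "i < n" "\<bar>x i\<bar> = nrm n x" using Suc.IH by auto
    then show ?thesis using False by (intro exI[of _ i]) auto
  qed
qed simp

lemma nrm_scale: "nrm n (\<lambda>i. c * x i) = \<bar>c\<bar> * nrm n x"
  by (induction n) (auto simp: abs_mult max_mult_distrib_left)

lemma nrm_cong: "(\<And>i. i < n \<Longrightarrow> x i = y i) \<Longrightarrow> nrm n x = nrm n y"
  by (induction n) auto

lemma nrm_triangle: "nrm n (\<lambda>i. x i + y i) \<le> nrm n x + nrm n y"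
  by (subst nrm_le_iff) (auto simp: nrm_nonneg intro!: abs_triangle_ineq[THEN order_trans] add_mono nrm_ge)

lemma continuous_coordinate: "continuous_on S (\<lambda>x :: nat \<Rightarrow> real. x i)"
  by (rule continuous_on_subset[OF continuous_on_product_coordinates]) simp

lemma continuous_nrm: "continuous_on S (nrm n)"
proof -
  have "continuous_on S (\<lambda>x. nrm n x)"
    by (induction n) (auto intro!: continuous_intros continuous_coordinate)
  then show ?thesis .
qed

lemma nrm_0_iff: "x \<in> espace n \<Longrightarrow> nrm n x = 0 \<longleftrightarrow> x = (\<lambda>_. 0)"
proof
  assume x: "x \<in> espace n" and "nrm n x = 0"
  then have "x i = 0" for i
    using nrm_ge[of i n x] by (cases "i < n") (auto simp: espace_def)
  then show "x = (\<lambda>_. 0)" by auto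
next
  show "x = (\<lambda>_. 0) \<Longrightarrow> nrm n x = 0"
    using nrm_scale[of n 0 x] by simp
qed

lemma espace_scale: "x \<in> espace n \<Longrightarrow> (\<lambda>i. c * x i) \<in> espace n" "x \<in> espace n \<Longrightarrow> (\<lambda>i. x i * c) \<in> espace n"
  by (auto simp: espace_def)

lemma zero_cube_int: "(\<lambda>_. 0) \<in> cube_int n"
  using nrm_0_iff[of "\<lambda>_. 0" n] by (simp add: cube_int_def espace_def)

lemma compact_coordinate_box: "compact {x :: nat \<Rightarrow> real. \<forall>i. x i \<in> (if i < n then {-c..c} else {0})}"
proof -
  have "compactin (powertop_real UNIV) (PiE UNIV (\<lambda>i. if i < n then {-c..c} else {0}))"
    by (subst compactin_PiE) auto
  then show ?thesis
    by (simp add: euclidean_product_topology PiE_UNIV_domain Pi_def)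
qed

lemma compact_nrm_ball: "0 \<le> c \<Longrightarrow> compact {x \<in> espace n. nrm n x \<le> c}"
proof -
  assume c: "0 \<le> c"
  have "x i \<in> (if i < n then {-c..c} else {0}) \<longleftrightarrow> (i < n \<longrightarrow> \<bar>x i\<bar> \<le> c) \<and> (n \<le> i \<longrightarrow> x i = 0)"
    for x :: "nat \<Rightarrow> real" and i
    by (simp add: abs_le_iff) linarith
  then have "{x. \<forall>i. x i \<in> (if i < n then {-c..c} else {0})} = {x \<in> espace n. nrm n x \<le> c}"
    using c by (simp add: espace_def nrm_le_iff) blast
  then show ?thesis using compact_coordinate_box[of n c] by simp
qed

lemma compact_cube: "compact (cube n)"
  unfolding cube_def by (rule compact_nrm_ball) simp

lemma compact_cube_bd: "compact (cube_bd n)"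
proof -
  have "cube_bd n = cube n \<inter> {x. nrm n x = 1}" by (auto simp: cube_bd_def cube_def)
  then show ?thesis
    by (auto intro!: compact_Int_closed compact_cube closed_Collect_eq continuous_nrm)
qed

section \<open>Round disks and cubes\<close>

text \<open>A vector is rescaled along its ray so that its \<open>M\<close>-size becomes its former
  \<open>N\<close>-size; this carries balls of \<open>N\<close> to balls of \<open>M\<close>. At the
  origin the formula returns the origin.\<close>

definition radial :: "((nat \<Rightarrow> real) \<Rightarrow> real) \<Rightarrow> ((nat \<Rightarrow> real) \<Rightarrow> real) \<Rightarrow> (nat \<Rightarrow> real) \<Rightarrow> nat \<Rightarrow> real" where
  "radial N M x i = x i * (N x / M x)"

text \<open>The common features of the maximum norm and the Euclidean norm on which rescaling rests.
  The bound on coordinates makes the gauge definite on \<open>espace n\<close> and controls the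
  rescaling near the origin.\<close>

definition is_gauge :: "nat \<Rightarrow> ((nat \<Rightarrow> real) \<Rightarrow> real) \<Rightarrow> bool" where
  "is_gauge n N \<longleftrightarrow> continuous_on UNIV N \<and> (\<forall>x i. i < n \<longrightarrow> \<bar>x i\<bar> \<le> N x) \<and>
     (\<forall>c x. 0 \<le> c \<longrightarrow> N (\<lambda>i. x i * c) = c * N x) \<and> (\<forall>x. 0 \<le> N x)"

lemma is_gauge_scale: "is_gauge n N \<Longrightarrow> 0 \<le> c \<Longrightarrow> N (\<lambda>i. x i * c) = c * N x"
  by (simp add: is_gauge_def)

lemma is_gauge_0: "is_gauge n N \<Longrightarrow> N (\<lambda>_. 0) = 0"
  using is_gauge_scale[of n N 0 "\<lambda>_. 0"] by simp

lemma is_gauge_eq_0: "is_gauge n N \<Longrightarrow> x \<in> espace n \<Longrightarrow> N x = 0 \<Longrightarrow> x = (\<lambda>_. 0)"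
proof (rule ext)
  fix i assume *: "is_gauge n N" "x \<in> espace n" "N x = 0"
  show "x i = 0"
  proof (cases "i < n")
    case True
    then have "\<bar>x i\<bar> \<le> N x" using *(1) unfolding is_gauge_def by blast
    then show ?thesis using *(3) by simp
  next
    case False
    then show ?thesis using *(2) by (simp add: espace_def)
  qed
qed

lemma radial_espace: "x \<in> espace n \<Longrightarrow> radial N M x \<in> espace n"
  by (simp add: espace_def radial_def)

lemma radial_gauge:
  assumes "is_gauge n N" "is_gauge n M" "x \<in> espace n"
  shows "M (radial N M x) = N x" "radial M N (radial N M x) = x"
proof -
  have *: "M (radial N M x) = N x \<and> radial M N (radial N M x) = x"
  proof (cases "x = (\<lambda>_. 0)")
    case True
    then have "radial N M x = x" by (simp add: radial_def fun_eq_iff)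
    moreover have "radial M N x = x" using True by (simp add: radial_def fun_eq_iff)
    ultimately show ?thesis using True is_gauge_0 assms by metis
  next
    case False
    then have p: "0 < N x" "0 < M x"
      using assms is_gauge_eq_0 by (metis is_gauge_def less_eq_real_def)+
    have r: "radial N M x = (\<lambda>i. x i * (N x / M x))" by (simp add: radial_def fun_eq_iff)
    have q: "0 \<le> N x / M x" using p by simp
    have sc: "M (\<lambda>i. x i * (N x / M x)) = N x / M x * M x" "N (\<lambda>i. x i * (N x / M x)) = N x / M x * N x"
      by (rule is_gauge_scale[OF assms(2) q] is_gauge_scale[OF assms(1) q])+
    show ?thesis using p unfolding r radial_def sc by (simp add: field_simps)
  qed
  then show "M (radial N M x) = N x" "radial M N (radial N M x) = x" by auto
qed

lemma continuous_radial:
  assumes N: "is_gauge n N" and M: "is_gauge n M"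
  shows "continuous_on (espace n) (radial N M)"
proof (rule continuous_on_coordinatewise_then_product)
  fix i
  have cN: "continuous_on (espace n) N" and cM: "continuous_on (espace n) M"
    using N M continuous_on_subset unfolding is_gauge_def by blast+
  show "continuous_on (espace n) (\<lambda>x. radial N M x i)"
    unfolding continuous_on_eq_continuous_within
  proof
    fix x assume x: "x \<in> espace n"
    show "continuous (at x within espace n) (\<lambda>x. radial N M x i)"
    proof (cases "x = (\<lambda>_. 0)")
      case False
      then have "M x \<noteq> 0" using is_gauge_eq_0[OF M x] by blast
      then show ?thesis
        unfolding radial_def using cN cM x continuous_coordinate[of "espace n" i]
        unfolding continuous_on_eq_continuous_within by (intro continuous_intros) auto
    next
      case True
      have lim: "(N \<longlongrightarrow> 0) (at x within espace n)"
        using cN x is_gauge_0[OF N] True unfolding continuous_on_def by metis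
      \<comment> \<open>The quotient of the two gauges need not converge at the origin. But a
        coordinate of \<open>y\<close> is at most \<open>M y\<close>, which cancels the denominator
        and leaves \<open>N y\<close>, and this tends to 0.\<close>
      have bound: "\<bar>radial N M y i\<bar> \<le> N y" if "y \<in> espace n" for y
      proof (cases "i < n")
        case True
        then have "\<bar>y i\<bar> \<le> M y" "0 \<le> N y" "0 \<le> M y" using M N unfolding is_gauge_def by auto
        then have "\<bar>y i\<bar> * (N y / M y) \<le> M y * (N y / M y)" by (intro mult_right_mono) auto
        then show ?thesis using \<open>0 \<le> N y\<close> \<open>0 \<le> M y\<close>
          by (cases "M y = 0") (auto simp: radial_def abs_mult)
      next
        case False
        then show ?thesis using that N by (simp add: radial_def espace_def is_gauge_def)
      qed
      have "((\<lambda>y. radial N M y i) \<longlongrightarrow> 0) (at x within espace n)"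
        by (rule Lim_null_comparison[OF _ lim]) (auto simp: eventually_at_filter bound)
      then show ?thesis using True by (simp add: continuous_within radial_def)
    qed
  qed
qed

lemma is_gauge_nrm: "is_gauge n (nrm n)"
  unfolding is_gauge_def
  using nrm_scale[of n] by (auto simp: continuous_nrm nrm_ge nrm_nonneg mult.commute)

definition l2 :: "nat \<Rightarrow> (nat \<Rightarrow> real) \<Rightarrow> real" where
  "l2 n x = sqrt (\<Sum>i<n. x i ^ 2)"

lemma is_gauge_l2: "is_gauge n (l2 n)"
  unfolding is_gauge_def
proof (intro conjI allI impI)
  have "continuous_on UNIV (\<lambda>x. l2 n x)"
    unfolding l2_def by (auto intro!: continuous_intros continuous_coordinate)
  then show "continuous_on UNIV (l2 n)" .
  show "\<bar>x i\<bar> \<le> l2 n x" if "i < n" for x i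
  proof -
    have "x i ^ 2 \<le> (\<Sum>i<n. x i ^ 2)" using that by (intro member_le_sum) auto
    then have "sqrt (x i ^ 2) \<le> l2 n x" unfolding l2_def by (rule real_sqrt_le_mono)
    then show ?thesis by simp
  qed
  show "l2 n (\<lambda>i. x i * c) = c * l2 n x" if "0 \<le> c" for c x
    using that by (simp add: l2_def power_mult_distrib sum_distrib_right[symmetric] real_sqrt_mult)
  show "0 \<le> l2 n x" for x by (simp add: l2_def sum_nonneg)
qed

lemma cell_alt:
  "cell_disk n = {x \<in> espace n. l2 n x \<le> 1}"
  "cell_interior n = {x \<in> espace n. l2 n x < 1}"
  "cell_boundary n = {x \<in> espace n. l2 n x = 1}"
  by (auto simp: cell_disk_def cell_interior_def cell_boundary_def espace_def l2_def topspace_Euclidean_space)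

definition to_disk where "to_disk n = radial (nrm n) (l2 n)"
definition to_cube where "to_cube n = radial (l2 n) (nrm n)"

lemma to_disk_cube:
  "x \<in> espace n \<Longrightarrow> to_disk n x \<in> espace n" "x \<in> espace n \<Longrightarrow> to_cube n x \<in> espace n"
  "x \<in> espace n \<Longrightarrow> l2 n (to_disk n x) = nrm n x" "x \<in> espace n \<Longrightarrow> nrm n (to_cube n x) = l2 n x"
  "x \<in> espace n \<Longrightarrow> to_cube n (to_disk n x) = x" "x \<in> espace n \<Longrightarrow> to_disk n (to_cube n x) = x"
  unfolding to_disk_def to_cube_def
  by (erule radial_espace radial_gauge[OF is_gauge_nrm is_gauge_l2] radial_gauge[OF is_gauge_l2 is_gauge_nrm])+

lemma to_disk_image:
  "to_disk n ` cube n = cell_disk n" "to_disk n ` cube_int n = cell_interior n" "to_disk n ` cube_bd n = cell_boundary n"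
  "to_cube n ` cell_disk n = cube n" "to_cube n ` cell_interior n = cube_int n" "to_cube n ` cell_boundary n = cube_bd n"
proof -
  have "to_disk n ` {x \<in> espace n. P (nrm n x)} = {x \<in> espace n. P (l2 n x)}"
    "to_cube n ` {x \<in> espace n. P (l2 n x)} = {x \<in> espace n. P (nrm n x)}" for P
  proof -
    show "to_disk n ` {x \<in> espace n. P (nrm n x)} = {x \<in> espace n. P (l2 n x)}"
    proof (intro equalityI subsetI)
      fix y assume "y \<in> {x \<in> espace n. P (l2 n x)}"
      then show "y \<in> to_disk n ` {x \<in> espace n. P (nrm n x)}"
        by (intro image_eqI[of _ _ "to_cube n y"]) (auto simp: to_disk_cube)
    qed (auto simp: to_disk_cube)
    show "to_cube n ` {x \<in> espace n. P (l2 n x)} = {x \<in> espace n. P (nrm n x)}"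
    proof (intro equalityI subsetI)
      fix y assume "y \<in> {x \<in> espace n. P (nrm n x)}"
      then show "y \<in> to_cube n ` {x \<in> espace n. P (l2 n x)}"
        by (intro image_eqI[of _ _ "to_disk n y"]) (auto simp: to_disk_cube)
    qed (auto simp: to_disk_cube)
  qed
  from this[of "\<lambda>t. t \<le> 1"] this[of "\<lambda>t. t < 1"] this[of "\<lambda>t. t = 1"]
  show "to_disk n ` cube n = cell_disk n" "to_disk n ` cube_int n = cell_interior n" "to_disk n ` cube_bd n = cell_boundary n"
    "to_cube n ` cell_disk n = cube n" "to_cube n ` cell_interior n = cube_int n" "to_cube n ` cell_boundary n = cube_bd n"
    by (auto simp: cell_alt cube_def cube_int_def cube_bd_def)
qed

lemma continuous_to_disk: "continuous_on (cube n) (to_disk n)"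
  and continuous_to_cube: "continuous_on (cell_disk n) (to_cube n)"
  unfolding to_disk_def to_cube_def cell_alt cube_def
  by (rule continuous_on_subset[OF continuous_radial]; auto intro: is_gauge_nrm is_gauge_l2)+

lemma subtopology_Euclidean_space:
  "S \<subseteq> espace n \<Longrightarrow> subtopology (Euclidean_space n) S = top_of_set S"
  by (simp add: Euclidean_space_def subtopology_subtopology euclidean_product_topology espace_def Int_absorb1)

text \<open>A continuous map from a compact space to a Hausdorff space is closed, and it remains
  closed when restricted to a saturated subset. An injective such restriction is a homeomorphism
  onto its image.\<close>

lemma homeomorphic_map_saturated:
  assumes D: "compact D" and X: "Hausdorff_space X" and c: "continuous_map (top_of_set D) X \<xi>"
    and U: "U \<subseteq> D" and inj: "inj_on \<xi> U" and sat: "\<xi> ` U \<inter> \<xi> ` (D - U) = {}"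
  shows "homeomorphic_map (top_of_set U) (subtopology X (\<xi> ` U)) \<xi>"
proof -
  have im: "\<xi> ` D \<subseteq> topspace X" using continuous_map_image_subset_topspace[OF c] by simp
  have "closed_map (top_of_set D) X \<xi>"
    using D X c by (intro continuous_imp_closed_map) (auto simp: compact_space_subtopology)
  moreover have "{x \<in> topspace (top_of_set D). \<xi> x \<in> \<xi> ` U} = U" using U sat by auto
  ultimately have "closed_map (subtopology (top_of_set D) U) (subtopology X (\<xi> ` U)) \<xi>"
    by (rule closed_map_restriction)
  moreover have "subtopology (top_of_set D) U = top_of_set U"
    using U by (simp add: subtopology_subtopology Int_absorb1)
  moreover have "continuous_map (top_of_set U) (subtopology X (\<xi> ` U)) \<xi>"
    using continuous_map_from_subtopology[OF c, of U] \<open>subtopology (top_of_set D) U = top_of_set U\<close>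
    by (simp add: continuous_map_in_subtopology)
  moreover have "topspace (subtopology X (\<xi> ` U)) = \<xi> ` U" using im U by auto
  ultimately show ?thesis
    using inj by (intro bijective_closed_imp_homeomorphic_map) auto
qed

section \<open>Cubical characteristic maps\<close>

text \<open>A CW structure with cubes as domains in which the homeomorphism condition on open cells
  is weakened to injectivity. The weaker form is easier to verify when a cell is added, and the full
  condition can be recovered from it.\<close>

definition cube_CW ::
  "'a topology \<Rightarrow> nat \<Rightarrow> (nat \<Rightarrow> nat) \<Rightarrow> (nat \<Rightarrow> (nat \<Rightarrow> real) \<Rightarrow> 'a) \<Rightarrow> bool" where
  "cube_CW X N d \<Psi> \<longleftrightarrow>
     Hausdorff_space X \<and>
     (\<forall>i<N. continuous_map (top_of_set (cube (d i))) X (\<Psi> i)) \<and>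
     (\<forall>i<N. inj_on (\<Psi> i) (cube_int (d i))) \<and>
     disjoint_family_on (\<lambda>i. \<Psi> i ` cube_int (d i)) {..<N} \<and>
     (\<Union>i<N. \<Psi> i ` cube_int (d i)) = topspace X \<and>
     (\<forall>i<N. \<Psi> i ` cube_bd (d i) \<subseteq> (\<Union>j\<in>{j. j < N \<and> d j < d i}. \<Psi> j ` cube_int (d j)))"

lemma cube_CW_D:
  assumes "cube_CW X N d \<Psi>"
  shows "Hausdorff_space X"
    "i < N \<Longrightarrow> continuous_map (top_of_set (cube (d i))) X (\<Psi> i)"
    "i < N \<Longrightarrow> inj_on (\<Psi> i) (cube_int (d i))"
    "i < N \<Longrightarrow> j < N \<Longrightarrow> i \<noteq> j \<Longrightarrow> \<Psi> i ` cube_int (d i) \<inter> \<Psi> j ` cube_int (d j) = {}"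
    "(\<Union>i<N. \<Psi> i ` cube_int (d i)) = topspace X"
    "i < N \<Longrightarrow> \<Psi> i ` cube_bd (d i) \<subseteq> (\<Union>j\<in>{j. j < N \<and> d j < d i}. \<Psi> j ` cube_int (d j))"
  using assms unfolding cube_CW_def disjoint_family_on_def by simp_all

lemma finite_CW_imp_cube_CW:
  assumes "finite_CW_structure X N d \<Phi>"
  shows "cube_CW X N d (\<lambda>i. \<Phi> i \<circ> to_disk (d i))"
  unfolding cube_CW_def image_comp[symmetric] to_disk_image
proof (intro conjI allI impI)
  note F = assms[unfolded finite_CW_structure_def]
  show "Hausdorff_space X" "disjoint_family_on (\<lambda>i. \<Phi> i ` cell_interior (d i)) {..<N}"
    "(\<Union>i<N. \<Phi> i ` cell_interior (d i)) = topspace X"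
    using F by auto
  fix i assume i: "i < N"
  show "\<Phi> i ` cell_boundary (d i) \<subseteq> (\<Union>j\<in>{j. j < N \<and> d j < d i}. \<Phi> j ` cell_interior (d j))"
    using F i by blast
  have "continuous_map (top_of_set (cell_disk (d i))) X (\<Phi> i)"
    using F i subtopology_Euclidean_space[of "cell_disk (d i)" "d i"] by (auto simp: cell_alt)
  moreover have "continuous_map (top_of_set (cube (d i))) (top_of_set (cell_disk (d i))) (to_disk (d i))"
    by (simp add: continuous_to_disk to_disk_image image_subset_iff_funcset[symmetric])
  ultimately show "continuous_map (top_of_set (cube (d i))) X (\<Phi> i \<circ> to_disk (d i))"
    by (rule continuous_map_compose[rotated])
  have "inj_on (\<Phi> i) (cell_interior (d i))"
  proof -
    have h: "homeomorphic_map (subtopology (Euclidean_space (d i)) (cell_interior (d i)))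
              (subtopology X (\<Phi> i ` cell_interior (d i))) (\<Phi> i)" using F i by blast
    have "topspace (subtopology (Euclidean_space (d i)) (cell_interior (d i))) = cell_interior (d i)"
      by (auto simp: cell_interior_def)
    then show ?thesis using homeomorphic_imp_injective_map[OF h] by simp
  qed
  moreover have "inj_on (to_disk (d i)) (cube_int (d i))"
    by (rule inj_on_inverseI[where g = "to_cube (d i)"]) (auto simp: cube_int_def to_disk_cube)
  ultimately show "inj_on (\<Phi> i \<circ> to_disk (d i)) (cube_int (d i))"
    by (simp add: comp_inj_on to_disk_image)
qed

text \<open>Boundary points of a cell are sent to open cells of smaller dimension, which are
  disjoint from its own open cell. So the open disk is saturated in the closed one, and
  \<open>homeomorphic_map_saturated\<close> turns injectivity into a homeomorphism.\<close>

lemma cube_CW_imp_finite_CW: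
  assumes "cube_CW X N d \<Psi>"
  shows "finite_CW_structure X N d (\<lambda>i. \<Psi> i \<circ> to_cube (d i))"
  unfolding finite_CW_structure_def image_comp[symmetric] to_disk_image
proof (intro conjI allI impI)
  note F = cube_CW_D[OF assms]
  show X: "Hausdorff_space X" "disjoint_family_on (\<lambda>i. \<Psi> i ` cube_int (d i)) {..<N}"
    "(\<Union>i<N. \<Psi> i ` cube_int (d i)) = topspace X"
    using F(1,4,5) by (auto simp: disjoint_family_on_def)
  fix i assume i: "i < N"
  show bd: "\<Psi> i ` cube_bd (d i) \<subseteq> (\<Union>j\<in>{j. j < N \<and> d j < d i}. \<Psi> j ` cube_int (d j))"
    by (rule F(6)[OF i])
  have "continuous_map (top_of_set (cell_disk (d i))) (top_of_set (cube (d i))) (to_cube (d i))"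
    by (simp add: continuous_to_cube to_disk_image image_subset_iff_funcset[symmetric])
  moreover have "continuous_map (top_of_set (cube (d i))) X (\<Psi> i)" by (rule F(2)[OF i])
  ultimately have c: "continuous_map (top_of_set (cell_disk (d i))) X (\<Psi> i \<circ> to_cube (d i))"
    by (rule continuous_map_compose)
  then show "continuous_map (subtopology (Euclidean_space (d i)) (cell_disk (d i))) X (\<Psi> i \<circ> to_cube (d i))"
    using subtopology_Euclidean_space[of "cell_disk (d i)" "d i"] by (auto simp: cell_alt)
  have cd: "compact (cell_disk (d i))"
    using compact_continuous_image[OF continuous_to_disk compact_cube] by (simp add: to_disk_image)
  have sub: "cell_interior (d i) \<subseteq> cell_disk (d i)" by (auto simp: cell_alt)
  have "inj_on (to_cube (d i)) (cell_interior (d i))"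
    by (rule inj_on_inverseI[where g = "to_disk (d i)"]) (auto simp: cell_alt to_disk_cube)
  then have inj: "inj_on (\<Psi> i \<circ> to_cube (d i)) (cell_interior (d i))"
    using F(3)[OF i] by (simp add: comp_inj_on to_disk_image)
  have "cell_disk (d i) - cell_interior (d i) = cell_boundary (d i)" by (auto simp: cell_alt)
  then have "(\<Psi> i \<circ> to_cube (d i)) ` cell_interior (d i) \<inter> (\<Psi> i \<circ> to_cube (d i)) ` (cell_disk (d i) - cell_interior (d i))
      = \<Psi> i ` cube_int (d i) \<inter> \<Psi> i ` cube_bd (d i)"
    by (simp only: image_comp[symmetric] to_disk_image)
  also have "\<dots> = {}"
  proof -
    have "\<Psi> i ` cube_int (d i) \<inter> \<Psi> j ` cube_int (d j) = {}" if "j < N" "d j < d i" for j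
      using F(4)[OF i that(1)] that(2) by blast
    then show ?thesis using bd by blast
  qed
  finally have sat: "(\<Psi> i \<circ> to_cube (d i)) ` cell_interior (d i) \<inter> (\<Psi> i \<circ> to_cube (d i)) ` (cell_disk (d i) - cell_interior (d i)) = {}" .
  have "homeomorphic_map (top_of_set (cell_interior (d i)))
      (subtopology X ((\<Psi> i \<circ> to_cube (d i)) ` cell_interior (d i))) (\<Psi> i \<circ> to_cube (d i))"
    by (rule homeomorphic_map_saturated[OF cd X(1) c sub inj sat])
  moreover have "(\<Psi> i \<circ> to_cube (d i)) ` cell_interior (d i) = \<Psi> i ` cube_int (d i)"
    by (simp only: image_comp[symmetric] to_disk_image)
  ultimately show "homeomorphic_map (subtopology (Euclidean_space (d i)) (cell_interior (d i)))
      (subtopology X (\<Psi> i ` cube_int (d i))) (\<Psi> i \<circ> to_cube (d i))"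
    using subtopology_Euclidean_space[of "cell_interior (d i)" "d i"] by (auto simp: cell_alt)
qed

lemma finite_CW_space_iff: "finite_CW_space X \<longleftrightarrow> (\<exists>N d \<Psi>. cube_CW X N d \<Psi>)"
  unfolding finite_CW_space_def using finite_CW_imp_cube_CW cube_CW_imp_finite_CW by blast

lemma cube_CW_compact:
  assumes "cube_CW X N d \<Psi>"
  shows "compact_space X"
proof -
  have im: "\<Psi> i ` cube (d i) \<subseteq> topspace X" if "i < N" for i
    using continuous_map_image_subset_topspace[OF cube_CW_D(2)[OF assms that]] by simp
  have "compactin X (\<Union>i<N. \<Psi> i ` cube (d i))"
    by (intro compactin_Union) (auto intro!: image_compactin[OF _ cube_CW_D(2)[OF assms]] simp: compact_cube compactin_subtopology)
  moreover have "(\<Union>i<N. \<Psi> i ` cube (d i)) = topspace X"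
  proof
    show "(\<Union>i<N. \<Psi> i ` cube (d i)) \<subseteq> topspace X" using im by blast
    have "(\<Union>i<N. \<Psi> i ` cube_int (d i)) = topspace X" by (rule cube_CW_D(5)[OF assms])
    then show "topspace X \<subseteq> (\<Union>i<N. \<Psi> i ` cube (d i))" using cube_split(1) by blast
  qed
  ultimately show ?thesis by (simp add: compact_space_def)
qed

lemma pointed_finite_CW_D:
  assumes "pointed_finite_CW X"
  shows "Hausdorff_space (spc X)" "compact_space (spc X)" "bpt X \<in> topspace (spc X)"
  using assms cube_CW_compact by (auto simp: pointed_finite_CW_def finite_CW_space_iff cube_CW_def)

text \<open>Sets of naturals and reals have the same cardinality, and a sequence of sets of naturals
  is coded by one set of pairs. Points of cells are sequences of reals, so this is what fits them
  into a universe that contains the reals.\<close>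

lemma inj_sequences_real: "\<exists>e :: (nat \<Rightarrow> real) \<Rightarrow> real. inj e"
proof -
  have "(UNIV :: nat set set) \<approx> (UNIV :: real set)" by (rule nat_sets_eqpoll_reals)
  then obtain u where u: "bij_betw u (UNIV :: nat set set) (UNIV :: real set)"
    unfolding eqpoll_def by blast
  define v where "v = inv u"
  have v: "inj v" using u unfolding v_def by (simp add: bij_betw_def surj_imp_inj_inv)
  have iu: "inj u" using u by (simp add: bij_betw_def)
  let ?w = "\<lambda>x :: nat \<Rightarrow> real. {prod_encode (i, j) | i j. j \<in> v (x i)}"
  have "inj ?w"
  proof (rule injI, rule ext)
    fix x y :: "nat \<Rightarrow> real" and i assume eq: "?w x = ?w y"
    have mem: "j \<in> v (x i) \<longleftrightarrow> prod_encode (i, j) \<in> ?w x" "j \<in> v (y i) \<longleftrightarrow> prod_encode (i, j) \<in> ?w y" for j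
      by (auto simp: prod_encode_eq)
    have "v (x i) = v (y i)"
      by (rule set_eqI) (rule trans[OF mem(1) trans[OF arg_cong[OF eq, of "\<lambda>A. prod_encode (i, _) \<in> A"] mem(2)[symmetric]]])
    then show "x i = y i" using v by (simp add: inj_eq)
  qed
  then have "inj (u \<circ> ?w)" using iu by (rule inj_compose[rotated])
  then show ?thesis by blast
qed

text \<open>Finitely many cells cover the space, and each has real sequences as coordinates; hence
  the carrier injects into the reals and into every type that contains them. Topology and cells are
  transported along this injection.\<close>

lemma pointed_finite_CW_relocate:
  fixes X :: "'a pointed"
  assumes X: "pointed_finite_CW X" and e: "\<exists>e :: real \<Rightarrow> 'u. inj e"
  obtains Q :: "'u pointed" and h where "pointed_finite_CW Q" "phomotopy_equivalence X Q h"
proof -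
  obtain N d \<Psi> where CW: "cube_CW (spc X) N d \<Psi>" and b: "bpt X \<in> topspace (spc X)"
    using X by (auto simp: pointed_finite_CW_def finite_CW_space_iff)
  let ?T = "topspace (spc X)"
  obtain c :: "(nat \<Rightarrow> real) \<Rightarrow> real" where c: "inj c" using inj_sequences_real by blast
  obtain e :: "real \<Rightarrow> 'u" where e: "inj e" using e by blast
  have cov: "\<exists>i x. i < N \<and> \<Psi> i x = p" if "p \<in> ?T" for p
    using that unfolding cube_CW_D(5)[OF CW, symmetric] by blast
  define code where "code p = (SOME ix. fst ix < N \<and> \<Psi> (fst ix) (snd ix) = p)" for p
  have code: "\<Psi> (fst (code p)) (snd (code p)) = p" if "p \<in> ?T" for p
    using someI_ex[of "\<lambda>ix. fst ix < N \<and> \<Psi> (fst ix) (snd ix) = p"] cov[OF that] by (auto simp: code_def)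
  \<comment> \<open>The index of a cell is prepended to the coordinates of a chosen preimage in that
    cell, so that the resulting sequence determines the point.\<close>
  define j where "j p = e (c (case_nat (real (fst (code p))) (snd (code p))))" for p
  have "inj_on j ?T"
  proof (rule inj_onI)
    fix p q assume p: "p \<in> ?T" and q: "q \<in> ?T" and "j p = j q"
    then have eq: "(case_nat (real (fst (code p))) (snd (code p)) :: nat \<Rightarrow> real) =
        case_nat (real (fst (code q))) (snd (code q))"
      using c e by (simp add: j_def inj_eq)
    have 1: "fst (code p) = fst (code q)" using fun_cong[OF eq, of 0] by simp
    have 2: "snd (code p) = snd (code q)"
    proof (rule ext)
      show "snd (code p) n = snd (code q) n" for n using fun_cong[OF eq, of "Suc n"] by simp
    qed
    show "p = q"
      by (rule trans[OF code[OF p, symmetric]]) (simp only: 1 2 code[OF q])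
  qed
  define i where "i = inv_into ?T j"
  have ij: "i (j p) = p" if "p \<in> ?T" for p using \<open>inj_on j ?T\<close> that by (simp add: i_def)
  define Y where "Y = pullback_topology (j ` ?T) i (spc X)"
  have TY: "topspace Y = j ` ?T" by (auto simp: Y_def topspace_pullback_topology ij)
  have ci: "continuous_map Y (spc X) i"
    unfolding Y_def by (rule continuous_map_pullback[OF continuous_map_id, unfolded id_o, simplified])
  have cj: "continuous_map (spc X) Y j"
    unfolding Y_def
  proof (rule continuous_map_pullback')
    show "continuous_map (spc X) (spc X) (i \<circ> j)"
      by (rule continuous_map_eq[OF continuous_map_id]) (simp add: ij)
  qed auto
  have hm: "homeomorphic_maps (spc X) Y j i"
    unfolding homeomorphic_maps_def using ci cj ij TY by auto
  have "cube_CW Y N d (\<lambda>n. j \<circ> \<Psi> n)"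
    unfolding cube_CW_def
  proof (intro conjI allI impI)
    show "Hausdorff_space Y"
      using cube_CW_D(1)[OF CW] homeomorphic_Hausdorff_space[of "spc X" Y] hm
      unfolding homeomorphic_space_def by blast
    have sub: "\<Psi> n ` cube (d n) \<subseteq> ?T" if "n < N" for n
      using continuous_map_image_subset_topspace[OF cube_CW_D(2)[OF CW that]] by simp
    then have sub': "\<Psi> n ` cube_int (d n) \<subseteq> ?T" if "n < N" for n
      using that cube_split(1) by blast
    show "disjoint_family_on (\<lambda>i. (j \<circ> \<Psi> i) ` cube_int (d i)) {..<N}"
      unfolding disjoint_family_on_def image_comp[symmetric]
    proof (intro ballI impI)
      fix m n assume mn: "m \<in> {..<N}" "n \<in> {..<N}" "m \<noteq> n"
      then have "\<Psi> m ` cube_int (d m) \<inter> \<Psi> n ` cube_int (d n) = {}"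
        by (intro cube_CW_D(4)[OF CW]) auto
      then show "j ` \<Psi> m ` cube_int (d m) \<inter> j ` \<Psi> n ` cube_int (d n) = {}"
        using inj_on_image_Int[OF \<open>inj_on j ?T\<close> sub' sub', of m n] mn by simp
    qed
    show "(\<Union>i<N. (j \<circ> \<Psi> i) ` cube_int (d i)) = topspace Y"
      unfolding TY cube_CW_D(5)[OF CW, symmetric] image_comp[symmetric] by (simp only: image_UN)
    fix n assume n: "n < N"
    show "continuous_map (top_of_set (cube (d n))) Y (j \<circ> \<Psi> n)"
    proof (rule continuous_map_compose[OF _ cj])
      show "continuous_map (top_of_set (cube (d n))) (spc X) (\<Psi> n)"
        by (rule cube_CW_D(2)[OF CW n])
    qed
    show "inj_on (j \<circ> \<Psi> n) (cube_int (d n))"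
    proof (rule comp_inj_on[OF _ inj_on_subset[OF \<open>inj_on j ?T\<close> sub'[OF n]]])
      show "inj_on (\<Psi> n) (cube_int (d n))"
        by (rule cube_CW_D(3)[OF CW n])
    qed
    show "(j \<circ> \<Psi> n) ` cube_bd (d n) \<subseteq> (\<Union>m\<in>{m. m < N \<and> d m < d n}. (j \<circ> \<Psi> m) ` cube_int (d m))"
    proof -
      have "\<Psi> n ` cube_bd (d n) \<subseteq> (\<Union>m\<in>{m. m < N \<and> d m < d n}. \<Psi> m ` cube_int (d m))"
        by (rule cube_CW_D(6)[OF CW n])
      then have "j ` \<Psi> n ` cube_bd (d n) \<subseteq> j ` (\<Union>m\<in>{m. m < N \<and> d m < d n}. \<Psi> m ` cube_int (d m))"
        by (rule image_mono)
      then show ?thesis unfolding image_comp[symmetric] by (simp only: image_UN)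
    qed
  qed
  then have "pointed_finite_CW (Pointed Y (j (bpt X)))"
    using b TY by (auto simp: pointed_finite_CW_def finite_CW_space_iff)
  moreover have "phomotopy_equivalence X (Pointed Y (j (bpt X))) j"
    using b ci cj ij TY by (intro phomotopy_equivalence_mutual_inverse[where k = i]) (auto simp: pmap_def)
  ultimately show thesis by (rule that)
qed

section \<open>Cellular approximation of maps from spheres\<close>

lemma cube_bd_coordinate:
  assumes "x \<in> cube_bd n"
  obtains i where "i < n" "\<bar>x i\<bar> = 1"
proof -
  have "n \<noteq> 0"
  proof
    assume "n = 0"
    then show False using assms by (simp add: cube_bd_def)
  qed
  then show thesis using nrm_attain[of n x] assms that by (auto simp: cube_bd_def)
qed

lemma cube_coordinate: "x \<in> cube n \<Longrightarrow> i < n \<Longrightarrow> -1 \<le> x i \<and> x i \<le> 1"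
  using nrm_ge[of i n x] by (auto simp: cube_def)

text \<open>The sphere is covered by \<open>O(k\<^sup>n\<^sup>-\<^sup>1)\<close> pieces of diameter \<open>1/k\<close>, too few for the images of these
  pieces to hit each of the \<open>M\<^sup>m\<close> points of a grid whose spacing exceeds the diameter of the images.\<close>

lemma Lipschitz_misses_point:
  fixes q :: "(nat \<Rightarrow> real) \<Rightarrow> nat \<Rightarrow> real"
  assumes nm: "n \<le> m" and S: "S \<subseteq> cube_bd n" and L: "0 \<le> L" and e: "0 < e"
    and Lip: "\<And>x y i. x \<in> S \<Longrightarrow> y \<in> S \<Longrightarrow> i < m \<Longrightarrow> \<bar>q x i - q y i\<bar> \<le> L * nrm n (\<lambda>j. x j - y j)"
  shows "\<exists>y. (\<forall>i<m. \<bar>y i\<bar> \<le> e) \<and> (\<forall>x\<in>S. \<exists>i<m. q x i \<noteq> y i)"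
proof (rule ccontr)
  assume neg: "\<not> ?thesis"
  \<comment> \<open>The grid has \<open>M\<close> points per coordinate and spacing h = e / M; the
    sphere is cut at mesh 1 / k with k = a M, and a > L / e yields L / k < h. There are at most 2 n
    (2 k + 1) ^ (n - 1) pieces, which is at most 2 n (c M) ^ (n - 1) since 2 a M + 1 is at most c M.
    Because k grows only linearly in \<open>M\<close>, taking M > 2 n c ^ (n - 1) makes this less
    than M ^ n.\<close>
  define a where "a = nat \<lceil>L / e\<rceil> + 1"
  define c where "c = 2 * a + 1"
  define M where "M = 2 * n * c ^ (n - 1) + 1"
  define k where "k = a * M"
  define h where "h = e / M"
  have M: "0 < M" by (simp add: M_def)
  have a: "L / e < real a" unfolding a_def by linarith
  have k: "0 < k" using M by (simp add: k_def a_def)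
  have h: "0 < h" using e M by (simp add: h_def)
  have Lk: "L * (1 / k) < h"
    using a e M k by (simp add: h_def k_def field_simps)
  define Gr where "Gr = (PiE {..<m} (\<lambda>_. {..<M}))"
  have "\<exists>x\<in>S. \<forall>i<m. q x i = h * real (b i)" if "b \<in> Gr" for b
  proof -
    have "\<bar>h * real (b i)\<bar> \<le> e" if "i < m" for i
    proof -
      have "b i < M" using \<open>b \<in> Gr\<close> that by (auto simp: Gr_def)
      then have "h * real (b i) \<le> h * M" using h by (intro mult_left_mono) auto
      also have "\<dots> = e" using M by (simp add: h_def)
      finally show ?thesis using h by simp
    qed
    then show ?thesis using neg[unfolded not_ex, THEN spec, of "\<lambda>i. h * real (b i)"] by blast
  qed
  then obtain X where X: "\<And>b. b \<in> Gr \<Longrightarrow> X b \<in> S" "\<And>b i. b \<in> Gr \<Longrightarrow> i < m \<Longrightarrow> q (X b) i = h * real (b i)"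
    by metis
  define face where "face x = (SOME i. i < n \<and> \<bar>x i\<bar> = 1)" for x :: "nat \<Rightarrow> real"
  have face: "face x < n" "\<bar>x (face x)\<bar> = 1" if "x \<in> S" for x
  proof -
    have "\<exists>i. i < n \<and> \<bar>x i\<bar> = 1" using cube_bd_coordinate S that by blast
    from someI_ex[OF this] show "face x < n" "\<bar>x (face x)\<bar> = 1" by (auto simp: face_def)
  qed
  define pos where "pos x j = nat \<lfloor>real k * (x j + 1)\<rfloor>" for x :: "nat \<Rightarrow> real" and j
  \<comment> \<open>A piece of the sphere is named by a face of the cube, the sign of the coordinate
    constant on it, and the mesh box of the other n - 1 coordinates. Points with the same key differ
    by at most 1 / k.\<close>
  define key where "key x = (face x, x (face x) > 0, restrict (pos x) ({..<n} - {face x}))" for x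
  define Ks where "Ks = (SIGMA i:{..<n}. (UNIV :: bool set) \<times> (PiE ({..<n} - {i}) (\<lambda>_. {..2*k})))"
  have key: "key x \<in> Ks" if x: "x \<in> S" for x
  proof -
    have "pos x j \<le> 2 * k" if "j < n" for j
    proof -
      have "x j \<le> 1" using x S that cube_coordinate cube_split by blast
      then have "real k * (x j + 1) \<le> real k * 2" by (intro mult_left_mono) auto
      then have "\<lfloor>real k * (x j + 1)\<rfloor> \<le> 2 * int k" by (simp add: floor_le_iff)
      then show ?thesis unfolding pos_def by (simp add: nat_le_iff mult.commute)
    qed
    then show ?thesis using face[OF x] by (auto simp: key_def Ks_def)
  qed
  have close: "nrm n (\<lambda>j. x j - y j) \<le> 1 / k" if x: "x \<in> S" and y: "y \<in> S" and eq: "key x = key y" for x y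
  proof -
    have "\<bar>x j - y j\<bar> \<le> 1 / k" if j: "j < n" for j
    proof (cases "j = face x")
      case True
      then have "x j = y j" using eq face[OF x] face[OF y] by (auto simp: key_def abs_if split: if_splits)
      then show ?thesis by simp
    next
      case False
      have eqs: "face x = face y" "restrict (pos x) ({..<n} - {face x}) = restrict (pos y) ({..<n} - {face y})"
        using eq by (auto simp: key_def)
      have "pos x j = pos y j" using fun_cong[OF eqs(2), of j] False j eqs(1) by simp
      moreover have "0 \<le> real k * (x j + 1)" "0 \<le> real k * (y j + 1)"
        using x y S j cube_coordinate[of x n j] cube_coordinate[of y n j] cube_split by auto
      ultimately have "\<lfloor>real k * (x j + 1)\<rfloor> = \<lfloor>real k * (y j + 1)\<rfloor>"
        unfolding pos_def by (metis eq_nat_nat_iff zero_le_floor)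
      then have "\<bar>real k * (x j + 1) - real k * (y j + 1)\<bar> < 1" by linarith
      then have "\<bar>real k * (x j - y j)\<bar> < 1" by (simp add: algebra_simps)
      then have "real k * \<bar>x j - y j\<bar> < 1" by (simp add: abs_mult)
      then show ?thesis using k by (simp add: pos_le_divide_eq mult.commute)
    qed
    then show ?thesis using k by (subst nrm_le_iff) auto
  qed
  have "inj_on (\<lambda>b. key (X b)) Gr"
  proof (rule inj_onI)
    fix b b' assume b: "b \<in> Gr" "b' \<in> Gr" and eq: "key (X b) = key (X b')"
    have "b i = b' i" if i: "i < m" for i
    proof -
      have "\<bar>h * real (b i) - h * real (b' i)\<bar> \<le> L * nrm n (\<lambda>j. X b j - X b' j)"
        using Lip[OF X(1) X(1) i, OF b] X(2) b i by simp
      also have "\<dots> \<le> L * (1 / k)" using L close[OF X(1) X(1) eq] b by (intro mult_left_mono)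
      also have "\<dots> < h * 1" using Lk by simp
      finally have "h * \<bar>real (b i) - real (b' i)\<bar> < h * 1"
        using h by (simp add: abs_mult flip: right_diff_distrib)
      then show ?thesis using h by simp
    qed
    then show "b = b'" using b unfolding Gr_def by (intro PiE_ext) auto
  qed
  moreover have "finite Ks" unfolding Ks_def by (intro finite_SigmaI finite_cartesian_product finite_PiE) auto
  moreover have "(\<lambda>b. key (X b)) ` Gr \<subseteq> Ks" using key X by blast
  ultimately have "card Gr \<le> card Ks" by (metis card_inj_on_le)
  moreover have "card Gr = M ^ m" by (simp add: Gr_def card_PiE)
  moreover have "card Ks = (\<Sum>i<n. 2 * (2 * k + 1) ^ (n - 1))"
    unfolding Ks_def by (subst card_SigmaI) (auto simp: card_cartesian_product card_PiE intro!: finite_PiE sum.cong)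
  ultimately have "M ^ m \<le> 2 * n * (2 * k + 1) ^ (n - 1)" by simp
  also have "\<dots> \<le> 2 * n * (c * M) ^ (n - 1)"
    using M by (intro mult_left_mono power_mono) (auto simp: k_def c_def)
  also have "\<dots> = 2 * n * c ^ (n - 1) * M ^ (n - 1)" by (simp add: power_mult_distrib)
  also have "\<dots> < M * M ^ (n - 1)" using M by (intro mult_strict_right_mono) (auto simp: M_def)
  finally have less: "M ^ m < M * M ^ (n - 1)" .
  show False
  \<comment> \<open>For n = 0 the exponent \<open>n - 1\<close> is truncated, so that M * M ^ (n -
    1) is not M ^ n. In that case the sphere is empty and every point is missed.\<close>
  proof (cases n)
    case 0
    then have "S = {}" using S by (auto simp: cube_bd_def)
    then show False using neg[unfolded not_ex, THEN spec, of "\<lambda>_. 0"] e by simp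
  next
    case (Suc n')
    then have "M * M ^ (n - 1) = M ^ n" by simp
    also have "\<dots> \<le> M ^ m" using M nm by (intro power_increasing) auto
    finally show False using less by simp
  qed
qed

section \<open>Approximation by Lipschitz functions\<close>

definition lip_const :: "nat \<Rightarrow> (nat \<Rightarrow> real) set \<Rightarrow> real \<Rightarrow> ((nat \<Rightarrow> real) \<Rightarrow> real) \<Rightarrow> bool" where
  "lip_const n S L f \<longleftrightarrow> (\<forall>x\<in>S. \<forall>y\<in>S. \<bar>f x - f y\<bar> \<le> L * nrm n (\<lambda>j. x j - y j))"

definition lip :: "nat \<Rightarrow> (nat \<Rightarrow> real) set \<Rightarrow> ((nat \<Rightarrow> real) \<Rightarrow> real) \<Rightarrow> bool" where
  "lip n S f \<longleftrightarrow> (\<exists>L\<ge>0. lip_const n S L f)"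

lemma lip_continuous:
  assumes "lip n S f"
  shows "continuous_on S f"
proof -
  obtain L where L: "\<And>x y. x \<in> S \<Longrightarrow> y \<in> S \<Longrightarrow> \<bar>f x - f y\<bar> \<le> L * nrm n (\<lambda>j. x j - y j)"
    using assms by (auto simp: lip_def lip_const_def)
  show ?thesis
    unfolding continuous_on_def
  proof
    fix x assume x: "x \<in> S"
    have "continuous_on S (\<lambda>y. L * nrm n (\<lambda>j. y j - x j))"
    proof -
      have "continuous_on S (\<lambda>y j. y j - x j)"
        by (intro continuous_on_coordinatewise_then_product continuous_intros continuous_coordinate)
      then have "continuous_on S (nrm n \<circ> (\<lambda>y j. y j - x j))"
        by (rule continuous_on_compose[OF _ continuous_nrm])
      then show ?thesis by (auto simp: o_def intro!: continuous_intros)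
    qed
    then have "((\<lambda>y. L * nrm n (\<lambda>j. y j - x j)) \<longlongrightarrow> L * nrm n (\<lambda>j. x j - x j)) (at x within S)"
      using x unfolding continuous_on_def by blast
    moreover have "nrm n (\<lambda>j. x j - x j) = 0" using nrm_0_iff[of "\<lambda>_. 0" n] by (simp add: espace_def)
    ultimately have "((\<lambda>y. L * nrm n (\<lambda>j. y j - x j)) \<longlongrightarrow> 0) (at x within S)" by simp
    then have "((\<lambda>y. f y - f x) \<longlongrightarrow> 0) (at x within S)"
      by (rule Lim_null_comparison[rotated]) (auto simp: eventually_at_filter L x)
    then show "(f \<longlongrightarrow> f x) (at x within S)" by (simp add: LIM_zero_iff)
  qed
qed

text \<open>Lipschitz functions on a compact set form a ring that contains the constants and
  separates points, so Stone-Weierstrass makes them dense. This brings an arbitrary continuous map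
  within reach of the counting argument in \<open>Lipschitz_misses_point\<close>.\<close>

lemma lip_ring:
  assumes S: "compact S" "S \<subseteq> espace n"
  shows "function_ring_on {f. lip n S f} S"
proof
  show "compact S" by fact
  show "continuous_on S f" if "f \<in> {f. lip n S f}" for f using that lip_continuous by blast
  show "(\<lambda>_. c) \<in> {f. lip n S f}" for c by (auto simp: lip_def lip_const_def intro!: exI[of _ 0])
  show "(\<lambda>x. f x + g x) \<in> {f. lip n S f}" if fg: "f \<in> {f. lip n S f}" "g \<in> {f. lip n S f}" for f g
  proof -
    obtain L where "0 \<le> L" "lip_const n S L f" using fg(1) by (auto simp: lip_def)
    moreover obtain L' where "0 \<le> L'" "lip_const n S L' g" using fg(2) by (auto simp: lip_def)
    ultimately have L: "0 \<le> L" "\<And>x y. x \<in> S \<Longrightarrow> y \<in> S \<Longrightarrow> \<bar>f x - f y\<bar> \<le> L * nrm n (\<lambda>j. x j - y j)"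
      "0 \<le> L'" "\<And>x y. x \<in> S \<Longrightarrow> y \<in> S \<Longrightarrow> \<bar>g x - g y\<bar> \<le> L' * nrm n (\<lambda>j. x j - y j)"
      by (simp_all add: lip_const_def)
    have "\<bar>(f x + g x) - (f y + g y)\<bar> \<le> (L + L') * nrm n (\<lambda>j. x j - y j)" if "x \<in> S" "y \<in> S" for x y
      using L(2)[OF that] L(4)[OF that] by (simp add: algebra_simps)
    then show ?thesis using L(1,3) by (auto simp: lip_def lip_const_def intro!: exI[of _ "L + L'"])
  qed
  show "(\<lambda>x. f x * g x) \<in> {f. lip n S f}" if fg: "f \<in> {f. lip n S f}" "g \<in> {f. lip n S f}" for f g
  proof -
    obtain L where "0 \<le> L" "lip_const n S L f" using fg(1) by (auto simp: lip_def)
    moreover obtain L' where "0 \<le> L'" "lip_const n S L' g" using fg(2) by (auto simp: lip_def)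
    ultimately have L: "0 \<le> L" "\<And>x y. x \<in> S \<Longrightarrow> y \<in> S \<Longrightarrow> \<bar>f x - f y\<bar> \<le> L * nrm n (\<lambda>j. x j - y j)"
      "0 \<le> L'" "\<And>x y. x \<in> S \<Longrightarrow> y \<in> S \<Longrightarrow> \<bar>g x - g y\<bar> \<le> L' * nrm n (\<lambda>j. x j - y j)"
      by (simp_all add: lip_const_def)
    have "bounded (f ` S)" "bounded (g ` S)"
      using fg lip_continuous S(1) by (auto intro!: compact_imp_bounded compact_continuous_image)
    then obtain B B' where B: "\<And>x. x \<in> S \<Longrightarrow> \<bar>f x\<bar> \<le> B" "\<And>x. x \<in> S \<Longrightarrow> \<bar>g x\<bar> \<le> B'"
      by (auto simp: bounded_iff)
    \<comment> \<open>The product rule f g - f' g' = f (g - g') + g' (f - f') with the bounds on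
      both factors. The absolute values keep the constant nonnegative even if \<open>S\<close> is
      empty, when \<open>B\<close> and \<open>B'\<close> may be negative.\<close>
    have "\<bar>f x * g x - f y * g y\<bar> \<le> (\<bar>B\<bar> * L' + \<bar>B'\<bar> * L) * nrm n (\<lambda>j. x j - y j)" if xy: "x \<in> S" "y \<in> S" for x y
    proof -
      have "f x * g x - f y * g y = f x * (g x - g y) + g y * (f x - f y)" by (simp add: algebra_simps)
      then have "\<bar>f x * g x - f y * g y\<bar> \<le> \<bar>f x\<bar> * \<bar>g x - g y\<bar> + \<bar>g y\<bar> * \<bar>f x - f y\<bar>"
        by (metis abs_mult abs_triangle_ineq)
      also have "\<dots> \<le> \<bar>B\<bar> * (L' * nrm n (\<lambda>j. x j - y j)) + \<bar>B'\<bar> * (L * nrm n (\<lambda>j. x j - y j))"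
        using B[OF xy(1)] B[OF xy(2)] L(2)[OF xy] L(4)[OF xy] by (intro add_mono mult_mono) auto
      finally show ?thesis by (simp add: algebra_simps)
    qed
    then show ?thesis using L(1,3) by (auto simp: lip_def lip_const_def intro!: exI[of _ "\<bar>B\<bar> * L' + \<bar>B'\<bar> * L"])
  qed
  show "\<exists>f\<in>{f. lip n S f}. f x \<noteq> f y" if xy: "x \<in> S" "y \<in> S" "x \<noteq> y" for x y
  proof -
    obtain i where i: "x i \<noteq> y i" using xy(3) by auto
    have "x \<in> espace n" "y \<in> espace n" using xy S(2) by blast+
    then have "i < n" using i by (force simp: espace_def not_le)
    then have "lip n S (\<lambda>z. z i)"
      using nrm_ge[of i n "\<lambda>j. _ j - _ j"] by (auto simp: lip_def lip_const_def intro!: exI[of _ 1])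
    then show ?thesis using i by (intro bexI[of _ "\<lambda>z. z i"]) simp_all
  qed
qed

lemma cm_paired:
  "continuous_map Z X a \<Longrightarrow> continuous_map Z Y b \<Longrightarrow> continuous_map Z (prod_topology X Y) (\<lambda>z. (a z, b z))"
  by (simp add: continuous_map_paired)

lemma homotopic_with_trueI:
  assumes "continuous_map (prod_topology (top_of_set {0..1::real}) X) Y h"
    "\<And>x. x \<in> topspace X \<Longrightarrow> h (0, x) = f x" "\<And>x. x \<in> topspace X \<Longrightarrow> h (1, x) = g x"
  shows "homotopic_with (\<lambda>_. True) X Y f g"
  using homotopic_with[of X "\<lambda>_. True" Y f g] assms by auto

text \<open>A map from a sphere of dimension less than \<open>m\<close> is first moved off the centre of an
  \<open>m\<close>-cell and then pushed out radially.\<close>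

locale cell_push =
  fixes X :: "'a topology" and A :: "'a set" and m :: nat and \<xi> :: "(nat \<Rightarrow> real) \<Rightarrow> 'a"
  assumes X: "Hausdorff_space X" and A: "closedin X A"
    and c\<xi>: "continuous_map (top_of_set (cube m)) X \<xi>" and inj: "inj_on \<xi> (cube_int m)"
    and disj: "\<xi> ` cube_int m \<inter> A = {}" and bd: "\<xi> ` cube_bd m \<subseteq> A"
begin

lemma \<xi>_eq: "y \<in> cube_int m \<Longrightarrow> y' \<in> cube m \<Longrightarrow> \<xi> y = \<xi> y' \<Longrightarrow> y = y'"
proof -
  assume y: "y \<in> cube_int m" "y' \<in> cube m" "\<xi> y = \<xi> y'"
  have "y' \<notin> cube_bd m"
  proof
    assume "y' \<in> cube_bd m"
    then have "\<xi> y \<in> A" using bd y(3) by auto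
    then show False using disj y(1) by blast
  qed
  then have "y' \<in> cube_int m" using y(2) cube_split(1) by blast
  then show ?thesis using inj_onD[OF inj y(3,1)] by simp
qed

lemma \<xi>_in: "y \<in> cube m \<Longrightarrow> \<xi> y \<in> topspace X"
  using continuous_map_image_subset_topspace[OF c\<xi>] by auto

text \<open>The segment from \<open>y\<close> to y / \<open>nrm m y\<close>, its radial projection
  to the boundary of the cube.\<close>

definition \<rho> :: "real \<Rightarrow> (nat \<Rightarrow> real) \<Rightarrow> nat \<Rightarrow> real" where
  "\<rho> s y i = (1 - s + s / nrm m y) * y i"

lemma \<rho>:
  assumes "y \<in> cube m" "y \<noteq> (\<lambda>_. 0)" "s \<in> {0..1}"
  shows "\<rho> s y \<in> cube m" "\<rho> 1 y \<in> cube_bd m" "\<rho> 0 y = y" "y \<in> cube_bd m \<Longrightarrow> \<rho> s y = y"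
proof -
  have y: "y \<in> espace m" "nrm m y \<le> 1" "nrm m y > 0"
    using assms nrm_0_iff[of y m] nrm_nonneg[of m y] by (auto simp: cube_def)
  have n: "nrm m (\<rho> s y) = (1 - s) * nrm m y + s" if "s \<in> {0..1}" for s
  proof -
    have "nrm m (\<rho> s y) = \<bar>1 - s + s / nrm m y\<bar> * nrm m y"
      unfolding \<rho>_def[abs_def] by (rule nrm_scale)
    also have "\<bar>1 - s + s / nrm m y\<bar> = 1 - s + s / nrm m y"
      using that y by (intro abs_of_nonneg add_nonneg_nonneg) auto
    finally show ?thesis using y by (simp add: distrib_right)
  qed
  have e: "\<rho> s y \<in> espace m" for s using espace_scale(1)[OF y(1)] unfolding \<rho>_def[abs_def] .
  have "(1 - s) * nrm m y + s \<le> (1 - s) * 1 + s" using y assms by (intro add_mono mult_left_mono) auto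
  then show "\<rho> s y \<in> cube m" using e n[OF assms(3)] by (simp add: cube_def)
  show "\<rho> 1 y \<in> cube_bd m" using e n[of 1] by (simp add: cube_bd_def)
  show "\<rho> 0 y = y" by (simp add: \<rho>_def fun_eq_iff)
  show "\<rho> s y = y" if "y \<in> cube_bd m" using that by (simp add: \<rho>_def fun_eq_iff cube_bd_def)
qed

abbreviation "pc \<equiv> cube m - {\<lambda>_. 0}"

text \<open>The radial deformation read in \<open>X\<close>: points of \<open>A\<close> stay fixed,
  and a point of the open cell is pulled back to the cube, moved outwards, and mapped to
  \<open>X\<close> again. The two prescriptions match because \<rho> fixes the boundary of the
  cube.\<close>

definition push :: "real \<times> 'a \<Rightarrow> 'a" where
  "push = (\<lambda>(s, z). if z \<in> A then z else \<xi> (\<rho> s (inv_into (cube_int m) \<xi> z)))"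

lemma push_A: "z \<in> A \<Longrightarrow> push (s, z) = z"
  by (simp add: push_def)

lemma push_\<xi>:
  assumes "s \<in> {0..1}" "y \<in> pc"
  shows "push (s, \<xi> y) = \<xi> (\<rho> s y)"
proof (cases "y \<in> cube_bd m")
  case True
  then have "\<xi> y \<in> A" using bd by blast
  then show ?thesis using \<rho>(4)[of y s] assms True by (simp add: push_def)
next
  case False
  then have y: "y \<in> cube_int m" using assms cube_split(1) by blast
  then have "\<xi> y \<notin> A" using disj by blast
  moreover have "inv_into (cube_int m) \<xi> (\<xi> y) = y" using inj y by (rule inv_into_f_f)
  ultimately show ?thesis by (simp add: push_def)
qed

text \<open>Two closed pieces are pasted. On \<open>A\<close> the map is a projection. On the image
  of the punctured cube it descends from \<rho> along \<xi>, which is a quotient map there: it is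
  closed on the full cube by compactness, and the punctured cube is saturated because the centre
  shares its image with no other point.\<close>

lemma continuous_push:
  "continuous_map (prod_topology (top_of_set {0..1}) (subtopology X (A \<union> \<xi> ` pc))) X push"
proof -
  let ?I = "top_of_set {0..1::real}"
  let ?Z = "prod_topology ?I (subtopology X (A \<union> \<xi> ` pc))"
  let ?\<kappa> = "\<lambda>z :: real \<times> (nat \<Rightarrow> real). (fst z, \<xi> (snd z))"
  have AX: "A \<subseteq> topspace X" using closedin_subset[OF A] .
  have pcX: "\<xi> ` pc \<subseteq> topspace X" using \<xi>_in by blast
  have ckappa: "continuous_map (prod_topology ?I (top_of_set (cube m))) (prod_topology ?I X) ?\<kappa>"
    by (rule cm_paired[OF continuous_map_fst cm_comp[OF c\<xi> cm_proj(2)]])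
  have "closed_map (prod_topology ?I (top_of_set (cube m))) (prod_topology ?I X) ?\<kappa>"
  proof (rule continuous_imp_closed_map[OF ckappa])
    show "compact_space (prod_topology ?I (top_of_set (cube m)))"
      by (simp add: compact_space_subtopology compact_Times compact_cube)
    show "Hausdorff_space (prod_topology ?I X)"
      using X by (simp add: Hausdorff_space_prod_topology Hausdorff_space_subtopology)
  qed
  moreover have sat: "{z \<in> topspace (prod_topology ?I (top_of_set (cube m))). ?\<kappa> z \<in> {0..1} \<times> \<xi> ` pc} = {0..1} \<times> pc"
  proof (intro equalityI subsetI)
    fix z assume "z \<in> {z \<in> topspace (prod_topology ?I (top_of_set (cube m))). ?\<kappa> z \<in> {0..1} \<times> \<xi> ` pc}"
    then obtain s y y' where z: "z = (s, y)" "s \<in> {0..1}" "y \<in> cube m" "y' \<in> pc" "\<xi> y = \<xi> y'"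
      by (cases z) auto
    have "y \<noteq> (\<lambda>_. 0)" using \<xi>_eq[OF zero_cube_int, of y'] z by auto
    then show "z \<in> {0..1} \<times> pc" using z by simp
  qed auto
  ultimately have cl: "closed_map (subtopology (prod_topology ?I (top_of_set (cube m))) ({0..1} \<times> pc))
      (subtopology (prod_topology ?I X) ({0..1} \<times> \<xi> ` pc)) ?\<kappa>"
    by (rule closed_map_restriction)
  have e1: "subtopology (prod_topology ?I (top_of_set (cube m))) ({0..1} \<times> pc) = top_of_set ({0..1} \<times> pc)"
    by (simp add: subtopology_subtopology Times_Int_Times Int_absorb1)
  have "continuous_map (top_of_set ({0..1} \<times> pc)) (subtopology (prod_topology ?I X) ({0..1} \<times> \<xi> ` pc)) ?\<kappa>"
    using continuous_map_from_subtopology[OF ckappa, of "{0..1} \<times> pc"]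
    unfolding e1 by (auto simp: continuous_map_in_subtopology)
  moreover have "?\<kappa> ` ({0..1} \<times> pc) = {0..1} \<times> \<xi> ` pc" by force
  ultimately have q: "quotient_map (top_of_set ({0..1} \<times> pc)) (subtopology (prod_topology ?I X) ({0..1} \<times> \<xi> ` pc)) ?\<kappa>"
    using cl pcX unfolding e1 by (intro continuous_closed_imp_quotient_map) auto
  have "continuous_on ({0..1} \<times> pc) (\<lambda>z. \<rho> (fst z) (snd z))"
    unfolding \<rho>_def[abs_def]
  proof (intro continuous_on_coordinatewise_then_product continuous_intros)
    show "continuous_on ({0..1} \<times> pc) (\<lambda>z. nrm m (snd z))"
      by (rule continuous_on_compose2[OF continuous_nrm continuous_on_snd]) (auto intro: continuous_intros)
    show "continuous_on ({0..1} \<times> pc) (\<lambda>z. snd z i)" for i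
      by (rule continuous_on_compose2[OF continuous_coordinate continuous_on_snd]) (auto intro: continuous_intros)
    show "\<forall>z \<in> {0..1} \<times> pc. nrm m (snd z) \<noteq> 0"
      using nrm_0_iff by (auto simp: cube_def)
  qed
  moreover have "(\<lambda>z. \<rho> (fst z) (snd z)) ` ({0..1} \<times> pc) \<subseteq> cube m" by (auto intro: \<rho>(1))
  ultimately have "continuous_map (top_of_set ({0..1} \<times> pc)) (top_of_set (cube m)) (\<lambda>z. \<rho> (fst z) (snd z))"
    by (simp add: image_subset_iff_funcset)
  from continuous_map_compose[OF this c\<xi>]
  have "continuous_map (top_of_set ({0..1} \<times> pc)) X (push \<circ> ?\<kappa>)"
    by (rule continuous_map_eq) (auto intro!: push_\<xi>[symmetric])
  then have c1: "continuous_map (subtopology (prod_topology ?I X) ({0..1} \<times> \<xi> ` pc)) X push"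
    by (rule continuous_compose_quotient_map[OF q])
  have c2: "continuous_map (subtopology (prod_topology ?I X) ({0..1} \<times> A)) X push"
    by (rule continuous_map_eq[OF continuous_map_from_subtopology[OF cm_proj(2)]]) (auto simp: push_A)
  have Z: "?Z = subtopology (prod_topology ?I X) ({0..1} \<times> (A \<union> \<xi> ` pc))"
    by (simp only: prod_topology_subtopology(2) topspace_euclidean_subtopology)
  have TZ: "topspace ?Z = {0..1} \<times> (A \<union> \<xi> ` pc)" using AX pcX by auto
  have cA: "closedin ?Z ({0..1} \<times> A)"
  proof -
    have "closedin (prod_topology ?I X) ({0..1} \<times> A)"
      using A by (simp add: closedin_prod_Times_iff)
    then show ?thesis unfolding Z by (intro closedin_subset_topspace) auto
  qed
  have cP: "closedin ?Z ({0..1} \<times> \<xi> ` pc)"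
  proof -
    have "compactin X (\<xi> ` cube m)"
      using image_compactin[OF _ c\<xi>, of "cube m"] compact_cube by (simp add: compactin_subtopology)
    then have "closedin X (\<xi> ` cube m)" using X compactin_imp_closedin by blast
    then have "closedin (prod_topology ?I X) ({0..1} \<times> \<xi> ` cube m)"
      by (simp add: closedin_prod_Times_iff)
    then have "closedin ?Z (({0..1} \<times> \<xi> ` cube m) \<inter> ({0..1} \<times> (A \<union> \<xi> ` pc)))"
      unfolding Z closedin_subtopology by blast
    moreover have "({0..1} \<times> \<xi> ` cube m) \<inter> ({0..1} \<times> (A \<union> \<xi> ` pc)) = {0..1::real} \<times> \<xi> ` pc"
    proof -
      have "\<xi> (\<lambda>_. 0) \<notin> A" using zero_cube_int disj by blast
      then show ?thesis by auto
    qed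
    ultimately show ?thesis by simp
  qed
  show ?thesis
  proof (rule pasting_lemma_closed[where I = "UNIV :: bool set" and f = "\<lambda>_. push"
        and T = "\<lambda>b. if b then {0..1} \<times> A else {0..1} \<times> \<xi> ` pc"])
    show "closedin ?Z (if b then {0..1} \<times> A else {0..1} \<times> \<xi> ` pc)" for b
      using cA cP by simp
    show "continuous_map (subtopology ?Z (if b then {0..1} \<times> A else {0..1} \<times> \<xi> ` pc)) X push" for b
    proof -
      have "({0..1} \<times> (A \<union> \<xi> ` pc)) \<inter> ({0..1} \<times> A) = {0..1::real} \<times> A"
        "({0..1} \<times> (A \<union> \<xi> ` pc)) \<inter> ({0..1} \<times> \<xi> ` pc) = {0..1::real} \<times> \<xi> ` pc" by auto
      then show ?thesis unfolding Z using c1 c2 by (simp add: subtopology_subtopology)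
    qed
    show "\<exists>j. j \<in> UNIV \<and> x \<in> (if j then {0..1} \<times> A else {0..1} \<times> \<xi> ` pc) \<and> push x = push x"
      if "x \<in> topspace ?Z" for x
      using that TZ by (auto simp: ex_bool_eq)
  qed auto
qed

lemma push_map:
  assumes c: "continuous_map Y X \<phi>" and im: "\<phi> ` topspace Y \<subseteq> A \<union> \<xi> ` pc"
  shows "\<exists>\<phi>'. homotopic_with (\<lambda>_. True) Y X \<phi> \<phi>' \<and> \<phi>' ` topspace Y \<subseteq> A"
proof (intro exI conjI)
  let ?I = "top_of_set {0..1::real}"
  have "continuous_map (prod_topology ?I Y) (prod_topology ?I (subtopology X (A \<union> \<xi> ` pc))) (\<lambda>z. (fst z, \<phi> (snd z)))"
    using im by (intro cm_paired continuous_map_fst continuous_map_into_subtopology cm_comp[OF c cm_proj(2)])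
       (simp add: image_subset_iff Pi_iff)
  from continuous_map_compose[OF this continuous_push]
  have h: "continuous_map (prod_topology ?I Y) X (\<lambda>z. push (fst z, \<phi> (snd z)))" by (simp add: o_def)
  show "homotopic_with (\<lambda>_. True) Y X \<phi> (\<lambda>x. push (1, \<phi> x))"
  proof (rule homotopic_with_trueI[OF h])
    fix x assume "x \<in> topspace Y"
    then have "\<phi> x \<in> A \<union> \<xi> ` pc" using im by blast
    then show "push (fst (0, x), \<phi> (snd (0, x))) = \<phi> x"
    proof
      assume "\<phi> x \<in> \<xi> ` pc"
      then obtain y where "y \<in> pc" "\<phi> x = \<xi> y" by blast
      then show ?thesis using push_\<xi>[of 0 y] \<rho>(3)[of y 0] by simp
    qed (simp add: push_A)
  qed simp
  show "(\<lambda>x. push (1, \<phi> x)) ` topspace Y \<subseteq> A"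
  proof clarify
    fix x assume "x \<in> topspace Y"
    then have "\<phi> x \<in> A \<union> \<xi> ` pc" using im by blast
    then show "push (1, \<phi> x) \<in> A"
    proof
      assume "\<phi> x \<in> \<xi> ` pc"
      then obtain y where "y \<in> pc" "\<phi> x = \<xi> y" by blast
      then show ?thesis using push_\<xi>[of 1 y] \<rho>(2)[of y 1] bd by auto
    qed (simp add: push_A)
  qed
qed

text \<open>Where the map lies well inside the cell, its cell coordinates are moved towards q - y0,
  with \<open>q\<close> a Lipschitz approximation and \<open>y0\<close> a small vector that
  \<open>q\<close> never attains, so q - y0 never vanishes. A cut-off function blends this with the
  unchanged map further out.\<close>

lemma move_off_centre:
  assumes nm: "n \<le> m" and c: "continuous_map (top_of_set (cube_bd n)) X \<phi>"
    and im: "\<phi> ` cube_bd n \<subseteq> A \<union> \<xi> ` cube m"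
  shows "\<exists>\<phi>'. homotopic_with (\<lambda>_. True) (top_of_set (cube_bd n)) X \<phi> \<phi>' \<and>
    \<phi>' ` cube_bd n \<subseteq> A \<union> \<xi> ` pc"
proof -
  let ?B = "cube_bd n"
  \<comment> \<open>Changes take place at norm at most 3/4. Approximation error and missed vector
    are each at most 1/8 per coordinate, so the displacement has norm at most 1/4 and the moved
    point stays in the cube.\<close>
  let ?D = "{y \<in> espace m. nrm m y \<le> 3/4}"
  let ?R = "{y \<in> cube m. 3/4 \<le> nrm m y}"
  have closed_image: "closedin X (\<xi> ` E)" if "compact E" "E \<subseteq> cube m" for E
    using image_compactin[OF _ c\<xi>, of E] that X compactin_imp_closedin by (auto simp: compactin_subtopology)
  have D: "compact ?D" "?D \<subseteq> cube_int m" "?D \<subseteq> cube m"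
    using compact_nrm_ball[of "3/4" m] by (auto simp: cube_int_def cube_def)
  have "?R = cube m \<inter> {y. 3/4 \<le> nrm m y}" by auto
  then have R: "compact ?R" "?R \<subseteq> cube m"
    using compact_Int_closed[OF compact_cube closed_Collect_le[OF continuous_on_const continuous_nrm], of m "3/4" m]
    by auto
  define S where "S = {x \<in> ?B. \<phi> x \<in> \<xi> ` ?D}"
  define T where "T = {x \<in> ?B. \<phi> x \<in> A \<union> \<xi> ` ?R}"
  have cS: "closedin (top_of_set ?B) S" and cT: "closedin (top_of_set ?B) T"
    unfolding S_def T_def
    using closedin_continuous_map_preimage[OF c closed_image[OF D(1,3)]]
      closedin_continuous_map_preimage[OF c closedin_Un[OF A closed_image[OF R]]] by simp_all
  have SB: "S \<subseteq> ?B" and TB: "T \<subseteq> ?B" by (auto simp: S_def T_def)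
  have compS: "compact S" using cS compact_cube_bd closedin_compact by blast
  have ST: "?B \<subseteq> S \<union> T"
  proof
    fix x assume x: "x \<in> ?B"
    show "x \<in> S \<union> T"
    proof (cases "\<phi> x \<in> A")
      case False
      then obtain y where y: "y \<in> cube m" "\<phi> x = \<xi> y" using im x by blast
      then show ?thesis
        by (cases "nrm m y \<le> 3/4") (use x in \<open>auto simp: S_def T_def cube_def\<close>)
    qed (use x in \<open>simp add: T_def\<close>)
  qed
  define g where "g x = inv_into (cube_int m) \<xi> (\<phi> x)" for x
  have g: "g x \<in> ?D" "\<xi> (g x) = \<phi> x" if "x \<in> S" for x
  proof -
    obtain y where y: "y \<in> ?D" "\<phi> x = \<xi> y" using \<open>x \<in> S\<close> by (auto simp: S_def)
    then have "y \<in> cube_int m" using D(2) by blast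
    then have "g x = y" unfolding g_def y(2) by (rule inv_into_f_f[OF inj])
    then show "g x \<in> ?D" "\<xi> (g x) = \<phi> x" using y by simp_all
  qed
  \<comment> \<open>\<open>g\<close> gives the cell coordinates of \<phi>. It is continuous because
    \<xi> is a homeomorphism from the open cube onto the open cell, again by saturation.\<close>
  have cg: "continuous_on S g"
  proof -
    have diff: "cube m - cube_int m = cube_bd m" using cube_split by blast
    have hm: "homeomorphic_map (top_of_set (cube_int m)) (subtopology X (\<xi> ` cube_int m)) \<xi>"
      by (rule homeomorphic_map_saturated[OF compact_cube X c\<xi> _ inj])
         (use diff disj bd cube_split in blast)+
    obtain i where i: "homeomorphic_maps (top_of_set (cube_int m)) (subtopology X (\<xi> ` cube_int m)) \<xi> i"
      using hm homeomorphic_map_maps by blast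
    have ci: "continuous_map (subtopology X (\<xi> ` cube_int m)) (top_of_set (cube_int m)) i"
      and i\<xi>: "\<And>y. y \<in> cube_int m \<Longrightarrow> i (\<xi> y) = y"
      using i by (auto simp: homeomorphic_maps_def)
    have "continuous_map (top_of_set S) (subtopology X (\<xi> ` cube_int m)) \<phi>"
    proof (rule continuous_map_into_subtopology)
      show "continuous_map (top_of_set S) X \<phi>"
        using continuous_map_from_subtopology[OF c, of S] SB by (simp add: subtopology_subtopology Int_absorb1)
      show "\<phi> \<in> topspace (top_of_set S) \<rightarrow> \<xi> ` cube_int m"
        using D(2) by (auto simp: S_def)
    qed
    from continuous_map_compose[OF this ci] have "continuous_map (top_of_set S) (top_of_set (cube_int m)) (i \<circ> \<phi>)" .
    then have "continuous_on S (i \<circ> \<phi>)" by simp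
    moreover have "(i \<circ> \<phi>) x = g x" if "x \<in> S" for x
      using i\<xi>[of "g x"] g[OF that] D(2) by auto
    ultimately show ?thesis by (metis (no_types, lifting) continuous_on_cong)
  qed
  have cgi: "continuous_on S (\<lambda>x. g x i)" for i
    by (rule continuous_on_compose2[OF continuous_coordinate[of UNIV] cg]) simp
  have cgn: "continuous_on S (\<lambda>x. nrm m (g x))"
    by (rule continuous_on_compose2[OF continuous_nrm[of UNIV] cg]) simp
  have "S \<subseteq> espace n" using SB by (auto simp: cube_bd_def)
  then interpret FR: function_ring_on "{f. lip n S f}" S by (rule lip_ring[OF compS])
  have "\<forall>i. \<exists>q. lip n S q \<and> (\<forall>x\<in>S. \<bar>g x i - q x\<bar> < 1/8)"
    using FR.Stone_Weierstrass_basic[OF cgi, of "1/8"] by auto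
  then obtain q where q: "\<And>i. lip n S (q i)" "\<And>i x. x \<in> S \<Longrightarrow> \<bar>g x i - q i x\<bar> < 1/8" by metis
  obtain L where L: "\<And>i. 0 \<le> L i" "\<And>i. lip_const n S (L i) (q i)"
    using q(1) unfolding lip_def by metis
  define M where "M = (\<Sum>i<m. L i)"
  have M: "0 \<le> M" "\<And>i. i < m \<Longrightarrow> L i \<le> M"
    unfolding M_def using L(1) by (auto intro: sum_nonneg member_le_sum)
  have "\<exists>y. (\<forall>i<m. \<bar>y i\<bar> \<le> 1/8) \<and> (\<forall>x\<in>S. \<exists>i<m. q i x \<noteq> y i)"
  proof (rule Lipschitz_misses_point[OF nm SB M(1), where q = "\<lambda>x i. q i x"])
    fix x y i assume "x \<in> S" "y \<in> S" "i < m"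
    then have "\<bar>q i x - q i y\<bar> \<le> L i * nrm n (\<lambda>j. x j - y j)" using L(2) by (simp add: lip_const_def)
    also have "\<dots> \<le> M * nrm n (\<lambda>j. x j - y j)"
      using M(2)[OF \<open>i < m\<close>] nrm_nonneg by (rule mult_right_mono)
    finally show "\<bar>q i x - q i y\<bar> \<le> M * nrm n (\<lambda>j. x j - y j)" .
  qed simp
  then obtain y0 where y0: "\<And>i. i < m \<Longrightarrow> \<bar>y0 i\<bar> \<le> 1/8" "\<And>x. x \<in> S \<Longrightarrow> \<exists>i<m. q i x \<noteq> y0 i"
    by blast
  \<comment> \<open>The displacement from \<open>g x\<close> to q x - y0, extended by zero so that
    the result stays in \<open>espace m\<close>.\<close>
  define v where "v x i = (if i < m then q i x - y0 i - g x i else 0)" for x i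
  \<comment> \<open>The cut-off is 1 up to norm 1/2 and 0 from norm 3/4 on. Where it equals 1, the
    map ends at q x - y0, which is nonzero; where it is smaller, the norm exceeds 1/2 while the
    displacement is at most 1/4, so the centre is not reached either.\<close>
  define l where "l x = max 0 (min 1 (3 - 4 * nrm m (g x)))" for x
  have l: "0 \<le> l x" "l x \<le> 1" for x by (auto simp: l_def)
  have cl: "continuous_on S l" unfolding l_def by (intro continuous_intros cgn)
  have cv: "continuous_on S (\<lambda>x. v x i)" for i
    unfolding v_def using q(1)[of i] lip_continuous cgi by (cases "i < m") (auto intro!: continuous_intros)
  have nv: "nrm m (v x) \<le> 1/4" if "x \<in> S" for x
  proof -
    have "\<bar>v x i\<bar> \<le> 1/4" if "i < m" for i
    proof -
      have "\<bar>q i x - y0 i - g x i\<bar> \<le> 1/4"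
        using q(2)[OF \<open>x \<in> S\<close>, of i] y0(1)[OF that] by linarith
      then show ?thesis using that by (simp add: v_def)
    qed
    then show ?thesis by (subst nrm_le_iff) auto
  qed
  define w where "w s x i = g x i + (s * l x) * v x i" for s x i
  have w: "w s x \<in> cube m" if "x \<in> S" "s \<in> {0..1}" for s x
  proof -
    have "nrm m (\<lambda>i. (s * l x) * v x i) = \<bar>s * l x\<bar> * nrm m (v x)" by (rule nrm_scale)
    also have "\<dots> \<le> 1 * (1/4)"
      using that l[of x] nv[OF that(1)] nrm_nonneg by (intro mult_mono) (auto simp: abs_mult mult_le_one)
    finally have "nrm m (w s x) \<le> 1"
      using nrm_triangle[of m "g x" "\<lambda>i. (s * l x) * v x i"] g(1)[OF that(1)] by (simp add: w_def[abs_def])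
    moreover have "w s x \<in> espace m" using g(1)[OF that(1)] by (simp add: w_def v_def espace_def)
    ultimately show ?thesis by (simp add: cube_def)
  qed
  have w_nonzero: "w 1 x \<noteq> (\<lambda>_. 0)" if xS: "x \<in> S" for x
  proof
    assume w0: "w 1 x = (\<lambda>_. 0)"
    show False
    proof (cases "l x = 1")
      case True
      obtain i where "i < m" "q i x \<noteq> y0 i" using y0(2)[OF xS] by blast
      then show False using fun_cong[OF w0, of i] True by (simp add: w_def v_def)
    next
      case False
      then have "nrm m (g x) > 1/2" by (auto simp: l_def)
      moreover have "g x = (\<lambda>i. - l x * v x i)"
        using w0 by (simp add: w_def fun_eq_iff add_eq_0_iff)
      then have "nrm m (g x) = \<bar>l x\<bar> * nrm m (v x)" using nrm_scale[of m "- l x" "v x"] by simp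
      moreover have "\<bar>l x\<bar> * nrm m (v x) \<le> 1 * (1/4)"
        using l[of x] nv[OF xS] nrm_nonneg by (intro mult_mono) auto
      ultimately show False by simp
    qed
  qed
  define H where "H z = (if snd z \<in> S then \<xi> (w (fst z) (snd z)) else \<phi> (snd z))" for z
  have HT: "H (s, x) = \<phi> x" if xT: "x \<in> T" for s x
  proof (cases "x \<in> S")
    case True
    have gi: "g x \<in> cube_int m" using g(1)[OF True] D(2) by blast
    then have "\<phi> x \<notin> A" using g(2)[OF True] disj by (metis IntI empty_iff imageI)
    then obtain y where y: "y \<in> cube m" "3/4 \<le> nrm m y" "\<phi> x = \<xi> y" using xT by (auto simp: T_def)
    have "g x = y" by (rule \<xi>_eq[OF gi y(1)]) (simp add: g(2)[OF True] y(3))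
    then have "l x = 0" using y(2) by (simp add: l_def)
    then have "w s x = g x" by (simp add: w_def fun_eq_iff)
    then show ?thesis using True g(2)[OF True] by (simp add: H_def)
  qed (simp add: H_def)
  have cH: "continuous_map (top_of_set ({0..1} \<times> ?B)) X H"
  proof (rule pasting_lemma_closed[where I = "UNIV :: bool set" and T = "\<lambda>b. {0..1} \<times> (if b then S else T)"
        and f = "\<lambda>b z. if b then \<xi> (w (fst z) (snd z)) else \<phi> (snd z)"])
    have cl01: "closedin (top_of_set {0..1::real}) {0..1}" by simp
    show "closedin (top_of_set ({0..1} \<times> ?B)) ({0..1} \<times> (if b then S else T))" for b
      using cS cT by (cases b) (simp_all add: closedin_Times)
    have c1: "continuous_map (top_of_set ({0..1} \<times> S)) X (\<lambda>z. \<xi> (w (fst z) (snd z)))"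
    proof -
      have comp: "continuous_on ({0..1} \<times> S) (\<lambda>z. h (snd z))" if "continuous_on S h" for h :: "(nat \<Rightarrow> real) \<Rightarrow> real"
        by (rule continuous_on_compose2[OF that]) (auto intro: continuous_intros)
      have "continuous_on ({0..1} \<times> S) (\<lambda>z. w (fst z) (snd z))"
        unfolding w_def[abs_def]
        by (intro continuous_on_coordinatewise_then_product continuous_intros comp cgi cl cv)
      then have "continuous_map (top_of_set ({0..1} \<times> S)) (top_of_set (cube m)) (\<lambda>z. w (fst z) (snd z))"
        using w by (auto simp: continuous_map_in_subtopology)
      from continuous_map_compose[OF this c\<xi>] show ?thesis by (simp add: o_def)
    qed
    have c2: "continuous_map (top_of_set ({0..1::real} \<times> T)) X (\<lambda>z. \<phi> (snd z))"
    proof -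
      have "continuous_map (top_of_set ({0..1::real} \<times> T)) (top_of_set ?B) snd"
        using TB by (auto simp: continuous_map_in_subtopology intro: continuous_intros)
      from continuous_map_compose[OF this c] show ?thesis by (simp add: o_def)
    qed
    show "continuous_map (subtopology (top_of_set ({0..1} \<times> ?B)) ({0..1} \<times> (if b then S else T))) X
        (\<lambda>z. if b then \<xi> (w (fst z) (snd z)) else \<phi> (snd z))" for b
    proof -
      have "({0..1} \<times> ?B) \<inter> ({0..1} \<times> S) = {0..1::real} \<times> S" "({0..1} \<times> ?B) \<inter> ({0..1} \<times> T) = {0..1::real} \<times> T"
        using SB TB by auto
      then show ?thesis using c1 c2 by (cases b) (simp_all add: subtopology_subtopology)
    qed
    fix z :: "real \<times> (nat \<Rightarrow> real)"
    assume "z \<in> topspace (top_of_set ({0..1} \<times> ?B))"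
    then have "snd z \<in> S \<or> snd z \<in> T" "fst z \<in> {0..1}" using ST by auto
    then show "\<exists>j. j \<in> UNIV \<and> z \<in> {0..1} \<times> (if j then S else T) \<and> H z = (if j then \<xi> (w (fst z) (snd z)) else \<phi> (snd z))"
    proof (cases "snd z \<in> S")
      case True
      then show ?thesis using \<open>fst z \<in> {0..1}\<close> by (intro exI[of _ True]) (auto simp: H_def mem_Times_iff)
    next
      case False
      then show ?thesis using \<open>fst z \<in> {0..1}\<close> \<open>snd z \<in> S \<or> snd z \<in> T\<close>
        by (intro exI[of _ False]) (auto simp: H_def mem_Times_iff)
    qed
  next
    fix i j and z :: "real \<times> (nat \<Rightarrow> real)" assume z: "z \<in> topspace (top_of_set ({0..1} \<times> ?B)) \<inter> ({0..1} \<times> (if i then S else T)) \<inter> ({0..1} \<times> (if j then S else T))"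
    have "\<xi> (w (fst z) (snd z)) = \<phi> (snd z)" if "snd z \<in> S" "snd z \<in> T"
      using HT[OF that(2), of "fst z"] that(1) by (simp add: H_def)
    then show "(if i then \<xi> (w (fst z) (snd z)) else \<phi> (snd z)) = (if j then \<xi> (w (fst z) (snd z)) else \<phi> (snd z))"
      using z by (cases i; cases j) (auto simp: mem_Times_iff)
  qed simp
  have H0: "H (0, x) = \<phi> x" if "x \<in> ?B" for x
  proof (cases "x \<in> S")
    case True
    have "w 0 x = g x" by (simp add: w_def fun_eq_iff)
    then show ?thesis using g(2)[OF True] True by (simp add: H_def)
  qed (simp add: H_def)
  have "homotopic_with (\<lambda>_. True) (top_of_set ?B) X \<phi> (\<lambda>x. H (1, x))"
    by (rule homotopic_with_trueI[where h = H]) (use cH H0 in simp_all)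
  moreover have "(\<lambda>x. H (1, x)) ` ?B \<subseteq> A \<union> \<xi> ` pc"
  proof clarify
    fix x assume x: "x \<in> ?B" "H (1, x) \<notin> \<xi> ` pc"
    have "x \<notin> S"
    proof
      assume S: "x \<in> S"
      then have "w 1 x \<in> pc" using w[OF S, of 1] w_nonzero[OF S] by simp
      then show False using x(2) S by (simp add: H_def)
    qed
    then have "x \<in> T" using x(1) ST by blast
    then have "\<phi> x \<in> A \<union> \<xi> ` ?R" "H (1, x) = \<phi> x" using HT by (simp_all add: T_def)
    moreover have "?R \<subseteq> pc" using nrm_0_iff[of "\<lambda>_. 0" m] by (auto simp: cube_def)
    ultimately show "H (1, x) \<in> A" using x(2) by auto
  qed
  ultimately show ?thesis by blast
qed

lemma push_off_cell:
  assumes "n \<le> m" "continuous_map (top_of_set (cube_bd n)) X \<phi>" "\<phi> ` cube_bd n \<subseteq> A \<union> \<xi> ` cube m"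
  shows "\<exists>\<phi>'. homotopic_with (\<lambda>_. True) (top_of_set (cube_bd n)) X \<phi> \<phi>' \<and> \<phi>' ` cube_bd n \<subseteq> A"
proof -
  obtain \<phi>1 where 1: "homotopic_with (\<lambda>_. True) (top_of_set (cube_bd n)) X \<phi> \<phi>1" "\<phi>1 ` cube_bd n \<subseteq> A \<union> \<xi> ` pc"
    using move_off_centre[OF assms] by blast
  obtain \<phi>2 where 2: "homotopic_with (\<lambda>_. True) (top_of_set (cube_bd n)) X \<phi>1 \<phi>2" "\<phi>2 ` cube_bd n \<subseteq> A"
    using push_map[of "top_of_set (cube_bd n)" \<phi>1] 1 homotopic_with_imp_continuous_maps[OF 1(1)] by auto
  show ?thesis using homotopic_with_trans[OF 1(1) 2(1)] 2(2) by blast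
qed

end

text \<open>Cells of dimension at least \<open>n\<close> are vacated one at a time, the largest
  dimension first. For a cell of top dimension among those still occupied, the union of the
  remaining cells is closed and contains its boundary, which is the situation of
  \<open>cell_push\<close>.\<close>

lemma cellular_approximation:
  assumes CW: "cube_CW X N d \<Psi>" and c: "continuous_map (top_of_set (cube_bd n)) X \<phi>"
  shows "\<exists>\<phi>'. homotopic_with (\<lambda>_. True) (top_of_set (cube_bd n)) X \<phi> \<phi>' \<and>
    \<phi>' ` cube_bd n \<subseteq> (\<Union>j\<in>{j. j < N \<and> d j < n}. \<Psi> j ` cube_int (d j))"
proof -
  note D = cube_CW_D[OF CW]
  define U where "U J = (\<Union>j\<in>J. \<Psi> j ` cube_int (d j))" for J
  \<comment> \<open>The index set \<open>J\<close> contains with a cell all cells of smaller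
    dimension. This keeps the union a subcomplex when a cell of maximal dimension is
    removed.\<close>
  have main: "\<exists>\<phi>'. homotopic_with (\<lambda>_. True) (top_of_set (cube_bd n)) X \<phi> \<phi>' \<and>
      \<phi>' ` cube_bd n \<subseteq> U {j. j < N \<and> d j < n}"
    if "J \<subseteq> {..<N}" "\<forall>j\<in>J. \<forall>k<N. d k < d j \<longrightarrow> k \<in> J" "continuous_map (top_of_set (cube_bd n)) X \<phi>"
      "\<phi> ` cube_bd n \<subseteq> U J" for J \<phi>
    using that
  proof (induction "card J" arbitrary: J \<phi>)
    case 0
    then have "J = {}" using finite_subset[OF 0(2)] by simp
    then show ?case using 0 by (intro exI[of _ \<phi>]) (auto simp: U_def)
  next
    case (Suc r)
    have fin: "finite J" using finite_subset[OF Suc.prems(1)] by simp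
    have "J \<noteq> {}" using Suc.hyps(2) by auto
    then have "Max (d ` J) \<in> d ` J" using fin by simp
    then obtain i where "Max (d ` J) = d i" "i \<in> J" by (rule imageE)
    then have i: "i \<in> J" "d i = Max (d ` J)" by simp_all
    have mx: "d j \<le> d i" if "j \<in> J" for j using fin that i(2) by simp
    have iN: "i < N" using i(1) Suc.prems(1) by blast
    show ?case
    proof (cases "d i < n")
      case True
      then have "J \<subseteq> {j. j < N \<and> d j < n}" using mx Suc.prems(1) by fastforce
      then have "U J \<subseteq> U {j. j < N \<and> d j < n}" unfolding U_def by blast
      then show ?thesis using Suc.prems(3,4) by (intro exI[of _ \<phi>]) auto
    next
      case False
      let ?J = "J - {i}"
      have J: "?J \<subseteq> {..<N}" "\<forall>j\<in>?J. \<forall>k<N. d k < d j \<longrightarrow> k \<in> ?J"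
      proof -
        show "?J \<subseteq> {..<N}" using Suc.prems(1) by blast
        show "\<forall>j\<in>?J. \<forall>k<N. d k < d j \<longrightarrow> k \<in> ?J"
        proof (intro ballI allI impI)
          fix j k assume "j \<in> ?J" "k < N" "d k < d j"
          then show "k \<in> ?J" using Suc.prems(2) mx[of j] by force
        qed
      qed
      have sub: "\<Psi> j ` cube (d j) \<subseteq> U ?J" if "j \<in> ?J" for j
      proof -
        have "\<Psi> j ` cube_bd (d j) \<subseteq> (\<Union>k\<in>{k. k < N \<and> d k < d j}. \<Psi> k ` cube_int (d k))"
          using D(6) that J(1) by blast
        also have "\<dots> \<subseteq> U ?J"
        proof -
          have "{k. k < N \<and> d k < d j} \<subseteq> ?J" using J(2) that by blast
          then show ?thesis unfolding U_def by (rule UN_mono) simp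
        qed
        finally show ?thesis unfolding cube_split(1) image_Un using that by (auto simp: U_def)
      qed
      \<comment> \<open>Since the boundary of each cell lies in cells that are also present, open
        and closed cells have the same union, and this union is compact.\<close>
      have "U ?J = (\<Union>j\<in>?J. \<Psi> j ` cube (d j))"
      proof
        show "U ?J \<subseteq> (\<Union>j\<in>?J. \<Psi> j ` cube (d j))" unfolding U_def cube_split(1) by blast
        show "(\<Union>j\<in>?J. \<Psi> j ` cube (d j)) \<subseteq> U ?J" by (intro UN_least sub)
      qed
      moreover have "compactin X (\<Union>j\<in>?J. \<Psi> j ` cube (d j))"
      proof (rule compactin_Union)
        show "compactin X S" if S: "S \<in> (\<lambda>j. \<Psi> j ` cube (d j)) ` ?J" for S
        proof -
          obtain j where j: "j \<in> ?J" "S = \<Psi> j ` cube (d j)" using S by blast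
          have "continuous_map (top_of_set (cube (d j))) X (\<Psi> j)" using D(2) j(1) J(1) by blast
          then show ?thesis unfolding j(2)
            by (rule image_compactin[rotated]) (simp add: compactin_subtopology compact_cube)
        qed
      qed (use fin in simp)
      ultimately have clU: "closedin X (U ?J)" using compactin_imp_closedin[OF D(1)] by simp
      interpret cell_push X "U ?J" "d i" "\<Psi> i"
      proof
        show "Hausdorff_space X" "closedin X (U ?J)" "continuous_map (top_of_set (cube (d i))) X (\<Psi> i)"
          "inj_on (\<Psi> i) (cube_int (d i))" by (fact D(1) clU D(2)[OF iN] D(3)[OF iN])+
        have "\<Psi> i ` cube_int (d i) \<inter> \<Psi> j ` cube_int (d j) = {}" if "j \<in> ?J" for j
          using that J(1) by (intro D(4) iN) auto
        then show "\<Psi> i ` cube_int (d i) \<inter> U ?J = {}" unfolding U_def by blast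
        have "\<Psi> i ` cube_bd (d i) \<subseteq> (\<Union>k\<in>{k. k < N \<and> d k < d i}. \<Psi> k ` cube_int (d k))"
          by (rule D(6)[OF iN])
        also have "\<dots> \<subseteq> U ?J"
        proof -
          have "{k. k < N \<and> d k < d i} \<subseteq> ?J" using Suc.prems(2) i(1) by blast
          then show ?thesis unfolding U_def by (rule UN_mono) simp
        qed
        finally show "\<Psi> i ` cube_bd (d i) \<subseteq> U ?J" .
      qed
      have "U J \<subseteq> U ?J \<union> \<Psi> i ` cube (d i)" unfolding U_def cube_split(1) by blast
      then have "\<phi> ` cube_bd n \<subseteq> U ?J \<union> \<Psi> i ` cube (d i)" using Suc.prems(4) by blast
      then obtain \<phi>1 where 1: "homotopic_with (\<lambda>_. True) (top_of_set (cube_bd n)) X \<phi> \<phi>1" "\<phi>1 ` cube_bd n \<subseteq> U ?J"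
        using push_off_cell[OF _ Suc.prems(3)] False by (metis not_less)
      have "r = card ?J" using Suc.hyps(2) i(1) fin by simp
      from Suc.hyps(1)[OF this J conjunct2[OF homotopic_with_imp_continuous_maps[OF 1(1)]] 1(2)]
      show ?thesis using homotopic_with_trans[OF 1(1)] by blast
    qed
  qed
  have "\<phi> ` cube_bd n \<subseteq> U {..<N}"
    using continuous_map_image_subset_topspace[OF c] D(5) by (simp add: U_def)
  then show ?thesis using main[of "{..<N}" \<phi>] c by (simp add: U_def)
qed

section \<open>Spaces built from a point by attaching cells\<close>

text \<open>The boundary of a new cell only has to land in the part already built, whatever the
  dimensions involved. This weaker notion is inherited by cylinders of maps that are not
  cellular.\<close>

inductive cell_built :: "'a topology \<Rightarrow> 'a \<Rightarrow> 'a set \<Rightarrow> bool" for X x0 where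
  point: "x0 \<in> topspace X \<Longrightarrow> cell_built X x0 {x0}"
| cell: "\<lbrakk>cell_built X x0 A; continuous_map (top_of_set (cube n)) X \<xi>; inj_on \<xi> (cube_int n);
    \<xi> ` cube_int n \<inter> A = {}; \<xi> ` cube_bd n \<subseteq> A\<rbrakk> \<Longrightarrow> cell_built X x0 (A \<union> \<xi> ` cube n)"

lemma cube_map_in:
  "continuous_map (top_of_set (cube n)) X \<xi> \<Longrightarrow> y \<in> cube n \<Longrightarrow> \<xi> y \<in> topspace X"
  using continuous_map_image_subset_topspace[of "top_of_set (cube n)" X \<xi>] by auto

lemma compactin_cube_image:
  "continuous_map (top_of_set (cube n)) X \<xi> \<Longrightarrow> compactin X (\<xi> ` cube n)"
  by (rule image_compactin[of "top_of_set (cube n)"]) (simp_all add: compactin_subtopology compact_cube)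

lemma cell_built_facts:
  assumes "cell_built X x0 A"
  shows "x0 \<in> A" "compactin X A" "A \<subseteq> topspace X"
proof -
  have "x0 \<in> A \<and> compactin X A"
    using assms by induction (auto intro: compactin_Un compactin_cube_image)
  then show "x0 \<in> A" "compactin X A" "A \<subseteq> topspace X"
    using compactin_subset_topspace by auto
qed

text \<open>Splitting off the coordinate with index \<open>n\<close> presents the cube of dimension
  \<open>Suc n\<close> as the product of a cube of dimension \<open>n\<close> with [-1, 1]; its
  boundary consists of the sides and the two ends.\<close>

lemma cube_SucD:
  assumes "y \<in> cube (Suc n)"
  shows "y(n := 0) \<in> cube n" "\<bar>y n\<bar> \<le> 1"
    "y \<in> cube_int (Suc n) \<Longrightarrow> y(n := 0) \<in> cube_int n \<and> \<bar>y n\<bar> < 1"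
    "y \<in> cube_bd (Suc n) \<Longrightarrow> y(n := 0) \<in> cube_bd n \<or> \<bar>y n\<bar> = 1"
proof -
  have n: "nrm n (y(n := 0)) = nrm n y" by (rule nrm_cong) simp
  have e: "y \<in> espace (Suc n)" using assms by (simp add: cube_def)
  then have "y(n := 0) \<in> espace n" by (auto simp: espace_def le_less_Suc_eq Suc_le_eq)
  then show "y(n := 0) \<in> cube n" "\<bar>y n\<bar> \<le> 1"
    "y \<in> cube_int (Suc n) \<Longrightarrow> y(n := 0) \<in> cube_int n \<and> \<bar>y n\<bar> < 1"
    "y \<in> cube_bd (Suc n) \<Longrightarrow> y(n := 0) \<in> cube_bd n \<or> \<bar>y n\<bar> = 1"
    using assms n by (auto simp: cube_def cube_int_def cube_bd_def max_def split: if_splits)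
qed

lemma cube_SucI:
  assumes "x \<in> cube n" "\<bar>t\<bar> \<le> 1"
  shows "x(n := t) \<in> cube (Suc n)" "(x(n := t))(n := 0) = x"
proof -
  have "nrm n (x(n := t)) = nrm n x" by (rule nrm_cong) simp
  then show "x(n := t) \<in> cube (Suc n)" using assms by (auto simp: cube_def espace_def)
  show "(x(n := t))(n := 0) = x" using assms by (auto simp: cube_def espace_def fun_eq_iff)
qed

lemma continuous_fun_upd: "continuous_on S (\<lambda>y :: nat \<Rightarrow> real. y(n := c))"
proof (rule continuous_on_coordinatewise_then_product)
  show "continuous_on S (\<lambda>y. (y(n := c)) i)" for i
    by (cases "i = n") (simp_all add: continuous_coordinate)
qed

context dmc
begin

lemma cell_built_iL:
  assumes "cell_built (spc L0) (bpt L0) A"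
  shows "cell_built (spc C) (bpt C) (iL ` A)"
  using assms
proof induction
  case point
  then show ?case using cell_built.point[OF bC] by (simp add: iL_bpt)
next
  case (cell A n \<xi>)
  have in0: "\<And>y. y \<in> cube n \<Longrightarrow> \<xi> y \<in> topspace (spc L0)" by (rule cube_map_in[OF cell(2)])
  have A: "A \<subseteq> topspace (spc L0)" by (rule cell_built_facts[OF cell(1)])
  have int: "cube_int n \<subseteq> cube n" using cube_split by blast
  have "cell_built (spc C) (bpt C) (iL ` A \<union> (iL \<circ> \<xi>) ` cube n)"
  proof (rule cell_built.cell[OF cell.IH])
    show "continuous_map (top_of_set (cube n)) (spc C) (iL \<circ> \<xi>)"
      by (rule continuous_map_compose[OF cell(2) cm_iL])
    show "inj_on (iL \<circ> \<xi>) (cube_int n)"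
    proof (rule comp_inj_on[OF cell(3)])
      show "inj_on iL (\<xi> ` cube_int n)"
        using in0 int by (intro inj_onI) (auto simp: iL_eq subset_iff)
    qed
    show "(iL \<circ> \<xi>) ` cube_int n \<inter> iL ` A = {}"
    proof (rule equals0I)
      fix z assume "z \<in> (iL \<circ> \<xi>) ` cube_int n \<inter> iL ` A"
      then obtain y a where ya: "y \<in> cube_int n" "a \<in> A" "iL (\<xi> y) = iL a" by auto
      then have "\<xi> y = a" using iL_eq[of "\<xi> y" a] in0 int A by blast
      then show False using cell(4) ya by blast
    qed
    show "(iL \<circ> \<xi>) ` cube_bd n \<subseteq> iL ` A" using cell(5) by auto
  qed
  then show ?case by (simp add: image_Un image_comp)
qed

lemma cell_built_iR:
  assumes "cell_built (spc L1) (bpt L1) B" and L0: "cell_built (spc L0) (bpt L0) (topspace (spc L0))"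
  shows "cell_built (spc C) (bpt C) (iL ` topspace (spc L0) \<union> iR ` B)"
  using assms(1)
proof induction
  case point
  \<comment> \<open>The two base points are identified in the cylinder, so the building of the right
    end starts at a point that is already present.\<close>
  have "iR (bpt L1) \<in> iL ` topspace (spc L0)" using bL0 iL_bpt iR_bpt by (metis imageI)
  then show ?case using cell_built_iL[OF L0] by (simp add: insert_absorb)
next
  case (cell B n \<xi>)
  have in1: "\<And>y. y \<in> cube n \<Longrightarrow> \<xi> y \<in> topspace (spc L1)" by (rule cube_map_in[OF cell(2)])
  note B = cell_built_facts[OF cell(1)]
  have int: "cube_int n \<subseteq> cube n" using cube_split by blast
  have "cell_built (spc C) (bpt C) ((iL ` topspace (spc L0) \<union> iR ` B) \<union> (iR \<circ> \<xi>) ` cube n)"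
  proof (rule cell_built.cell[OF cell.IH])
    show "continuous_map (top_of_set (cube n)) (spc C) (iR \<circ> \<xi>)"
      by (rule continuous_map_compose[OF cell(2) cm_iR])
    show "inj_on (iR \<circ> \<xi>) (cube_int n)"
    proof (rule comp_inj_on[OF cell(3)])
      show "inj_on iR (\<xi> ` cube_int n)"
        using in1 int by (intro inj_onI) (auto simp: iR_eq subset_iff)
    qed
    show "(iR \<circ> \<xi>) ` cube_int n \<inter> (iL ` topspace (spc L0) \<union> iR ` B) = {}"
    proof (rule equals0I)
      fix z assume "z \<in> (iR \<circ> \<xi>) ` cube_int n \<inter> (iL ` topspace (spc L0) \<union> iR ` B)"
      then obtain y where y: "y \<in> cube_int n" "iR (\<xi> y) \<in> iL ` topspace (spc L0) \<union> iR ` B" by auto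
      have yB: "\<xi> y \<notin> B" using cell(4) y by blast
      have yt: "\<xi> y \<in> topspace (spc L1)" using in1 int y by blast
      from y(2) show False
      proof
        assume "iR (\<xi> y) \<in> iL ` topspace (spc L0)"
        then obtain x where "x \<in> topspace (spc L0)" "iL x = iR (\<xi> y)" by (metis imageE)
        then have "\<xi> y = bpt L1" using iL_iR_eq[OF _ yt] by blast
        then show False using yB B(1) by simp
      next
        assume "iR (\<xi> y) \<in> iR ` B"
        then obtain b where "b \<in> B" "iR (\<xi> y) = iR b" by blast
        then have "\<xi> y = b" using iR_eq[OF yt, of b] B(3) by blast
        then show False using yB \<open>b \<in> B\<close> by simp
      qed
    qed
    show "(iR \<circ> \<xi>) ` cube_bd n \<subseteq> iL ` topspace (spc L0) \<union> iR ` B" using cell(5) by auto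
  qed
  then show ?case by (simp add: image_Un image_comp Un_assoc)
qed

text \<open>Each cell of \<open>K\<close> contributes its product with the interval, a cell of one
  dimension more. Its two ends are mapped into \<open>L0\<close> and \<open>L1\<close> by
  \<open>f\<close> and \<open>g\<close>, and its sides lie over the part of \<open>K\<close> treated
  before. The line over the base point is collapsed and contributes nothing.\<close>

lemma cell_built_iM:
  assumes "cell_built (spc K) (bpt K) A" and L0: "cell_built (spc L0) (bpt L0) (topspace (spc L0))"
    and L1: "cell_built (spc L1) (bpt L1) (topspace (spc L1))"
  shows "cell_built (spc C) (bpt C) (iL ` topspace (spc L0) \<union> iR ` topspace (spc L1)
    \<union> (\<lambda>z. iM (fst z) (snd z)) ` ({0..1} \<times> A))"
  using assms(1)
proof induction
  case point
  have "(\<lambda>z. iM (fst z) (snd z)) ` ({0..1} \<times> {bpt K}) \<subseteq> iL ` topspace (spc L0)"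
  proof (rule image_subsetI)
    fix z :: "real \<times> 'k" assume "z \<in> {0..1} \<times> {bpt K}"
    then have "iM (fst z) (snd z) = iL (bpt L0)" using iM_bpt[of "fst z"] by (auto simp: iL_bpt)
    then show "iM (fst z) (snd z) \<in> iL ` topspace (spc L0)" using bL0 by simp
  qed
  then have "iL ` topspace (spc L0) \<union> iR ` topspace (spc L1)
    \<union> (\<lambda>z. iM (fst z) (snd z)) ` ({0..1} \<times> {bpt K}) = iL ` topspace (spc L0) \<union> iR ` topspace (spc L1)"
    by blast
  then show ?case using cell_built_iR[OF L1 L0] by simp
next
  case (cell A n \<xi>)
  let ?B = "iL ` topspace (spc L0) \<union> iR ` topspace (spc L1) \<union> (\<lambda>z. iM (fst z) (snd z)) ` ({0..1} \<times> A)"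
  have inK: "\<And>y. y \<in> cube n \<Longrightarrow> \<xi> y \<in> topspace (spc K)" by (rule cube_map_in[OF cell(2)])
  note A = cell_built_facts[OF cell(1)]
  \<comment> \<open>The last coordinate of the cube, in [-1, 1], is rescaled to the cylinder
    parameter in [0, 1]; the other coordinates are fed to the characteristic map of the cell of
    \<open>K\<close>.\<close>
  define \<eta> where "\<eta> y = iM ((1 + y n) / 2) (\<xi> (y(n := 0)))" for y :: "nat \<Rightarrow> real"
  have int: "cube_int m \<subseteq> cube m" "cube_bd m \<subseteq> cube m" for m using cube_split by blast+
  have interior: "\<xi> (y(n := 0)) \<in> topspace (spc K) \<and> 0 < (1 + y n) / 2 \<and> (1 + y n) / 2 < 1 \<and>
      \<xi> (y(n := 0)) \<notin> A \<and> \<xi> (y(n := 0)) \<noteq> bpt K" if y: "y \<in> cube_int (Suc n)" for y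
  proof -
    have 1: "y(n := 0) \<in> cube_int n" "\<bar>y n\<bar> < 1" using cube_SucD(3)[of y n] y int by blast+
    then have "\<xi> (y(n := 0)) \<notin> A" using cell(4) by blast
    then show ?thesis using 1 A(1) inK int by (auto simp: abs_less_iff)
  qed
  have "cell_built (spc C) (bpt C) (?B \<union> \<eta> ` cube (Suc n))"
  proof (rule cell_built.cell[OF cell.IH])
    show "continuous_map (top_of_set (cube (Suc n))) (spc C) \<eta>"
      unfolding \<eta>_def
    proof (rule jcont_comp[OF jcont_iM])
      show "continuous_map (top_of_set (cube (Suc n))) euclideanreal (\<lambda>y. (1 + y n) / 2)"
        by (auto intro!: continuous_intros continuous_coordinate)
      have "continuous_map (top_of_set (cube (Suc n))) (top_of_set (cube n)) (\<lambda>y. y(n := 0))"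
        using continuous_fun_upd cube_SucD(1) by (auto simp: continuous_map_in_subtopology)
      then show "continuous_map (top_of_set (cube (Suc n))) (spc K) (\<lambda>y. \<xi> (y(n := 0)))"
        by (rule cm_comp[OF cell(2)])
      show "0 \<le> (1 + y n) / 2 \<and> (1 + y n) / 2 \<le> 1" if "y \<in> topspace (top_of_set (cube (Suc n)))" for y
        using cube_SucD(2)[of y n] that by (auto simp: abs_le_iff)
    qed
    show "inj_on \<eta> (cube_int (Suc n))"
    proof (rule inj_onI)
      fix y y' assume y: "y \<in> cube_int (Suc n)" "y' \<in> cube_int (Suc n)" and eq: "\<eta> y = \<eta> y'"
      note i = interior[OF y(1)] interior[OF y(2)]
      have "(1 + y n) / 2 = (1 + y' n) / 2 \<and> \<xi> (y(n := 0)) = \<xi> (y'(n := 0))"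
        using iM_interior(3)[of "\<xi> (y(n := 0))" "(1 + y n) / 2" "\<xi> (y'(n := 0))" "(1 + y' n) / 2"] i eq
        unfolding \<eta>_def by auto
      moreover have "y(n := 0) \<in> cube_int n" "y'(n := 0) \<in> cube_int n"
        using cube_SucD(3) y int by blast+
      ultimately have "y n = y' n" "y(n := 0) = y'(n := 0)" using inj_onD[OF cell(3)] by auto
      then show "y = y'" by (metis fun_upd_triv fun_upd_upd)
    qed
    show "\<eta> ` cube_int (Suc n) \<inter> ?B = {}"
    proof (rule equals0I)
      fix z assume "z \<in> \<eta> ` cube_int (Suc n) \<inter> ?B"
      then obtain y where y: "y \<in> cube_int (Suc n)" "\<eta> y \<in> ?B" by blast
      note i = interior[OF y(1)]
      note ii = iM_interior[of "\<xi> (y(n := 0))" "(1 + y n) / 2"]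
      from y(2) consider (1) x where "x \<in> topspace (spc L0)" "\<eta> y = iL x"
        | (2) x where "x \<in> topspace (spc L1)" "\<eta> y = iR x"
        | (3) t k where "0 \<le> t" "t \<le> 1" "k \<in> A" "\<eta> y = iM t k" by auto
      then show False
      proof cases
        case 1
        then show ?thesis using ii(1) i unfolding \<eta>_def by blast
      next
        case 2
        then show ?thesis using ii(2) i unfolding \<eta>_def by blast
      next
        case 3
        then have "k \<in> topspace (spc K)" using A(3) by blast
        then have "\<xi> (y(n := 0)) = k" using ii(3)[of k t] i 3 unfolding \<eta>_def by blast
        then show ?thesis using i 3 by blast
      qed
    qed
    show "\<eta> ` cube_bd (Suc n) \<subseteq> ?B"
    proof (rule image_subsetI)
      fix y assume y: "y \<in> cube_bd (Suc n)"
      then have yc: "y \<in> cube (Suc n)" using int by blast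
      have k: "\<xi> (y(n := 0)) \<in> topspace (spc K)" by (rule inK[OF cube_SucD(1)[OF yc]])
      have t: "(1 + y n) / 2 \<in> {0..1}" using cube_SucD(2)[OF yc] by (auto simp: abs_le_iff)
      from cube_SucD(4)[OF yc y] consider "y(n := 0) \<in> cube_bd n" | "y n = 1" | "y n = -1"
        by (auto simp: abs_if split: if_splits)
      then have "\<eta> y \<in> (\<lambda>z. iM (fst z) (snd z)) ` ({0..1} \<times> A) \<or> \<eta> y \<in> iL ` topspace (spc L0) \<or> \<eta> y \<in> iR ` topspace (spc L1)"
      proof cases
        case 1
        then have "((1 + y n) / 2, \<xi> (y(n := 0))) \<in> {0..1} \<times> A" using cell(5) t by blast
        from imageI[OF this, of "\<lambda>z. iM (fst z) (snd z)"] show ?thesis by (simp add: \<eta>_def)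
      next
        case 2
        then have "\<eta> y = iR (g (\<xi> (y(n := 0))))" using iM_1[OF k] by (simp add: \<eta>_def)
        then show ?thesis using pmap_in[OF pg k] by blast
      next
        case 3
        then have "\<eta> y = iL (f (\<xi> (y(n := 0))))" using iM_0[OF k] by (simp add: \<eta>_def)
        then show ?thesis using pmap_in[OF pf k] by blast
      qed
      then show "\<eta> y \<in> ?B" by blast
    qed
  qed
  moreover have "\<eta> ` cube (Suc n) = (\<lambda>z. iM (fst z) (snd z)) ` ({0..1} \<times> \<xi> ` cube n)"
  proof (intro equalityI subsetI)
    fix z assume "z \<in> \<eta> ` cube (Suc n)"
    then obtain y where y: "y \<in> cube (Suc n)" "z = \<eta> y" by blast
    have "((1 + y n) / 2, \<xi> (y(n := 0))) \<in> {0..1} \<times> \<xi> ` cube n"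
      using cube_SucD(1,2)[OF y(1)] by (auto simp: abs_le_iff)
    from imageI[OF this, of "\<lambda>z. iM (fst z) (snd z)"] show "z \<in> (\<lambda>z. iM (fst z) (snd z)) ` ({0..1} \<times> \<xi> ` cube n)"
      by (simp add: y(2) \<eta>_def)
  next
    fix z assume "z \<in> (\<lambda>z. iM (fst z) (snd z)) ` ({0..1} \<times> \<xi> ` cube n)"
    then obtain t x where z: "0 \<le> t" "t \<le> 1" "x \<in> cube n" "z = iM t (\<xi> x)" by auto
    have "\<bar>2 * t - 1\<bar> \<le> 1" using z by (auto simp: abs_le_iff)
    from cube_SucI[OF z(3) this] have "x(n := 2 * t - 1) \<in> cube (Suc n)" "\<eta> (x(n := 2 * t - 1)) = z"
      by (simp_all add: \<eta>_def z(4))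
    then show "z \<in> \<eta> ` cube (Suc n)" by blast
  qed
  ultimately show ?case by (simp add: Un_assoc image_Un Sigma_Un_distrib2 Times_Un_distrib1)
qed

lemma cell_built_C:
  assumes K: "cell_built (spc K) (bpt K) (topspace (spc K))"
    and L0: "cell_built (spc L0) (bpt L0) (topspace (spc L0))"
    and L1: "cell_built (spc L1) (bpt L1) (topspace (spc L1))"
  shows "cell_built (spc C) (bpt C) (topspace (spc C))"
proof -
  have "topspace (spc C) = iL ` topspace (spc L0) \<union> iR ` topspace (spc L1)
    \<union> (\<lambda>z. iM (fst z) (snd z)) ` ({0..1} \<times> topspace (spc K))" (is "_ = ?R")
  proof
    show "topspace (spc C) \<subseteq> ?R"
    proof
      fix z assume "z \<in> topspace (spc C)"
      then show "z \<in> ?R"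
      proof (cases rule: C_cases)
        case (M t k)
        then have "(t, k) \<in> {0..1} \<times> topspace (spc K)" by simp
        from imageI[OF this, of "\<lambda>z. iM (fst z) (snd z)"] show ?thesis using M by simp
      qed auto
    qed
    show "?R \<subseteq> topspace (spc C)" using iL_in iR_in iM_in by auto
  qed
  then show ?thesis using cell_built_iM[OF assms] by simp
qed

end

text \<open>A cell containing the base point in its interior is cut along the coordinate hyperplanes
  through that point.\<close>

lemma cell_built_pointed_cell:
  assumes A: "cell_built X x0 A" and c: "continuous_map (top_of_set (cube n)) X \<xi>"
    and inj: "inj_on \<xi> (cube_int n)" and a: "a \<in> cube_int n" "\<xi> a \<in> A"
    and disj: "\<xi> ` (cube_int n - {a}) \<inter> A = {}" and bd: "\<xi> ` cube_bd n \<subseteq> A"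
  shows "cell_built X x0 (A \<union> \<xi> ` cube n)"
proof -
  \<comment> \<open>\<open>F k\<close> is the slice of the cube through \<open>a\<close> in which
    only the first \<open>k\<close> coordinates vary. It grows from the single point
    \<open>a\<close> at k = 0 to the whole cube at k = n.\<close>
  define F where "F k = {x \<in> cube n. \<forall>i\<ge>k. x i = a i}" for k
  have ae: "a i = 0" if "n \<le> i" for i using a that by (simp add: cube_int_def espace_def)
  have a1: "\<bar>a i\<bar> < 1" if "i < n" for i
    using nrm_ge[OF that, of a] a by (simp add: cube_int_def)
  have int: "cube_int n \<subseteq> cube n" using cube_split by blast
  have \<xi>_eq: "y = y'" if "y \<in> cube_int n" "y \<noteq> a" "y' \<in> cube n" "\<xi> y = \<xi> y'" for y y'
  proof -
    have "\<xi> y \<notin> A" using disj that by blast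
    then have "y' \<notin> cube_bd n" using bd that(4) by auto
    then have "y' \<in> cube_int n" using that(3) cube_split by blast
    then show ?thesis using inj_onD[OF inj that(4,1)] by simp
  qed
  \<comment> \<open>A parametrization of one half of the slice \<open>F (Suc k)\<close>: the
    coordinate with index \<open>k\<close> runs from \<open>a k\<close>, at parameter -1, to the
    face \<open>e\<close>, at parameter 1, with \<open>e\<close> equal to 1 or -1.\<close>
  define p where "p k e y i = (if i < k then y i else if i = k then a k + (e - a k) * (y k + 1) / 2 else a i)"
    for k and e :: real and y :: "nat \<Rightarrow> real" and i
  \<comment> \<open>The boundary of such a half lies on the boundary of the cube, hence in
    \<open>A\<close>, or in the slice \<open>F k\<close>. The last condition on \<open>B\<close>
    says that the open half is not yet covered.\<close>
  have half: "cell_built X x0 (B \<union> \<xi> ` p k e ` cube (Suc k))"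
    if k: "k < n" and e: "e = 1 \<or> e = -1" and B: "cell_built X x0 B" "A \<subseteq> B" "\<xi> ` F k \<subseteq> B"
      "\<And>y. y \<in> cube_int n \<Longrightarrow> (y k - a k) * e > 0 \<Longrightarrow> (\<forall>i>k. y i = a i) \<Longrightarrow> \<xi> y \<notin> B" for k e B
  proof -
    have ak: "\<bar>a k\<bar> < 1" by (rule a1[OF k])
    have pe: "p k e y \<in> espace n" if "y \<in> cube (Suc k)" for y
      using k ae by (auto simp: p_def espace_def)
    have pk: "\<bar>a k + (e - a k) * (s + 1) / 2\<bar> \<le> 1" if "\<bar>s\<bar> \<le> 1" for s
    proof -
      have "a k + (e - a k) * (s + 1) / 2 = (1 - (s + 1) / 2) * a k + ((s + 1) / 2) * e" by (simp add: field_simps)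
      also have "\<bar>\<dots>\<bar> \<le> \<bar>1 - (s + 1) / 2\<bar> * \<bar>a k\<bar> + \<bar>(s + 1) / 2\<bar> * \<bar>e\<bar>"
        by (rule abs_triangle_ineq[THEN order_trans]) (simp add: abs_mult)
      also have "\<dots> \<le> (1 - (s + 1) / 2) * 1 + ((s + 1) / 2) * 1"
        using that ak e by (intro add_mono mult_mono) auto
      finally show ?thesis by simp
    qed
    have pk': "\<bar>a k + (e - a k) * (s + 1) / 2\<bar> < 1" if "\<bar>s\<bar> < 1" for s
    proof -
      have "a k + (e - a k) * (s + 1) / 2 = (1 - (s + 1) / 2) * a k + ((s + 1) / 2) * e" by (simp add: field_simps)
      also have "\<bar>\<dots>\<bar> \<le> \<bar>1 - (s + 1) / 2\<bar> * \<bar>a k\<bar> + \<bar>(s + 1) / 2\<bar> * \<bar>e\<bar>"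
        by (rule abs_triangle_ineq[THEN order_trans]) (simp add: abs_mult)
      also have "\<bar>1 - (s + 1) / 2\<bar> = 1 - (s + 1) / 2" using that by auto
      also have "(1 - (s + 1) / 2) * \<bar>a k\<bar> + \<bar>(s + 1) / 2\<bar> * \<bar>e\<bar> < (1 - (s + 1) / 2) * 1 + ((s + 1) / 2) * 1"
      proof (rule add_less_le_mono)
        show "(1 - (s + 1) / 2) * \<bar>a k\<bar> < (1 - (s + 1) / 2) * 1"
          using that ak by (intro mult_strict_left_mono) (auto simp: abs_less_iff)
        show "\<bar>(s + 1) / 2\<bar> * \<bar>e\<bar> \<le> (s + 1) / 2 * 1" using that e by auto
      qed
      finally show ?thesis by simp
    qed
    have pc: "p k e y \<in> cube n" if y: "y \<in> cube (Suc k)" for y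
    proof -
      have "\<bar>p k e y i\<bar> \<le> 1" if "i < n" for i
        using cube_coordinate[OF y, of i] pk[of "y k"] cube_SucD(2)[OF y] a1[OF that]
        by (auto simp: p_def abs_le_iff)
      then show ?thesis using pe[OF y] by (simp add: cube_def nrm_le_iff)
    qed
    have pint: "p k e y \<in> cube_int n \<and> (p k e y k - a k) * e > 0 \<and> (\<forall>i>k. p k e y i = a i)" if y: "y \<in> cube_int (Suc k)" for y
    proof -
      have yi: "\<bar>y i\<bar> < 1" if "i < Suc k" for i
        using y that by (simp add: cube_int_def nrm_less_iff del: nrm.simps)
      have "\<bar>p k e y i\<bar> < 1" if "i < n" for i
        using yi[of i] pk'[OF yi[of k]] a1[OF that] by (auto simp: p_def)
      then have "p k e y \<in> cube_int n"
        using pe[of y] y cube_split(1)[of "Suc k"] by (simp add: cube_int_def nrm_less_iff)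
      moreover have "(p k e y k - a k) * e > 0"
      proof -
        have "(p k e y k - a k) * e = ((e - a k) * e) * ((y k + 1) / 2)" by (simp add: p_def)
        moreover have "(e - a k) * e > 0" using e ak by (auto simp: abs_less_iff)
        moreover have "(y k + 1) / 2 > 0" using yi[of k] by (auto simp: abs_less_iff)
        ultimately show ?thesis by (metis mult_pos_pos)
      qed
      ultimately show ?thesis by (simp add: p_def)
    qed
    have "cell_built X x0 (B \<union> (\<xi> \<circ> p k e) ` cube (Suc k))"
    proof (rule cell_built.cell[OF B(1)])
      have "continuous_on (cube (Suc k)) (p k e)"
      proof (rule continuous_on_coordinatewise_then_product)
        show "continuous_on (cube (Suc k)) (\<lambda>y. p k e y i)" for i
          unfolding p_def by (cases "i < k"; cases "i = k") (auto intro!: continuous_intros continuous_coordinate)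
      qed
      then have "continuous_map (top_of_set (cube (Suc k))) (top_of_set (cube n)) (p k e)"
        using pc by (auto simp: continuous_map_in_subtopology)
      then show "continuous_map (top_of_set (cube (Suc k))) X (\<xi> \<circ> p k e)"
        using c by (rule continuous_map_compose)
      show "inj_on (\<xi> \<circ> p k e) (cube_int (Suc k))"
      proof (rule inj_onI)
        fix y y' assume y: "y \<in> cube_int (Suc k)" "y' \<in> cube_int (Suc k)" and eq: "(\<xi> \<circ> p k e) y = (\<xi> \<circ> p k e) y'"
        have "p k e y \<noteq> a" using pint[OF y(1)] by auto
        then have peq: "p k e y = p k e y'"
          using \<xi>_eq[of "p k e y" "p k e y'"] pint[OF y(1)] pint[OF y(2)] eq int by auto
        have ea: "e - a k \<noteq> 0" using e ak by auto
        show "y = y'"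
        proof
          fix i
          show "y i = y' i"
          proof (cases "i < k \<or> i = k")
            case True
            then show ?thesis using fun_cong[OF peq, of i] ea by (auto simp: p_def)
          next
            case False
            then show ?thesis using y by (auto simp: cube_int_def espace_def)
          qed
        qed
      qed
      show "(\<xi> \<circ> p k e) ` cube_int (Suc k) \<inter> B = {}"
        using B(4) pint by fastforce
      show "(\<xi> \<circ> p k e) ` cube_bd (Suc k) \<subseteq> B"
      proof clarify
        fix y assume y: "y \<in> cube_bd (Suc k)"
        then have yc: "y \<in> cube (Suc k)" using cube_split by blast
        obtain i where i: "i < Suc k" "\<bar>y i\<bar> = 1" using cube_bd_coordinate[OF y] .
        have bdI: "\<xi> (p k e y) \<in> B" if "j < n" "\<bar>p k e y j\<bar> = 1" for j
        proof -
          have "nrm n (p k e y) = 1" using nrm_ge[OF that(1), of "p k e y"] pc[OF yc] that(2) by (simp add: cube_def)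
          then have "p k e y \<in> cube_bd n" using pe[OF yc] by (simp add: cube_bd_def)
          then show ?thesis using bd B(2) by blast
        qed
        show "(\<xi> \<circ> p k e) y \<in> B"
        proof (cases "i < k")
          case True
          then show ?thesis using bdI[of i] i k by (simp add: p_def)
        next
          case False
          then have ik: "i = k" using i by simp
          then consider "y k = 1" | "y k = -1" using i by (auto simp: abs_if split: if_splits)
          then show ?thesis
          proof cases
            case 1
            then have "p k e y k = e" by (simp add: p_def field_simps)
            then have "\<bar>p k e y k\<bar> = 1" using e by auto
            then show ?thesis using bdI[OF k] by simp
          next
            case 2
            then have "p k e y i = a i" if "i \<ge> k" for i using that by (simp add: p_def)
            then have "p k e y \<in> F k" using pc[OF yc] by (simp add: F_def)
            then show ?thesis using B(3) by auto
          qed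
        qed
      qed
    qed
    then show ?thesis by (simp add: image_comp)
  qed
  have pimage: "p k e ` cube (Suc k) = {x \<in> F (Suc k). (x k - a k) * e \<ge> 0}" if k: "k < n" and e: "e = 1 \<or> e = -1" for k e
  proof -
    have ak: "\<bar>a k\<bar> < 1" by (rule a1[OF k])
    have ea: "(e - a k) * e > 0" using e ak by (auto simp: abs_less_iff)
    show ?thesis
    proof (intro equalityI subsetI)
      fix x assume "x \<in> p k e ` cube (Suc k)"
      then obtain y where y: "y \<in> cube (Suc k)" "x = p k e y" by blast
      have yk: "-1 \<le> y k" "y k \<le> 1" using cube_coordinate[OF y(1), of k] by auto
      have "\<bar>x i\<bar> \<le> 1" if "i < n" for i
      proof -
        have "\<bar>a k + (e - a k) * (y k + 1) / 2\<bar> \<le> 1"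
        proof -
          have "a k + (e - a k) * (y k + 1) / 2 = (1 - (y k + 1) / 2) * a k + ((y k + 1) / 2) * e" by (simp add: field_simps)
          also have "\<bar>\<dots>\<bar> \<le> \<bar>1 - (y k + 1) / 2\<bar> * \<bar>a k\<bar> + \<bar>(y k + 1) / 2\<bar> * \<bar>e\<bar>"
            by (rule abs_triangle_ineq[THEN order_trans]) (simp add: abs_mult)
          also have "\<dots> \<le> (1 - (y k + 1) / 2) * 1 + ((y k + 1) / 2) * 1"
            using yk ak e by (intro add_mono mult_mono) auto
          finally show ?thesis by simp
        qed
        then show ?thesis using cube_coordinate[OF y(1), of i] a1[OF that] by (auto simp: y(2) p_def abs_le_iff)
      qed
      moreover have "x \<in> espace n" using k ae by (auto simp: y(2) p_def espace_def)
      ultimately have "x \<in> F (Suc k)" by (simp add: F_def cube_def nrm_le_iff) (simp add: y(2) p_def)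
      moreover have eq: "(x k - a k) * e = ((e - a k) * e) * ((y k + 1) / 2)" by (simp add: y(2) p_def)
      have "(x k - a k) * e \<ge> 0" unfolding eq by (rule mult_nonneg_nonneg) (use ea yk in auto)
      ultimately show "x \<in> {x \<in> F (Suc k). (x k - a k) * e \<ge> 0}" by simp
    next
      fix x assume "x \<in> {x \<in> F (Suc k). (x k - a k) * e \<ge> 0}"
      then have x: "x \<in> cube n" "\<And>i. i > k \<Longrightarrow> x i = a i" "(x k - a k) * e \<ge> 0" by (auto simp: F_def)
      define u where "u = (x k - a k) / (e - a k)"
      define s where "s = 2 * u - 1"
      have e0: "e - a k \<noteq> 0" using ea by auto
      have xk: "-1 \<le> x k" "x k \<le> 1" using cube_coordinate[OF x(1) k] by auto
      have "0 \<le> u \<and> u \<le> 1"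
        using e x(3) xk ak by (auto simp: u_def divide_simps abs_less_iff)
      then have s: "\<bar>s\<bar> \<le> 1" by (auto simp: s_def abs_le_iff)
      define y where "y i = (if i < k then x i else if i = k then s else 0)" for i
      have "\<bar>y i\<bar> \<le> 1" if "i < Suc k" for i
        using cube_coordinate[OF x(1), of i] s k that by (auto simp: y_def abs_le_iff)
      then have "y \<in> cube (Suc k)" by (simp add: cube_def nrm_le_iff espace_def del: nrm.simps) (simp add: y_def)
      moreover have "p k e y = x"
      proof
        have "a k + (e - a k) * (s + 1) / 2 = x k" using e0 by (simp add: s_def u_def field_simps)
        then show "p k e y i = x i" for i using x(2) by (simp add: p_def y_def)
      qed
      ultimately show "x \<in> p k e ` cube (Suc k)" by blast
    qed
  qed
  have "cell_built X x0 (A \<union> \<xi> ` F k)" if "k \<le> n" for k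
    using that
  proof (induction k)
    case 0
    have "F 0 = {a}" using a int by (auto simp: F_def)
    then show ?case using A a(2) by (simp add: insert_absorb)
  next
    case (Suc k)
    then have k: "k < n" by simp
    have IH: "cell_built X x0 (A \<union> \<xi> ` F k)" using Suc by simp
    have Fc: "F k \<subseteq> cube n" by (auto simp: F_def)
    \<comment> \<open>The slice grows by its two halves in turn. They meet only in
      \<open>F k\<close>, because on an open half the difference to \<open>a k\<close> has a strict
      sign.\<close>
    let ?B1 = "(A \<union> \<xi> ` F k) \<union> \<xi> ` p k 1 ` cube (Suc k)"
    have 1: "cell_built X x0 ?B1"
    proof (rule half[OF k _ IH])
      fix y assume y: "y \<in> cube_int n" "(y k - a k) * 1 > 0" "\<forall>i>k. y i = a i"
      then have "y \<noteq> a" by auto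
      then have "\<xi> y \<notin> A" using disj y(1) by blast
      moreover have "\<xi> y \<notin> \<xi> ` F k"
      proof
        assume "\<xi> y \<in> \<xi> ` F k"
        then obtain y' where "y' \<in> F k" "\<xi> y = \<xi> y'" by blast
        then have "y \<in> F k" using \<xi>_eq[OF y(1) \<open>y \<noteq> a\<close>, of y'] Fc by blast
        then show False using y(2) by (simp add: F_def)
      qed
      ultimately show "\<xi> y \<notin> A \<union> \<xi> ` F k" by blast
    qed auto
    have 2: "cell_built X x0 (?B1 \<union> \<xi> ` p k (-1) ` cube (Suc k))"
    proof (rule half[OF k _ 1])
      fix y assume y: "y \<in> cube_int n" "(y k - a k) * (-1) > 0" "\<forall>i>k. y i = a i"
      then have "y \<noteq> a" by auto
      then have "\<xi> y \<notin> A" using disj y(1) by blast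
      moreover have "\<xi> y \<notin> \<xi> ` G" if "G \<subseteq> cube n" "y \<notin> G" for G
        using \<xi>_eq[OF y(1) \<open>y \<noteq> a\<close>] that by blast
      moreover have "y \<notin> F k" using y(2) by (auto simp: F_def)
      moreover have "p k 1 ` cube (Suc k) \<subseteq> cube n" "y \<notin> p k 1 ` cube (Suc k)"
        using pimage[OF k, of 1] y(2) by (auto simp: F_def)
      ultimately show "\<xi> y \<notin> ?B1" using Fc by blast
    qed auto
    have "F (Suc k) = F k \<union> p k 1 ` cube (Suc k) \<union> p k (-1) ` cube (Suc k)"
      using pimage[OF k, of 1] pimage[OF k, of "-1"] by (auto simp: F_def)
    then have "?B1 \<union> \<xi> ` p k (-1) ` cube (Suc k) = A \<union> \<xi> ` F (Suc k)" by (simp add: image_Un Un_assoc)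
    then show ?case using 2 by simp
  qed
  moreover have "F n = cube n" using ae by (auto simp: F_def cube_def espace_def)
  ultimately show ?thesis by (metis order_refl)
qed

text \<open>The base point need not be a vertex. It is put down first, and then the cells are
  attached in order of dimension; only the open cell through the base point meets the part already
  present, and \<open>cell_built_pointed_cell\<close> takes care of it.\<close>

lemma cube_CW_cell_built:
  assumes CW: "cube_CW X N d \<Psi>" and x0: "x0 \<in> topspace X"
  shows "cell_built X x0 (topspace X)"
proof -
  note D = cube_CW_D[OF CW]
  define U where "U J = (\<Union>j\<in>J. \<Psi> j ` cube_int (d j))" for J
  have main: "cell_built X x0 (insert x0 (U J))"
    if "J \<subseteq> {..<N}" "\<forall>j\<in>J. \<forall>k<N. d k < d j \<longrightarrow> k \<in> J" for J
    using that
  proof (induction "card J" arbitrary: J)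
    case 0
    then have "J = {}" using finite_subset[OF 0(2)] by simp
    then show ?case using cell_built.point[OF x0] by (simp add: U_def)
  next
    case (Suc r)
    have fin: "finite J" using finite_subset[OF Suc.prems(1)] by simp
    have "J \<noteq> {}" using Suc.hyps(2) by auto
    then have "Max (d ` J) \<in> d ` J" using fin by simp
    then obtain i where "Max (d ` J) = d i" "i \<in> J" by (rule imageE)
    then have i: "i \<in> J" "d i = Max (d ` J)" by simp_all
    have mx: "d j \<le> d i" if "j \<in> J" for j using fin that i(2) by simp
    have iN: "i < N" using i(1) Suc.prems(1) by blast
    let ?J = "J - {i}"
    have J: "?J \<subseteq> {..<N}" using Suc.prems(1) by blast
    have J': "\<forall>j\<in>?J. \<forall>k<N. d k < d j \<longrightarrow> k \<in> ?J"
    proof (intro ballI allI impI)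
      fix j k assume "j \<in> ?J" "k < N" "d k < d j"
      then show "k \<in> ?J" using Suc.prems(2) mx[of j] by force
    qed
    have "r = card ?J" using Suc.hyps(2) i(1) fin by simp
    then have IH: "cell_built X x0 (insert x0 (U ?J))" by (rule Suc.hyps(1)[OF _ J J'])
    have "{k. k < N \<and> d k < d i} \<subseteq> ?J" using Suc.prems(2) i(1) by blast
    then have "(\<Union>k\<in>{k. k < N \<and> d k < d i}. \<Psi> k ` cube_int (d k)) \<subseteq> U ?J"
      unfolding U_def by (rule UN_mono) simp
    then have bd: "\<Psi> i ` cube_bd (d i) \<subseteq> U ?J" using D(6)[OF iN] by blast
    have "\<Psi> i ` cube_int (d i) \<inter> \<Psi> j ` cube_int (d j) = {}" if "j \<in> ?J" for j
      using that J by (intro D(4) iN) auto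
    then have disj: "\<Psi> i ` cube_int (d i) \<inter> U ?J = {}" unfolding U_def by blast
    have "cell_built X x0 (insert x0 (U ?J) \<union> \<Psi> i ` cube (d i))"
    proof (cases "x0 \<in> \<Psi> i ` cube_int (d i)")
      case False
      show ?thesis
        by (rule cell_built.cell[OF IH D(2)[OF iN] D(3)[OF iN]]) (use False disj bd in auto)
    next
      case True
      then obtain a where a: "a \<in> cube_int (d i)" "\<Psi> i a = x0" by blast
      have "\<Psi> i ` (cube_int (d i) - {a}) \<inter> insert x0 (U ?J) = {}"
        using disj a inj_onD[OF D(3)[OF iN]] by blast
      then show ?thesis
        using a bd by (intro cell_built_pointed_cell[OF IH D(2)[OF iN] D(3)[OF iN] a(1)]) auto
    qed
    moreover have "insert x0 (U ?J) \<union> \<Psi> i ` cube (d i) = insert x0 (U J)"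
    proof -
      have "U J = U ?J \<union> \<Psi> i ` cube_int (d i)" using i(1) unfolding U_def by blast
      then show ?thesis using bd unfolding cube_split(1) image_Un by blast
    qed
    ultimately show ?case by simp
  qed
  have "U {..<N} = topspace X" using D(5) by (simp add: U_def)
  then show ?thesis using main[of "{..<N}"] x0 by (simp add: insert_absorb)
qed

section \<open>Finite CW models\<close>

text \<open>A disjoint base point is added to the sphere \<open>cube_bd n\<close>: it is the only point of the
  union whose \<open>n\<close>-th coordinate is nonzero.\<close>

definition extra_pt :: "nat \<Rightarrow> nat \<Rightarrow> real" where
  "extra_pt n i = (if i = n then 1 else 0)"

definition sphere_plus :: "nat \<Rightarrow> (nat \<Rightarrow> real) pointed" where
  "sphere_plus n = Pointed (top_of_set (insert (extra_pt n) (cube_bd n))) (extra_pt n)"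

definition plus_map :: "nat \<Rightarrow> 'a \<Rightarrow> ((nat \<Rightarrow> real) \<Rightarrow> 'a) \<Rightarrow> (nat \<Rightarrow> real) \<Rightarrow> 'a" where
  "plus_map n y0 \<phi> x = (if x n = 0 then \<phi> x else y0)"

text \<open>The pointed sphere of dimension 0. In the cone below, \<open>False\<close> receives the
  disjoint base point and \<open>True\<close> becomes the apex.\<close>

definition two_pts :: "bool pointed" where
  "two_pts = Pointed (discrete_topology UNIV) False"

lemma cube_bd_n: "x \<in> cube_bd n \<Longrightarrow> x n = 0"
  by (simp add: cube_bd_def espace_def)

lemma extra_pt_n: "extra_pt n n = 1"
  by (simp add: extra_pt_def)

lemma sphere_plus_simps [simp]:
  "topspace (spc (sphere_plus n)) = insert (extra_pt n) (cube_bd n)"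
  "bpt (sphere_plus n) = extra_pt n"
  "topspace (spc two_pts) = UNIV" "bpt two_pts = False"
  by (simp_all add: sphere_plus_def two_pts_def)

lemma plus_map_simps:
  "x \<in> cube_bd n \<Longrightarrow> plus_map n y0 \<phi> x = \<phi> x" "plus_map n y0 \<phi> (extra_pt n) = y0"
  by (simp_all add: plus_map_def cube_bd_n extra_pt_n)

lemma continuous_snd_coordinate: "continuous_on S (\<lambda>z :: 't :: topological_space \<times> (nat \<Rightarrow> real). snd z i)"
  by (rule continuous_on_compose2[OF continuous_coordinate[of UNIV] continuous_on_snd[OF continuous_on_id]]) simp

lemma jcont_plus_map:
  assumes H: "jcont (top_of_set (cube_bd n)) Y H" and y0: "y0 \<in> topspace Y"
  shows "jcont (spc (sphere_plus n)) Y (\<lambda>t. plus_map n y0 (H t))"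
proof -
  let ?T = "{0..1::real} \<times> insert (extra_pt n) (cube_bd n)"
  \<comment> \<open>The coordinate with index \<open>n\<close> is 0 on the sphere and 1 at the extra
    point, so comparison with 1/2 separates them into closed pieces.\<close>
  have le: "?T \<inter> {z \<in> ?T. snd z n \<le> 1/2} = {0..1} \<times> cube_bd n"
    by (auto simp: cube_bd_n extra_pt_n)
  have "continuous_map (top_of_set ?T) Y (\<lambda>z. if snd z n \<le> 1/2 then H (fst z) (snd z) else y0)"
  proof (rule continuous_map_cases_le)
    show "continuous_map (top_of_set ?T) euclideanreal (\<lambda>z. snd z n)"
      by (simp add: continuous_snd_coordinate)
    show "continuous_map (subtopology (top_of_set ?T) {z \<in> topspace (top_of_set ?T). snd z n \<le> 1/2}) Y (\<lambda>z. H (fst z) (snd z))"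
    proof -
      have "subtopology (top_of_set ?T) {z \<in> topspace (top_of_set ?T). snd z n \<le> 1/2} = top_of_set ({0..1} \<times> cube_bd n)"
        by (simp only: subtopology_subtopology topspace_euclidean_subtopology le)
      then show ?thesis using H by (simp add: jcont_def)
    qed
    show "continuous_map (subtopology (top_of_set ?T) {z \<in> topspace (top_of_set ?T). 1/2 \<le> snd z n}) Y (\<lambda>z. y0)"
      using y0 by simp
  qed (auto simp: cube_bd_n extra_pt_n)
  then show ?thesis
    unfolding jcont_def sphere_plus_def
    by (simp, elim continuous_map_eq) (auto simp: plus_map_def cube_bd_n extra_pt_n)
qed

lemma pmap_plus_map:
  assumes "continuous_map (top_of_set (cube_bd n)) (spc Y) \<phi>" "bpt Y \<in> topspace (spc Y)"
  shows "pmap (sphere_plus n) Y (plus_map n (bpt Y) \<phi>)"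
  using jcont_at[OF jcont_plus_map[OF jcont_const[OF assms(1)] assms(2)], of 0]
  by (simp add: pmap_def plus_map_simps)

text \<open>With a disjoint base point added, a free homotopy of maps on the sphere becomes a
  pointed one. This is why cellular approximation is proved for free homotopies only.\<close>

lemma phomotopic_plus_map:
  assumes "homotopic_with (\<lambda>_. True) (top_of_set (cube_bd n)) (spc Y) \<phi> \<phi>'" "bpt Y \<in> topspace (spc Y)"
  shows "phomotopic (sphere_plus n) Y (plus_map n (bpt Y) \<phi>) (plus_map n (bpt Y) \<phi>')"
proof -
  obtain h where h: "continuous_map (prod_topology (top_of_set {0..1::real}) (top_of_set (cube_bd n))) (spc Y) h"
    "\<And>x. h (0, x) = \<phi> x" "\<And>x. h (1, x) = \<phi>' x"
    using assms(1) unfolding homotopic_with_def by blast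
  have "jcont (top_of_set (cube_bd n)) (spc Y) (\<lambda>t x. h (t, x))"
    unfolding jcont_def using h(1) by simp
  then have "jcont (spc (sphere_plus n)) (spc Y) (\<lambda>t. plus_map n (bpt Y) (\<lambda>x. h (t, x)))"
    using assms(2) by (rule jcont_plus_map)
  then show ?thesis
    by (rule phomotopicI[rotated]) (auto simp: plus_map_def h extra_pt_n)
qed

definition collapse :: "nat \<Rightarrow> (nat \<Rightarrow> real) \<Rightarrow> bool" where
  "collapse n = plus_map n False (\<lambda>_. True)"

lemma pmap_collapse: "pmap (sphere_plus n) two_pts (collapse n)"
  using pmap_plus_map[of n two_pts "\<lambda>_. True"] by (simp add: collapse_def two_pts_def)

lemma dmc_attach:
  assumes "continuous_map (top_of_set (cube_bd n)) (spc Y) \<phi>" "bpt Y \<in> topspace (spc Y)"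
  shows "dmc (sphere_plus n) Y two_pts (plus_map n (bpt Y) \<phi>) (collapse n)"
  using pmap_plus_map[OF assms] pmap_collapse by unfold_locales simp_all

lemma compact_Hausdorff_sphere_plus:
  "compact_space (spc (sphere_plus n))" "Hausdorff_space (spc (sphere_plus n))"
  "compact_space (spc two_pts)" "Hausdorff_space (spc two_pts)"
proof -
  have "compact (insert (extra_pt n) (cube_bd n))" using compact_cube_bd by (rule compact_insert)
  then show "compact_space (spc (sphere_plus n))"
    by (simp add: sphere_plus_def compact_space_subtopology)
  show "Hausdorff_space (spc (sphere_plus n))"
    by (simp add: sphere_plus_def Hausdorff_space_subtopology)
  show "compact_space (spc two_pts)" "Hausdorff_space (spc two_pts)"
    by (simp_all add: two_pts_def compact_space_discrete_topology Hausdorff_space_discrete_topology)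
qed

text \<open>Polar coordinates on the cube with t = 0 on the boundary and t = 1 at the centre, to
  match the cone, whose base is at parameter 0 and whose apex is at 1.\<close>

definition polar :: "real \<Rightarrow> (nat \<Rightarrow> real) \<Rightarrow> nat \<Rightarrow> real" where
  "polar t x i = (1 - t) * x i"

definition direction :: "nat \<Rightarrow> (nat \<Rightarrow> real) \<Rightarrow> nat \<Rightarrow> real" where
  "direction n y i = (1 / nrm n y) * y i"

lemma polar:
  assumes "x \<in> cube_bd n" "0 \<le> t" "t \<le> 1"
  shows "polar t x \<in> cube n" "nrm n (polar t x) = 1 - t" "t < 1 \<Longrightarrow> direction n (polar t x) = x"
    "t < 1 \<Longrightarrow> polar t x \<noteq> (\<lambda>_. 0)" "0 < t \<Longrightarrow> polar t x \<in> cube_int n"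
proof -
  have x: "x \<in> espace n" "nrm n x = 1" using assms(1) by (simp_all add: cube_bd_def)
  show n: "nrm n (polar t x) = 1 - t"
    using nrm_scale[of n "1 - t" x] x assms by (simp add: polar_def[abs_def])
  have e: "polar t x \<in> espace n" using espace_scale(1)[OF x(1)] by (simp add: polar_def[abs_def])
  show "polar t x \<in> cube n" "0 < t \<Longrightarrow> polar t x \<in> cube_int n"
    using e n assms by (simp_all add: cube_def cube_int_def)
  show "t < 1 \<Longrightarrow> direction n (polar t x) = x" by (simp add: direction_def n fun_eq_iff) (simp add: polar_def)
  show "t < 1 \<Longrightarrow> polar t x \<noteq> (\<lambda>_. 0)" using n nrm_0_iff[of "\<lambda>_. 0" n] by (auto simp: espace_def)
qed

lemma direction:
  assumes "y \<in> cube n" "y \<noteq> (\<lambda>_. 0)"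
  shows "direction n y \<in> cube_bd n" "polar (1 - nrm n y) (direction n y) = y" "0 < nrm n y" "nrm n y \<le> 1"
proof -
  have y: "y \<in> espace n" "nrm n y \<le> 1" using assms by (simp_all add: cube_def)
  show p: "0 < nrm n y" using nrm_0_iff[OF y(1)] assms(2) nrm_nonneg[of n y] by linarith
  show "nrm n y \<le> 1" by fact
  have "nrm n (direction n y) = 1"
    using nrm_scale[of n "1 / nrm n y" y] p by (simp add: direction_def[abs_def])
  moreover have "direction n y \<in> espace n" using espace_scale(1)[OF y(1), of "1 / nrm n y"] unfolding direction_def[abs_def] .
  ultimately show "direction n y \<in> cube_bd n" by (simp add: cube_bd_def)
  show "polar (1 - nrm n y) (direction n y) = y" using p by (simp add: polar_def direction_def fun_eq_iff)
qed

lemma continuous_polar: "continuous_on S (\<lambda>z. polar (fst z) (snd z))"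
  unfolding polar_def[abs_def]
  by (intro continuous_on_coordinatewise_then_product continuous_intros continuous_snd_coordinate)

text \<open>The cylinder with right end \<open>two_pts\<close> is the mapping cone of the unpointed map \<open>\<phi>\<close>.\<close>

locale mapping_cone =
  fixes Y :: "'a pointed" and n :: nat and \<phi> :: "(nat \<Rightarrow> real) \<Rightarrow> 'a"
  assumes c\<phi>: "continuous_map (top_of_set (cube_bd n)) (spc Y) \<phi>" and bY: "bpt Y \<in> topspace (spc Y)"
begin

sublocale dmc "sphere_plus n" Y two_pts "plus_map n (bpt Y) \<phi>" "collapse n"
  by (rule dmc_attach[OF c\<phi> bY])

lemma \<phi>_in: "x \<in> cube_bd n \<Longrightarrow> \<phi> x \<in> topspace (spc Y)"
  using continuous_map_image_subset_topspace[OF c\<phi>] by auto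

lemma bd_in: "x \<in> cube_bd n \<Longrightarrow> x \<in> topspace (spc (sphere_plus n))" "x \<in> cube_bd n \<Longrightarrow> x \<noteq> bpt (sphere_plus n)"
  using cube_bd_n extra_pt_n by fastforce+

lemma cone_ends: "x \<in> cube_bd n \<Longrightarrow> iM 0 x = iL (\<phi> x)" "x \<in> cube_bd n \<Longrightarrow> iM 1 x = iR True"
  using iM_0[OF bd_in(1)] iM_1[OF bd_in(1)] by (simp_all add: plus_map_simps collapse_def)

lemma cone_cases:
  assumes "z \<in> topspace (spc C)"
  obtains (base) y where "y \<in> topspace (spc Y)" "z = iL y"
  | (mid) t x where "0 < t" "t < 1" "x \<in> cube_bd n" "z = iM t x"
  | (apex) "z = iR True"
  using assms
proof (cases rule: C_cases)
  case (L y)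
  then show ?thesis by (rule base)
next
  case (M t x)
  show ?thesis
  proof (cases "x = extra_pt n")
    case True
    then have "z = iL (bpt Y)" using M iM_bpt[of t] by (simp add: iL_bpt)
    then show ?thesis using bY base by blast
  next
    case False
    then have x: "x \<in> cube_bd n" using M by simp
    consider "t = 0" | "t = 1" | "0 < t" "t < 1" using M by fastforce
    then show ?thesis
    proof cases
      case 1
      then show ?thesis using M cone_ends(1)[OF x] \<phi>_in[OF x] base by simp
    next
      case 2
      then show ?thesis using M cone_ends(2)[OF x] apex by simp
    next
      case 3
      then show ?thesis using M x mid by blast
    qed
  qed
next
  case (R b)
  then show ?thesis
    using apex base[OF bY] iR_bpt by (cases b) (simp_all add: iL_bpt)
qed

text \<open>The characteristic map of the attached cell: rays of the cube go to lines of the cone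
  and the centre goes to the apex.\<close>

definition char :: "(nat \<Rightarrow> real) \<Rightarrow> ('a, nat \<Rightarrow> real, bool) cyl_pt set" where
  "char y = (if y = (\<lambda>_. 0) then iR True else iM (1 - nrm n y) (direction n y))"

lemma char_polar: "x \<in> cube_bd n \<Longrightarrow> 0 \<le> t \<Longrightarrow> t \<le> 1 \<Longrightarrow> char (polar t x) = iM t x"
  using polar[of x n t] cone_ends(2)[of x]
  by (cases "t = 1") (auto simp: char_def polar_def[of 1, abs_def])

lemma char_bd: "x \<in> cube_bd n \<Longrightarrow> char x = iL (\<phi> x)"
  using char_polar[of x 0] cone_ends(1)[of x] by (simp add: polar_def[abs_def])

text \<open>By compactness polar coordinates present the cube as a quotient of the product of the
  interval with its boundary, which reduces the claim to the continuity of \<open>iM\<close>. For n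
  = 0 the boundary is empty and the centre is not reached in this way; the cube is then a single
  point.\<close>

lemma continuous_char: "continuous_map (top_of_set (cube n)) (spc C) char"
proof (cases "n = 0")
  case True
  then have "cube n = {\<lambda>_. 0}" by (auto simp: cube_def espace_def fun_eq_iff)
  have "iR True \<in> topspace (spc C)" by (rule iR_in) simp
  then have "continuous_map (top_of_set (cube n)) (spc C) (\<lambda>_. iR True)" by simp
  then show ?thesis
    by (rule continuous_map_eq) (simp add: char_def \<open>cube n = {\<lambda>_. 0}\<close>)
next
  case False
  let ?p = "\<lambda>z :: real \<times> (nat \<Rightarrow> real). polar (fst z) (snd z)"
  have im: "?p ` ({0..1} \<times> cube_bd n) = cube n"
  proof (intro equalityI subsetI)
    fix y assume y: "y \<in> cube n"
    show "y \<in> ?p ` ({0..1} \<times> cube_bd n)"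
    proof (cases "y = (\<lambda>_. 0)")
      case True
      let ?x = "\<lambda>i. if i = 0 then 1 else 0 :: real"
      have "nrm n ?x = 1"
      proof (rule antisym)
        show "nrm n ?x \<le> 1" by (subst nrm_le_iff) auto
        show "1 \<le> nrm n ?x" using nrm_ge[of 0 n ?x] False by simp
      qed
      then have "?x \<in> cube_bd n" using False by (auto simp: cube_bd_def espace_def)
      then show ?thesis using True by (intro image_eqI[of _ _ "(1, ?x)"]) (auto simp: polar_def fun_eq_iff)
    next
      case False
      show ?thesis using direction[OF y False] nrm_nonneg[of n y]
        by (intro image_eqI[of _ _ "(1 - nrm n y, direction n y)"]) auto
    qed
  qed (auto intro: polar)
  have cp: "continuous_map (top_of_set ({0..1} \<times> cube_bd n)) (top_of_set (cube n)) ?p"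
    using im continuous_polar by (simp add: image_subset_iff_funcset[symmetric])
  have "compact ({0..1::real} \<times> cube_bd n)" by (intro compact_Times compact_cube_bd) simp
  then have "closed_map (top_of_set ({0..1} \<times> cube_bd n)) (top_of_set (cube n)) ?p"
    by (intro continuous_imp_closed_map[OF cp]) (simp_all add: compact_space_subtopology Hausdorff_space_subtopology)
  then have q: "quotient_map (top_of_set ({0..1} \<times> cube_bd n)) (top_of_set (cube n)) ?p"
    using cp im by (intro continuous_closed_imp_quotient_map) simp_all
  have "continuous_map (top_of_set ({0..1} \<times> cube_bd n)) (spc C) (\<lambda>z. iM (fst z) (snd z))"
  proof (rule jcont_comp[OF jcont_iM])
    show "continuous_map (top_of_set ({0..1} \<times> cube_bd n)) (spc (sphere_plus n)) snd"
      by (auto simp: sphere_plus_def continuous_map_in_subtopology intro: continuous_intros)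
  qed (auto intro: continuous_intros)
  then have "continuous_map (top_of_set ({0..1} \<times> cube_bd n)) (spc C) (char \<circ> ?p)"
    by (rule continuous_map_eq) (auto simp: char_polar)
  then show ?thesis by (rule continuous_compose_quotient_map[OF q])
qed

lemma char_cases:
  assumes "y \<in> cube_int n"
  obtains "y = (\<lambda>_. 0)" "char y = iR True"
  | t x where "0 < t" "t < 1" "x \<in> cube_bd n" "y = polar t x" "char y = iM t x"
proof (cases "y = (\<lambda>_. 0)")
  case True
  then show ?thesis using that(1) by (simp add: char_def)
next
  case False
  have y: "y \<in> cube n" "nrm n y < 1" using assms by (auto simp: cube_int_def cube_def)
  note d = direction[OF y(1) False]
  show ?thesis
    by (rule that(2)[of "1 - nrm n y" "direction n y"]) (use d y False in \<open>simp_all add: char_def\<close>)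
qed

lemma iM_mid:
  assumes "0 < t" "t < 1" "x \<in> cube_bd n"
  shows "y \<in> topspace (spc Y) \<Longrightarrow> iM t x \<noteq> iL y" "iM t x \<noteq> iR True"
    "0 < t' \<Longrightarrow> t' < 1 \<Longrightarrow> x' \<in> cube_bd n \<Longrightarrow> iM t x = iM t' x' \<Longrightarrow> t = t' \<and> x = x'"
  using iM_interior[OF bd_in(1)[OF assms(3)] assms(1,2) bd_in(2)[OF assms(3)]] bd_in(1)[of x'] by simp_all

lemma apex_not_base: "y \<in> topspace (spc Y) \<Longrightarrow> iL y \<noteq> iR True"
  using iL_iR_eq[of y True] by simp

lemma char_int_not_base: "y \<in> cube_int n \<Longrightarrow> w \<in> topspace (spc Y) \<Longrightarrow> char y \<noteq> iL w"
  by (erule char_cases) (use iM_mid(1) apex_not_base in fastforce)+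

lemma inj_char: "inj_on char (cube_int n)"
proof (rule inj_onI)
  fix y y' assume y: "y \<in> cube_int n" "y' \<in> cube_int n" and eq: "char y = char y'"
  from y(1) show "y = y'"
  proof (cases rule: char_cases)
    case 1
    from y(2) show ?thesis
    proof (cases rule: char_cases)
      case (2 t x)
      then show ?thesis using 1 eq iM_mid(2)[of t x] by metis
    qed (use 1 in simp)
  next
    case (2 t x)
    from y(2) show ?thesis
    proof (cases rule: char_cases)
      case 1
      then show ?thesis using 2 eq iM_mid(2)[of t x] by metis
    next
      case (2 t' x')
      then show ?thesis using \<open>0 < t\<close> \<open>t < 1\<close> \<open>x \<in> cube_bd n\<close> \<open>y = polar t x\<close> \<open>char y = iM t x\<close> eq
          iM_mid(3)[of t x t' x'] by metis
    qed
  qed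
qed

lemma char_image: "topspace (spc C) = iL ` topspace (spc Y) \<union> char ` cube_int n"
proof
  show "topspace (spc C) \<subseteq> iL ` topspace (spc Y) \<union> char ` cube_int n"
  proof
    fix z assume "z \<in> topspace (spc C)"
    then show "z \<in> iL ` topspace (spc Y) \<union> char ` cube_int n"
    proof (cases rule: cone_cases)
      case (mid t x)
      then have "z = char (polar t x)" "polar t x \<in> cube_int n" using char_polar polar(5) by simp_all
      then show ?thesis by blast
    next
      case apex
      then have "z = char (\<lambda>_. 0)" by (simp add: char_def)
      then show ?thesis using zero_cube_int by blast
    qed blast
  qed
  have "char ` cube_int n \<subseteq> topspace (spc C)"
    using continuous_map_image_subset_topspace[OF continuous_char] cube_split(1)[of n] by auto
  then show "iL ` topspace (spc Y) \<union> char ` cube_int n \<subseteq> topspace (spc C)" using iL_in by blast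
qed

text \<open>The attaching map takes its values in cells of dimension less than \<open>n\<close>, so
  the new cell, with index \<open>N\<close>, satisfies the boundary condition of a genuine CW
  structure.\<close>

lemma cube_CW_cone:
  assumes CW: "cube_CW (spc Y) N d \<Psi>"
    and \<phi>: "\<phi> ` cube_bd n \<subseteq> (\<Union>j\<in>{j. j < N \<and> d j < n}. \<Psi> j ` cube_int (d j))"
  shows "cube_CW (spc C) (Suc N) (d(N := n)) (\<lambda>i. if i < N then iL \<circ> \<Psi> i else char)"
    (is "cube_CW _ _ ?d ?\<Psi>")
proof -
  note D = cube_CW_D[OF CW]
  have in0: "\<Psi> i y \<in> topspace (spc Y)" if "i < N" "y \<in> cube (d i)" for i y
    using cube_map_in[OF D(2)[OF that(1)] that(2)] .
  have int: "cube_int m \<subseteq> cube m" for m using cube_split by blast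
  have old: "?\<Psi> i ` cube_int (?d i) = iL ` \<Psi> i ` cube_int (d i)" if "i < N" for i
    using that by (simp add: image_comp)
  have new: "?\<Psi> N ` cube_int (?d N) = char ` cube_int n" by simp
  have inj_iL: "inj_on iL (topspace (spc Y))" by (auto intro: inj_onI simp: iL_eq)
  have sub: "\<Psi> i ` cube_int (d i) \<subseteq> topspace (spc Y)" if "i < N" for i using in0 that int by blast
  have disj_new: "iL ` \<Psi> i ` cube_int (d i) \<inter> char ` cube_int n = {}" if "i < N" for i
  proof (rule equals0I)
    fix z assume "z \<in> iL ` \<Psi> i ` cube_int (d i) \<inter> char ` cube_int n"
    then obtain w y where wy: "w \<in> \<Psi> i ` cube_int (d i)" "y \<in> cube_int n" "iL w = char y" by auto
    then show False using char_int_not_base[OF wy(2), of w] sub[OF that] by auto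
  qed
  have disj_old: "iL ` \<Psi> i ` cube_int (d i) \<inter> iL ` \<Psi> j ` cube_int (d j) = {}" if "i < N" "j < N" "i \<noteq> j" for i j
    using inj_on_image_Int[OF inj_iL sub[OF that(1)] sub[OF that(2)]] D(4)[OF that] by simp
  show ?thesis
    unfolding cube_CW_def
  proof (intro conjI allI impI)
    show "Hausdorff_space (spc C)"
      using Hausdorff_C compact_Hausdorff_sphere_plus D(1) cube_CW_compact[OF CW] by blast
    show "disjoint_family_on (\<lambda>i. ?\<Psi> i ` cube_int (?d i)) {..<Suc N}"
      unfolding disjoint_family_on_def
    proof (intro ballI impI)
      fix i j assume ij: "i \<in> {..<Suc N}" "j \<in> {..<Suc N}" "i \<noteq> j"
      then consider "i < N" "j < N" | "i < N" "j = N" | "i = N" "j < N" by fastforce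
      then show "?\<Psi> i ` cube_int (?d i) \<inter> ?\<Psi> j ` cube_int (?d j) = {}"
      proof cases
        case 1
        then show ?thesis unfolding old[OF 1(1)] old[OF 1(2)] using disj_old ij(3) by blast
      next
        case 2
        then show ?thesis unfolding 2(2) old[OF 2(1)] new using disj_new by blast
      next
        case 3
        then show ?thesis unfolding 3(1) old[OF 3(2)] new using disj_new by blast
      qed
    qed
    show "(\<Union>i<Suc N. ?\<Psi> i ` cube_int (?d i)) = topspace (spc C)"
    proof -
      have "(\<Union>i<Suc N. ?\<Psi> i ` cube_int (?d i)) = ?\<Psi> N ` cube_int (?d N) \<union> (\<Union>i<N. ?\<Psi> i ` cube_int (?d i))"
        unfolding lessThan_Suc by simp
      also have "(\<Union>i<N. ?\<Psi> i ` cube_int (?d i)) = (\<Union>i<N. iL ` \<Psi> i ` cube_int (d i))"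
        by (rule SUP_cong) (use old in auto)
      also have "\<dots> = iL ` topspace (spc Y)" unfolding D(5)[symmetric] image_UN ..
      finally show ?thesis unfolding new char_image by blast
    qed
    fix i assume i: "i < Suc N"
    show "continuous_map (top_of_set (cube (?d i))) (spc C) (?\<Psi> i)"
      using i continuous_char continuous_map_compose[OF D(2) cm_iL] by (cases "i < N") auto
    show "inj_on (?\<Psi> i) (cube_int (?d i))"
    proof (cases "i < N")
      case True
      then show ?thesis using comp_inj_on[OF D(3)[OF True] inj_on_subset[OF inj_iL sub[OF True]]] by simp
    next
      case False
      then show ?thesis using i inj_char by (simp add: less_Suc_eq)
    qed
    show "?\<Psi> i ` cube_bd (?d i) \<subseteq> (\<Union>j\<in>{j. j < Suc N \<and> ?d j < ?d i}. ?\<Psi> j ` cube_int (?d j))"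
    proof -
      have step: "iL ` (\<Union>j\<in>{j. j < N \<and> d j < m}. \<Psi> j ` cube_int (d j)) \<subseteq> (\<Union>j\<in>{j. j < Suc N \<and> ?d j < m}. ?\<Psi> j ` cube_int (?d j))" for m
      proof clarify
        fix j y assume j: "j < N" "d j < m" "y \<in> cube_int (d j)"
        then have "iL (\<Psi> j y) \<in> ?\<Psi> j ` cube_int (?d j)" unfolding old[OF j(1)] by blast
        moreover have "j \<in> {j. j < Suc N \<and> ?d j < m}" using j by simp
        ultimately show "iL (\<Psi> j y) \<in> (\<Union>j\<in>{j. j < Suc N \<and> ?d j < m}. ?\<Psi> j ` cube_int (?d j))" by blast
      qed
      show ?thesis
      proof (cases "i < N")
        case True
        have "?\<Psi> i ` cube_bd (?d i) = iL ` \<Psi> i ` cube_bd (d i)" using True by (simp add: image_comp)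
        also have "\<dots> \<subseteq> iL ` (\<Union>j\<in>{j. j < N \<and> d j < d i}. \<Psi> j ` cube_int (d j))"
          by (rule image_mono[OF D(6)[OF True]])
        finally show ?thesis using step[of "d i"] True by simp
      next
        case False
        then have "i = N" using i by simp
        then have "?\<Psi> i ` cube_bd (?d i) = iL ` \<phi> ` cube_bd n" using char_bd by (simp add: image_image)
        also have "\<dots> \<subseteq> iL ` (\<Union>j\<in>{j. j < N \<and> d j < n}. \<Psi> j ` cube_int (d j))" by (rule image_mono[OF \<phi>])
        finally show ?thesis using step[of n] \<open>i = N\<close> by simp
      qed
    qed
  qed
qed

end

text \<open>The comparison map from the mapping cone is a homeomorphism because the cone is compact.\<close>

lemma attached_cell_cone:
  assumes Z: "Hausdorff_space Z" and A: "compactin Z A" "z0 \<in> A"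
    and c: "continuous_map (top_of_set (cube n)) Z \<xi>" and inj: "inj_on \<xi> (cube_int n)"
    and disj: "\<xi> ` cube_int n \<inter> A = {}" and bd: "\<xi> ` cube_bd n \<subseteq> A"
  shows "\<exists>k. phomotopy_equivalence (Pointed (subtopology Z (A \<union> \<xi> ` cube n)) z0)
    (Cyl (sphere_plus n) (Pointed (subtopology Z A) z0) two_pts (plus_map n z0 \<xi>) (collapse n)) k"
proof -
  define Y where "Y = Pointed (subtopology Z A) z0"
  have spcY: "spc Y = subtopology Z A" and bptY: "bpt Y = z0" by (simp_all add: Y_def)
  let ?W = "Pointed (subtopology Z (A \<union> \<xi> ` cube n)) z0"
  have AZ: "A \<subseteq> topspace Z" using A(1) by (rule compactin_subset_topspace)
  have TY: "topspace (spc Y) = A" using AZ by (auto simp: spcY)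
  have \<xi>Z: "\<xi> ` cube n \<subseteq> topspace Z" using cube_map_in[OF c] by blast
  have TW: "topspace (spc ?W) = A \<union> \<xi> ` cube n" using AZ \<xi>Z by auto
  have bdc: "cube_bd n \<subseteq> cube n" "cube_int n \<subseteq> cube n" using cube_split by blast+
  have cbd: "continuous_map (top_of_set (cube_bd n)) (spc Y) \<xi>"
  proof -
    have "continuous_map (top_of_set (cube_bd n)) Z \<xi>"
      using continuous_map_from_subtopology[OF c, of "cube_bd n"] bdc
      by (simp add: subtopology_subtopology Int_absorb1)
    then show ?thesis using bd by (simp add: spcY continuous_map_in_subtopology flip: image_subset_iff_funcset)
  qed
  interpret mapping_cone Y n \<xi>
    by unfold_locales (use cbd A AZ in \<open>auto simp: spcY bptY\<close>)
  let ?e = "\<lambda>t x. plus_map n z0 (\<lambda>x. \<xi> (polar t x)) x"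
  \<comment> \<open>The comparison map is the inclusion on \<open>A\<close>, follows the rays of the
    cell on the cone lines, and sends the apex to the image of the centre.\<close>
  define \<theta> where "\<theta> = cmap (\<lambda>a. a) ?e (\<lambda>b. if b then \<xi> (\<lambda>_. 0) else z0)"
  have zc: "(\<lambda>_. 0) \<in> cube n" using zero_cube_int bdc by blast
  have polar0: "polar 0 x = x" "polar 1 x = (\<lambda>_. 0)" for x by (simp_all add: polar_def fun_eq_iff)
  have e: "jcont (spc (sphere_plus n)) (spc ?W) ?e"
  proof (rule jcont_plus_map)
    have "continuous_map (top_of_set ({0..1::real} \<times> cube_bd n)) (top_of_set (cube n)) (\<lambda>z. polar (fst z) (snd z))"
      using continuous_polar polar(1) by (auto simp: continuous_map_in_subtopology)
    from continuous_map_compose[OF this c]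
    have "continuous_map (top_of_set ({0..1::real} \<times> cube_bd n)) Z (\<lambda>z. \<xi> (polar (fst z) (snd z)))" by (simp add: o_def)
    then show "jcont (top_of_set (cube_bd n)) (spc ?W) (\<lambda>t x. \<xi> (polar t x))"
      using polar(1) by (auto simp: jcont_def continuous_map_in_subtopology)
    show "z0 \<in> topspace (spc ?W)" using TW A by simp
  qed
  have incl: "pmap Y ?W (\<lambda>a. a)"
    by (auto simp: pmap_def spcY bptY continuous_map_in_subtopology continuous_map_from_subtopology)
  have apexp: "pmap two_pts ?W (\<lambda>b. if b then \<xi> (\<lambda>_. 0) else z0)"
    using TW A zc by (auto simp: pmap_def two_pts_def)
  have e0: "?e 0 x = plus_map n z0 \<xi> x" "?e 1 x = (if collapse n x then \<xi> (\<lambda>_. 0) else z0)" for x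
    by (simp_all add: plus_map_def polar0 collapse_def)
  have eb: "?e t (extra_pt n) = z0" for t by (simp add: plus_map_simps)
  have \<theta>p: "pmap C ?W \<theta>"
    unfolding \<theta>_def by (rule cmap_pmap[OF incl apexp e]) (simp_all add: e0 eb bptY)
  have \<theta>L: "\<theta> (iL a) = a" if "a \<in> A" for a
    unfolding \<theta>_def using that TY by (subst cmap_eq(1)[where ?y0.0 = z0]) (simp_all add: e0 eb bptY)
  have \<theta>M: "\<theta> (iM t x) = \<xi> (polar t x)" if "0 \<le> t" "t \<le> 1" "x \<in> cube_bd n" for t x
    unfolding \<theta>_def using that
    by (subst cmap_eq(2)[where ?y0.0 = z0]) (simp_all add: e0 eb bptY plus_map_simps)
  have \<theta>R: "\<theta> (iR True) = \<xi> (\<lambda>_. 0)"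
    unfolding \<theta>_def by (subst cmap_eq(3)[where ?y0.0 = z0]) (simp_all add: e0 eb bptY)
  have \<theta>char: "\<theta> (char y) = \<xi> y" if "y \<in> cube_int n" for y
    using that
  proof (cases rule: char_cases)
    case 1
    show ?thesis unfolding 1(2) \<theta>R unfolding 1(1) ..
  next
    case (2 t x)
    show ?thesis unfolding 2(5) unfolding 2(4) by (rule \<theta>M) (use 2 in simp_all)
  qed
  have "inj_on \<theta> (topspace (spc C))"
    unfolding char_image TY
  proof (subst inj_on_Un, intro conjI)
    show "inj_on \<theta> (iL ` A)" by (rule inj_onI) (auto simp: \<theta>L)
    show "inj_on \<theta> (char ` cube_int n)"
      by (rule inj_on_imageI) (use inj \<theta>char in \<open>simp add: inj_on_def\<close>)
    have "\<theta> ` (iL ` A) \<subseteq> A" "\<theta> ` (char ` cube_int n) \<subseteq> \<xi> ` cube_int n" using \<theta>L \<theta>char by auto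
    then show "\<theta> ` (iL ` A - char ` cube_int n) \<inter> \<theta> ` (char ` cube_int n - iL ` A) = {}"
      using disj by blast
  qed
  moreover have "\<theta> ` topspace (spc C) = topspace (spc ?W)"
  proof -
    have "\<theta> ` topspace (spc C) = \<theta> ` iL ` A \<union> \<theta> ` char ` cube_int n"
      unfolding char_image TY by (rule image_Un)
    also have "\<theta> ` iL ` A = A" using \<theta>L by (simp add: image_image)
    also have "\<theta> ` char ` cube_int n = \<xi> ` cube_int n" using \<theta>char by (simp add: image_image)
    also have "A \<union> \<xi> ` cube_int n = A \<union> \<xi> ` cube n"
      using bd by (auto simp: cube_split(1)[of n])
    finally show ?thesis by (simp only: TW)
  qed
  moreover have "closed_map (spc C) (spc ?W) \<theta>"
  proof (rule continuous_imp_closed_map[OF pmap_cm[OF \<theta>p]])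
    show "compact_space (spc C)"
      using A(1) by (intro compact_C compact_Hausdorff_sphere_plus) (simp add: spcY compact_space_subtopology)
    show "Hausdorff_space (spc ?W)" using Z by (simp add: Hausdorff_space_subtopology)
  qed
  ultimately have "homeomorphic_map (spc C) (spc ?W) \<theta>"
    using pmap_cm[OF \<theta>p] by (intro bijective_closed_imp_homeomorphic_map)
  then obtain \<kappa> where \<kappa>: "homeomorphic_maps (spc C) (spc ?W) \<theta> \<kappa>" using homeomorphic_map_maps by blast
  then have k: "continuous_map (spc ?W) (spc C) \<kappa>" "\<And>x. x \<in> topspace (spc C) \<Longrightarrow> \<kappa> (\<theta> x) = x"
    "\<And>y. y \<in> topspace (spc ?W) \<Longrightarrow> \<theta> (\<kappa> y) = y"
    unfolding homeomorphic_maps_def by auto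
  have "\<kappa> (bpt ?W) = bpt C" using k(2)[OF bC] pmap_bpt[OF \<theta>p] by simp
  then have kp: "pmap ?W C \<kappa>" using k(1) by (simp add: pmap_def)
  have bW: "bpt ?W \<in> topspace (spc ?W)" using TW A by simp
  have "phomotopy_equivalence ?W C \<kappa>"
    by (rule phomotopy_equivalence_mutual_inverse[OF bW bC kp \<theta>p]) (fact k)+
  then show ?thesis unfolding bptY unfolding Y_def by blast
qed

text \<open>The attaching map is carried over to the model \<open>P\<close> and deformed into cells
  of small dimension before the cell is attached there. Replacement and deformation together are a
  single case of \<open>cyl_shift_equivalence\<close>, applied to the left end of the cylinder that
  represents the cone.\<close>

lemma attach_cell_model:
  fixes Z :: "'z topology" and P :: "'u pointed"
  assumes e: "\<exists>e :: real \<Rightarrow> 'u. inj e" and Z: "Hausdorff_space Z" and A: "compactin Z A" "z0 \<in> A"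
    and P: "pointed_finite_CW P" "phomotopy_equivalence (Pointed (subtopology Z A) z0) P h"
    and c: "continuous_map (top_of_set (cube n)) Z \<xi>" and inj: "inj_on \<xi> (cube_int n)"
    and disj: "\<xi> ` cube_int n \<inter> A = {}" and bd: "\<xi> ` cube_bd n \<subseteq> A"
  shows "\<exists>(Q :: 'u pointed) k. pointed_finite_CW Q \<and>
    phomotopy_equivalence (Pointed (subtopology Z (A \<union> \<xi> ` cube n)) z0) Q k"
proof -
  let ?Y = "Pointed (subtopology Z A) z0"
  obtain N d \<Psi> where CW: "cube_CW (spc P) N d \<Psi>" and bP: "bpt P \<in> topspace (spc P)"
    using P(1) by (auto simp: pointed_finite_CW_def finite_CW_space_iff)
  have cbd: "continuous_map (top_of_set (cube_bd n)) (spc ?Y) \<xi>"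
  proof -
    have "cube_bd n \<subseteq> cube n" using cube_split by blast
    then have "continuous_map (top_of_set (cube_bd n)) Z \<xi>"
      using continuous_map_from_subtopology[OF c, of "cube_bd n"]
      by (simp add: subtopology_subtopology Int_absorb1)
    then show ?thesis using bd by (simp add: continuous_map_in_subtopology flip: image_subset_iff_funcset)
  qed
  have bY: "bpt ?Y \<in> topspace (spc ?Y)" using A compactin_subset_topspace by fastforce
  note hp = phomotopy_equivalence_pmap[OF P(2)]
  have "continuous_map (top_of_set (cube_bd n)) (spc P) (h \<circ> \<xi>)"
    using continuous_map_compose[OF cbd pmap_cm[OF hp]] .
  from cellular_approximation[OF CW this] obtain \<phi>' where
    \<phi>': "homotopic_with (\<lambda>_. True) (top_of_set (cube_bd n)) (spc P) (h \<circ> \<xi>) \<phi>'"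
      "\<phi>' ` cube_bd n \<subseteq> (\<Union>j\<in>{j. j < N \<and> d j < n}. \<Psi> j ` cube_int (d j))" by blast
  have c\<phi>': "continuous_map (top_of_set (cube_bd n)) (spc P) \<phi>'"
    using homotopic_with_imp_continuous_maps[OF \<phi>'(1)] by blast
  interpret M: mapping_cone P n \<phi>' using c\<phi>' bP by unfold_locales
  have "h \<circ> plus_map n (bpt ?Y) \<xi> = plus_map n (bpt P) (h \<circ> \<xi>)"
    using pmap_bpt[OF hp] by (auto simp: plus_map_def fun_eq_iff)
  then have "phomotopic (sphere_plus n) P (h \<circ> plus_map n (bpt ?Y) \<xi>) (plus_map n (bpt P) \<phi>')"
    using phomotopic_plus_map[OF \<phi>'(1) bP] by simp
  then obtain \<psi> where \<psi>: "phomotopy_equivalence (Cyl (sphere_plus n) ?Y two_pts (plus_map n (bpt ?Y) \<xi>) (collapse n)) M.C \<psi>"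
    using cyl_shift_equivalence[OF dmc_attach[OF cbd bY] P(2)] by metis
  obtain k where k: "phomotopy_equivalence (Pointed (subtopology Z (A \<union> \<xi> ` cube n)) z0)
    (Cyl (sphere_plus n) ?Y two_pts (plus_map n z0 \<xi>) (collapse n)) k"
    using attached_cell_cone[OF Z A c inj disj bd] by blast
  have "pointed_finite_CW M.C"
    using M.cube_CW_cone[OF CW \<phi>'(2)] M.bC by (auto simp: pointed_finite_CW_def finite_CW_space_iff)
  then obtain Q :: "'u pointed" and q where Q: "pointed_finite_CW Q" "phomotopy_equivalence M.C Q q"
    using pointed_finite_CW_relocate e by blast
  have "phomotopy_equivalence (Pointed (subtopology Z (A \<union> \<xi> ` cube n)) z0) Q (q \<circ> (\<psi> \<circ> k))"
    using \<psi> k Q(2) by (auto intro: phomotopy_equivalence_compose)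
  then show ?thesis using Q(1) by blast
qed

lemma cell_built_model:
  fixes Z :: "'z topology"
  assumes e: "\<exists>e :: real \<Rightarrow> 'u. inj e" and Z: "Hausdorff_space Z" and A: "cell_built Z z0 A"
  shows "\<exists>(Q :: 'u pointed) k. pointed_finite_CW Q \<and> phomotopy_equivalence (Pointed (subtopology Z A) z0) Q k"
  using A
proof induction
  case point
  have c0: "cube 0 = {\<lambda>_. 0}" "cube_int 0 = {\<lambda>_. 0}" "cube_bd 0 = {}"
    by (auto simp: cube_def cube_int_def cube_bd_def espace_def)
  have "cube_CW (subtopology Z {z0}) 1 (\<lambda>_. 0) (\<lambda>_ _. z0)"
    unfolding cube_CW_def c0 using Z point
    by (auto simp: Hausdorff_space_subtopology disjoint_family_on_def)
  then have "pointed_finite_CW (Pointed (subtopology Z {z0}) z0)"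
    using point by (auto simp: pointed_finite_CW_def finite_CW_space_iff)
  then show ?case using pointed_finite_CW_relocate[OF _ e] by metis
next
  case (cell A n \<xi>)
  then obtain P :: "'u pointed" and h where "pointed_finite_CW P" "phomotopy_equivalence (Pointed (subtopology Z A) z0) P h"
    by blast
  from attach_cell_model[OF e Z cell_built_facts(2,1)[OF cell(1)] this cell(2-5)] show ?case .
qed

text \<open>This provides the finite CW model, inside the universe, of a composite of cospans.
  Closure of the cospan category under composition depends on it, as does the use of the
  Mayer-Vietoris relation for cylinders.\<close>

lemma Cyl_model:
  fixes K L0 L1 :: "'a pointed"
  assumes e: "\<exists>e :: real \<Rightarrow> 'u. inj e"
    and CW: "pointed_finite_CW K" "pointed_finite_CW L0" "pointed_finite_CW L1" and fg: "pmap K L0 f" "pmap K L1 g"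
  shows "\<exists>(Q :: 'u pointed) k. pointed_finite_CW Q \<and> phomotopy_equivalence (Cyl K L0 L1 f g) Q k"
proof -
  interpret dmc K L0 L1 f g
    using pointed_finite_CW_D(3)[OF CW(1)] fg by unfold_locales
  have built: "cell_built (spc X) (bpt X) (topspace (spc X))" if "pointed_finite_CW X" for X :: "'a pointed"
    using that cube_CW_cell_built by (auto simp: pointed_finite_CW_def finite_CW_space_iff)
  have "cell_built (spc C) (bpt C) (topspace (spc C))"
    by (rule cell_built_C[OF built[OF CW(1)] built[OF CW(2)] built[OF CW(3)]])
  moreover have "Hausdorff_space (spc C)"
    by (rule Hausdorff_C) (use pointed_finite_CW_D CW in blast)+
  ultimately show ?thesis using cell_built_model[OF e, of "spc C" "bpt C" "topspace (spc C)"] by simp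
qed

section \<open>Cospans up to homotopy equivalence\<close>

text \<open>Cospans whose apex is any space of any type. Congruence, units and associativity are
  proved at this generality, so that cylinders can be handled before they are replaced by CW
  models.\<close>

definition is_cospan :: "'k pointed \<Rightarrow> 'k pointed \<Rightarrow> ('k, 'a) cospan \<Rightarrow> bool" where
  "is_cospan K0 K1 c \<longleftrightarrow> bpt K0 \<in> topspace (spc K0) \<and> bpt K1 \<in> topspace (spc K1) \<and>
     pmap K0 (apex c) (lleg c) \<and> pmap K1 (apex c) (rleg c)"

text \<open>Reversal transfers the statements about the left factor of a composite to the right
  factor, by \<open>cyl_cospan_swap\<close>.\<close>

definition swap_cospan :: "('k, 'a) cospan \<Rightarrow> ('k, 'a) cospan" where
  "swap_cospan c = Cospan (apex c) (rleg c) (lleg c)"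

lemma swap_cospan_simps [simp]:
  "apex (swap_cospan c) = apex c" "lleg (swap_cospan c) = rleg c" "rleg (swap_cospan c) = lleg c"
  "is_cospan K0 K1 (swap_cospan c) \<longleftrightarrow> is_cospan K1 K0 c"
  "cospan_equiv K0 K1 (swap_cospan c) (swap_cospan c') \<longleftrightarrow> cospan_equiv K1 K0 c c'"
  "swap_cospan (swap_cospan c) = c"
  by (auto simp: swap_cospan_def is_cospan_def cospan_equiv_def)

lemma cospan_equivI:
  assumes "phomotopy_equivalence (apex c) (apex c') h"
    "phomotopic K0 (apex c') (lleg c') (h \<circ> lleg c)" "phomotopic K1 (apex c') (rleg c') (h \<circ> rleg c)"
  shows "cospan_equiv K0 K1 c c'"
  using assms unfolding cospan_equiv_def by blast

lemma cospan_equiv_refl: "is_cospan K0 K1 c \<Longrightarrow> cospan_equiv K0 K1 c c"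
  by (rule cospan_equivI[OF phomotopy_equivalence_id]) (auto simp: is_cospan_def o_def phomotopic_refl)

lemma cospan_equiv_sym:
  assumes c: "is_cospan K0 K1 c" and "cospan_equiv K0 K1 c c'"
  shows "cospan_equiv K0 K1 c' c"
proof -
  obtain h where h: "phomotopy_equivalence (apex c) (apex c') h"
    "phomotopic K0 (apex c') (lleg c') (h \<circ> lleg c)" "phomotopic K1 (apex c') (rleg c') (h \<circ> rleg c)"
    using assms(2) unfolding cospan_equiv_def by blast
  obtain k where k: "phomotopy_equivalence (apex c') (apex c) k" "phomotopic (apex c) (apex c) (k \<circ> h) (\<lambda>x. x)"
    using h(1) by (rule phomotopy_equivalence_inverse)
  have *: "phomotopic K (apex c) l (k \<circ> l')" if "phomotopic K (apex c') l' (h \<circ> l)" "pmap K (apex c) l" for K l l'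
  proof -
    have "phomotopic K (apex c) (k \<circ> l') (k \<circ> (h \<circ> l))"
      by (rule phomotopic_post[OF that(1) phomotopy_equivalence_pmap[OF k(1)]])
    moreover have "phomotopic K (apex c) ((k \<circ> h) \<circ> l) ((\<lambda>x. x) \<circ> l)"
      by (rule phomotopic_pre[OF k(2) that(2)])
    ultimately have "phomotopic K (apex c) (k \<circ> l') l"
      unfolding o_def by (rule phomotopic_trans)
    then show ?thesis by (rule phomotopic_sym)
  qed
  show ?thesis
    using k(1) *[OF h(2)] *[OF h(3)] c by (intro cospan_equivI) (auto simp: is_cospan_def)
qed

lemma cospan_equiv_trans:
  assumes "cospan_equiv K0 K1 c c'" "cospan_equiv K0 K1 c' c''"
  shows "cospan_equiv K0 K1 c c''"
proof -
  obtain h where h: "phomotopy_equivalence (apex c) (apex c') h"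
    "phomotopic K0 (apex c') (lleg c') (h \<circ> lleg c)" "phomotopic K1 (apex c') (rleg c') (h \<circ> rleg c)"
    using assms(1) unfolding cospan_equiv_def by blast
  obtain k where k: "phomotopy_equivalence (apex c') (apex c'') k"
    "phomotopic K0 (apex c'') (lleg c'') (k \<circ> lleg c')" "phomotopic K1 (apex c'') (rleg c'') (k \<circ> rleg c')"
    using assms(2) unfolding cospan_equiv_def by blast
  note kp = phomotopy_equivalence_pmap[OF k(1)]
  show ?thesis
  proof (rule cospan_equivI[OF phomotopy_equivalence_compose[OF h(1) k(1)]])
    show "phomotopic K0 (apex c'') (lleg c'') (k \<circ> h \<circ> lleg c)"
      using phomotopic_trans[OF k(2) phomotopic_post[OF h(2) kp]] by (simp add: o_assoc)
    show "phomotopic K1 (apex c'') (rleg c'') (k \<circ> h \<circ> rleg c)"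
      using phomotopic_trans[OF k(3) phomotopic_post[OF h(3) kp]] by (simp add: o_assoc)
  qed
qed

lemma is_cospan_dmc:
  "is_cospan K0 K1 c \<Longrightarrow> is_cospan K1 K2 d \<Longrightarrow> dmc K1 (apex c) (apex d) (rleg c) (lleg d)"
  by unfold_locales (auto simp: is_cospan_def)

abbreviation cyl_left :: "'k pointed \<Rightarrow> ('k, 'a) cospan \<Rightarrow> ('k, 'b) cospan \<Rightarrow> 'a \<Rightarrow> ('a, 'k, 'b) cyl_pt set" where
  "cyl_left K c d \<equiv> dmc.iL K (apex c) (apex d) (rleg c) (lleg d)"

abbreviation cyl_right :: "'k pointed \<Rightarrow> ('k, 'a) cospan \<Rightarrow> ('k, 'b) cospan \<Rightarrow> 'b \<Rightarrow> ('a, 'k, 'b) cyl_pt set" where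
  "cyl_right K c d \<equiv> dmc.iR K (apex c) (apex d) (rleg c) (lleg d)"

lemma cyl_cospan_simps:
  assumes "is_cospan K0 K1 c" "is_cospan K1 K2 d"
  shows "apex (cyl_cospan K1 c d) = Cyl K1 (apex c) (apex d) (rleg c) (lleg d)"
    "lleg (cyl_cospan K1 c d) = cyl_left K1 c d \<circ> lleg c"
    "rleg (cyl_cospan K1 c d) = cyl_right K1 c d \<circ> rleg d"
    "is_cospan K0 K2 (cyl_cospan K1 c d)"
proof -
  interpret dmc K1 "apex c" "apex d" "rleg c" "lleg d" by (rule is_cospan_dmc[OF assms])
  show 1: "apex (cyl_cospan K1 c d) = Cyl K1 (apex c) (apex d) (rleg c) (lleg d)"
    "lleg (cyl_cospan K1 c d) = iL \<circ> lleg c" "rleg (cyl_cospan K1 c d) = iR \<circ> rleg d"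
    by (simp_all add: cyl_cospan_def Let_def iL_def[abs_def] iR_def[abs_def] o_def)
  show "is_cospan K0 K2 (cyl_cospan K1 c d)"
    using assms pmap_compose[OF _ pmap_iL] pmap_compose[OF _ pmap_iR]
    unfolding is_cospan_def 1 by blast
qed

lemma cyl_cospan_cong_left:
  assumes c: "is_cospan K0 K1 c" and c': "is_cospan K0 K1 c'" and d: "is_cospan K1 K2 d"
    and eq: "cospan_equiv K0 K1 c c'"
  shows "cospan_equiv K0 K2 (cyl_cospan K1 c d) (cyl_cospan K1 c' d)"
proof -
  interpret A: dmc K1 "apex c" "apex d" "rleg c" "lleg d" by (rule is_cospan_dmc[OF c d])
  interpret B: dmc K1 "apex c'" "apex d" "rleg c'" "lleg d" by (rule is_cospan_dmc[OF c' d])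
  obtain h where h: "phomotopy_equivalence (apex c) (apex c') h"
    "phomotopic K0 (apex c') (lleg c') (h \<circ> lleg c)" "phomotopic K1 (apex c') (rleg c') (h \<circ> rleg c)"
    using eq unfolding cospan_equiv_def by blast
  obtain \<phi> where \<phi>: "phomotopy_equivalence A.C B.C \<phi>"
    "\<And>x. x \<in> topspace (spc (apex c)) \<Longrightarrow> \<phi> (A.iL x) = B.iL (h x)"
    "\<And>y. y \<in> topspace (spc (apex d)) \<Longrightarrow> \<phi> (A.iR y) = B.iR y"
    by (rule cyl_shift_equivalence[OF A.dmc_axioms h(1) phomotopic_sym[OF h(3)]], rule that) simp_all
  note legs = c[unfolded is_cospan_def] c'[unfolded is_cospan_def] d[unfolded is_cospan_def]
  show ?thesis
  proof (rule cospan_equivI[of _ _ \<phi>], unfold cyl_cospan_simps[OF c d] cyl_cospan_simps[OF c' d])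
    show "phomotopy_equivalence A.C B.C \<phi>" by (rule \<phi>(1))
    have "phomotopic K0 B.C (B.iL \<circ> lleg c') (B.iL \<circ> (h \<circ> lleg c))"
      by (rule phomotopic_post[OF h(2) B.pmap_iL])
    moreover have "phomotopic K0 B.C (B.iL \<circ> (h \<circ> lleg c)) (\<phi> \<circ> (A.iL \<circ> lleg c))"
      using legs phomotopy_equivalence_pmap[OF h(1)] \<phi>(2) pmap_in
      by (intro phomotopic_eq pmap_compose[OF _ B.pmap_iL] pmap_compose[of K0]) fastforce+
    ultimately show "phomotopic K0 B.C (B.iL \<circ> lleg c') (\<phi> \<circ> (A.iL \<circ> lleg c))"
      by (rule phomotopic_trans)
    show "phomotopic K2 B.C (B.iR \<circ> rleg d) (\<phi> \<circ> (A.iR \<circ> rleg d))"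
      using legs \<phi>(3) pmap_in
      by (intro phomotopic_eq pmap_compose[OF _ B.pmap_iR]) fastforce+
  qed
qed

lemma cyl_cospan_swap:
  assumes c: "is_cospan K0 K1 c" and d: "is_cospan K1 K2 d"
  shows "cospan_equiv K0 K2 (cyl_cospan K1 c d) (swap_cospan (cyl_cospan K1 (swap_cospan d) (swap_cospan c)))"
proof -
  have s: "is_cospan K2 K1 (swap_cospan d)" "is_cospan K1 K0 (swap_cospan c)" using c d by simp_all
  interpret A: dmc K1 "apex c" "apex d" "rleg c" "lleg d" by (rule is_cospan_dmc[OF c d])
  interpret B: dmc K1 "apex d" "apex c" "lleg d" "rleg c" using is_cospan_dmc[OF s] by simp
  obtain \<phi> where \<phi>: "phomotopy_equivalence A.C B.C \<phi>"
    "\<And>x. x \<in> topspace (spc (apex c)) \<Longrightarrow> \<phi> (A.iL x) = B.iR x"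
    "\<And>y. y \<in> topspace (spc (apex d)) \<Longrightarrow> \<phi> (A.iR y) = B.iL y"
    by (rule cyl_swap[OF A.dmc_axioms], rule that) simp_all
  note legs = c[unfolded is_cospan_def] d[unfolded is_cospan_def]
  show ?thesis
  proof (rule cospan_equivI[of _ _ \<phi>], unfold swap_cospan_simps cyl_cospan_simps[OF c d] cyl_cospan_simps[OF s])
    show "phomotopy_equivalence A.C B.C \<phi>" by (rule \<phi>(1))
    show "phomotopic K0 B.C (B.iR \<circ> lleg c) (\<phi> \<circ> (A.iL \<circ> lleg c))"
      using legs \<phi>(2) pmap_in by (intro phomotopic_eq pmap_compose[OF _ B.pmap_iR]) fastforce+
    show "phomotopic K2 B.C (B.iL \<circ> rleg d) (\<phi> \<circ> (A.iR \<circ> rleg d))"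
      using legs \<phi>(3) pmap_in by (intro phomotopic_eq pmap_compose[OF _ B.pmap_iL]) fastforce+
  qed
qed

lemma cyl_cospan_cong_right:
  assumes c: "is_cospan K0 K1 c" and d: "is_cospan K1 K2 d" and d': "is_cospan K1 K2 d'"
    and eq: "cospan_equiv K1 K2 d d'"
  shows "cospan_equiv K0 K2 (cyl_cospan K1 c d) (cyl_cospan K1 c d')"
proof -
  have "cospan_equiv K2 K0 (cyl_cospan K1 (swap_cospan d) (swap_cospan c)) (cyl_cospan K1 (swap_cospan d') (swap_cospan c))"
    using assms by (intro cyl_cospan_cong_left) simp_all
  then have "cospan_equiv K0 K2 (swap_cospan (cyl_cospan K1 (swap_cospan d) (swap_cospan c)))
      (swap_cospan (cyl_cospan K1 (swap_cospan d') (swap_cospan c)))"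
    by simp
  moreover have "cospan_equiv K0 K2 (swap_cospan (cyl_cospan K1 (swap_cospan d') (swap_cospan c))) (cyl_cospan K1 c d')"
    by (rule cospan_equiv_sym[OF cyl_cospan_simps(4)[OF c d'] cyl_cospan_swap[OF c d']])
  ultimately show ?thesis
    using cospan_equiv_trans[OF cyl_cospan_swap[OF c d]] cospan_equiv_trans by metis
qed

text \<open>The cylinder collapses onto the apex of \<open>d\<close> by \<open>cyl_id_left\<close>.
  The free leg \<open>x\<close> lets one statement cover the unit law, the functoriality of
  \<open>iota_plus\<close> and the factorization of a cospan into its two legs.\<close>

lemma cyl_cospan_left_unit:
  assumes d: "is_cospan K1 K2 d" and x: "pmap K0 K1 x" and K0: "bpt K0 \<in> topspace (spc K0)"
  shows "cospan_equiv K0 K2 (cyl_cospan K1 (Cospan K1 x (\<lambda>x. x)) d) (Cospan (apex d) (lleg d \<circ> x) (rleg d))"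
proof -
  have c: "is_cospan K0 K1 (Cospan K1 x (\<lambda>x. x))" using d x K0 by (simp add: is_cospan_def pmap_id)
  interpret A: dmc K1 K1 "apex d" "\<lambda>x. x" "lleg d" using is_cospan_dmc[OF c d] by simp
  obtain \<phi> where \<phi>: "phomotopy_equivalence A.C (apex d) \<phi>"
    "\<And>x. x \<in> topspace (spc K1) \<Longrightarrow> \<phi> (A.iL x) = lleg d x"
    "\<And>y. y \<in> topspace (spc (apex d)) \<Longrightarrow> \<phi> (A.iR y) = y"
    by (rule cyl_id_left[OF A.dmc_axioms], rule that) simp_all
  note legs = d[unfolded is_cospan_def]
  show ?thesis
  proof (rule cospan_equivI[of _ _ \<phi>], unfold cyl_cospan_simps[OF c d] cospan.sel)
    show "phomotopy_equivalence A.C (apex d) \<phi>" by (rule \<phi>(1))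
    show "phomotopic K0 (apex d) (lleg d \<circ> x) (\<phi> \<circ> (A.iL \<circ> x))"
      using legs x K0 \<phi>(2) pmap_in by (intro phomotopic_eq pmap_compose[OF x]) fastforce+
    show "phomotopic K2 (apex d) (rleg d) (\<phi> \<circ> (A.iR \<circ> rleg d))"
      using legs \<phi>(3) pmap_in by (intro phomotopic_eq) fastforce+
  qed
qed

lemma cyl_cospan_right_unit:
  assumes c: "is_cospan K0 K1 c" and y: "pmap K2 K1 y" and K2: "bpt K2 \<in> topspace (spc K2)"
  shows "cospan_equiv K0 K2 (cyl_cospan K1 c (Cospan K1 (\<lambda>x. x) y)) (Cospan (apex c) (lleg c) (rleg c \<circ> y))"
proof -
  let ?d = "Cospan K1 (\<lambda>x. x) y"
  have d: "is_cospan K1 K2 ?d" using c y K2 by (simp add: is_cospan_def pmap_id)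
  have "cospan_equiv K2 K0 (cyl_cospan K1 (Cospan K1 y (\<lambda>x. x)) (swap_cospan c))
      (Cospan (apex (swap_cospan c)) (lleg (swap_cospan c) \<circ> y) (rleg (swap_cospan c)))"
    using c y K2 by (intro cyl_cospan_left_unit) simp_all
  moreover have "Cospan K1 y (\<lambda>x. x) = swap_cospan ?d"
    "Cospan (apex (swap_cospan c)) (lleg (swap_cospan c) \<circ> y) (rleg (swap_cospan c)) = swap_cospan (Cospan (apex c) (lleg c) (rleg c \<circ> y))"
    by (simp_all add: swap_cospan_def)
  ultimately have "cospan_equiv K2 K0 (cyl_cospan K1 (swap_cospan ?d) (swap_cospan c)) (swap_cospan (Cospan (apex c) (lleg c) (rleg c \<circ> y)))"
    by (simp only:)
  then have "cospan_equiv K0 K2 (swap_cospan (cyl_cospan K1 (swap_cospan ?d) (swap_cospan c))) (Cospan (apex c) (lleg c) (rleg c \<circ> y))"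
    by (metis swap_cospan_simps(5,6))
  then show ?thesis by (rule cospan_equiv_trans[OF cyl_cospan_swap[OF c d]])
qed

lemma cyl_cospan_assoc:
  assumes c: "is_cospan K0 K1 c" and d: "is_cospan K1 K2 d" and e: "is_cospan K2 K3 e"
  shows "cospan_equiv K0 K3 (cyl_cospan K2 (cyl_cospan K1 c d) e) (cyl_cospan K1 c (cyl_cospan K2 d e))"
proof -
  note cd = cyl_cospan_simps[OF c d] and de = cyl_cospan_simps[OF d e]
  interpret A: dmc K1 "apex c" "apex d" "rleg c" "lleg d" by (rule is_cospan_dmc[OF c d])
  interpret B: dmc K2 "apex d" "apex e" "rleg d" "lleg e" by (rule is_cospan_dmc[OF d e])
  interpret AC: dmc K2 A.C "apex e" "A.iR \<circ> rleg d" "lleg e"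
    using is_cospan_dmc[OF cd(4) e] unfolding cd .
  interpret BC: dmc K1 "apex c" B.C "rleg c" "B.iL \<circ> lleg d"
    using is_cospan_dmc[OF c de(4)] unfolding de .
  obtain \<phi> where \<phi>: "phomotopy_equivalence AC.C BC.C \<phi>"
    "\<And>x. x \<in> topspace (spc (apex c)) \<Longrightarrow> \<phi> (AC.iL (A.iL x)) = BC.iL x"
    "\<And>y. y \<in> topspace (spc (apex e)) \<Longrightarrow> \<phi> (AC.iR y) = BC.iR (B.iR y)"
    by (rule cyl_assoc[OF A.dmc_axioms B.dmc_axioms], rule that) simp_all
  note legs = c[unfolded is_cospan_def] e[unfolded is_cospan_def]
  show ?thesis
  proof (rule cospan_equivI[of _ _ \<phi>], unfold cyl_cospan_simps[OF cd(4) e] cyl_cospan_simps[OF c de(4)], unfold cd de)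
    show "phomotopy_equivalence AC.C BC.C \<phi>" by (rule \<phi>(1))
    show "phomotopic K0 BC.C (BC.iL \<circ> lleg c) (\<phi> \<circ> (AC.iL \<circ> (A.iL \<circ> lleg c)))"
      using legs \<phi>(2) pmap_in by (intro phomotopic_eq pmap_compose[OF _ BC.pmap_iL]) fastforce+
    show "phomotopic K3 BC.C (BC.iR \<circ> (B.iR \<circ> rleg e)) (\<phi> \<circ> (AC.iR \<circ> rleg e))"
      using legs \<phi>(3) pmap_in
      by (intro phomotopic_eq pmap_compose[OF _ BC.pmap_iR] pmap_compose[OF _ B.pmap_iR]) fastforce+
  qed
qed

section \<open>The two categories\<close>

lemma pointed_CW_bpt: "pointed_finite_CW K \<Longrightarrow> bpt K \<in> topspace (spc K)"
  by (simp add: pointed_finite_CW_def)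

lemma Obj_HCW: "K \<in> Obj HCW \<longleftrightarrow> pointed_finite_CW K"
  by (simp add: HCW_def)

lemma Obj_CospCW: "K \<in> Obj CospCW \<longleftrightarrow> pointed_finite_CW K"
  by (simp add: CospCW_def)

lemma Hom_HCW: "F \<in> Hom HCW K L \<longleftrightarrow> (\<exists>f. pmap K L f \<and> F = hclass K L f)"
  by (auto simp: HCW_def)

lemma hclass_self: "pmap K L f \<Longrightarrow> f \<in> hclass K L f"
  by (simp add: hclass_def phomotopic_refl)

lemma hclass_eq: "phomotopic K L f g \<Longrightarrow> hclass K L f = hclass K L g"
  unfolding hclass_def by (blast intro: phomotopic_trans phomotopic_sym)

lemma Comp_HCW:
  assumes "pmap K L f" "pmap L M g"
  shows "Comp HCW K L M (hclass L M g) (hclass K L f) = hclass K M (g \<circ> f)"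
proof -
  have "(\<exists>g'\<in>hclass L M g. \<exists>f'\<in>hclass K L f. phomotopic K M (g' \<circ> f') h) \<longleftrightarrow> phomotopic K M (g \<circ> f) h" for h
  proof
    assume "\<exists>g'\<in>hclass L M g. \<exists>f'\<in>hclass K L f. phomotopic K M (g' \<circ> f') h"
    then obtain g' f' where "phomotopic L M g g'" "phomotopic K L f f'" "phomotopic K M (g' \<circ> f') h"
      by (auto simp: hclass_def)
    then show "phomotopic K M (g \<circ> f) h"
      using phomotopic_trans[OF phomotopic_compose] by blast
  next
    assume "phomotopic K M (g \<circ> f) h"
    then show "\<exists>g'\<in>hclass L M g. \<exists>f'\<in>hclass K L f. phomotopic K M (g' \<circ> f') h"
      using hclass_self assms by blast
  qed
  then show ?thesis by (simp add: HCW_def) (simp add: hclass_def)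
qed

lemma category_HCW: "category HCW"
proof
  fix X Y Z W :: "'a pointed" and f g h
  show "Id HCW X \<in> Hom HCW X X" by (auto simp: Hom_HCW HCW_def pmap_id)
  show "Comp HCW X Y Z g f \<in> Hom HCW X Z" if "f \<in> Hom HCW X Y" "g \<in> Hom HCW Y Z"
    using that unfolding Hom_HCW by (metis Comp_HCW pmap_compose)
  have I: "Id HCW X = hclass X X (\<lambda>x. x)" for X :: "'a pointed" by (simp add: HCW_def)
  show "Comp HCW X Y Y (Id HCW Y) f = f" "Comp HCW X X Y f (Id HCW X) = f" if f: "f \<in> Hom HCW X Y"
  proof -
    obtain a where a: "pmap X Y a" "f = hclass X Y a" using f unfolding Hom_HCW by blast
    show "Comp HCW X Y Y (Id HCW Y) f = f" "Comp HCW X X Y f (Id HCW X) = f"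
      unfolding I a(2) Comp_HCW[OF a(1) pmap_id] Comp_HCW[OF pmap_id a(1)] by (simp_all add: o_def)
  qed
  show "Comp HCW X Z W h (Comp HCW X Y Z g f) = Comp HCW X Y W (Comp HCW Y Z W h g) f"
    if fgh: "f \<in> Hom HCW X Y" "g \<in> Hom HCW Y Z" "h \<in> Hom HCW Z W"
  proof -
    obtain a b c where a: "pmap X Y a" "f = hclass X Y a" and b: "pmap Y Z b" "g = hclass Y Z b"
      and c: "pmap Z W c" "h = hclass Z W c"
      using fgh unfolding Hom_HCW by blast
    show ?thesis
      unfolding a(2) b(2) c(2) Comp_HCW[OF a(1) b(1)] Comp_HCW[OF b(1) c(1)]
        Comp_HCW[OF pmap_compose[OF a(1) b(1)] c(1)] Comp_HCW[OF a(1) pmap_compose[OF b(1) c(1)]]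
      by (simp add: o_assoc)
  qed
qed

lemma category_op_cat:
  assumes "category C"
  shows "category (op_cat C)"
proof -
  interpret category C by fact
  show ?thesis
    by unfold_locales (simp_all add: op_cat_def Id_in Comp_in Comp_Id_left Comp_Id_right Comp_assoc)
qed

lemma finite_CW_is_cospan:
  "finite_CW_cospan K0 K1 c \<Longrightarrow> pointed_finite_CW K0 \<Longrightarrow> pointed_finite_CW K1 \<Longrightarrow> is_cospan K0 K1 c"
  by (simp add: finite_CW_cospan_def is_cospan_def pointed_CW_bpt)

lemma cospan_class_eq:
  assumes "is_cospan K0 K1 c" "cospan_equiv K0 K1 c c'"
  shows "cospan_class K0 K1 c = cospan_class K0 K1 c'"
  unfolding cospan_class_def
  using assms cospan_equiv_sym[OF assms] by (blast intro: cospan_equiv_trans)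

lemma cospan_class_self:
  assumes "finite_CW_cospan K0 K1 c" "pointed_finite_CW K0" "pointed_finite_CW K1"
  shows "c \<in> cospan_class K0 K1 c"
  using cospan_equiv_refl[OF finite_CW_is_cospan[OF assms]] assms(1) by (simp add: cospan_class_def)

lemma Hom_CospCW:
  fixes C :: "('u, 'u) cospan set"
  shows "C \<in> Hom CospCW K0 K1 \<longleftrightarrow> (\<exists>c :: ('u, 'u) cospan. finite_CW_cospan K0 K1 c \<and> C = cospan_class K0 K1 c)"
  by (auto simp: CospCW_def)

text \<open>The composite is defined as a union over all pairs of representatives. By congruence all
  its terms coincide, and there is at least one, since a class contains the cospan that defines
  it.\<close>

lemma Comp_CospCW:
  fixes c d :: "('u, 'u) cospan"
  assumes K: "pointed_finite_CW K0" "pointed_finite_CW K1" "pointed_finite_CW K2"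
    and c: "finite_CW_cospan K0 K1 c" and d: "finite_CW_cospan K1 K2 d"
  shows "Comp CospCW K0 K1 K2 (cospan_class K1 K2 d) (cospan_class K0 K1 c) = cospan_class K0 K2 (cyl_cospan K1 c d)"
proof -
  note c' = finite_CW_is_cospan[OF c K(1,2)] and d' = finite_CW_is_cospan[OF d K(2,3)]
  have eq: "cospan_class K0 K2 (cyl_cospan K1 x y) = cospan_class K0 K2 (cyl_cospan K1 c d)"
    if x: "x \<in> cospan_class K0 K1 c" and y: "y \<in> cospan_class K1 K2 d" for x y :: "('u, 'u) cospan"
  proof -
    have xf: "finite_CW_cospan K0 K1 x" "cospan_equiv K0 K1 c x"
      and yf: "finite_CW_cospan K1 K2 y" "cospan_equiv K1 K2 d y"
      using x y by (auto simp: cospan_class_def)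
    note xc = finite_CW_is_cospan[OF xf(1) K(1,2)] and yc = finite_CW_is_cospan[OF yf(1) K(2,3)]
    have "cospan_equiv K0 K2 (cyl_cospan K1 c d) (cyl_cospan K1 x y)"
      by (rule cospan_equiv_trans[OF cyl_cospan_cong_left[OF c' xc d' xf(2)] cyl_cospan_cong_right[OF xc d' yc yf(2)]])
    then show ?thesis by (rule cospan_class_eq[symmetric, OF cyl_cospan_simps(4)[OF c' d']])
  qed
  have "Comp CospCW K0 K1 K2 (cospan_class K1 K2 d) (cospan_class K0 K1 c)
     = (\<Union>x\<in>cospan_class K0 K1 c. \<Union>y\<in>cospan_class K1 K2 d. cospan_class K0 K2 (cyl_cospan K1 x y))"
    by (simp add: CospCW_def)
  also have "\<dots> = (\<Union>x\<in>cospan_class K0 K1 c. \<Union>y\<in>cospan_class K1 K2 d. cospan_class K0 K2 (cyl_cospan K1 c d))"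
    using eq by simp
  also have "\<dots> = cospan_class K0 K2 (cyl_cospan K1 c d)"
    using cospan_class_self[OF c K(1,2)] cospan_class_self[OF d K(2,3)] by blast
  finally show ?thesis .
qed

lemma cyl_cospan_model:
  fixes c d :: "('u, 'u) cospan"
  assumes e: "\<exists>e :: real \<Rightarrow> 'u. inj e"
    and K: "pointed_finite_CW K0" "pointed_finite_CW K1" "pointed_finite_CW K2"
    and c: "finite_CW_cospan K0 K1 c" and d: "finite_CW_cospan K1 K2 d"
  obtains Q :: "'u pointed" and h where "pointed_finite_CW Q"
    "phomotopy_equivalence (Cyl K1 (apex c) (apex d) (rleg c) (lleg d)) Q h"
    "finite_CW_cospan K0 K2 (Cospan Q (h \<circ> (cyl_left K1 c d \<circ> lleg c)) (h \<circ> (cyl_right K1 c d \<circ> rleg d)))"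
    "cospan_equiv K0 K2 (cyl_cospan K1 c d) (Cospan Q (h \<circ> (cyl_left K1 c d \<circ> lleg c)) (h \<circ> (cyl_right K1 c d \<circ> rleg d)))"
proof -
  note c' = finite_CW_is_cospan[OF c K(1,2)] and d' = finite_CW_is_cospan[OF d K(2,3)]
  note cd = cyl_cospan_simps[OF c' d']
  obtain Q :: "'u pointed" and h where Q: "pointed_finite_CW Q"
    "phomotopy_equivalence (Cyl K1 (apex c) (apex d) (rleg c) (lleg d)) Q h"
    using Cyl_model[OF e K(2), of "apex c" "apex d" "rleg c" "lleg d"] c d
    unfolding finite_CW_cospan_def by blast
  note hp = phomotopy_equivalence_pmap[OF Q(2)]
  have p: "pmap K0 Q (h \<circ> (cyl_left K1 c d \<circ> lleg c))" "pmap K2 Q (h \<circ> (cyl_right K1 c d \<circ> rleg d))"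
    using cd(4) unfolding is_cospan_def cd(1-3) by (auto intro: pmap_compose[OF _ hp])
  let ?m = "Cospan Q (h \<circ> (cyl_left K1 c d \<circ> lleg c)) (h \<circ> (cyl_right K1 c d \<circ> rleg d))"
  have "finite_CW_cospan K0 K2 ?m" using p Q(1) by (simp add: finite_CW_cospan_def)
  moreover have "cospan_equiv K0 K2 (cyl_cospan K1 c d) ?m"
    by (rule cospan_equivI[of _ _ h]) (simp_all add: cd(1-3) Q(2) p phomotopic_refl)
  ultimately show thesis using Q that by blast
qed

lemma category_CospCW:
  assumes e: "\<exists>e :: real \<Rightarrow> 'u. inj e"
  shows "category (CospCW :: ('u pointed, ('u, 'u) cospan set) cat)"
proof
  fix X Y Z W :: "'u pointed" and f g h
  have I: "Id CospCW X = cospan_class X X (Cospan X (\<lambda>x. x) (\<lambda>x. x))" for X :: "'u pointed"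
    by (simp add: CospCW_def)
  have Ifin: "finite_CW_cospan X X (Cospan X (\<lambda>x. x) (\<lambda>x. x))" if "pointed_finite_CW X" for X :: "'u pointed"
    using that by (simp add: finite_CW_cospan_def pmap_id)
  show "Id CospCW X \<in> Hom CospCW X X" if "X \<in> Obj CospCW"
    using that Ifin unfolding I Hom_CospCW Obj_CospCW by blast
  have comp: "\<exists>m :: ('u, 'u) cospan. finite_CW_cospan X Z m \<and> cospan_equiv X Z (cyl_cospan Y c d) m \<and>
      Comp CospCW X Y Z (cospan_class Y Z d) (cospan_class X Y c) = cospan_class X Z m"
    if K: "pointed_finite_CW X" "pointed_finite_CW Y" "pointed_finite_CW Z"
      and c: "finite_CW_cospan X Y c" and d: "finite_CW_cospan Y Z d" for X Y Z :: "'u pointed" and c d :: "('u, 'u) cospan"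
  proof -
    note cd = cyl_cospan_simps(4)[OF finite_CW_is_cospan[OF c K(1,2)] finite_CW_is_cospan[OF d K(2,3)]]
    obtain m :: "('u, 'u) cospan" where "finite_CW_cospan X Z m" "cospan_equiv X Z (cyl_cospan Y c d) m"
      using cyl_cospan_model[OF e K c d] by metis
    then show ?thesis using Comp_CospCW[OF K c d] cospan_class_eq[OF cd] by metis
  qed
  show "Comp CospCW X Y Z g f \<in> Hom CospCW X Z"
    if "X \<in> Obj CospCW" "Y \<in> Obj CospCW" "Z \<in> Obj CospCW" "f \<in> Hom CospCW X Y" "g \<in> Hom CospCW Y Z"
    using that comp unfolding Obj_CospCW Hom_CospCW by metis
  show "Comp CospCW X Y Y (Id CospCW Y) f = f" "Comp CospCW X X Y f (Id CospCW X) = f"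
    if X: "X \<in> Obj CospCW" and Y: "Y \<in> Obj CospCW" and f: "f \<in> Hom CospCW X Y"
  proof -
    have X': "pointed_finite_CW X" and Y': "pointed_finite_CW Y" using X Y by (simp_all add: Obj_CospCW)
    obtain c :: "('u, 'u) cospan" where c: "finite_CW_cospan X Y c" "f = cospan_class X Y c" using f unfolding Hom_CospCW by blast
    note c' = finite_CW_is_cospan[OF c(1) X' Y']
    note IX = finite_CW_is_cospan[OF Ifin[OF X'] X' X'] and IY = finite_CW_is_cospan[OF Ifin[OF Y'] Y' Y']
    have "cospan_equiv X Y (cyl_cospan Y c (Cospan Y (\<lambda>x. x) (\<lambda>x. x))) (Cospan (apex c) (lleg c) (rleg c \<circ> (\<lambda>x. x)))"
      by (rule cyl_cospan_right_unit[OF c' pmap_id pointed_CW_bpt[OF Y']])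
    then show "Comp CospCW X Y Y (Id CospCW Y) f = f"
      unfolding c(2) I Comp_CospCW[OF X' Y' Y' c(1) Ifin[OF Y']]
      using cospan_class_eq[OF cyl_cospan_simps(4)[OF c' IY]] by (simp add: o_def)
    have "cospan_equiv X Y (cyl_cospan X (Cospan X (\<lambda>x. x) (\<lambda>x. x)) c) (Cospan (apex c) (lleg c \<circ> (\<lambda>x. x)) (rleg c))"
      by (rule cyl_cospan_left_unit[OF c' pmap_id pointed_CW_bpt[OF X']])
    then show "Comp CospCW X X Y f (Id CospCW X) = f"
      unfolding c(2) I Comp_CospCW[OF X' X' Y' Ifin[OF X'] c(1)]
      using cospan_class_eq[OF cyl_cospan_simps(4)[OF IX c']] by (simp add: o_def)
  qed
  show "Comp CospCW X Z W h (Comp CospCW X Y Z g f) = Comp CospCW X Y W (Comp CospCW Y Z W h g) f"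
    if "X \<in> Obj CospCW" "Y \<in> Obj CospCW" "Z \<in> Obj CospCW" "W \<in> Obj CospCW"
      and fgh: "f \<in> Hom CospCW X Y" "g \<in> Hom CospCW Y Z" "h \<in> Hom CospCW Z W"
  proof -
    have K: "pointed_finite_CW X" "pointed_finite_CW Y" "pointed_finite_CW Z" "pointed_finite_CW W"
      using that by (simp_all add: Obj_CospCW)
    obtain a b c :: "('u, 'u) cospan" where a: "finite_CW_cospan X Y a" "f = cospan_class X Y a"
      and b: "finite_CW_cospan Y Z b" "g = cospan_class Y Z b"
      and c: "finite_CW_cospan Z W c" "h = cospan_class Z W c"
      using fgh unfolding Hom_CospCW by blast
    note a' = finite_CW_is_cospan[OF a(1) K(1,2)] and b' = finite_CW_is_cospan[OF b(1) K(2,3)]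
      and c' = finite_CW_is_cospan[OF c(1) K(3,4)]
    obtain m :: "('u, 'u) cospan" where m: "finite_CW_cospan X Z m" "cospan_equiv X Z (cyl_cospan Y a b) m"
      "Comp CospCW X Y Z (cospan_class Y Z b) (cospan_class X Y a) = cospan_class X Z m"
      using comp[OF K(1-3) a(1) b(1)] by blast
    obtain n :: "('u, 'u) cospan" where n: "finite_CW_cospan Y W n" "cospan_equiv Y W (cyl_cospan Z b c) n"
      "Comp CospCW Y Z W (cospan_class Z W c) (cospan_class Y Z b) = cospan_class Y W n"
      using comp[OF K(2-4) b(1) c(1)] by blast
    note m' = finite_CW_is_cospan[OF m(1) K(1,3)] and n' = finite_CW_is_cospan[OF n(1) K(2,4)]
    note ab = cyl_cospan_simps(4)[OF a' b'] and bc = cyl_cospan_simps(4)[OF b' c']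
    \<comment> \<open>The models \<open>m\<close> and \<open>n\<close> are exchanged for the
      cylinders they represent, which may appear as factors because congruence allows arbitrary
      apexes; associativity then applies to iterated cylinders.\<close>
    have "cospan_class X W (cyl_cospan Z m c) = cospan_class X W (cyl_cospan Z (cyl_cospan Y a b) c)"
      by (rule cospan_class_eq[symmetric, OF cyl_cospan_simps(4)[OF ab c'] cyl_cospan_cong_left[OF ab m' c' m(2)]])
    also have "\<dots> = cospan_class X W (cyl_cospan Y a (cyl_cospan Z b c))"
      by (rule cospan_class_eq[OF cyl_cospan_simps(4)[OF ab c'] cyl_cospan_assoc[OF a' b' c']])
    also have "\<dots> = cospan_class X W (cyl_cospan Y a n)"
      by (rule cospan_class_eq[OF cyl_cospan_simps(4)[OF a' bc] cyl_cospan_cong_right[OF a' bc n' n(2)]])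
    finally show ?thesis
      unfolding a(2) b(2) c(2) m(3) n(3) Comp_CospCW[OF K(1,3,4) m(1) c(1)] Comp_CospCW[OF K(1,2,4) a(1) n(1)] .
  qed
qed

section \<open>The diagram \<open>\<iota>\<^sup>\<plusminus>\<close>\<close>

lemma ar_iota_plus:
  assumes K: "pointed_finite_CW K" and L: "pointed_finite_CW L" and f: "pmap K L f"
  shows "ar iota_plus K L (hclass K L f) = cospan_class K L (Cospan L f (\<lambda>x. x))"
    "finite_CW_cospan K L (Cospan L f (\<lambda>x. x))"
proof -
  show fin: "finite_CW_cospan K L (Cospan L f (\<lambda>x. x))" using L f by (simp add: finite_CW_cospan_def pmap_id)
  have "cospan_class K L (Cospan L f' (\<lambda>x. x)) = cospan_class K L (Cospan L f (\<lambda>x. x))" if "f' \<in> hclass K L f" for f'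
  proof (rule cospan_class_eq[symmetric, OF finite_CW_is_cospan[OF fin K L]])
    have "phomotopic K L f' f" using that by (simp add: hclass_def phomotopic_sym)
    then show "cospan_equiv K L (Cospan L f (\<lambda>x. x)) (Cospan L f' (\<lambda>x. x))"
      by (intro cospan_equivI[of _ _ "\<lambda>x. x"]) (simp_all add: phomotopy_equivalence_id o_def phomotopic_refl pmap_id)
  qed
  then have "(\<Union>f'\<in>hclass K L f. cospan_class K L (Cospan L f' (\<lambda>x. x))) = (\<Union>f'\<in>hclass K L f. cospan_class K L (Cospan L f (\<lambda>x. x)))"
    by (rule SUP_cong[OF refl])
  moreover have "hclass K L f \<noteq> {}" using hclass_self[OF f] by blast
  ultimately show "ar iota_plus K L (hclass K L f) = cospan_class K L (Cospan L f (\<lambda>x. x))"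
    by (simp add: iota_plus_def)
qed

lemma ar_iota_minus:
  assumes K: "pointed_finite_CW K" and L: "pointed_finite_CW L" and f: "pmap K L f"
  shows "ar iota_minus L K (hclass K L f) = cospan_class L K (Cospan L (\<lambda>x. x) f)"
    "finite_CW_cospan L K (Cospan L (\<lambda>x. x) f)"
proof -
  show fin: "finite_CW_cospan L K (Cospan L (\<lambda>x. x) f)" using L f by (simp add: finite_CW_cospan_def pmap_id)
  have "cospan_class L K (Cospan L (\<lambda>x. x) f') = cospan_class L K (Cospan L (\<lambda>x. x) f)" if "f' \<in> hclass K L f" for f'
  proof (rule cospan_class_eq[symmetric, OF finite_CW_is_cospan[OF fin L K]])
    have "phomotopic K L f' f" using that by (simp add: hclass_def phomotopic_sym)
    then show "cospan_equiv L K (Cospan L (\<lambda>x. x) f) (Cospan L (\<lambda>x. x) f')"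
      by (intro cospan_equivI[of _ _ "\<lambda>x. x"]) (simp_all add: phomotopy_equivalence_id o_def phomotopic_refl pmap_id)
  qed
  then have "(\<Union>f'\<in>hclass K L f. cospan_class L K (Cospan L (\<lambda>x. x) f')) = (\<Union>f'\<in>hclass K L f. cospan_class L K (Cospan L (\<lambda>x. x) f))"
    by (rule SUP_cong[OF refl])
  moreover have "hclass K L f \<noteq> {}" using hclass_self[OF f] by blast
  ultimately show "ar iota_minus L K (hclass K L f) = cospan_class L K (Cospan L (\<lambda>x. x) f)"
    by (simp add: iota_minus_def)
qed

lemma ob_iota: "ob iota_plus K = K" "ob iota_minus K = K"
  by (simp_all add: iota_plus_def iota_minus_def)

text \<open>The two factors are joined along identities of the apex, so their cylinder collapses by
  \<open>cyl_cospan_left_unit\<close>.\<close>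

lemma Comp_iota_minus_plus:
  assumes K: "pointed_finite_CW K0" "pointed_finite_CW K1" and c: "finite_CW_cospan K0 K1 c"
  shows "Comp CospCW K0 (apex c) K1 (ar iota_minus (apex c) K1 (hclass K1 (apex c) (rleg c)))
      (ar iota_plus K0 (apex c) (hclass K0 (apex c) (lleg c))) = cospan_class K0 K1 c"
proof -
  have L: "pointed_finite_CW (apex c)" and p: "pmap K0 (apex c) (lleg c)" "pmap K1 (apex c) (rleg c)"
    using c by (auto simp: finite_CW_cospan_def)
  note ip = ar_iota_plus[OF K(1) L p(1)] and im = ar_iota_minus[OF K(2) L p(2)]
  note ip' = finite_CW_is_cospan[OF ip(2) K(1) L] and im' = finite_CW_is_cospan[OF im(2) L K(2)]
  have "cospan_equiv K0 K1 (cyl_cospan (apex c) (Cospan (apex c) (lleg c) (\<lambda>x. x)) (Cospan (apex c) (\<lambda>x. x) (rleg c))) c"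
    using cyl_cospan_left_unit[OF im' p(1) pointed_CW_bpt[OF K(1)]] by (simp add: o_def)
  then show ?thesis
    unfolding ip(1) im(1) Comp_CospCW[OF K(1) L K(2) ip(2) im(2)]
    by (rule cospan_class_eq[OF cyl_cospan_simps(4)[OF ip' im']])
qed

lemma functor_iota_plus:
  assumes e: "\<exists>e :: real \<Rightarrow> 'u. inj e"
  shows "is_functor HCW CospCW (iota_plus :: ('u pointed, ('u \<Rightarrow> 'u) set, 'u pointed, ('u, 'u) cospan set) fctr)"
proof -
  interpret A: category HCW by (rule category_HCW)
  interpret B: category "CospCW :: ('u pointed, ('u, 'u) cospan set) cat" by (rule category_CospCW[OF e])
  show ?thesis
  proof
    fix X Y Z :: "'u pointed" and f g
    show "ob iota_plus X \<in> Obj CospCW" if "X \<in> Obj HCW" using that by (simp add: ob_iota Obj_HCW Obj_CospCW)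
    show "ar iota_plus X Y f \<in> Hom CospCW (ob iota_plus X) (ob iota_plus Y)"
      if "X \<in> Obj HCW" "Y \<in> Obj HCW" "f \<in> Hom HCW X Y"
    proof -
      from that obtain a where K: "pointed_finite_CW X" "pointed_finite_CW Y" and a: "pmap X Y a" "f = hclass X Y a"
        unfolding Obj_HCW Hom_HCW by blast
      show ?thesis
        unfolding ob_iota Hom_CospCW a(2) using ar_iota_plus[OF K a(1)] by blast
    qed
    show "ar iota_plus X X (Id HCW X) = Id CospCW (ob iota_plus X)" if "X \<in> Obj HCW"
      using that ar_iota_plus(1)[OF _ _ pmap_id, of X] by (simp add: ob_iota Obj_HCW) (simp add: HCW_def CospCW_def)
    assume X: "X \<in> Obj HCW" and Y: "Y \<in> Obj HCW" and Z: "Z \<in> Obj HCW"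
      and f: "f \<in> Hom HCW X Y" and g: "g \<in> Hom HCW Y Z"
    have K: "pointed_finite_CW X" "pointed_finite_CW Y" "pointed_finite_CW Z" using X Y Z by (simp_all add: Obj_HCW)
    obtain a b where a: "pmap X Y a" "f = hclass X Y a" and b: "pmap Y Z b" "g = hclass Y Z b"
      using f g unfolding Hom_HCW by blast
    note ia = ar_iota_plus[OF K(1,2) a(1)] and ib = ar_iota_plus[OF K(2,3) b(1)]
    note ia' = finite_CW_is_cospan[OF ia(2) K(1,2)] and ib' = finite_CW_is_cospan[OF ib(2) K(2,3)]
    have "cospan_equiv X Z (cyl_cospan Y (Cospan Y a (\<lambda>x. x)) (Cospan Z b (\<lambda>x. x))) (Cospan Z (b \<circ> a) (\<lambda>x. x))"
      using cyl_cospan_left_unit[OF ib' a(1) pointed_CW_bpt[OF K(1)]] by simp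
    then have "cospan_class X Z (cyl_cospan Y (Cospan Y a (\<lambda>x. x)) (Cospan Z b (\<lambda>x. x))) = cospan_class X Z (Cospan Z (b \<circ> a) (\<lambda>x. x))"
      by (rule cospan_class_eq[OF cyl_cospan_simps(4)[OF ia' ib']])
    then show "ar iota_plus X Z (Comp HCW X Y Z g f) =
        Comp CospCW (ob iota_plus X) (ob iota_plus Y) (ob iota_plus Z) (ar iota_plus Y Z g) (ar iota_plus X Y f)"
      unfolding ob_iota a(2) b(2) Comp_HCW[OF a(1) b(1)] ia(1) ib(1) Comp_CospCW[OF K ia(2) ib(2)]
        ar_iota_plus(1)[OF K(1,3) pmap_compose[OF a(1) b(1)]] by simp
  qed
qed

lemma op_HCW_simps:
  "Obj (op_cat HCW) = Obj HCW" "Hom (op_cat HCW) X Y = Hom HCW Y X" "Id (op_cat HCW) = Id HCW"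
  "Comp (op_cat HCW) X Y Z g f = Comp HCW Z Y X f g"
  by (simp_all add: op_cat_def)

lemma functor_iota_minus:
  assumes e: "\<exists>e :: real \<Rightarrow> 'u. inj e"
  shows "is_functor (op_cat HCW) CospCW (iota_minus :: ('u pointed, ('u \<Rightarrow> 'u) set, 'u pointed, ('u, 'u) cospan set) fctr)"
proof -
  interpret A: category "op_cat HCW" by (rule category_op_cat[OF category_HCW])
  interpret B: category "CospCW :: ('u pointed, ('u, 'u) cospan set) cat" by (rule category_CospCW[OF e])
  show ?thesis
  proof (unfold_locales, unfold op_HCW_simps)
    fix X Y Z :: "'u pointed" and f g
    show "ob iota_minus X \<in> Obj CospCW" if "X \<in> Obj HCW" using that by (simp add: ob_iota Obj_HCW Obj_CospCW)
    show "ar iota_minus X Y f \<in> Hom CospCW (ob iota_minus X) (ob iota_minus Y)"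
      if "X \<in> Obj HCW" "Y \<in> Obj HCW" "f \<in> Hom HCW Y X"
    proof -
      from that obtain a where K: "pointed_finite_CW X" "pointed_finite_CW Y" and a: "pmap Y X a" "f = hclass Y X a"
        unfolding Obj_HCW Hom_HCW by blast
      show ?thesis
        unfolding ob_iota Hom_CospCW a(2) using ar_iota_minus[OF K(2,1) a(1)] by blast
    qed
    show "ar iota_minus X X (Id HCW X) = Id CospCW (ob iota_minus X)" if "X \<in> Obj HCW"
      using that ar_iota_minus(1)[OF _ _ pmap_id, of X] by (simp add: ob_iota Obj_HCW) (simp add: HCW_def CospCW_def)
    assume X: "X \<in> Obj HCW" and Y: "Y \<in> Obj HCW" and Z: "Z \<in> Obj HCW"
      and f: "f \<in> Hom HCW Y X" and g: "g \<in> Hom HCW Z Y"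
    have K: "pointed_finite_CW X" "pointed_finite_CW Y" "pointed_finite_CW Z" using X Y Z by (simp_all add: Obj_HCW)
    obtain a b where a: "pmap Y X a" "f = hclass Y X a" and b: "pmap Z Y b" "g = hclass Z Y b"
      using f g unfolding Hom_HCW by blast
    note ia = ar_iota_minus[OF K(2,1) a(1)] and ib = ar_iota_minus[OF K(3,2) b(1)]
    note ia' = finite_CW_is_cospan[OF ia(2) K(1,2)] and ib' = finite_CW_is_cospan[OF ib(2) K(2,3)]
    have "cospan_equiv X Z (cyl_cospan Y (Cospan X (\<lambda>x. x) a) (Cospan Y (\<lambda>x. x) b)) (Cospan X (\<lambda>x. x) (a \<circ> b))"
      using cyl_cospan_right_unit[OF ia' b(1) pointed_CW_bpt[OF K(3)]] by simp
    then have "cospan_class X Z (cyl_cospan Y (Cospan X (\<lambda>x. x) a) (Cospan Y (\<lambda>x. x) b)) = cospan_class X Z (Cospan X (\<lambda>x. x) (a \<circ> b))"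
      by (rule cospan_class_eq[OF cyl_cospan_simps(4)[OF ia' ib']])
    then show "ar iota_minus X Z (Comp HCW Z Y X f g) =
        Comp CospCW (ob iota_minus X) (ob iota_minus Y) (ob iota_minus Z) (ar iota_minus Y Z g) (ar iota_minus X Y f)"
      unfolding ob_iota a(2) b(2) Comp_HCW[OF b(1) a(1)] ia(1) ib(1) Comp_CospCW[OF K ia(2) ib(2)]
        ar_iota_minus(1)[OF K(3,1) pmap_compose[OF b(1) a(1)]] by simp
  qed
qed

text \<open>For the two corner legs of a homotopy pushout, one side of the relation is the class of
  the cospan with apex \<open>T\<close> and the other is the class of the cylinder. The induced map
  \<phi> is an equivalence between these cospans, strictly compatible with the legs on their
  carriers.\<close>

lemma MV_PN_iota:
  assumes e: "\<exists>e :: real \<Rightarrow> 'u. inj e"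
  shows "MV_PN_diagram CospCW
       (iota_plus :: ('u pointed, ('u \<Rightarrow> 'u) set, 'u pointed, ('u, 'u) cospan set) fctr) iota_minus"
proof -
  interpret P: is_functor HCW CospCW "iota_plus :: ('u pointed, ('u \<Rightarrow> 'u) set, 'u pointed, ('u, 'u) cospan set) fctr"
    by (rule functor_iota_plus[OF e])
  interpret M: is_functor "op_cat HCW" CospCW "iota_minus :: ('u pointed, ('u \<Rightarrow> 'u) set, 'u pointed, ('u, 'u) cospan set) fctr"
    by (rule functor_iota_minus[OF e])
  show ?thesis
  proof (unfold_locales, unfold ob_iota)
    fix K L0 L1 T :: "'u pointed" and f0 g0 g1 f1
    assume "homotopy_pushout K L0 L1 T f0 g0 g1 f1"
    note hp = this[unfolded homotopy_pushout_def Obj_HCW]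
    have CW: "pointed_finite_CW K" "pointed_finite_CW L0" "pointed_finite_CW L1" "pointed_finite_CW T"
      and hom: "f0 \<in> Hom HCW K L0" "g0 \<in> Hom HCW K L1" "g1 \<in> Hom HCW L0 T" "f1 \<in> Hom HCW L1 T"
      using hp by blast+
    obtain a0 b0 b1 a1 \<phi> where mem: "a0 \<in> f0" "b0 \<in> g0" "b1 \<in> g1" "a1 \<in> f1"
      and \<phi>: "\<forall>x \<in> topspace (spc L0). \<phi> (cyl_class K L0 L1 a0 b0 (CLeft x)) = b1 x"
        "\<forall>y \<in> topspace (spc L1). \<phi> (cyl_class K L0 L1 a0 b0 (CRight y)) = a1 y"
        "phomotopy_equivalence (Cyl K L0 L1 a0 b0) T \<phi>"
      using hp by blast
    have rep: "pmap X Y x \<and> F = hclass X Y x" if "F \<in> Hom HCW X Y" "x \<in> F" for X Y :: "'u pointed" and F x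
    proof -
      obtain y where "F = hclass X Y y" using \<open>F \<in> Hom HCW X Y\<close> unfolding Hom_HCW by blast
      then have "phomotopic X Y y x" using \<open>x \<in> F\<close> by (simp add: hclass_def)
      then show ?thesis using hclass_eq phomotopic_imp_pmap(2) \<open>F = hclass X Y y\<close> by blast
    qed
    have p: "pmap K L0 a0" "pmap K L1 b0" "pmap L0 T b1" "pmap L1 T a1"
      and cl: "f0 = hclass K L0 a0" "g0 = hclass K L1 b0" "g1 = hclass L0 T b1" "f1 = hclass L1 T a1"
      using rep[OF hom(1) mem(1)] rep[OF hom(2) mem(2)] rep[OF hom(3) mem(3)] rep[OF hom(4) mem(4)] by blast+
    let ?s = "Cospan T b1 a1"
    have "finite_CW_cospan L0 L1 ?s" using CW p by (simp add: finite_CW_cospan_def)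
    from Comp_iota_minus_plus[OF CW(2,3) this]
    have "Comp CospCW L0 T L1 (ar iota_minus T L1 f1) (ar iota_plus L0 T g1) = cospan_class L0 L1 ?s"
      unfolding cl by simp
    also have "\<dots> = cospan_class L0 L1 (cyl_cospan K (Cospan L0 (\<lambda>x. x) a0) (Cospan L1 b0 (\<lambda>x. x)))"
    proof (rule cospan_class_eq[symmetric])
      note i = ar_iota_minus(2)[OF CW(1,2) p(1)] ar_iota_plus(2)[OF CW(1,3) p(2)]
      note i' = finite_CW_is_cospan[OF i(1) CW(2,1)] finite_CW_is_cospan[OF i(2) CW(1,3)]
      interpret D: dmc K L0 L1 a0 b0 using pointed_CW_bpt[OF CW(1)] p by unfold_locales
      show "is_cospan L0 L1 (cyl_cospan K (Cospan L0 (\<lambda>x. x) a0) (Cospan L1 b0 (\<lambda>x. x)))"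
        by (rule cyl_cospan_simps(4)[OF i'])
      show "cospan_equiv L0 L1 (cyl_cospan K (Cospan L0 (\<lambda>x. x) a0) (Cospan L1 b0 (\<lambda>x. x))) ?s"
      proof (rule cospan_equivI[of _ _ \<phi>], unfold cyl_cospan_simps[OF i'] cospan.sel)
        show "phomotopy_equivalence D.C T \<phi>" by (rule \<phi>(3))
        show "phomotopic L0 T b1 (\<phi> \<circ> (D.iL \<circ> (\<lambda>x. x)))"
          using \<phi>(1) p(3) by (intro phomotopic_eq[OF D.bL0]) (simp_all add: D.iL_def)
        show "phomotopic L1 T a1 (\<phi> \<circ> (D.iR \<circ> (\<lambda>x. x)))"
          using \<phi>(2) p(4) by (intro phomotopic_eq[OF D.bL1]) (simp_all add: D.iR_def)
      qed
    qed
    also have "\<dots> = Comp CospCW L0 K L1 (ar iota_plus K L1 g0) (ar iota_minus L0 K f0)"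
      unfolding cl ar_iota_minus(1)[OF CW(1,2) p(1)] ar_iota_plus(1)[OF CW(1,3) p(2)]
      by (rule Comp_CospCW[symmetric, OF CW(2,1,3) ar_iota_minus(2)[OF CW(1,2) p(1)] ar_iota_plus(2)[OF CW(1,3) p(2)]])
    finally show "Comp CospCW L0 T L1 (ar iota_minus T L1 f1) (ar iota_plus L0 T g1) =
       Comp CospCW L0 K L1 (ar iota_plus K L1 g0) (ar iota_minus L0 K f0)" .
  qed simp
qed

section \<open>Universality\<close>

context MV_PN_diagram
begin

abbreviation "P K \<equiv> ob Fp K"
definition "p K L f = ar Fp K L (hclass K L f)"
definition "n L K f = ar Fm L K (hclass K L f)"

lemma P_in: "pointed_finite_CW K \<Longrightarrow> P K \<in> Obj S"
  using Fp.ob_in by (simp add: Obj_HCW)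

lemma ob_Fm: "pointed_finite_CW K \<Longrightarrow> ob Fm K = P K"
  using same_ob by (simp add: Obj_HCW)

lemma p_in: "pointed_finite_CW K \<Longrightarrow> pointed_finite_CW L \<Longrightarrow> pmap K L f \<Longrightarrow> p K L f \<in> Hom S (P K) (P L)"
  unfolding p_def by (rule Fp.ar_in) (auto simp: Obj_HCW Hom_HCW)

lemma n_in: "pointed_finite_CW K \<Longrightarrow> pointed_finite_CW L \<Longrightarrow> pmap K L f \<Longrightarrow> n L K f \<in> Hom S (P L) (P K)"
  unfolding n_def using Fm.ar_in[of L K "hclass K L f"] by (auto simp: op_HCW_simps Obj_HCW Hom_HCW ob_Fm)

lemma p_comp:
  assumes "pointed_finite_CW K" "pointed_finite_CW L" "pointed_finite_CW M" "pmap K L f" "pmap L M g"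
  shows "p K M (g \<circ> f) = Comp S (P K) (P L) (P M) (p L M g) (p K L f)"
  using Fp.ar_Comp[of K L M "hclass K L f" "hclass L M g"] assms
  by (auto simp: p_def Obj_HCW Hom_HCW Comp_HCW)

lemma n_comp:
  assumes "pointed_finite_CW K" "pointed_finite_CW L" "pointed_finite_CW M" "pmap K L f" "pmap L M g"
  shows "n M K (g \<circ> f) = Comp S (P M) (P L) (P K) (n L K f) (n M L g)"
  using Fm.ar_Comp[of M L K "hclass L M g" "hclass K L f"] assms
  by (auto simp: n_def op_HCW_simps Obj_HCW Hom_HCW Comp_HCW ob_Fm)

lemma p_id: "pointed_finite_CW K \<Longrightarrow> p K K (\<lambda>x. x) = Id S (P K)"
  using Fp.ar_Id[of K] by (simp add: p_def Obj_HCW) (simp add: HCW_def)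

lemma n_id: "pointed_finite_CW K \<Longrightarrow> n K K (\<lambda>x. x) = Id S (P K)"
  using Fm.ar_Id[of K] by (simp add: n_def Obj_HCW op_HCW_simps ob_Fm) (simp add: HCW_def)

lemma p_cong: "phomotopic K L f g \<Longrightarrow> p K L f = p K L g"
  and n_cong: "phomotopic K L f g \<Longrightarrow> n L K f = n L K g"
  by (simp_all add: p_def n_def hclass_eq)

text \<open>A cylinder is not an object of the source category, so the relation is used for a model
  \<open>Q\<close>. The images under \<open>h\<close> of the cylinder lines form the homotopy of the
  square, and \<open>h\<close> itself is the induced map.\<close>

lemma MV_Cyl:
  assumes CW: "pointed_finite_CW K" "pointed_finite_CW L0" "pointed_finite_CW L1" "pointed_finite_CW Q"
    and fg: "pmap K L0 f" "pmap K L1 g" and h: "phomotopy_equivalence (Cyl K L0 L1 f g) Q h"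
  shows "Comp S (P L0) (P Q) (P L1) (n Q L1 (h \<circ> dmc.iR K L0 L1 f g)) (p L0 Q (h \<circ> dmc.iL K L0 L1 f g))
    = Comp S (P L0) (P K) (P L1) (p K L1 g) (n L0 K f)"
proof -
  interpret D: dmc K L0 L1 f g using pointed_CW_bpt[OF CW(1)] fg by unfold_locales
  note hp = phomotopy_equivalence_pmap[OF h]
  have p: "pmap L0 Q (h \<circ> D.iL)" "pmap L1 Q (h \<circ> D.iR)"
    using pmap_compose[OF D.pmap_iL hp] pmap_compose[OF D.pmap_iR hp] .
  have jc: "jcont (spc K) (spc Q) (\<lambda>t k. h (D.iM t k))"
    by (rule jcont_post[OF D.jcont_iM pmap_cm[OF hp]])
  have hb: "h (bpt D.C) = bpt Q" by (rule pmap_bpt[OF hp])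
  have "homotopy_pushout K L0 L1 Q (hclass K L0 f) (hclass K L1 g) (hclass L0 Q (h \<circ> D.iL)) (hclass L1 Q (h \<circ> D.iR))"
    unfolding homotopy_pushout_def
  proof (intro conjI)
    show "\<exists>a0\<in>hclass K L0 f. \<exists>b0\<in>hclass K L1 g. \<exists>b1\<in>hclass L0 Q (h \<circ> D.iL). \<exists>a1\<in>hclass L1 Q (h \<circ> D.iR). \<exists>\<eta> \<phi>.
        continuous_map (prod_topology (top_of_set {0..1}) (spc K)) (spc Q) \<eta> \<and>
        (\<forall>k \<in> topspace (spc K). \<eta> (0, k) = b1 (a0 k) \<and> \<eta> (1, k) = a1 (b0 k)) \<and>
        (\<forall>t \<in> {0..1}. \<eta> (t, bpt K) = bpt Q) \<and>
        (\<forall>x \<in> topspace (spc L0). \<phi> (cyl_class K L0 L1 a0 b0 (CLeft x)) = b1 x) \<and>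
        (\<forall>t \<in> {0..1}. \<forall>k \<in> topspace (spc K). \<phi> (cyl_class K L0 L1 a0 b0 (CMid t k)) = \<eta> (t, k)) \<and>
        (\<forall>y \<in> topspace (spc L1). \<phi> (cyl_class K L0 L1 a0 b0 (CRight y)) = a1 y) \<and>
        phomotopy_equivalence (Cyl K L0 L1 a0 b0) Q \<phi>"
    proof (rule bexI[of _ f], rule bexI[of _ g], rule bexI[of _ "h \<circ> D.iL"], rule bexI[of _ "h \<circ> D.iR"],
        rule exI[of _ "\<lambda>z. h (D.iM (fst z) (snd z))"], rule exI[of _ h], intro conjI ballI)
      show "continuous_map (prod_topology (top_of_set {0..1}) (spc K)) (spc Q) (\<lambda>z. h (D.iM (fst z) (snd z)))"
        using jc by (simp add: jcont_def)
    qed (simp_all add: D.iM_0 D.iM_1 D.iM_bpt hb h hclass_self fg p flip: D.iL_def D.iR_def D.iM_def)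
  qed (use CW fg p in \<open>auto simp: Obj_HCW Hom_HCW\<close>)
  from Mayer_Vietoris[OF this] show ?thesis by (simp add: p_def n_def)
qed

text \<open>The square with all four corners \<open>L, L, L, L'\<close> and maps \<open>id, id, h, h\<close> is a homotopy pushout.\<close>

lemma equivalence_retract:
  assumes CW: "pointed_finite_CW L" "pointed_finite_CW L'" and h: "phomotopy_equivalence L L' h"
  shows "Comp S (P L) (P L') (P L) (n L' L h) (p L L' h) = Id S (P L)"
proof -
  interpret D: dmc L L L "\<lambda>x. x" "\<lambda>x. x" using pointed_CW_bpt[OF CW(1)] by unfold_locales (simp_all add: pmap_id)
  obtain \<phi> where \<phi>: "phomotopy_equivalence D.C L \<phi>" "\<And>x. x \<in> topspace (spc L) \<Longrightarrow> \<phi> (D.iL x) = x"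
    "\<And>y. y \<in> topspace (spc L) \<Longrightarrow> \<phi> (D.iR y) = y"
    by (rule cyl_id_left[OF D.dmc_axioms], rule that) simp_all
  note hp = phomotopy_equivalence_pmap[OF h]
  \<comment> \<open>Both inclusions of \<open>L\<close> into the cylinder are sections of \<phi>, so
    the legs of the square with corner \<open>L'\<close> are represented by
    \<open>h\<close>.\<close>
  have "phomotopic L L' h (h \<circ> \<phi> \<circ> D.iL)" "phomotopic L L' h (h \<circ> \<phi> \<circ> D.iR)"
    using \<phi>(2,3) by (auto intro!: phomotopic_eq[OF D.bK hp])
  then have "p L L' h = p L L' (h \<circ> \<phi> \<circ> D.iL)" "n L' L h = n L' L (h \<circ> \<phi> \<circ> D.iR)"
    by (simp_all only: p_cong[of L L' h "h \<circ> \<phi> \<circ> D.iL"] n_cong[of L L' h "h \<circ> \<phi> \<circ> D.iR"])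
  then have "Comp S (P L) (P L') (P L) (n L' L h) (p L L' h) = Comp S (P L) (P L) (P L) (p L L (\<lambda>x. x)) (n L L (\<lambda>x. x))"
    using MV_Cyl[OF CW(1,1,1,2) pmap_id pmap_id phomotopy_equivalence_compose[OF \<phi>(1) h]] by simp
  also have "\<dots> = Id S (P L)"
    unfolding p_id[OF CW(1)] n_id[OF CW(1)]
    by (rule Fp.cod.Comp_Id_left[OF P_in P_in Fp.cod.Id_in[OF P_in]]) (rule CW(1))+
  finally show ?thesis .
qed

definition cospan_value :: "'u pointed \<Rightarrow> 'u pointed \<Rightarrow> ('u, 'u) cospan \<Rightarrow> 'm" where
  "cospan_value K0 K1 c = Comp S (P K0) (P (apex c)) (P K1) (n (apex c) K1 (rleg c)) (p K0 (apex c) (lleg c))"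

text \<open>The value on a class is read off from a chosen representative;
  \<open>cospan_value_cong\<close> makes it independent of the choice.\<close>

definition induced :: "('u pointed, ('u, 'u) cospan set, 'o, 'm) fctr" where
  "induced = \<lparr>ob = P, ar = (\<lambda>K0 K1 C. cospan_value K0 K1 (SOME c. c \<in> C))\<rparr>"

text \<open>Rebracketing isolates the two middle arrows \<open>c\<close> and \<open>b\<close>, the
  place where the Mayer-Vietoris relation or the identity of \<open>equivalence_retract\<close> is
  inserted.\<close>

lemma Comp4:
  assumes "A0 \<in> Obj S" "A1 \<in> Obj S" "A2 \<in> Obj S" "A3 \<in> Obj S" "A4 \<in> Obj S"
    and "a \<in> Hom S A0 A1" "b \<in> Hom S A1 A2" "c \<in> Hom S A2 A3" "d \<in> Hom S A3 A4"
  shows "Comp S A0 A2 A4 (Comp S A2 A3 A4 d c) (Comp S A0 A1 A2 b a)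
    = Comp S A0 A3 A4 d (Comp S A0 A1 A3 (Comp S A1 A2 A3 c b) a)"
proof -
  have "Comp S A0 A2 A4 (Comp S A2 A3 A4 d c) (Comp S A0 A1 A2 b a)
      = Comp S A0 A3 A4 d (Comp S A0 A2 A3 c (Comp S A0 A1 A2 b a))"
    using assms by (intro Fp.cod.Comp_assoc[symmetric] Fp.cod.Comp_in)
  also have "Comp S A0 A2 A3 c (Comp S A0 A1 A2 b a) = Comp S A0 A1 A3 (Comp S A1 A2 A3 c b) a"
    using assms by (intro Fp.cod.Comp_assoc)
  finally show ?thesis .
qed

lemma cospan_value_cong:
  assumes K: "pointed_finite_CW K0" "pointed_finite_CW K1"
    and c: "finite_CW_cospan K0 K1 c" and c': "finite_CW_cospan K0 K1 c'" and eq: "cospan_equiv K0 K1 c c'"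
  shows "cospan_value K0 K1 c = cospan_value K0 K1 c'"
proof -
  obtain h where h: "phomotopy_equivalence (apex c) (apex c') h"
    "phomotopic K0 (apex c') (lleg c') (h \<circ> lleg c)" "phomotopic K1 (apex c') (rleg c') (h \<circ> rleg c)"
    using eq unfolding cospan_equiv_def by blast
  note hp = phomotopy_equivalence_pmap[OF h(1)]
  have L: "pointed_finite_CW (apex c)" "pointed_finite_CW (apex c')"
    and l: "pmap K0 (apex c) (lleg c)" "pmap K1 (apex c) (rleg c)"
    using c c' by (auto simp: finite_CW_cospan_def)
  have "cospan_value K0 K1 c' = Comp S (P K0) (P (apex c')) (P K1)
      (Comp S (P (apex c')) (P (apex c)) (P K1) (n (apex c) K1 (rleg c)) (n (apex c') (apex c) h))
      (Comp S (P K0) (P (apex c)) (P (apex c')) (p (apex c) (apex c') h) (p K0 (apex c) (lleg c)))"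
    unfolding cospan_value_def p_cong[OF h(2)] n_cong[OF h(3)]
      p_comp[OF K(1) L l(1) hp] n_comp[OF K(2) L l(2) hp] ..
  also have "\<dots> = Comp S (P K0) (P (apex c)) (P K1) (n (apex c) K1 (rleg c))
      (Comp S (P K0) (P (apex c)) (P (apex c)) (Comp S (P (apex c)) (P (apex c')) (P (apex c))
        (n (apex c') (apex c) h) (p (apex c) (apex c') h)) (p K0 (apex c) (lleg c)))"
    using K L l hp by (intro Comp4 P_in p_in n_in)
  also have "\<dots> = cospan_value K0 K1 c"
    unfolding equivalence_retract[OF L h(1)] cospan_value_def
    using K L l by (subst Fp.cod.Comp_Id_left) (auto intro: P_in p_in)
  finally show ?thesis ..
qed

lemma ar_induced:
  assumes K: "pointed_finite_CW K0" "pointed_finite_CW K1" and c: "finite_CW_cospan K0 K1 c"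
  shows "ar induced K0 K1 (cospan_class K0 K1 c) = cospan_value K0 K1 c"
proof -
  let ?c = "SOME c'. c' \<in> cospan_class K0 K1 c"
  have "?c \<in> cospan_class K0 K1 c"
    using cospan_class_self[OF c K] by (rule someI)
  then have "finite_CW_cospan K0 K1 ?c" "cospan_equiv K0 K1 c ?c"
    unfolding cospan_class_def by blast+
  from cospan_value_cong[OF K c this] show ?thesis by (simp add: induced_def)
qed

lemma cospan_value_in:
  assumes "pointed_finite_CW K0" "pointed_finite_CW K1" "finite_CW_cospan K0 K1 c"
  shows "cospan_value K0 K1 c \<in> Hom S (P K0) (P K1)"
  using assms unfolding cospan_value_def finite_CW_cospan_def
  by (intro Fp.cod.Comp_in P_in p_in n_in) blast+

lemma cospan_value_comp:
  assumes e: "\<exists>e :: real \<Rightarrow> 'u. inj e"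
    and K: "pointed_finite_CW K0" "pointed_finite_CW K1" "pointed_finite_CW K2"
    and c: "finite_CW_cospan K0 K1 c" and d: "finite_CW_cospan K1 K2 d"
  shows "ar induced K0 K2 (cospan_class K0 K2 (cyl_cospan K1 c d)) =
    Comp S (P K0) (P K1) (P K2) (cospan_value K1 K2 d) (cospan_value K0 K1 c)"
proof -
  note c' = finite_CW_is_cospan[OF c K(1,2)] and d' = finite_CW_is_cospan[OF d K(2,3)]
  interpret D: dmc K1 "apex c" "apex d" "rleg c" "lleg d" by (rule is_cospan_dmc[OF c' d'])
  obtain Q :: "'u pointed" and h where Q: "pointed_finite_CW Q" "phomotopy_equivalence D.C Q h"
    and m: "finite_CW_cospan K0 K2 (Cospan Q (h \<circ> (D.iL \<circ> lleg c)) (h \<circ> (D.iR \<circ> rleg d)))"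
    and eq: "cospan_equiv K0 K2 (cyl_cospan K1 c d) (Cospan Q (h \<circ> (D.iL \<circ> lleg c)) (h \<circ> (D.iR \<circ> rleg d)))"
    by (rule cyl_cospan_model[OF e K c d], rule that)
  let ?m = "Cospan Q (h \<circ> (D.iL \<circ> lleg c)) (h \<circ> (D.iR \<circ> rleg d))"
  have L: "pointed_finite_CW (apex c)" "pointed_finite_CW (apex d)"
    and l: "pmap K0 (apex c) (lleg c)" "pmap K1 (apex c) (rleg c)" "pmap K1 (apex d) (lleg d)" "pmap K2 (apex d) (rleg d)"
    using c d by (auto simp: finite_CW_cospan_def)
  note hp = phomotopy_equivalence_pmap[OF Q(2)]
  note hL = pmap_compose[OF D.pmap_iL hp] and hR = pmap_compose[OF D.pmap_iR hp]
  have "ar induced K0 K2 (cospan_class K0 K2 (cyl_cospan K1 c d)) = cospan_value K0 K2 ?m"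
    unfolding cospan_class_eq[OF cyl_cospan_simps(4)[OF c' d'] eq] by (rule ar_induced[OF K(1,3) m])
  also have "\<dots> = Comp S (P K0) (P Q) (P K2)
      (Comp S (P Q) (P (apex d)) (P K2) (n (apex d) K2 (rleg d)) (n Q (apex d) (h \<circ> D.iR)))
      (Comp S (P K0) (P (apex c)) (P Q) (p (apex c) Q (h \<circ> D.iL)) (p K0 (apex c) (lleg c)))"
    unfolding cospan_value_def cospan.sel o_assoc
      p_comp[OF K(1) L(1) Q(1) l(1) hL] n_comp[OF K(3) L(2) Q(1) l(4) hR] ..
  also have "\<dots> = Comp S (P K0) (P (apex d)) (P K2) (n (apex d) K2 (rleg d))
      (Comp S (P K0) (P (apex c)) (P (apex d)) (Comp S (P (apex c)) (P Q) (P (apex d))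
        (n Q (apex d) (h \<circ> D.iR)) (p (apex c) Q (h \<circ> D.iL))) (p K0 (apex c) (lleg c)))"
    using K L l hL hR Q(1) by (intro Comp4 P_in p_in n_in)
  \<comment> \<open>The middle pair passes through the model of the cylinder; the Mayer-Vietoris
    relation reroutes it through \<open>K1\<close>, after which the four arrows can be regrouped as
    the two given cospans.\<close>
  also have "\<dots> = Comp S (P K0) (P (apex d)) (P K2) (n (apex d) K2 (rleg d))
      (Comp S (P K0) (P (apex c)) (P (apex d)) (Comp S (P (apex c)) (P K1) (P (apex d))
        (p K1 (apex d) (lleg d)) (n (apex c) K1 (rleg c))) (p K0 (apex c) (lleg c)))"
    unfolding MV_Cyl[OF K(2) L Q(1) l(2,3) Q(2)] ..
  also have "\<dots> = Comp S (P K0) (P K1) (P K2)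
      (Comp S (P K1) (P (apex d)) (P K2) (n (apex d) K2 (rleg d)) (p K1 (apex d) (lleg d)))
      (Comp S (P K0) (P (apex c)) (P K1) (n (apex c) K1 (rleg c)) (p K0 (apex c) (lleg c)))"
    using K L l by (intro Comp4[symmetric] P_in p_in n_in)
  finally show ?thesis unfolding cospan_value_def .
qed

lemma cospan_value_plus:
  assumes "pointed_finite_CW K" "pointed_finite_CW L" "pmap K L f"
  shows "cospan_value K L (Cospan L f (\<lambda>x. x)) = p K L f"
  unfolding cospan_value_def cospan.sel n_id[OF assms(2)]
  by (rule Fp.cod.Comp_Id_left[OF P_in[OF assms(1)] P_in[OF assms(2)] p_in[OF assms]])

lemma cospan_value_minus:
  assumes "pointed_finite_CW K" "pointed_finite_CW L" "pmap K L f"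
  shows "cospan_value L K (Cospan L (\<lambda>x. x) f) = n L K f"
  unfolding cospan_value_def cospan.sel p_id[OF assms(2)]
  by (rule Fp.cod.Comp_Id_right[OF P_in[OF assms(2)] P_in[OF assms(1)] n_in[OF assms]])

lemma functor_induced:
  assumes e: "\<exists>e :: real \<Rightarrow> 'u. inj e"
  shows "is_functor CospCW S induced"
proof -
  interpret A: category "CospCW :: ('u pointed, ('u, 'u) cospan set) cat" by (rule category_CospCW[OF e])
  have ob: "ob induced = P" by (simp add: induced_def)
  show ?thesis
  proof (unfold_locales, unfold ob Obj_CospCW)
    fix X Y Z :: "'u pointed" and f g
    show "P X \<in> Obj S" if "pointed_finite_CW X" using that by (rule P_in)
    show "ar induced X Y f \<in> Hom S (P X) (P Y)" if "pointed_finite_CW X" "pointed_finite_CW Y" "f \<in> Hom CospCW X Y"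
      using that ar_induced cospan_value_in unfolding Hom_CospCW by metis
    show "ar induced X X (Id CospCW X) = Id S (P X)" if X: "pointed_finite_CW X"
    proof -
      have "finite_CW_cospan X X (Cospan X (\<lambda>x. x) (\<lambda>x. x))" using X by (simp add: finite_CW_cospan_def pmap_id)
      from ar_induced[OF X X this] show ?thesis
        using cospan_value_plus[OF X X pmap_id] p_id[OF X] by (simp add: CospCW_def)
    qed
    assume K: "pointed_finite_CW X" "pointed_finite_CW Y" "pointed_finite_CW Z"
      and "f \<in> Hom CospCW X Y" "g \<in> Hom CospCW Y Z"
    then obtain c d :: "('u, 'u) cospan" where c: "finite_CW_cospan X Y c" "f = cospan_class X Y c"
      and d: "finite_CW_cospan Y Z d" "g = cospan_class Y Z d"
      unfolding Hom_CospCW by blast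
    show "ar induced X Z (Comp CospCW X Y Z g f) = Comp S (P X) (P Y) (P Z) (ar induced Y Z g) (ar induced X Y f)"
      unfolding c(2) d(2) Comp_CospCW[OF K c(1) d(1)] cospan_value_comp[OF e K c(1) d(1)]
        ar_induced[OF K(1,2) c(1)] ar_induced[OF K(2,3) d(1)] ..
  qed
qed

lemma induced_plus: "fctr_eq HCW (fctr_comp induced iota_plus) Fp"
  unfolding fctr_eq_def
proof (intro conjI ballI)
  fix X Y :: "'u pointed" and f
  show "ob (fctr_comp induced iota_plus) X = P X" by (simp add: fctr_comp_def induced_def ob_iota)
  assume "X \<in> Obj HCW" "Y \<in> Obj HCW" "f \<in> Hom HCW X Y"
  then obtain a where K: "pointed_finite_CW X" "pointed_finite_CW Y" and a: "pmap X Y a" "f = hclass X Y a"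
    unfolding Obj_HCW Hom_HCW by blast
  have "ar (fctr_comp induced iota_plus) X Y f = ar induced X Y (ar iota_plus X Y f)"
    by (simp add: fctr_comp_def ob_iota)
  also have "\<dots> = cospan_value X Y (Cospan Y a (\<lambda>x. x))"
    unfolding a(2) ar_iota_plus(1)[OF K a(1)] by (rule ar_induced[OF K ar_iota_plus(2)[OF K a(1)]])
  also have "\<dots> = ar Fp X Y f" unfolding cospan_value_plus[OF K a(1)] p_def a(2) ..
  finally show "ar (fctr_comp induced iota_plus) X Y f = ar Fp X Y f" .
qed

lemma induced_minus: "fctr_eq (op_cat HCW) (fctr_comp induced iota_minus) Fm"
  unfolding fctr_eq_def op_HCW_simps
proof (intro conjI ballI)
  fix X Y :: "'u pointed" and f
  show "ob (fctr_comp induced iota_minus) X = ob Fm X" if "X \<in> Obj HCW"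
    using that by (simp add: fctr_comp_def induced_def ob_iota same_ob)
  assume "X \<in> Obj HCW" "Y \<in> Obj HCW" "f \<in> Hom HCW Y X"
  then obtain a where K: "pointed_finite_CW X" "pointed_finite_CW Y" and a: "pmap Y X a" "f = hclass Y X a"
    unfolding Obj_HCW Hom_HCW by blast
  have "ar (fctr_comp induced iota_minus) X Y f = ar induced X Y (ar iota_minus X Y f)"
    by (simp add: fctr_comp_def ob_iota)
  also have "\<dots> = cospan_value X Y (Cospan X (\<lambda>x. x) a)"
    unfolding a(2) ar_iota_minus(1)[OF K(2,1) a(1)] by (rule ar_induced[OF K ar_iota_minus(2)[OF K(2,1) a(1)]])
  also have "\<dots> = ar Fm X Y f" unfolding cospan_value_minus[OF K(2,1) a(1)] n_def a(2) ..
  finally show "ar (fctr_comp induced iota_minus) X Y f = ar Fm X Y f" .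
qed

lemma induced_unique:
  assumes G: "is_functor CospCW S G" "fctr_eq HCW (fctr_comp G iota_plus) Fp"
    "fctr_eq (op_cat HCW) (fctr_comp G iota_minus) Fm"
  shows "fctr_eq CospCW G induced"
proof -
  interpret G: is_functor CospCW S G by (rule G(1))
  have obG: "ob G K = P K" if "pointed_finite_CW K" for K
    using G(2) that by (simp add: fctr_eq_def fctr_comp_def ob_iota Obj_HCW)
  have arp: "ar G K L (ar iota_plus K L F) = ar Fp K L F"
    if "pointed_finite_CW K" "pointed_finite_CW L" "F \<in> Hom HCW K L" for K L F
    using G(2) that by (simp add: fctr_eq_def fctr_comp_def ob_iota Obj_HCW)
  have arm: "ar G K L (ar iota_minus K L F) = ar Fm K L F"
    if "pointed_finite_CW K" "pointed_finite_CW L" "F \<in> Hom HCW L K" for K L F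
    using G(3) that by (simp add: fctr_eq_def fctr_comp_def ob_iota Obj_HCW op_HCW_simps)
  show ?thesis
    unfolding fctr_eq_def Obj_CospCW
  proof (intro conjI ballI)
    fix X Y :: "'u pointed" and f
    assume "X \<in> Obj CospCW"
    then have X: "pointed_finite_CW X" by (simp add: Obj_CospCW)
    show "ob G X = ob induced X" using obG[OF X] by (simp add: induced_def)
    assume "Y \<in> Obj CospCW" "f \<in> Hom CospCW X Y"
    then obtain c :: "('u, 'u) cospan" where Y: "pointed_finite_CW Y" and c: "finite_CW_cospan X Y c" "f = cospan_class X Y c"
      unfolding Obj_CospCW Hom_CospCW by blast
    have L: "pointed_finite_CW (apex c)" and l: "pmap X (apex c) (lleg c)" "pmap Y (apex c) (rleg c)"
      using c(1) by (auto simp: finite_CW_cospan_def)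
    let ?p = "ar iota_plus X (apex c) (hclass X (apex c) (lleg c))"
    let ?m = "ar iota_minus (apex c) Y (hclass Y (apex c) (rleg c))"
    have hom: "?p \<in> Hom CospCW X (apex c)" "?m \<in> Hom CospCW (apex c) Y"
      unfolding Hom_CospCW using ar_iota_plus[OF X L l(1)] ar_iota_minus[OF Y L l(2)] by blast+
    have "ar G X Y f = ar G X Y (Comp CospCW X (apex c) Y ?m ?p)"
      unfolding c(2) Comp_iota_minus_plus[OF X Y c(1)] ..
    also have "\<dots> = Comp S (ob G X) (ob G (apex c)) (ob G Y) (ar G (apex c) Y ?m) (ar G X (apex c) ?p)"
      by (rule G.ar_Comp) (simp_all add: Obj_CospCW X L Y hom)
    also have "\<dots> = cospan_value X Y c"
    proof -
      have F: "hclass X (apex c) (lleg c) \<in> Hom HCW X (apex c)" "hclass Y (apex c) (rleg c) \<in> Hom HCW Y (apex c)"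
        unfolding Hom_HCW using l by blast+
      show ?thesis
        unfolding obG[OF X] obG[OF L] obG[OF Y] arp[OF X L F(1)] arm[OF L Y F(2)] cospan_value_def p_def n_def ..
    qed
    also have "\<dots> = ar induced X Y f" unfolding c(2) by (rule ar_induced[symmetric, OF X Y c(1)])
    finally show "ar G X Y f = ar induced X Y f" .
  qed
qed

end

theorem theorem3p5:
  assumes "\<exists>e :: real \<Rightarrow> 'u. inj e"
  shows
    "MV_PN_diagram CospCW
       (iota_plus :: ('u pointed, ('u \<Rightarrow> 'u) set, 'u pointed, ('u, 'u) cospan set) fctr) iota_minus \<and>
     (\<forall>(S :: ('o, 'm) cat) (Fp :: ('u pointed, ('u \<Rightarrow> 'u) set, 'o, 'm) fctr) Fm.
        MV_PN_diagram S Fp Fm \<longrightarrow>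
        (\<exists>F. is_functor CospCW S F \<and>
             fctr_eq HCW (fctr_comp F iota_plus) Fp \<and>
             fctr_eq (op_cat HCW) (fctr_comp F iota_minus) Fm \<and>
             (\<forall>G. is_functor CospCW S G \<and>
                  fctr_eq HCW (fctr_comp G iota_plus) Fp \<and>
                  fctr_eq (op_cat HCW) (fctr_comp G iota_minus) Fm \<longrightarrow>
                  fctr_eq CospCW G F)))"
proof (intro conjI allI impI)
  show "MV_PN_diagram CospCW
       (iota_plus :: ('u pointed, ('u \<Rightarrow> 'u) set, 'u pointed, ('u, 'u) cospan set) fctr) iota_minus"
    by (rule MV_PN_iota[OF assms])
  fix S :: "('o, 'm) cat" and Fp :: "('u pointed, ('u \<Rightarrow> 'u) set, 'o, 'm) fctr" and Fm
  assume "MV_PN_diagram S Fp Fm"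
  then interpret MV_PN_diagram S Fp Fm .
  show "\<exists>F. is_functor CospCW S F \<and>
             fctr_eq HCW (fctr_comp F iota_plus) Fp \<and>
             fctr_eq (op_cat HCW) (fctr_comp F iota_minus) Fm \<and>
             (\<forall>G. is_functor CospCW S G \<and>
                  fctr_eq HCW (fctr_comp G iota_plus) Fp \<and>
                  fctr_eq (op_cat HCW) (fctr_comp G iota_minus) Fm \<longrightarrow>
                  fctr_eq CospCW G F)"
    by (intro exI[of _ induced] conjI allI impI functor_induced[OF assms] induced_plus induced_minus)
      (rule induced_unique; blast)
qed

end
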